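(* (i) $\tilde\delta^2=0$. (ii) (Fundamental Formula) $\tilde\delta\delta+\delta\tilde\delta+\tau=\mathrm{id}$ on $W\otimes_A\Omega$.
   Context: $k$ is a field of characteristic zero. $A$ is a commutative affine regular domain over $k$ which is a Poisson algebra (commutative $k$-algebra with a Lie bracket $\{\cdot,\cdot\}$ satisfying $\{ab,c\}=a\{b,c\}+\{a,c\}b$) and is symplectic: the $A$-module $\mathrm{Der}\,A$ of $k$-derivations of $A$ is generated by the derivations $\mathrm{ham}\,a:b\mapsto\{a,b\}$, $a\in A$. $\Omega^q=\Omega^q(A)$ is the module of (alternating, Kähler) differential $q$-forms, a finitely generated projective $A$-module, and $\Omega=\bigoplus_q\Omega^q$ is the exterior algebra; pairing $\langle Z,u\,dv\rangle=uZ(v)$ for $Z\in\mathrm{Der}\,A$. The map $\sharp:\Omega^1\to\mathrm{Der}\,A$, $(\sum a_i\,db_i)^\sharp=\sum a_i\,\mathrm{ham}\,b_i$, is an $A$-module isomorphism with inverse $\flat$; $\omega(X,Y)=\langle X,Y^\flat\rangle$ is a nondegenerate alternating $A$-bilinear form on $\mathrm{Der}\,A$. $L=hA\oplus\mathrm{Der}\,A$ is the Lie $A$-algebra with $h$ central and $[X,Y]=h\,\omega(X,Y)$. Its enveloping algebra $U_A(L)$ is graded by giving elements of $\mathrm{Der}\,A$ degree 1 and $h$ degree 2. $\pi:U_A(L)\to S_A(\mathrm{Der}\,A)$ is the $A$-algebra homomorphism to the symmetric algebra killing $h$ and identical on $\mathrm{Der}\,A$; $\pi^\dagger:S_A(\mathrm{Der}\,A)\to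 U_A(L)$ is the $A$-linear symmetrization $Y_1\cdots Y_m\mapsto\frac1{m!}\sum_{\sigma\in\mathcal S_m}Y_{\sigma(1)}\cdots Y_{\sigma(m)}$. $W=\prod_pW_p$ and $S=\prod_pS_p$ are the completions of $U_A(L)$ and $S_A(\mathrm{Der}\,A)$; $S_p^\dagger=\pi^\dagger(S_p)\subseteq W_p$, $S^\dagger=\prod_pS_p^\dagger$. $\pi,\pi^\dagger$ are extended to the completions and then (tensoring with $\mathrm{id}_\Omega$) to maps between $W\otimes_A\Omega$ and $S\otimes_A\Omega$, which are algebras via $(x\otimes\mu)(y\otimes\nu)=xy\otimes\mu\nu$. Maps are taken continuous (commuting with convergent infinite sums). Every element of $W\otimes\Omega$ is uniquely a convergent sum $\sum_{m\ge0}h^ms_m$ with $s_m\in S^\dagger\otimes\Omega$. $\delta:W\otimes\Omega\to W\otimes\Omega$ is the unique continuous additive map with $\delta(W\otimes\Omega^q)\subseteq W\otimes\Omega^{q+1}$, $\delta(xy)=\delta(x)y+(-1)^qx\delta(y)$ for $x\in W\otimes\Omega^q$, $\delta(\Omega)=0$, $\delta(h)=0$, $\delta(X)=X^\flat$ for $X\in\mathrm{Der}\,A$. $\delta^*:\Omega\to\mathrm{Der}\,A\otimes_A\Omega$ is the unique $A$-linear map with $\delta^*(\nu)=\nu^\sharp$ for $\nu\in\Omega^1$ and $\delta^*(\alpha\beta)=\delta^*(\alpha)\beta+(-1)^q\alpha\delta^*(\beta)$ for $\alpha\in\Omega^q$, $\beta\in\Omega$; $\delta_S^*:S\otimes\Omega\to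 S\otimes\Omega$ is its extension $\delta_S^*(s\otimes\nu)=s\,\delta^*(\nu)$. $\tilde\delta:W\otimes\Omega\to W\otimes\Omega$: $\tilde\delta(a)=0$ for $a\in A$; $\tilde\delta(x)=\frac1{p+q}\pi^\dagger\delta_S^*\pi(x)$ for $x\in S_p^\dagger\otimes\Omega^q$, $(p,q)\ne(0,0)$; extended $A[[h]]$-linearly (and continuously) to $W\otimes\Omega$ using the $h$-series. $\tau_S:S\otimes\Omega\to A$ is the projection $S\otimes\Omega\to S\otimes\Omega^0=S$ followed by the augmentation $S\to S_0=A$. $\tau:W\otimes\Omega\to A[[h]]$ is $\tau(\sum_{m\ge0}h^ms_m)=\sum_{m\ge0}h^m\tau_S\pi(s_m)$ for $s_m\in S^\dagger\otimes\Omega$. *)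

theory Defs
  imports
    "HOL-Combinatorics.Permutations"
    "HOL-Library.Poly_Mapping"
    "HOL-Library.Extended_Nat"
    "HOL-Computational_Algebra.Fraction_Field"
    "HOL-Computational_Algebra.Formal_Power_Series"
    "HOL-Algebra.Generated_Rings"
    "HOL-Algebra.QuotRing"
    "HOL-Algebra.Ring_Divisibility"
begin

text \<open>
  The field \<open>k\<close> is a type \<^typ>\<open>'k\<close> of class \<^class>\<open>field_char_0\<close>, the domain \<open>A\<close> is a type
  \<^typ>\<open>'a\<close> of class \<^class>\<open>idom\<close>, and \<open>sc :: 'k \<Rightarrow> 'a \<Rightarrow> 'a\<close> is the \<open>k\<close>-algebra structure.
  Modules and algebras over \<open>A\<close> depend on \<open>sc\<close> and on the Poisson bracket \<open>br\<close>; they are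
  records of type \<^typ>\<open>('a, 'm) module\<close>, and quotients are built from cosets as in
  \<^const>\<open>FactRing\<close>.
\<close>


section \<open>Symplectic affine regular domains\<close>

definition base_mod :: "('a::comm_ring_1, 'a) module" where
  "base_mod = \<lparr>carrier = UNIV, mult = (*), one = 1, zero = 0, add = (+), smult = (*)\<rparr>"

definition krull_dim :: "('r, 'm) ring_scheme \<Rightarrow> enat" where
  "krull_dim R = Sup {enat n | n. \<exists>P :: nat \<Rightarrow> 'r set.
     (\<forall>i\<le>n. primeideal (P i) R) \<and> (\<forall>i<n. P i \<subset> P (Suc i))}"

definition regular_local_ring :: "('r, 'm) ring_scheme \<Rightarrow> bool" where
  "regular_local_ring R \<longleftrightarrow> cring R \<and> noetherian_ring R \<and>
     (\<exists>m. (\<forall>J. maximalideal J R \<longleftrightarrow> J = m) \<and>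
       (\<exists>X. finite X \<and> X \<subseteq> carrier R \<and> m = Idl\<^bsub>R\<^esub> X \<and> enat (card X) = krull_dim R))"

text \<open>For a prime ideal \<open>P\<close> of a domain, the localization at \<open>P\<close> inside the field of fractions.\<close>

definition localization :: "'a::idom set \<Rightarrow> 'a fract ring" where
  "localization P = \<lparr>carrier = {Fract a s | a s. s \<notin> P},
     mult = (*), one = 1, zero = 0, add = (+)\<rparr>"

definition regular_domain :: "'a::idom itself \<Rightarrow> bool" where
  "regular_domain TYPE('a) \<longleftrightarrow> noetherian_ring (base_mod :: ('a, 'a) module) \<and>
     (\<forall>P. primeideal P (base_mod :: ('a, 'a) module) \<longrightarrow> regular_local_ring (localization P))"

definition gen_submod :: "('a::comm_ring_1, 'm) module \<Rightarrow> 'm set \<Rightarrow> 'm set" where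
  "gen_submod M S = \<Inter>{H. submodule H base_mod M \<and> S \<subseteq> H}"

text \<open>The \<open>A\<close>-module of \<open>k\<close>-derivations of \<open>A\<close>. It has no product; as usual for modules, the
  multiplicative fields of the record are left unspecified.\<close>

definition Der :: "('k \<Rightarrow> 'a \<Rightarrow> 'a::comm_ring_1) \<Rightarrow> ('a, 'a \<Rightarrow> 'a) module" where
  "Der sc = \<lparr>carrier = {Z. (\<forall>a b. Z (a + b) = Z a + Z b) \<and> (\<forall>c a. Z (sc c a) = sc c (Z a)) \<and>
       (\<forall>a b. Z (a * b) = a * Z b + b * Z a)},
     mult = undefined, one = undefined,
     zero = (\<lambda>_. 0), add = (\<lambda>X Y b. X b + Y b), smult = (\<lambda>a X b. a * X b)\<rparr>"

locale symplectic_affine_regular_domain = vector_space sc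
  for sc :: "'k::field_char_0 \<Rightarrow> 'a::idom \<Rightarrow> 'a" +
  fixes br :: "'a \<Rightarrow> 'a \<Rightarrow> 'a"
  assumes scale_mult: "sc t (a * b) = sc t a * b"
    and affine: "\<exists>X. finite X \<and> generate_ring base_mod (X \<union> range (\<lambda>c. sc c 1)) = UNIV"
    and regular: "regular_domain TYPE('a)"
    and bracket_add: "br (a + b) c = br a c + br b c"
    and bracket_scale: "br (sc t a) b = sc t (br a b)"
    and bracket_alternating: "br a a = 0"
    and jacobi: "br a (br b c) + br b (br c a) + br c (br a b) = 0"
    and leibniz: "br (a * b) c = a * br b c + br a c * b"
    and symplectic: "carrier (Der sc) = gen_submod (Der sc) (range (\<lambda>a b. br a b))"


section \<open>Modules and algebras by generators and relations\<close>

text \<open>The quotient of a module by a submodule, or of an algebra by a two-sided ideal.\<close>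

definition mod_quot :: "('a, 'm) module \<Rightarrow> 'm set \<Rightarrow> ('a, 'm set) module" where
  "mod_quot M I = \<lparr>carrier = carrier (M Quot I), mult = mult (M Quot I), one = one (M Quot I),
     zero = zero (M Quot I), add = add (M Quot I),
     smult = (\<lambda>a X. \<Union>x\<in>X. I +>\<^bsub>M\<^esub> (a \<odot>\<^bsub>M\<^esub> x))\<rparr>"

text \<open>If \<open>X\<close> is a coset of finitely supported functions, \<open>lin_lift N g X\<close> is the value at \<open>X\<close> of
  the linear map to \<open>N\<close> that sends (the class of) each basis element \<open>k\<close> to \<open>g k\<close>. It is only
  used where this map is well defined on cosets.\<close>

definition lin_lift ::
  "('a::comm_ring_1, 'n) module \<Rightarrow> ('k \<Rightarrow> 'n) \<Rightarrow> ('k \<Rightarrow>\<^sub>0 'a) set \<Rightarrow> 'n" where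
  "lin_lift N g X = the_elem ((\<lambda>f. finsum N (\<lambda>k. Poly_Mapping.lookup f k \<odot>\<^bsub>N\<^esub> g k)
     (Poly_Mapping.keys f)) ` X)"

text \<open>Words form the free monoid, written additively so that \<open>'g word \<Rightarrow>\<^sub>0 'a\<close> carries the
  product of the free associative \<open>A\<close>-algebra on \<^typ>\<open>'g\<close>.\<close>

datatype 'g word = Word (letters: "'g list")

instantiation word :: (type) monoid_add
begin

definition "0 = Word []"

definition "v + w = Word (letters v @ letters w)"

instance
  by standard (simp_all add: zero_word_def plus_word_def)

end

definition free_alg :: "'g set \<Rightarrow> ('a::comm_ring_1, 'g word \<Rightarrow>\<^sub>0 'a) module" where
  "free_alg G = \<lparr>carrier = {f. \<forall>w \<in> Poly_Mapping.keys f. set (letters w) \<subseteq> G},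
     mult = (*), one = 1, zero = 0, add = (+), smult = (\<lambda>a. Poly_Mapping.map ((*) a))\<rparr>"

definition letter :: "'g \<Rightarrow> ('g word \<Rightarrow>\<^sub>0 'a::comm_ring_1)" where
  "letter x = Poly_Mapping.single (Word [x]) 1"

text \<open>The \<open>A\<close>-algebra generated by the module \<open>M\<close> subject to the relations \<open>R\<close>, that is, the
  tensor algebra of \<open>M\<close> over \<open>A\<close> modulo \<open>R\<close>.\<close>

definition linear_rel :: "('a::comm_ring_1, 'g) module \<Rightarrow> ('g word \<Rightarrow>\<^sub>0 'a) set" where
  "linear_rel M =
     {letter (x \<oplus>\<^bsub>M\<^esub> y) - letter x - letter y | x y. x \<in> carrier M \<and> y \<in> carrier M} \<union>
     {letter (a \<odot>\<^bsub>M\<^esub> x) - Poly_Mapping.single (Word [x]) a | a x. x \<in> carrier M}"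

definition pres_ideal ::
  "('a::comm_ring_1, 'g) module \<Rightarrow> ('g word \<Rightarrow>\<^sub>0 'a) set \<Rightarrow> ('g word \<Rightarrow>\<^sub>0 'a) set" where
  "pres_ideal M R = Idl\<^bsub>free_alg (carrier M)\<^esub> (linear_rel M \<union> R)"

definition pres_alg ::
  "('a::comm_ring_1, 'g) module \<Rightarrow> ('g word \<Rightarrow>\<^sub>0 'a) set \<Rightarrow>
     ('a, ('g word \<Rightarrow>\<^sub>0 'a) set) module" where
  "pres_alg M R = mod_quot (free_alg (carrier M)) (pres_ideal M R)"

definition pres_gen ::
  "('a::comm_ring_1, 'g) module \<Rightarrow> ('g word \<Rightarrow>\<^sub>0 'a) set \<Rightarrow> 'g \<Rightarrow> ('g word \<Rightarrow>\<^sub>0 'a) set" where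
  "pres_gen M R x = pres_ideal M R +>\<^bsub>free_alg (carrier M)\<^esub> letter x"

text \<open>The homogeneous part of degree \<open>p\<close> when the elements of \<open>D d\<close> are given degree \<open>d\<close>.\<close>

definition words_of_degree :: "(nat \<Rightarrow> 'g set) \<Rightarrow> nat \<Rightarrow> 'g word set" where
  "words_of_degree D p =
     {Word (map snd ds) | ds. (\<forall>(d, x) \<in> set ds. x \<in> D d) \<and> sum_list (map fst ds) = p}"

definition pres_grade ::
  "('a::comm_ring_1, 'g) module \<Rightarrow> ('g word \<Rightarrow>\<^sub>0 'a) set \<Rightarrow> (nat \<Rightarrow> 'g set) \<Rightarrow> nat \<Rightarrow>
     ('g word \<Rightarrow>\<^sub>0 'a) set set" where
  "pres_grade M R D p = {pres_ideal M R +>\<^bsub>free_alg (carrier M)\<^esub> f | f.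
     f \<in> carrier (free_alg (carrier M)) \<and> Poly_Mapping.keys f \<subseteq> words_of_degree D p}"

definition env_rel ::
  "('a::comm_ring_1, 'g) module \<Rightarrow> ('g \<Rightarrow> 'g \<Rightarrow> 'g) \<Rightarrow> ('g word \<Rightarrow>\<^sub>0 'a) set" where
  "env_rel L b = {letter x * letter y - letter y * letter x - letter (b x y) | x y.
     x \<in> carrier L \<and> y \<in> carrier L}"

definition sym_rel :: "('a::comm_ring_1, 'g) module \<Rightarrow> ('g word \<Rightarrow>\<^sub>0 'a) set" where
  "sym_rel M = {letter x * letter y - letter y * letter x | x y. x \<in> carrier M \<and> y \<in> carrier M}"

definition ext_rel :: "('a::comm_ring_1, 'g) module \<Rightarrow> ('g word \<Rightarrow>\<^sub>0 'a) set" where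
  "ext_rel M = {letter x * letter x | x. x \<in> carrier M}"


section \<open>Tensor products and completions\<close>

definition free_tens ::
  "('a::comm_ring_1, 'm) module \<Rightarrow> ('a, 'n) module \<Rightarrow> ('a, 'm \<times> 'n \<Rightarrow>\<^sub>0 'a) module" where
  "free_tens M N = \<lparr>carrier = {f. Poly_Mapping.keys f \<subseteq> carrier M \<times> carrier N},
     mult = (\<lambda>f g. \<Sum>p \<in> Poly_Mapping.keys f. \<Sum>q \<in> Poly_Mapping.keys g.
       Poly_Mapping.single (fst p \<otimes>\<^bsub>M\<^esub> fst q, snd p \<otimes>\<^bsub>N\<^esub> snd q)
         (Poly_Mapping.lookup f p * Poly_Mapping.lookup g q)),
     one = Poly_Mapping.single (\<one>\<^bsub>M\<^esub>, \<one>\<^bsub>N\<^esub>) 1, zero = 0, add = (+),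
     smult = (\<lambda>a. Poly_Mapping.map ((*) a))\<rparr>"

definition bilin_rel ::
  "('a::comm_ring_1, 'm) module \<Rightarrow> ('a, 'n) module \<Rightarrow> ('m \<times> 'n \<Rightarrow>\<^sub>0 'a) set" where
  "bilin_rel M N =
     {Poly_Mapping.single (x \<oplus>\<^bsub>M\<^esub> y, n) 1 - Poly_Mapping.single (x, n) 1
        - Poly_Mapping.single (y, n) 1 | x y n.
        x \<in> carrier M \<and> y \<in> carrier M \<and> n \<in> carrier N} \<union>
     {Poly_Mapping.single (x, m \<oplus>\<^bsub>N\<^esub> n) 1 - Poly_Mapping.single (x, m) 1
        - Poly_Mapping.single (x, n) 1 | x m n.
        x \<in> carrier M \<and> m \<in> carrier N \<and> n \<in> carrier N} \<union>
     {Poly_Mapping.single (a \<odot>\<^bsub>M\<^esub> x, n) 1 - Poly_Mapping.single (x, n) a | a x n.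
        x \<in> carrier M \<and> n \<in> carrier N} \<union>
     {Poly_Mapping.single (x, a \<odot>\<^bsub>N\<^esub> n) 1 - Poly_Mapping.single (x, n) a | a x n.
        x \<in> carrier M \<and> n \<in> carrier N}"

text \<open>The tensor product over \<open>A\<close> of two modules; for algebras it is an algebra under
  \<open>(x \<otimes> \<mu>) (y \<otimes> \<nu>) = x y \<otimes> \<mu> \<nu>\<close>.\<close>

definition tens_ideal ::
  "('a::comm_ring_1, 'm) module \<Rightarrow> ('a, 'n) module \<Rightarrow> ('m \<times> 'n \<Rightarrow>\<^sub>0 'a) set" where
  "tens_ideal M N = gen_submod (free_tens M N) (bilin_rel M N)"

definition tensor ::
  "('a::comm_ring_1, 'm) module \<Rightarrow> ('a, 'n) module \<Rightarrow>
     ('a, ('m \<times> 'n \<Rightarrow>\<^sub>0 'a) set) module" where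
  "tensor M N = mod_quot (free_tens M N) (tens_ideal M N)"

definition tens ::
  "('a::comm_ring_1, 'm) module \<Rightarrow> ('a, 'n) module \<Rightarrow> 'm \<Rightarrow> 'n \<Rightarrow> ('m \<times> 'n \<Rightarrow>\<^sub>0 'a) set" where
  "tens M N x n = tens_ideal M N +>\<^bsub>free_tens M N\<^esub> Poly_Mapping.single (x, n) 1"

text \<open>The image of \<open>X \<otimes> Y\<close> in \<open>M \<otimes> N\<close>.\<close>

definition tens_part ::
  "('a::comm_ring_1, 'm) module \<Rightarrow> ('a, 'n) module \<Rightarrow> 'm set \<Rightarrow> 'n set \<Rightarrow>
     ('m \<times> 'n \<Rightarrow>\<^sub>0 'a) set set" where
  "tens_part M N X Y = gen_submod (tensor M N) {tens M N x y | x y. x \<in> X \<and> y \<in> Y}"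

text \<open>The completion \<open>\<Prod>p. G p\<close> of an algebra graded by the submodules \<open>G p\<close>.\<close>

definition completion ::
  "('a, 'u) module \<Rightarrow> (nat \<Rightarrow> 'u set) \<Rightarrow> ('a, nat \<Rightarrow> 'u) module" where
  "completion U G = \<lparr>carrier = {w. \<forall>p. w p \<in> G p},
     mult = (\<lambda>v w p. finsum U (\<lambda>i. v i \<otimes>\<^bsub>U\<^esub> w (p - i)) {..p}),
     one = (\<lambda>p. if p = 0 then \<one>\<^bsub>U\<^esub> else \<zero>\<^bsub>U\<^esub>), zero = (\<lambda>p. \<zero>\<^bsub>U\<^esub>),
     add = (\<lambda>v w p. v p \<oplus>\<^bsub>U\<^esub> w p), smult = (\<lambda>a w p. a \<odot>\<^bsub>U\<^esub> w p)\<rparr>"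

definition homog :: "('a, 'u) module \<Rightarrow> nat \<Rightarrow> 'u \<Rightarrow> nat \<Rightarrow> 'u" where
  "homog U p u = (\<lambda>i. if i = p then u else \<zero>\<^bsub>U\<^esub>)"

text \<open>Convergence of \<open>\<Sum>m. f m = x\<close> in \<open>C \<otimes> N\<close>, for a completion \<open>C\<close>: a basis of
  neighbourhoods of \<open>0\<close> is given by the images of \<open>(\<Prod>i\<ge>p. G i) \<otimes> N\<close>.\<close>

definition nbhd ::
  "('a::comm_ring_1, nat \<Rightarrow> 'u) module \<Rightarrow> ('a, 'n) module \<Rightarrow> nat \<Rightarrow>
     ((nat \<Rightarrow> 'u) \<times> 'n \<Rightarrow>\<^sub>0 'a) set set" where
  "nbhd C N p = tens_part C N {x \<in> carrier C. \<forall>i<p. x i = \<zero>\<^bsub>C\<^esub> i} (carrier N)"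

definition conv_sum ::
  "('a::comm_ring_1, nat \<Rightarrow> 'u) module \<Rightarrow> ('a, 'n) module \<Rightarrow>
     (nat \<Rightarrow> ((nat \<Rightarrow> 'u) \<times> 'n \<Rightarrow>\<^sub>0 'a) set) \<Rightarrow> ((nat \<Rightarrow> 'u) \<times> 'n \<Rightarrow>\<^sub>0 'a) set \<Rightarrow> bool" where
  "conv_sum C N f x \<longleftrightarrow> range f \<subseteq> carrier (tensor C N) \<and> x \<in> carrier (tensor C N) \<and>
     (\<forall>p. \<exists>n0. \<forall>n\<ge>n0. x \<ominus>\<^bsub>tensor C N\<^esub> finsum (tensor C N) f {..<n} \<in> nbhd C N p)"

definition continuous_map ::
  "('a::comm_ring_1, nat \<Rightarrow> 'u) module \<Rightarrow> ('a, 'n) module \<Rightarrow>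
     (((nat \<Rightarrow> 'u) \<times> 'n \<Rightarrow>\<^sub>0 'a) set \<Rightarrow> ((nat \<Rightarrow> 'u) \<times> 'n \<Rightarrow>\<^sub>0 'a) set) \<Rightarrow> bool" where
  "continuous_map C N d \<longleftrightarrow> (\<forall>f x. conv_sum C N f x \<longrightarrow> conv_sum C N (\<lambda>m. d (f m)) (d x))"

definition signed :: "('a, 'm) module \<Rightarrow> nat \<Rightarrow> 'm \<Rightarrow> 'm" where
  "signed M q x = (if even q then x else \<ominus>\<^bsub>M\<^esub> x)"


section \<open>Differential forms, the symplectic form and the musical isomorphisms\<close>

type_synonym 'a kform1 = "('a \<Rightarrow>\<^sub>0 'a) set"
type_synonym 'a kform = "('a kform1 word \<Rightarrow>\<^sub>0 'a) set"

text \<open>The basis element \<open>Poly_Mapping.single b 1\<close> stands for \<open>db\<close>.\<close>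

definition kahler_free :: "('a::comm_ring_1, 'a \<Rightarrow>\<^sub>0 'a) module" where
  "kahler_free = \<lparr>carrier = UNIV, mult = undefined, one = undefined, zero = 0, add = (+),
     smult = (\<lambda>a. Poly_Mapping.map ((*) a))\<rparr>"

definition kahler_rel :: "('k \<Rightarrow> 'a \<Rightarrow> 'a::comm_ring_1) \<Rightarrow> ('a \<Rightarrow>\<^sub>0 'a) set" where
  "kahler_rel sc =
     {Poly_Mapping.single (a + b) 1 - Poly_Mapping.single a 1 - Poly_Mapping.single b 1 | a b. True} \<union>
     {Poly_Mapping.single (sc c a) 1 - Poly_Mapping.single a (sc c 1) | c a. True} \<union>
     {Poly_Mapping.single (a * b) 1 - Poly_Mapping.single b a - Poly_Mapping.single a b | a b. True}"

definition Omega1 :: "('k \<Rightarrow> 'a \<Rightarrow> 'a::comm_ring_1) \<Rightarrow> ('a, 'a kform1) module" where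
  "Omega1 sc = mod_quot kahler_free (gen_submod kahler_free (kahler_rel sc))"

definition Omega :: "('k \<Rightarrow> 'a \<Rightarrow> 'a::comm_ring_1) \<Rightarrow> ('a, 'a kform) module" where
  "Omega sc = pres_alg (Omega1 sc) (ext_rel (Omega1 sc))"

definition form1 :: "('k \<Rightarrow> 'a \<Rightarrow> 'a::comm_ring_1) \<Rightarrow> 'a kform1 \<Rightarrow> 'a kform" where
  "form1 sc \<nu> = pres_gen (Omega1 sc) (ext_rel (Omega1 sc)) \<nu>"

definition OmegaQ :: "('k \<Rightarrow> 'a \<Rightarrow> 'a::comm_ring_1) \<Rightarrow> nat \<Rightarrow> 'a kform set" where
  "OmegaQ sc = pres_grade (Omega1 sc) (ext_rel (Omega1 sc))
     (\<lambda>d. if d = 1 then carrier (Omega1 sc) else {})"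

definition pairing :: "('a \<Rightarrow> 'a::comm_ring_1) \<Rightarrow> 'a kform1 \<Rightarrow> 'a" where
  "pairing Z \<nu> = lin_lift base_mod Z \<nu>"

definition sharp ::
  "('k \<Rightarrow> 'a \<Rightarrow> 'a::comm_ring_1) \<Rightarrow> ('a \<Rightarrow> 'a \<Rightarrow> 'a) \<Rightarrow> 'a kform1 \<Rightarrow> ('a \<Rightarrow> 'a)" where
  "sharp sc br \<nu> = lin_lift (Der sc) (\<lambda>b c. br b c) \<nu>"

definition flat ::
  "('k \<Rightarrow> 'a \<Rightarrow> 'a::comm_ring_1) \<Rightarrow> ('a \<Rightarrow> 'a \<Rightarrow> 'a) \<Rightarrow> ('a \<Rightarrow> 'a) \<Rightarrow> 'a kform1" where
  "flat sc br = inv_into (carrier (Omega1 sc)) (sharp sc br)"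

definition omega ::
  "('k \<Rightarrow> 'a \<Rightarrow> 'a::comm_ring_1) \<Rightarrow> ('a \<Rightarrow> 'a \<Rightarrow> 'a) \<Rightarrow> ('a \<Rightarrow> 'a) \<Rightarrow> ('a \<Rightarrow> 'a) \<Rightarrow> 'a" where
  "omega sc br X Y = pairing X (flat sc br Y)"


section \<open>The algebras \<open>W\<close> and \<open>S\<close>\<close>

type_synonym 'a lie = "'a \<times> ('a \<Rightarrow> 'a)"
type_synonym 'a env = "('a lie word \<Rightarrow>\<^sub>0 'a) set"
type_synonym 'a sym = "(('a \<Rightarrow> 'a) word \<Rightarrow>\<^sub>0 'a) set"
type_synonym 'a WOm = "((nat \<Rightarrow> 'a env) \<times> 'a kform \<Rightarrow>\<^sub>0 'a) set"
type_synonym 'a SOm = "((nat \<Rightarrow> 'a sym) \<times> 'a kform \<Rightarrow>\<^sub>0 'a) set"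

text \<open>\<open>L = hA \<oplus> Der A\<close>; the pair \<open>(a, X)\<close> is \<open>ha + X\<close>.\<close>

definition Lie_mod :: "('k \<Rightarrow> 'a \<Rightarrow> 'a::comm_ring_1) \<Rightarrow> ('a, 'a lie) module" where
  "Lie_mod sc = \<lparr>carrier = UNIV \<times> carrier (Der sc), mult = undefined, one = undefined,
     zero = (0, \<zero>\<^bsub>Der sc\<^esub>), add = (\<lambda>(a, X) (b, Y). (a + b, X \<oplus>\<^bsub>Der sc\<^esub> Y)),
     smult = (\<lambda>c (a, X). (c * a, c \<odot>\<^bsub>Der sc\<^esub> X))\<rparr>"

definition lie_bracket ::
  "('k \<Rightarrow> 'a \<Rightarrow> 'a::comm_ring_1) \<Rightarrow> ('a \<Rightarrow> 'a \<Rightarrow> 'a) \<Rightarrow> 'a lie \<Rightarrow> 'a lie \<Rightarrow> 'a lie" where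
  "lie_bracket sc br x y = (omega sc br (snd x) (snd y), \<zero>\<^bsub>Der sc\<^esub>)"

definition U_rel ::
  "('k \<Rightarrow> 'a \<Rightarrow> 'a::comm_ring_1) \<Rightarrow> ('a \<Rightarrow> 'a \<Rightarrow> 'a) \<Rightarrow> ('a lie word \<Rightarrow>\<^sub>0 'a) set" where
  "U_rel sc br = env_rel (Lie_mod sc) (lie_bracket sc br)"

definition U_alg ::
  "('k \<Rightarrow> 'a \<Rightarrow> 'a::comm_ring_1) \<Rightarrow> ('a \<Rightarrow> 'a \<Rightarrow> 'a) \<Rightarrow> ('a, 'a env) module" where
  "U_alg sc br = pres_alg (Lie_mod sc) (U_rel sc br)"

definition U_in ::
  "('k \<Rightarrow> 'a \<Rightarrow> 'a::comm_ring_1) \<Rightarrow> ('a \<Rightarrow> 'a \<Rightarrow> 'a) \<Rightarrow> 'a lie \<Rightarrow> 'a env" where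
  "U_in sc br = pres_gen (Lie_mod sc) (U_rel sc br)"

definition U_grade ::
  "('k \<Rightarrow> 'a \<Rightarrow> 'a::comm_ring_1) \<Rightarrow> ('a \<Rightarrow> 'a \<Rightarrow> 'a) \<Rightarrow> nat \<Rightarrow> 'a env set" where
  "U_grade sc br = pres_grade (Lie_mod sc) (U_rel sc br)
     (\<lambda>d. if d = 1 then {0} \<times> carrier (Der sc)
          else if d = 2 then UNIV \<times> {\<zero>\<^bsub>Der sc\<^esub>} else {})"

definition Sym :: "('k \<Rightarrow> 'a \<Rightarrow> 'a::comm_ring_1) \<Rightarrow> ('a, 'a sym) module" where
  "Sym sc = pres_alg (Der sc) (sym_rel (Der sc))"

definition Sym_in :: "('k \<Rightarrow> 'a \<Rightarrow> 'a::comm_ring_1) \<Rightarrow> ('a \<Rightarrow> 'a) \<Rightarrow> 'a sym" where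
  "Sym_in sc = pres_gen (Der sc) (sym_rel (Der sc))"

definition Sym_grade :: "('k \<Rightarrow> 'a \<Rightarrow> 'a::comm_ring_1) \<Rightarrow> nat \<Rightarrow> 'a sym set" where
  "Sym_grade sc = pres_grade (Der sc) (sym_rel (Der sc))
     (\<lambda>d. if d = 1 then carrier (Der sc) else {})"

definition W_alg ::
  "('k \<Rightarrow> 'a \<Rightarrow> 'a::comm_ring_1) \<Rightarrow> ('a \<Rightarrow> 'a \<Rightarrow> 'a) \<Rightarrow> ('a, nat \<Rightarrow> 'a env) module" where
  "W_alg sc br = completion (U_alg sc br) (U_grade sc br)"

definition S_alg :: "('k \<Rightarrow> 'a \<Rightarrow> 'a::comm_ring_1) \<Rightarrow> ('a, nat \<Rightarrow> 'a sym) module" where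
  "S_alg sc = completion (Sym sc) (Sym_grade sc)"

definition WOmega ::
  "('k \<Rightarrow> 'a \<Rightarrow> 'a::comm_ring_1) \<Rightarrow> ('a \<Rightarrow> 'a \<Rightarrow> 'a) \<Rightarrow> ('a, 'a WOm) module" where
  "WOmega sc br = tensor (W_alg sc br) (Omega sc)"

definition SOmega :: "('k \<Rightarrow> 'a \<Rightarrow> 'a::comm_ring_1) \<Rightarrow> ('a, 'a SOm) module" where
  "SOmega sc = tensor (S_alg sc) (Omega sc)"

text \<open>The canonical maps \<open>W \<rightarrow> W \<otimes> \<Omega>\<close>, \<open>\<Omega> \<rightarrow> W \<otimes> \<Omega>\<close>, \<open>L \<rightarrow> W \<otimes> \<Omega>\<close> and \<open>A[[h]] \<rightarrow> W \<otimes> \<Omega>\<close>.\<close>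

definition inW ::
  "('k \<Rightarrow> 'a \<Rightarrow> 'a::comm_ring_1) \<Rightarrow> ('a \<Rightarrow> 'a \<Rightarrow> 'a) \<Rightarrow> (nat \<Rightarrow> 'a env) \<Rightarrow> 'a WOm" where
  "inW sc br w = tens (W_alg sc br) (Omega sc) w \<one>\<^bsub>Omega sc\<^esub>"

definition inOmega ::
  "('k \<Rightarrow> 'a \<Rightarrow> 'a::comm_ring_1) \<Rightarrow> ('a \<Rightarrow> 'a \<Rightarrow> 'a) \<Rightarrow> 'a kform \<Rightarrow> 'a WOm" where
  "inOmega sc br \<mu> = tens (W_alg sc br) (Omega sc) \<one>\<^bsub>W_alg sc br\<^esub> \<mu>"

definition inDer ::
  "('k \<Rightarrow> 'a \<Rightarrow> 'a::comm_ring_1) \<Rightarrow> ('a \<Rightarrow> 'a \<Rightarrow> 'a) \<Rightarrow> ('a \<Rightarrow> 'a) \<Rightarrow> 'a WOm" where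
  "inDer sc br X = inW sc br (homog (U_alg sc br) 1 (U_in sc br (0, X)))"

definition h_W ::
  "('k \<Rightarrow> 'a \<Rightarrow> 'a::comm_ring_1) \<Rightarrow> ('a \<Rightarrow> 'a \<Rightarrow> 'a) \<Rightarrow> 'a WOm" where
  "h_W sc br = inW sc br (homog (U_alg sc br) 2 (U_in sc br (1, \<zero>\<^bsub>Der sc\<^esub>)))"

definition inA ::
  "('k \<Rightarrow> 'a \<Rightarrow> 'a::comm_ring_1) \<Rightarrow> ('a \<Rightarrow> 'a \<Rightarrow> 'a) \<Rightarrow> 'a \<Rightarrow> 'a WOm" where
  "inA sc br a = a \<odot>\<^bsub>WOmega sc br\<^esub> \<one>\<^bsub>WOmega sc br\<^esub>"

definition inAh ::
  "('k \<Rightarrow> 'a \<Rightarrow> 'a::comm_ring_1) \<Rightarrow> ('a \<Rightarrow> 'a \<Rightarrow> 'a) \<Rightarrow> 'a fps \<Rightarrow> 'a WOm" where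
  "inAh sc br c = inW sc br (\<lambda>p. if even p
     then fps_nth c (p div 2) \<odot>\<^bsub>U_alg sc br\<^esub> (U_in sc br (1, \<zero>\<^bsub>Der sc\<^esub>) [^]\<^bsub>U_alg sc br\<^esub> (p div 2))
     else \<zero>\<^bsub>U_alg sc br\<^esub>)"

definition WOmegaQ ::
  "('k \<Rightarrow> 'a \<Rightarrow> 'a::comm_ring_1) \<Rightarrow> ('a \<Rightarrow> 'a \<Rightarrow> 'a) \<Rightarrow> nat \<Rightarrow> 'a WOm set" where
  "WOmegaQ sc br q = tens_part (W_alg sc br) (Omega sc) (carrier (W_alg sc br)) (OmegaQ sc q)"


section \<open>The maps \<open>\<pi>\<close> and \<open>\<pi>\<^sup>\<dagger>\<close>\<close>

definition prod_of :: "('m, 'z) monoid_scheme \<Rightarrow> 'm list \<Rightarrow> 'm" where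
  "prod_of M xs = foldr (\<lambda>x y. x \<otimes>\<^bsub>M\<^esub> y) xs \<one>\<^bsub>M\<^esub>"

definition pi_U :: "('k \<Rightarrow> 'a \<Rightarrow> 'a::comm_ring_1) \<Rightarrow> 'a env \<Rightarrow> 'a sym" where
  "pi_U sc = lin_lift (Sym sc) (\<lambda>w. prod_of (Sym sc) (map (\<lambda>(a, X). Sym_in sc X) (letters w)))"

definition symmetrized ::
  "('k::field_char_0 \<Rightarrow> 'a \<Rightarrow> 'a::comm_ring_1) \<Rightarrow> ('a \<Rightarrow> 'a \<Rightarrow> 'a) \<Rightarrow> ('a \<Rightarrow> 'a) list \<Rightarrow> 'a env" where
  "symmetrized sc br Ys = sc (1 / fact (length Ys)) 1 \<odot>\<^bsub>U_alg sc br\<^esub>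
     finsum (U_alg sc br)
       (\<lambda>\<sigma>. prod_of (U_alg sc br) (map (\<lambda>i. U_in sc br (0, Ys ! \<sigma> i)) [0..<length Ys]))
       {\<sigma>. \<sigma> permutes {..<length Ys}}"

definition pi_dag_U ::
  "('k::field_char_0 \<Rightarrow> 'a \<Rightarrow> 'a::comm_ring_1) \<Rightarrow> ('a \<Rightarrow> 'a \<Rightarrow> 'a) \<Rightarrow> 'a sym \<Rightarrow> 'a env" where
  "pi_dag_U sc br = lin_lift (U_alg sc br) (\<lambda>w. symmetrized sc br (letters w))"

definition pi_map ::
  "('k \<Rightarrow> 'a \<Rightarrow> 'a::comm_ring_1) \<Rightarrow> 'a WOm \<Rightarrow> 'a SOm" where
  "pi_map sc = lin_lift (SOmega sc)
     (\<lambda>(w, \<mu>). tens (S_alg sc) (Omega sc) (\<lambda>p. pi_U sc (w p)) \<mu>)"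

definition pi_dag ::
  "('k::field_char_0 \<Rightarrow> 'a \<Rightarrow> 'a::comm_ring_1) \<Rightarrow> ('a \<Rightarrow> 'a \<Rightarrow> 'a) \<Rightarrow> 'a SOm \<Rightarrow> 'a WOm" where
  "pi_dag sc br = lin_lift (WOmega sc br)
     (\<lambda>(s, \<mu>). tens (W_alg sc br) (Omega sc) (\<lambda>p. pi_dag_U sc br (s p)) \<mu>)"

definition S_dag_grade ::
  "('k::field_char_0 \<Rightarrow> 'a \<Rightarrow> 'a::comm_ring_1) \<Rightarrow> ('a \<Rightarrow> 'a \<Rightarrow> 'a) \<Rightarrow> nat \<Rightarrow> 'a env set" where
  "S_dag_grade sc br p = pi_dag_U sc br ` Sym_grade sc p"

text \<open>\<open>S\<^sub>p\<^sup>\<dagger> \<otimes> \<Omega>\<^sup>q\<close> and \<open>S\<^sup>\<dagger> \<otimes> \<Omega>\<close>, as subsets of \<open>W \<otimes> \<Omega>\<close>.\<close>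

definition SdagOmegaPQ ::
  "('k::field_char_0 \<Rightarrow> 'a \<Rightarrow> 'a::comm_ring_1) \<Rightarrow> ('a \<Rightarrow> 'a \<Rightarrow> 'a) \<Rightarrow> nat \<Rightarrow> nat \<Rightarrow> 'a WOm set" where
  "SdagOmegaPQ sc br p q = tens_part (W_alg sc br) (Omega sc)
     (homog (U_alg sc br) p ` S_dag_grade sc br p) (OmegaQ sc q)"

definition SdagOmega ::
  "('k::field_char_0 \<Rightarrow> 'a \<Rightarrow> 'a::comm_ring_1) \<Rightarrow> ('a \<Rightarrow> 'a \<Rightarrow> 'a) \<Rightarrow> 'a WOm set" where
  "SdagOmega sc br = tens_part (W_alg sc br) (Omega sc)
     {w. \<forall>p. w p \<in> S_dag_grade sc br p} (carrier (Omega sc))"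


section \<open>The operators \<open>\<delta>\<close>, \<open>\<delta>\<^sup>*\<close>, \<open>\<delta>\<close>-tilde and \<open>\<tau>\<close>\<close>

text \<open>These maps are characterized by their defining properties, which determine them on the
  carriers; values elsewhere are irrelevant. Since \<open>\<flat>\<close> is the inverse of \<open>\<sharp>\<close>, the condition \<open>\<delta>(X) = X\<^sup>\<flat>\<close> on \<open>Der A\<close> is
  \<open>\<delta>(\<nu>\<^sup>\<sharp>) = \<nu>\<close> on \<open>\<Omega>\<^sup>1\<close>.\<close>

definition is_delta ::
  "('k \<Rightarrow> 'a \<Rightarrow> 'a::comm_ring_1) \<Rightarrow> ('a \<Rightarrow> 'a \<Rightarrow> 'a) \<Rightarrow> ('a WOm \<Rightarrow> 'a WOm) \<Rightarrow> bool" where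
  "is_delta sc br d \<longleftrightarrow>
     d \<in> carrier (WOmega sc br) \<rightarrow> carrier (WOmega sc br) \<and>
     continuous_map (W_alg sc br) (Omega sc) d \<and>
     (\<forall>x \<in> carrier (WOmega sc br). \<forall>y \<in> carrier (WOmega sc br).
        d (x \<oplus>\<^bsub>WOmega sc br\<^esub> y) = d x \<oplus>\<^bsub>WOmega sc br\<^esub> d y) \<and>
     (\<forall>q. d ` WOmegaQ sc br q \<subseteq> WOmegaQ sc br (Suc q)) \<and>
     (\<forall>q. \<forall>x \<in> WOmegaQ sc br q. \<forall>y \<in> carrier (WOmega sc br).
        d (x \<otimes>\<^bsub>WOmega sc br\<^esub> y) = d x \<otimes>\<^bsub>WOmega sc br\<^esub> y \<oplus>\<^bsub>WOmega sc br\<^esub>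
          signed (WOmega sc br) q (x \<otimes>\<^bsub>WOmega sc br\<^esub> d y)) \<and>
     (\<forall>\<mu> \<in> carrier (Omega sc). d (inOmega sc br \<mu>) = \<zero>\<^bsub>WOmega sc br\<^esub>) \<and>
     d (h_W sc br) = \<zero>\<^bsub>WOmega sc br\<^esub> \<and>
     (\<forall>\<nu> \<in> carrier (Omega1 sc). d (inDer sc br (sharp sc br \<nu>)) = inOmega sc br (form1 sc \<nu>))"

text \<open>\<open>Der A \<otimes> \<Omega>\<close> is identified with \<open>S\<^sub>1 \<otimes> \<Omega> \<subseteq> S \<otimes> \<Omega>\<close>.\<close>

definition DerOmega :: "('k \<Rightarrow> 'a \<Rightarrow> 'a::comm_ring_1) \<Rightarrow> 'a SOm set" where
  "DerOmega sc = tens_part (S_alg sc) (Omega sc)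
     ((\<lambda>X. homog (Sym sc) 1 (Sym_in sc X)) ` carrier (Der sc)) (carrier (Omega sc))"

definition is_delta_star ::
  "('k \<Rightarrow> 'a \<Rightarrow> 'a::comm_ring_1) \<Rightarrow> ('a \<Rightarrow> 'a \<Rightarrow> 'a) \<Rightarrow> ('a kform \<Rightarrow> 'a SOm) \<Rightarrow> bool" where
  "is_delta_star sc br d \<longleftrightarrow>
     d \<in> carrier (Omega sc) \<rightarrow> DerOmega sc \<and>
     (\<forall>\<alpha> \<in> carrier (Omega sc). \<forall>\<beta> \<in> carrier (Omega sc).
        d (\<alpha> \<oplus>\<^bsub>Omega sc\<^esub> \<beta>) = d \<alpha> \<oplus>\<^bsub>SOmega sc\<^esub> d \<beta>) \<and>
     (\<forall>a. \<forall>\<alpha> \<in> carrier (Omega sc). d (a \<odot>\<^bsub>Omega sc\<^esub> \<alpha>) = a \<odot>\<^bsub>SOmega sc\<^esub> d \<alpha>) \<and>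
     (\<forall>\<nu> \<in> carrier (Omega1 sc). d (form1 sc \<nu>) =
        tens (S_alg sc) (Omega sc) (homog (Sym sc) 1 (Sym_in sc (sharp sc br \<nu>))) \<one>\<^bsub>Omega sc\<^esub>) \<and>
     (\<forall>q. \<forall>\<alpha> \<in> OmegaQ sc q. \<forall>\<beta> \<in> carrier (Omega sc).
        d (\<alpha> \<otimes>\<^bsub>Omega sc\<^esub> \<beta>) =
          d \<alpha> \<otimes>\<^bsub>SOmega sc\<^esub> tens (S_alg sc) (Omega sc) \<one>\<^bsub>S_alg sc\<^esub> \<beta> \<oplus>\<^bsub>SOmega sc\<^esub>
          signed (SOmega sc) q (tens (S_alg sc) (Omega sc) \<one>\<^bsub>S_alg sc\<^esub> \<alpha> \<otimes>\<^bsub>SOmega sc\<^esub> d \<beta>))"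

definition delta_star_S ::
  "('k \<Rightarrow> 'a \<Rightarrow> 'a::comm_ring_1) \<Rightarrow> ('a kform \<Rightarrow> 'a SOm) \<Rightarrow> 'a SOm \<Rightarrow> 'a SOm" where
  "delta_star_S sc ds = lin_lift (SOmega sc)
     (\<lambda>(s, \<nu>). tens (S_alg sc) (Omega sc) s \<one>\<^bsub>Omega sc\<^esub> \<otimes>\<^bsub>SOmega sc\<^esub> ds \<nu>)"

definition is_delta_tilde ::
  "('k::field_char_0 \<Rightarrow> 'a \<Rightarrow> 'a::comm_ring_1) \<Rightarrow> ('a \<Rightarrow> 'a \<Rightarrow> 'a) \<Rightarrow>
     ('a kform \<Rightarrow> 'a SOm) \<Rightarrow> ('a WOm \<Rightarrow> 'a WOm) \<Rightarrow> bool" where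
  "is_delta_tilde sc br ds d \<longleftrightarrow>
     d \<in> carrier (WOmega sc br) \<rightarrow> carrier (WOmega sc br) \<and>
     continuous_map (W_alg sc br) (Omega sc) d \<and>
     (\<forall>x \<in> carrier (WOmega sc br). \<forall>y \<in> carrier (WOmega sc br).
        d (x \<oplus>\<^bsub>WOmega sc br\<^esub> y) = d x \<oplus>\<^bsub>WOmega sc br\<^esub> d y) \<and>
     (\<forall>c. \<forall>x \<in> carrier (WOmega sc br).
        d (inAh sc br c \<otimes>\<^bsub>WOmega sc br\<^esub> x) = inAh sc br c \<otimes>\<^bsub>WOmega sc br\<^esub> d x) \<and>
     (\<forall>a. d (inA sc br a) = \<zero>\<^bsub>WOmega sc br\<^esub>) \<and>
     (\<forall>p q. (p, q) \<noteq> (0, 0) \<longrightarrow> (\<forall>x \<in> SdagOmegaPQ sc br p q.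
        d x = sc (1 / of_nat (p + q)) 1 \<odot>\<^bsub>WOmega sc br\<^esub>
          pi_dag sc br (delta_star_S sc ds (pi_map sc x))))"

text \<open>\<open>\<Omega>\<^sup>0\<close> and \<open>S\<^sub>0\<close> are \<open>A\<close>: for a class in \<open>\<Omega>\<close> or in \<open>S\<close>, the coefficient of the empty word is
  its component in degree \<open>0\<close>.\<close>

definition coeff0 :: "('g word \<Rightarrow>\<^sub>0 'a::comm_ring_1) set \<Rightarrow> 'a" where
  "coeff0 = lin_lift base_mod (\<lambda>w. if w = 0 then 1 else 0)"

definition tau_S :: "'a::comm_ring_1 SOm \<Rightarrow> 'a" where
  "tau_S = lin_lift base_mod (\<lambda>(s, \<mu>). coeff0 (s 0) * coeff0 \<mu>)"

definition is_tau ::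
  "('k::field_char_0 \<Rightarrow> 'a \<Rightarrow> 'a::comm_ring_1) \<Rightarrow> ('a \<Rightarrow> 'a \<Rightarrow> 'a) \<Rightarrow> ('a WOm \<Rightarrow> 'a fps) \<Rightarrow> bool" where
  "is_tau sc br t \<longleftrightarrow> (\<forall>s x. (\<forall>m. s m \<in> SdagOmega sc br) \<and>
     conv_sum (W_alg sc br) (Omega sc)
       (\<lambda>m. h_W sc br [^]\<^bsub>WOmega sc br\<^esub> (m::nat) \<otimes>\<^bsub>WOmega sc br\<^esub> s m) x \<longrightarrow>
     t x = Abs_fps (\<lambda>m. tau_S (pi_map sc (s m))))"

end

theory Submission
  imports Defs "HOL-Combinatorics.Multiset_Permutations"
begin

text \<open>
  Both operators are additive, continuous and compatible with \<open>h\<close>, so it suffices to treat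
  \<open>x = \<pi>\<^sup>\<dagger>(Y\<^sub>1 \<dots> Y\<^sub>p) \<otimes> \<mu>\<close> with \<open>Y\<^sub>i = \<nu>\<^sub>i\<^sup>\<sharp>\<close> and \<open>\<mu> \<in> \<Omega>\<^sup>q\<close>: such elements, multiplied by powers of \<open>h\<close>, span a
  dense submodule, and limits are unique because \<open>A\<close> is noetherian and \<open>\<Omega>\<close> is finitely generated.
  Symmetrized products are differentiated like commutative ones,
  \<open>\<delta>(\<pi>\<^sup>\<dagger>(Y\<^sub>1 \<dots> Y\<^sub>p)) = \<Sum>\<^sub>i \<pi>\<^sup>\<dagger>(\<Prod>\<^sub>j\<^sub>\<noteq>\<^sub>i Y\<^sub>j) \<otimes> \<nu>\<^sub>i\<close>, by recursion on the first letter, and thus \<open>\<delta>\<close> and \<open>(p + q) \<delta>\<close>-tilde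
  become the Koszul differential and its adjoint on \<open>S \<otimes> \<Omega>\<close>. With
  \<open>R = \<Sum>\<^sub>i \<pi>\<^sup>\<dagger>(\<Prod>\<^sub>j\<^sub>\<noteq>\<^sub>i Y\<^sub>j \<otimes> \<nu>\<^sub>i \<delta>\<^sup>*\<mu>)\<close>, the two products of \<open>\<delta>\<close> and \<open>(p + q) \<delta>\<close>-tilde send \<open>x\<close> to \<open>p x - R\<close> and
  to \<open>q x + R\<close>. For \<open>p = q = 0\<close> both vanish, and \<open>\<tau>\<close> gives back \<open>x\<close>. The square of \<open>\<delta>\<close>-tilde is zero because
  \<open>\<delta>\<^sup>*\<close> is an antiderivation into \<open>Der A \<otimes> \<Omega>\<close> and the symmetric algebra is commutative.
\<close>


section \<open>Modules over the base ring\<close>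

text \<open>Three points shape the proof. No product rule is available for delta-tilde, because of
  the division by p + q and the detour through the symmetric algebra, so both products have to be
  computed on whole symmetrized elements. These are indexed by finite sets, so that deleting or
  adjoining a factor needs no renumbering. The term R occurs with opposite signs because delta*(nu
  mu) = nu^# mu - nu delta*(mu), and with the same denominator because both operators preserve p +
  q. The coefficient q of x is Euler's identity: turning the derivation in delta*(mu) back into its
  1-form and multiplying it to the front gives q mu. The tensor product with the forms is algebraic
  and not completed, so an element could a priori lie in every neighbourhood of 0; excluding this
  takes finitely many relations between finitely many generators of the forms. Finally, tau is
  specified only through expansions in powers of h, so such expansions must be shown to exist. This
  is the spanning half of a Poincare-Birkhoff-Witt theorem.\<close>

lemma base_mod_simps [simp]:
  "carrier base_mod = UNIV" "a \<otimes>\<^bsub>base_mod\<^esub> b = a * b" "a \<oplus>\<^bsub>base_mod\<^esub> b = a + b"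
  "\<one>\<^bsub>base_mod\<^esub> = 1" "\<zero>\<^bsub>base_mod\<^esub> = 0" "a \<odot>\<^bsub>base_mod\<^esub> b = a * b"
  by (simp_all add: base_mod_def)

lemma cring_base_mod: "cring (base_mod :: ('a::comm_ring_1, 'a) module)"
proof (intro cringI abelian_groupI comm_monoidI)
  fix x :: 'a assume "x \<in> carrier base_mod"
  show "\<exists>y\<in>carrier base_mod. y \<oplus>\<^bsub>base_mod\<^esub> x = \<zero>\<^bsub>base_mod\<^esub>"
    by (rule bexI[of _ "- x"]) simp_all
qed (simp_all add: algebra_simps)

lemma base_mod_uminus [simp]: "\<ominus>\<^bsub>base_mod\<^esub> (a::'a::comm_ring_1) = - a"
proof -
  interpret cring "base_mod :: ('a, 'a) module" by (rule cring_base_mod)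
  show ?thesis by (rule sum_zero_eq_neg[symmetric]) simp_all
qed

locale amod = module base_mod M for M :: "('a::comm_ring_1, 'm) module" (structure)

text \<open>Additive inverses come from the scalar \<open>- 1\<close>: distributivity, the unit law
  and the zero law make \<open>- 1 \<odot> x\<close> inverse to \<open>x\<close>.\<close>

lemma amodI:
  fixes M (structure)
  assumes "\<zero> \<in> carrier M"
    and "\<And>x y. x \<in> carrier M \<Longrightarrow> y \<in> carrier M \<Longrightarrow> x \<oplus> y \<in> carrier M"
    and "\<And>a x. x \<in> carrier M \<Longrightarrow> a \<odot> x \<in> carrier M"
    and "\<And>x y z. x \<in> carrier M \<Longrightarrow> y \<in> carrier M \<Longrightarrow> z \<in> carrier M \<Longrightarrow> x \<oplus> y \<oplus> z = x \<oplus> (y \<oplus> z)"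
    and "\<And>x y. x \<in> carrier M \<Longrightarrow> y \<in> carrier M \<Longrightarrow> x \<oplus> y = y \<oplus> x"
    and "\<And>x. x \<in> carrier M \<Longrightarrow> \<zero> \<oplus> x = x"
    and "\<And>x. x \<in> carrier M \<Longrightarrow> 0 \<odot> x = \<zero>"
    and "\<And>x. x \<in> carrier M \<Longrightarrow> 1 \<odot> x = x"
    and "\<And>a b x. x \<in> carrier M \<Longrightarrow> (a + b) \<odot> x = a \<odot> x \<oplus> b \<odot> x"
    and "\<And>a x y. x \<in> carrier M \<Longrightarrow> y \<in> carrier M \<Longrightarrow> a \<odot> (x \<oplus> y) = a \<odot> x \<oplus> a \<odot> y"
    and "\<And>a b x. x \<in> carrier M \<Longrightarrow> (a * b) \<odot> x = a \<odot> (b \<odot> x)"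
  shows "amod M"
proof (intro amod.intro moduleI cring_base_mod abelian_groupI)
  fix x assume x: "x \<in> carrier M"
  have "- 1 \<odot> x \<oplus> x = (- 1 + 1) \<odot> x"
    using assms(8,9) x by metis
  then show "\<exists>y\<in>carrier M. y \<oplus> x = \<zero>"
    using assms(3,7) x by (intro bexI[of _ "- 1 \<odot> x"]) simp_all
  show "\<zero> \<oplus> x = x" using assms(6) x by simp
next
  fix x y assume "x \<in> carrier M" "y \<in> carrier M"
  then show "x \<oplus> y = y \<oplus> x" by (rule assms(5))
qed (simp_all add: assms(1-4,6-11))

context amod
begin

lemma smult_closedI [simp, intro]: "x \<in> carrier M \<Longrightarrow> a \<odot> x \<in> carrier M"
  by simp

lemmas smult_add_left = smult_l_distr[simplified]
lemmas smult_add_right = smult_r_distr[simplified]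
lemmas smult_mult = smult_assoc1[simplified]
lemmas smult_1 [simp] = smult_one[simplified]
lemmas smult_0 [simp] = smult_l_null[simplified]
lemma smult_zero: "a \<odot> \<zero> = \<zero>"
  by simp

lemmas smult_uminus = smult_l_minus[simplified]
lemmas smult_finsum = finsum_smult_ldistr[simplified]

lemma neg_eq_smult: "x \<in> carrier M \<Longrightarrow> \<ominus> x = - 1 \<odot> x"
  by (simp add: smult_uminus)

lemma neg_zero [simp]: "\<ominus> \<zero> = \<zero>"
  by (simp add: neg_eq_smult)

lemma submoduleI':
  assumes "H \<subseteq> carrier M" "\<zero> \<in> H" "\<And>x y. x \<in> H \<Longrightarrow> y \<in> H \<Longrightarrow> x \<oplus> y \<in> H"
    "\<And>a x. x \<in> H \<Longrightarrow> a \<odot> x \<in> H"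
  shows "submodule H base_mod M"
  using assms by (intro submoduleI) (auto simp: neg_eq_smult subset_iff)

lemma submoduleD:
  assumes "submodule H base_mod M"
  shows "H \<subseteq> carrier M" "\<zero> \<in> H" "x \<in> H \<Longrightarrow> y \<in> H \<Longrightarrow> x \<oplus> y \<in> H" "x \<in> H \<Longrightarrow> a \<odot> x \<in> H"
    "x \<in> H \<Longrightarrow> \<ominus> x \<in> H" "x \<in> H \<Longrightarrow> y \<in> H \<Longrightarrow> x \<ominus> y \<in> H"
proof -
  show "H \<subseteq> carrier M" "x \<in> H \<Longrightarrow> y \<in> H \<Longrightarrow> x \<oplus> y \<in> H" "x \<in> H \<Longrightarrow> a \<odot> x \<in> H" "x \<in> H \<Longrightarrow> \<ominus> x \<in> H"
    "x \<in> H \<Longrightarrow> y \<in> H \<Longrightarrow> x \<ominus> y \<in> H"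
    using submoduleE[OF assms] by (auto simp: a_minus_def)
  obtain h where "h \<in> H" using submoduleE(2)[OF assms] by blast
  then have "h \<ominus> h \<in> H" "h \<in> carrier M"
    using submoduleE[OF assms] by (auto simp: a_minus_def)
  then show "\<zero> \<in> H" by (simp add: a_minus_def M.r_neg)
qed

lemma submodule_finsum:
  assumes "submodule H base_mod M" "\<And>i. i \<in> I \<Longrightarrow> f i \<in> H"
  shows "finsum M f I \<in> H"
  using assms(2)
proof (induction I rule: infinite_finite_induct)
  case (insert i I)
  then show ?case
    using submoduleD[OF assms(1)] by (simp add: Pi_def subset_iff)
qed (use submoduleD[OF assms(1)] in simp_all)

lemma gen_submod_incl: "S \<subseteq> gen_submod M S"
  by (auto simp: gen_submod_def)

lemma gen_submod_least: "submodule H base_mod M \<Longrightarrow> S \<subseteq> H \<Longrightarrow> gen_submod M S \<subseteq> H"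
  by (auto simp: gen_submod_def)

lemma gen_submod_submodule:
  assumes "S \<subseteq> carrier M"
  shows "submodule (gen_submod M S) base_mod M"
proof (rule submoduleI')
  show "gen_submod M S \<subseteq> carrier M"
    by (rule gen_submod_least[OF carrier_is_submodule assms])
qed (auto simp: gen_submod_def dest: submoduleD)

text \<open>The elements all of whose scalar multiples satisfy \<open>P\<close> form a submodule.
  This strengthening is why the generator case carries a scalar, while \<open>P\<close> itself is
  only asked to respect zero and sums.\<close>

lemma gen_submod_induct [consumes 2, case_names zero add gen]:
  assumes "x \<in> gen_submod M S" "S \<subseteq> carrier M" "P \<zero>"
    and add: "\<And>x y. x \<in> carrier M \<Longrightarrow> y \<in> carrier M \<Longrightarrow> P x \<Longrightarrow> P y \<Longrightarrow> P (x \<oplus> y)"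
    and gen: "\<And>a x. x \<in> S \<Longrightarrow> P (a \<odot> x)"
  shows "P x"
proof -
  have "submodule {x \<in> carrier M. \<forall>a. P (a \<odot> x)} base_mod M"
    by (rule submoduleI') (auto simp: assms(3) add smult_add_right smult_mult[symmetric])
  then have "gen_submod M S \<subseteq> {x \<in> carrier M. \<forall>a. P (a \<odot> x)}"
    using assms(2) gen by (intro gen_submod_least) auto
  with assms(1) have "P (1 \<odot> x)" "x \<in> carrier M" by auto
  then show ?thesis by simp
qed

lemma minus_eq_zero_iff: "x \<in> carrier M \<Longrightarrow> y \<in> carrier M \<Longrightarrow> x \<ominus> y = \<zero> \<longleftrightarrow> x = y"
  by (metis M.minus_equality a_minus_def M.minus_minus M.r_neg a_inv_closed)

lemma finsum_minus:
  assumes "f \<in> I \<rightarrow> carrier M" "g \<in> I \<rightarrow> carrier M"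
  shows "finsum M f I \<ominus> finsum M g I = finsum M (\<lambda>i. f i \<ominus> g i) I"
proof (cases "finite I")
  case True
  then show ?thesis
    using assms
  proof (induction I)
    case (insert i I)
    then show ?case
      by (simp add: Pi_def a_minus_def M.minus_add M.a_ac)
  qed (simp add: a_minus_def)
qed (simp add: a_minus_def)

lemma finsum_swap:
  assumes "finite I" "finite J" "\<And>i j. i \<in> I \<Longrightarrow> j \<in> J \<Longrightarrow> f i j \<in> carrier M"
  shows "(\<Oplus>i\<in>I. \<Oplus>j\<in>J. f i j) = (\<Oplus>j\<in>J. \<Oplus>i\<in>I. f i j)"
  using assms(1,3)
proof (induction I)
  case (insert i I)
  then have "(\<Oplus>i\<in>insert i I. \<Oplus>j\<in>J. f i j) = (\<Oplus>j\<in>J. f i j) \<oplus> (\<Oplus>j\<in>J. \<Oplus>i\<in>I. f i j)"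
    by (simp add: Pi_def)
  also have "\<dots> = (\<Oplus>j\<in>J. f i j \<oplus> (\<Oplus>i\<in>I. f i j))"
    using insert by (intro M.finsum_addf[symmetric]) (auto simp: Pi_def)
  also have "\<dots> = (\<Oplus>j\<in>J. \<Oplus>i\<in>insert i I. f i j)"
    using insert by (intro M.finsum_cong') (auto simp: Pi_def)
  finally show ?case .
qed (simp add: M.finsum_zero)

lemma finsum_of_nat: "finite I \<Longrightarrow> x \<in> carrier M \<Longrightarrow> (\<Oplus>i\<in>I. x) = of_nat (card I) \<odot> x"
  by (induction rule: finite_induct) (simp_all add: smult_add_left)

end

definition lin_map :: "('a::comm_ring_1, 'm) module \<Rightarrow> ('a, 'n) module \<Rightarrow> ('m \<Rightarrow> 'n) \<Rightarrow> bool" where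
  "lin_map M N f \<longleftrightarrow> f \<in> carrier M \<rightarrow> carrier N \<and>
     (\<forall>x \<in> carrier M. \<forall>y \<in> carrier M. f (x \<oplus>\<^bsub>M\<^esub> y) = f x \<oplus>\<^bsub>N\<^esub> f y) \<and>
     (\<forall>a. \<forall>x \<in> carrier M. f (a \<odot>\<^bsub>M\<^esub> x) = a \<odot>\<^bsub>N\<^esub> f x)"

lemma lin_mapD:
  assumes "lin_map M N f"
  shows "x \<in> carrier M \<Longrightarrow> f x \<in> carrier N"
    "x \<in> carrier M \<Longrightarrow> y \<in> carrier M \<Longrightarrow> f (x \<oplus>\<^bsub>M\<^esub> y) = f x \<oplus>\<^bsub>N\<^esub> f y"
    "x \<in> carrier M \<Longrightarrow> f (a \<odot>\<^bsub>M\<^esub> x) = a \<odot>\<^bsub>N\<^esub> f x"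
  using assms by (auto simp: lin_map_def)

locale lin = M: amod M + N: amod N
  for M :: "('a::comm_ring_1, 'm) module" and N :: "('a, 'n) module" and f +
  assumes lin: "lin_map M N f"
begin

lemmas closed = lin_mapD(1)[OF lin]
  and add = lin_mapD(2)[OF lin]
  and smult = lin_mapD(3)[OF lin]

lemma zero: "f \<zero>\<^bsub>M\<^esub> = \<zero>\<^bsub>N\<^esub>"
  using smult[of "\<zero>\<^bsub>M\<^esub>" 0] closed[of "\<zero>\<^bsub>M\<^esub>"] by simp

lemma neg: "x \<in> carrier M \<Longrightarrow> f (\<ominus>\<^bsub>M\<^esub> x) = \<ominus>\<^bsub>N\<^esub> f x"
  by (simp add: M.neg_eq_smult N.neg_eq_smult smult closed)

lemma minus: "x \<in> carrier M \<Longrightarrow> y \<in> carrier M \<Longrightarrow> f (x \<ominus>\<^bsub>M\<^esub> y) = f x \<ominus>\<^bsub>N\<^esub> f y"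
  by (simp add: a_minus_def add neg)

lemma finsum: "g \<in> I \<rightarrow> carrier M \<Longrightarrow> f (finsum M g I) = finsum N (\<lambda>i. f (g i)) I"
  by (induction I rule: infinite_finite_induct) (auto simp: zero add closed Pi_def)

lemma kernel_submodule: "submodule {x \<in> carrier M. f x = \<zero>\<^bsub>N\<^esub>} base_mod M"
  by (rule M.submoduleI') (auto simp: zero add smult)

end

section \<open>Free modules and their quotients\<close>

abbreviation scal :: "'a::comm_ring_1 \<Rightarrow> ('k \<Rightarrow>\<^sub>0 'a) \<Rightarrow> ('k \<Rightarrow>\<^sub>0 'a)" where
  "scal a \<equiv> Poly_Mapping.map ((*) a)"

lemma lookup_scal [simp]: "Poly_Mapping.lookup (scal a f) k = a * Poly_Mapping.lookup f k"
  by transfer (simp add: when_def)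

lemma scal_simps [simp]:
  "scal a (0 :: 'k \<Rightarrow>\<^sub>0 'a::comm_ring_1) = 0" "scal 0 (f :: 'k \<Rightarrow>\<^sub>0 'a) = 0" "scal 1 f = f"
  by (rule poly_mapping_eqI; simp)+

lemma scal_distrib:
  fixes f g :: "'k \<Rightarrow>\<^sub>0 'a::comm_ring_1"
  shows "scal a (f + g) = scal a f + scal a g" "scal (a + b) f = scal a f + scal b f"
    "scal (a * b) f = scal a (scal b f)" "scal a (f - g) = scal a f - scal a g"
    "scal (- 1) f = - f"
  by (rule poly_mapping_eqI; simp add: lookup_add lookup_minus algebra_simps)+

lemma keys_scal: "Poly_Mapping.keys (scal a f) \<subseteq> Poly_Mapping.keys f"
  by (auto simp: in_keys_iff)

lemma keys_uminus: "Poly_Mapping.keys (- f :: 'k \<Rightarrow>\<^sub>0 'a::comm_ring_1) = Poly_Mapping.keys f"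
  by (auto simp: in_keys_iff)

lemma keys_minus_subset:
  "Poly_Mapping.keys (f - g :: 'k \<Rightarrow>\<^sub>0 'a::comm_ring_1) \<subseteq> Poly_Mapping.keys f \<union> Poly_Mapping.keys g"
  by (auto simp: in_keys_iff lookup_minus)

text \<open>Splitting off one key makes the support strictly smaller, so induction on its size
  works. All supports stay inside \<open>K\<close>, which keeps carrier conditions at hand in the
  sum case.\<close>

lemma poly_mapping_lin_induct [consumes 1, case_names zero add single]:
  fixes f :: "'k \<Rightarrow>\<^sub>0 'a::comm_ring_1"
  assumes "Poly_Mapping.keys f \<subseteq> K" "P 0"
    and add: "\<And>f g. Poly_Mapping.keys f \<subseteq> K \<Longrightarrow> Poly_Mapping.keys g \<subseteq> K \<Longrightarrow> P f \<Longrightarrow> P g \<Longrightarrow> P (f + g)"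
    and single: "\<And>k a. k \<in> K \<Longrightarrow> P (Poly_Mapping.single k a)"
  shows "P f"
  using assms(1)
proof (induction "card (Poly_Mapping.keys f)" arbitrary: f rule: less_induct)
  case less
  show ?case
  proof (cases "f = 0")
    case False
    then obtain k where k: "k \<in> Poly_Mapping.keys f" by (metis ex_in_conv keys_eq_empty)
    define s where "s = Poly_Mapping.single k (Poly_Mapping.lookup f k)"
    define g where "g = f - s"
    have lk: "Poly_Mapping.lookup g j = (if j = k then 0 else Poly_Mapping.lookup f j)" for j
      by (auto simp: g_def s_def lookup_minus lookup_single when_def)
    then have "Poly_Mapping.keys g = Poly_Mapping.keys f - {k}"
      by (auto simp: in_keys_iff split: if_splits)
    with k have "Poly_Mapping.keys g \<subset> Poly_Mapping.keys f"
      and keys: "Poly_Mapping.keys g \<subseteq> K"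
      using less.prems by auto
    then have "card (Poly_Mapping.keys g) < card (Poly_Mapping.keys f)"
      by (simp only: psubset_card_mono finite_keys)
    then have "P g" using less.hyps keys by blast
    moreover have "P s" "Poly_Mapping.keys s \<subseteq> K"
      using k less.prems single unfolding s_def by (auto split: if_splits)
    ultimately have "P (g + s)" using keys add by blast
    then show ?thesis by (simp add: g_def)
  qed (simp add: assms(2))
qed

text \<open>The function under \<open>the_elem\<close> in \<open>lin_lift\<close>; conversely
  \<open>lin_lift\<close> is the descent of \<open>ext\<close> to cosets.\<close>

definition ext :: "('a::comm_ring_1, 'n) module \<Rightarrow> ('k \<Rightarrow> 'n) \<Rightarrow> ('k \<Rightarrow>\<^sub>0 'a) \<Rightarrow> 'n" where
  "ext N g f = finsum N (\<lambda>k. Poly_Mapping.lookup f k \<odot>\<^bsub>N\<^esub> g k) (Poly_Mapping.keys f)"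

lemma lin_lift_ext: "lin_lift N g X = the_elem (ext N g ` X)"
  by (simp add: lin_lift_def ext_def)

context amod
begin

text \<open>Cancellation can shrink the support of a sum, so the values at several functions are
  compared as sums over one common finite set.\<close>

lemma ext_superset:
  assumes "Poly_Mapping.keys f \<subseteq> T" "finite T" "g \<in> T \<rightarrow> carrier M"
  shows "ext M g f = finsum M (\<lambda>k. Poly_Mapping.lookup f k \<odot> g k) T"
  unfolding ext_def using assms
  by (intro M.add.finprod_mono_neutral_cong_left) (auto simp: in_keys_iff Pi_def)

lemma ext_closed:
  assumes "Poly_Mapping.keys f \<subseteq> K" "g \<in> K \<rightarrow> carrier M"
  shows "ext M g f \<in> carrier M"
  unfolding ext_def using assms by (intro M.finsum_closed) (auto simp: Pi_def)

lemma ext_zero [simp]: "ext M g 0 = \<zero>"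
  by (simp add: ext_def)

lemma ext_add:
  assumes "Poly_Mapping.keys f \<subseteq> K" "Poly_Mapping.keys f' \<subseteq> K" "g \<in> K \<rightarrow> carrier M"
  shows "ext M g (f + f') = ext M g f \<oplus> ext M g f'"
proof -
  let ?T = "Poly_Mapping.keys f \<union> Poly_Mapping.keys f'"
  have g: "g \<in> ?T \<rightarrow> carrier M" using assms by auto
  have "ext M g (f + f') = finsum M (\<lambda>k. Poly_Mapping.lookup f k \<odot> g k \<oplus> Poly_Mapping.lookup f' k \<odot> g k) ?T"
  proof -
    have "ext M g (f + f') = finsum M (\<lambda>k. Poly_Mapping.lookup (f + f') k \<odot> g k) ?T"
      using g keys_add[of f f'] by (intro ext_superset) auto
    also have "\<dots> = finsum M (\<lambda>k. Poly_Mapping.lookup f k \<odot> g k \<oplus> Poly_Mapping.lookup f' k \<odot> g k) ?T"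
      using g by (intro M.finsum_cong') (auto simp: lookup_add smult_add_left Pi_def)
    finally show ?thesis .
  qed
  also have "\<dots> = ext M g f \<oplus> ext M g f'"
    using g by (subst M.finsum_addf) (auto simp: ext_superset[of _ ?T] Pi_def)
  finally show ?thesis .
qed

lemma ext_scal:
  assumes "Poly_Mapping.keys f \<subseteq> K" "g \<in> K \<rightarrow> carrier M"
  shows "ext M g (scal a f) = a \<odot> ext M g f"
proof -
  have "ext M g (scal a f) = finsum M (\<lambda>k. a \<odot> (Poly_Mapping.lookup f k \<odot> g k)) (Poly_Mapping.keys f)"
    using assms keys_scal[of a f]
    by (subst ext_superset[of _ "Poly_Mapping.keys f"])
      (auto simp: smult_mult Pi_def intro!: M.finsum_cong')
  also have "\<dots> = a \<odot> ext M g f"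
    unfolding ext_def using assms by (subst smult_finsum) auto
  finally show ?thesis .
qed

lemma ext_single [simp]: "g k \<in> carrier M \<Longrightarrow> ext M g (Poly_Mapping.single k a) = a \<odot> g k"
  by (subst ext_superset[of _ "{k}"]) auto

lemma ext_minus:
  assumes "Poly_Mapping.keys f \<subseteq> K" "Poly_Mapping.keys f' \<subseteq> K" "g \<in> K \<rightarrow> carrier M"
  shows "ext M g (f - f') = ext M g f \<ominus> ext M g f'"
proof -
  have "f - f' = f + scal (- 1) f'" by (simp add: scal_distrib)
  moreover have "Poly_Mapping.keys (scal (- 1) f') \<subseteq> K" using keys_scal[of "- 1" f'] assms by auto
  ultimately show ?thesis
    using ext_add[of f K "scal (- 1) f'" g] ext_scal[of f' K g "- 1"] assms ext_closed[of f' K g]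
    by (simp only: neg_eq_smult a_minus_def)
qed

end

text \<open>All quotients in the definitions are quotients of modules of finitely supported functions with
  support in a set \<open>K\<close>.\<close>

locale free_quot =
  fixes F :: "('a::comm_ring_1, 'k \<Rightarrow>\<^sub>0 'a) module" and K :: "'k set" and I :: "('k \<Rightarrow>\<^sub>0 'a) set"
  assumes F_carrier: "carrier F = {f. Poly_Mapping.keys f \<subseteq> K}"
    and F_add [simp]: "f \<oplus>\<^bsub>F\<^esub> g = f + g" and F_zero [simp]: "\<zero>\<^bsub>F\<^esub> = 0"
    and F_smult [simp]: "a \<odot>\<^bsub>F\<^esub> f = scal a f"
    and I_submod: "submodule I base_mod F"

lemma free_amod:
  fixes F :: "('a::comm_ring_1, 'k \<Rightarrow>\<^sub>0 'a) module"
  assumes "carrier F = {f. Poly_Mapping.keys f \<subseteq> K}"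
    and "\<And>f g. f \<oplus>\<^bsub>F\<^esub> g = f + g" "\<zero>\<^bsub>F\<^esub> = 0" "\<And>a f. a \<odot>\<^bsub>F\<^esub> f = scal a f"
  shows "amod F"
proof (rule amodI)
  fix x y assume "x \<in> carrier F" "y \<in> carrier F"
  then show "x \<oplus>\<^bsub>F\<^esub> y \<in> carrier F"
    using keys_add[of x y] by (auto simp: assms)
next
  fix x a assume "x \<in> carrier F"
  then show "a \<odot>\<^bsub>F\<^esub> x \<in> carrier F"
    using keys_scal[of a x] by (auto simp: assms)
qed (simp_all add: assms scal_distrib algebra_simps)

context free_quot
begin

sublocale F: amod F
  by (rule free_amod[OF F_carrier F_add F_zero F_smult])

definition cl :: "('k \<Rightarrow>\<^sub>0 'a) \<Rightarrow> ('k \<Rightarrow>\<^sub>0 'a) set" where "cl f = I +>\<^bsub>F\<^esub> f"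

abbreviation "Q \<equiv> mod_quot F I"

lemma cl_image: "cl f = (\<lambda>i. i + f) ` I"
  by (auto simp: cl_def a_r_coset_def r_coset_def)

lemma I_rules: "I \<subseteq> carrier F" "0 \<in> I" "f \<in> I \<Longrightarrow> g \<in> I \<Longrightarrow> f + g \<in> I" "f \<in> I \<Longrightarrow> scal a f \<in> I"
  using F.submoduleD[OF I_submod] by auto

lemma I_minus: "f \<in> I \<Longrightarrow> g \<in> I \<Longrightarrow> f - g \<in> I" "f \<in> I \<Longrightarrow> - f \<in> I"
  using I_rules(3)[of f "scal (- 1) g"] I_rules(4)[of g "- 1"] I_rules(4)[of f "- 1"]
  by (simp_all add: scal_distrib)

lemma carrier_keys: "f \<in> carrier F \<longleftrightarrow> Poly_Mapping.keys f \<subseteq> K"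
  by (simp add: F_carrier)

lemma carrier_rules [simp]:
  "0 \<in> carrier F" "f \<in> carrier F \<Longrightarrow> g \<in> carrier F \<Longrightarrow> f + g \<in> carrier F"
  "f \<in> carrier F \<Longrightarrow> scal a f \<in> carrier F" "f \<in> carrier F \<Longrightarrow> - f \<in> carrier F"
  "f \<in> carrier F \<Longrightarrow> g \<in> carrier F \<Longrightarrow> f - g \<in> carrier F"
  "k \<in> K \<Longrightarrow> Poly_Mapping.single k a \<in> carrier F"
  using keys_add[of f g] keys_scal[of a f] keys_uminus[of f] keys_minus_subset[of f g]
  by (auto simp: F_carrier split: if_splits)

lemma cl_self: "f \<in> cl f"
  using I_rules(2) by (force simp: cl_image)

lemma mem_cl: "g \<in> cl f \<longleftrightarrow> g - f \<in> I"
  by (auto simp: cl_image image_iff algebra_simps intro: bexI[of _ "g - f"])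

lemma cl_eq: "cl f = cl g \<longleftrightarrow> f - g \<in> I"
proof
  show "cl f = cl g \<Longrightarrow> f - g \<in> I" using cl_self[of f] by (simp add: mem_cl)
  assume *: "f - g \<in> I"
  show "cl f = cl g"
  proof (rule Set.set_eqI)
    fix h
    show "h \<in> cl f \<longleftrightarrow> h \<in> cl g"
      using I_rules(3)[OF _ *, of "h - f"] I_minus(1)[OF _ *, of "h - g"]
      by (auto simp: mem_cl algebra_simps)
  qed
qed

lemma Q_carrier: "carrier Q = cl ` carrier F"
  by (auto simp: mod_quot_def FactRing_def A_RCOSETS_def RCOSETS_def a_r_coset_def cl_def)

lemma cl_closed [simp, intro]: "f \<in> carrier F \<Longrightarrow> cl f \<in> carrier Q"
  by (simp add: Q_carrier)

lemma Q_zero: "\<zero>\<^bsub>Q\<^esub> = cl 0"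
  by (simp add: mod_quot_def FactRing_def cl_image)

lemma Q_one: "\<one>\<^bsub>Q\<^esub> = cl \<one>\<^bsub>F\<^esub>"
  by (simp add: mod_quot_def FactRing_def cl_def)

lemma Q_add: "cl f \<oplus>\<^bsub>Q\<^esub> cl g = cl (f + g)"
proof -
  have "cl f \<oplus>\<^bsub>Q\<^esub> cl g = {x + y | x y. x \<in> cl f \<and> y \<in> cl g}"
    by (auto simp: mod_quot_def FactRing_def set_add_def set_mult_def)
  also have "\<dots> = cl (f + g)"
  proof (intro Set.set_eqI iffI)
    fix z assume "z \<in> {x + y | x y. x \<in> cl f \<and> y \<in> cl g}"
    then obtain x y where "z = x + y" "x - f \<in> I" "y - g \<in> I" by (auto simp: mem_cl)
    then show "z \<in> cl (f + g)" using I_rules(3)[of "x - f" "y - g"] by (simp add: mem_cl algebra_simps)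
  next
    fix z assume "z \<in> cl (f + g)"
    then have "z - g \<in> cl f" by (simp add: mem_cl algebra_simps)
    then show "z \<in> {x + y | x y. x \<in> cl f \<and> y \<in> cl g}" using cl_self[of g] by force
  qed
  finally show ?thesis .
qed

lemma Q_smult: "f \<in> carrier F \<Longrightarrow> a \<odot>\<^bsub>Q\<^esub> cl f = cl (scal a f)"
proof -
  have "cl (scal a g) = cl (scal a f)" if "g \<in> cl f" for g
    using that I_rules(4)[of "g - f" a] by (simp add: cl_eq mem_cl scal_distrib)
  then have "(\<Union>x\<in>cl f. cl (scal a x)) = cl (scal a f)"
    using cl_self[of f] by blast
  then show ?thesis by (simp add: mod_quot_def cl_def)
qed

text \<open>The product of cosets in \<open>mod_quot\<close> is a union over all representatives. It
  collapses to one coset as soon as the product respects congruence at the two given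
  representatives. In this local form the lemma serves free algebras as well as tensor
  products.\<close>

lemma Q_mult:
  assumes "\<And>f' g'. f' - f \<in> I \<Longrightarrow> g' - g \<in> I \<Longrightarrow> f' \<otimes>\<^bsub>F\<^esub> g' - f \<otimes>\<^bsub>F\<^esub> g \<in> I"
  shows "cl f \<otimes>\<^bsub>Q\<^esub> cl g = cl (f \<otimes>\<^bsub>F\<^esub> g)"
proof -
  have "cl f \<otimes>\<^bsub>Q\<^esub> cl g = (\<Union>x\<in>cl f. \<Union>y\<in>cl g. cl (x \<otimes>\<^bsub>F\<^esub> y))"
    by (simp add: mod_quot_def FactRing_def rcoset_mult_def cl_def)
  moreover have "cl (x \<otimes>\<^bsub>F\<^esub> y) = cl (f \<otimes>\<^bsub>F\<^esub> g)" if "x \<in> cl f" "y \<in> cl g" for x y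
    using that assms by (simp add: mem_cl cl_eq)
  ultimately show ?thesis using cl_self by blast
qed

lemma Q_amod: "amod Q"
  by (rule amodI)
    (auto simp: Q_carrier Q_add Q_smult Q_zero scal_distrib algebra_simps simp del: F_add F_smult)

lemma Q_induct [consumes 1, case_names zero add gen]:
  assumes "x \<in> carrier Q" "P \<zero>\<^bsub>Q\<^esub>"
    and add: "\<And>x y. x \<in> carrier Q \<Longrightarrow> y \<in> carrier Q \<Longrightarrow> P x \<Longrightarrow> P y \<Longrightarrow> P (x \<oplus>\<^bsub>Q\<^esub> y)"
    and gen: "\<And>k a. k \<in> K \<Longrightarrow> P (a \<odot>\<^bsub>Q\<^esub> cl (Poly_Mapping.single k 1))"
  shows "P x"
proof -
  obtain f where f: "x = cl f" "Poly_Mapping.keys f \<subseteq> K"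
    using assms(1) by (auto simp: Q_carrier F_carrier)
  from f(2) have "P (cl f)"
  proof (induction rule: poly_mapping_lin_induct)
    case (add f g)
    then show ?case using assms(3)[of "cl f" "cl g"] by (simp add: Q_add carrier_keys[symmetric])
  next
    case (single k a)
    then show ?case using gen[of k a] by (simp add: Q_smult)
  qed (use assms(2) in \<open>simp add: Q_zero\<close>)
  with f show ?thesis by simp
qed

text \<open>\<open>the_elem\<close> is meaningful here: two representatives differ by an element of
  \<open>I\<close>, where the linear extension vanishes, so the image of the coset is a
  singleton.\<close>

lemma lin_lift_cl:
  assumes "amod N" "g \<in> K \<rightarrow> carrier N" "\<And>f. f \<in> I \<Longrightarrow> ext N g f = \<zero>\<^bsub>N\<^esub>" "f \<in> carrier F"
  shows "lin_lift N g (cl f) = ext N g f"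
proof -
  interpret N: amod N by fact
  have "ext N g x = ext N g f" if "x \<in> cl f" for x
  proof -
    have *: "x - f \<in> I" using that by (simp add: mem_cl)
    then have "x - f + f \<in> carrier F" using I_rules(1) assms(4) by (intro carrier_rules(2)) auto
    then have "x \<in> carrier F" by simp
    then have kx: "Poly_Mapping.keys x \<subseteq> K" and kf: "Poly_Mapping.keys f \<subseteq> K"
      using assms(4) by (simp_all only: carrier_keys)
    have "ext N g x \<ominus>\<^bsub>N\<^esub> ext N g f = \<zero>\<^bsub>N\<^esub>"
      using assms(3)[OF *] N.ext_minus[OF kx kf assms(2)] by simp
    then show ?thesis
      using N.minus_eq_zero_iff N.ext_closed[OF kx assms(2)] N.ext_closed[OF kf assms(2)] by blast
  qed
  then have "ext N g ` cl f = {ext N g f}" using cl_self[of f] by blast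
  then show ?thesis unfolding lin_lift_ext by (simp only: the_elem_eq)
qed

lemma lin_lift_lin:
  assumes "amod N" "g \<in> K \<rightarrow> carrier N" "\<And>f. f \<in> I \<Longrightarrow> ext N g f = \<zero>\<^bsub>N\<^esub>"
  shows "lin_map Q N (lin_lift N g)"
proof -
  interpret N: amod N by fact
  note lift = lin_lift_cl[OF assms]
  show ?thesis
    unfolding lin_map_def
  proof (intro conjI ballI allI funcsetI)
    fix x assume "x \<in> carrier Q"
    then obtain f where f: "x = cl f" "f \<in> carrier F" by (auto simp: Q_carrier)
    then show "lin_lift N g x \<in> carrier N"
      using N.ext_closed[of f K g] assms(2) by (simp add: lift carrier_keys)
    show "lin_lift N g (a \<odot>\<^bsub>Q\<^esub> x) = a \<odot>\<^bsub>N\<^esub> lin_lift N g x" for a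
      using f assms(2) N.ext_scal[of f K g a] by (simp add: lift Q_smult carrier_keys[of f])
    fix y assume "y \<in> carrier Q"
    then obtain f' where "y = cl f'" "f' \<in> carrier F" by (auto simp: Q_carrier)
    then show "lin_lift N g (x \<oplus>\<^bsub>Q\<^esub> y) = lin_lift N g x \<oplus>\<^bsub>N\<^esub> lin_lift N g y"
      using f assms(2) N.ext_add[of f K f' g]
      by (simp add: lift Q_add carrier_keys[of f] carrier_keys[of f'])
  qed
qed

lemma lin_lift_single:
  assumes "amod N" "g \<in> K \<rightarrow> carrier N" "\<And>f. f \<in> I \<Longrightarrow> ext N g f = \<zero>\<^bsub>N\<^esub>" "k \<in> K"
  shows "lin_lift N g (cl (Poly_Mapping.single k 1)) = g k"
proof -
  interpret N: amod N by fact
  show ?thesis using assms by (subst lin_lift_cl[OF assms(1-3)]) (auto simp: Pi_def)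
qed

end

section \<open>Algebras by generators and relations\<close>

text \<open>Associativity is kept separate, since products in completions are only needed when one factor
  is homogeneous.\<close>

locale balg = amod +
  assumes b_closed [simp, intro]: "x \<in> carrier M \<Longrightarrow> y \<in> carrier M \<Longrightarrow> x \<otimes> y \<in> carrier M"
    and b_one [simp, intro]: "\<one> \<in> carrier M"
    and b_l_one [simp]: "x \<in> carrier M \<Longrightarrow> \<one> \<otimes> x = x"
    and b_r_one [simp]: "x \<in> carrier M \<Longrightarrow> x \<otimes> \<one> = x"
    and b_l_distr: "x \<in> carrier M \<Longrightarrow> y \<in> carrier M \<Longrightarrow> z \<in> carrier M \<Longrightarrow> (x \<oplus> y) \<otimes> z = x \<otimes> z \<oplus> y \<otimes> z"
    and b_r_distr: "x \<in> carrier M \<Longrightarrow> y \<in> carrier M \<Longrightarrow> z \<in> carrier M \<Longrightarrow> z \<otimes> (x \<oplus> y) = z \<otimes> x \<oplus> z \<otimes> y"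
    and b_smult_l: "x \<in> carrier M \<Longrightarrow> y \<in> carrier M \<Longrightarrow> (a \<odot> x) \<otimes> y = a \<odot> (x \<otimes> y)"
    and b_smult_r: "x \<in> carrier M \<Longrightarrow> y \<in> carrier M \<Longrightarrow> x \<otimes> (a \<odot> y) = a \<odot> (x \<otimes> y)"
begin

lemma b_zero_l [simp]: "x \<in> carrier M \<Longrightarrow> \<zero> \<otimes> x = \<zero>"
  using b_smult_l[of \<zero> x 0] by simp

lemma b_zero_r [simp]: "x \<in> carrier M \<Longrightarrow> x \<otimes> \<zero> = \<zero>"
  using b_smult_r[of x \<zero> 0] by simp

lemma b_neg_l: "x \<in> carrier M \<Longrightarrow> y \<in> carrier M \<Longrightarrow> (\<ominus> x) \<otimes> y = \<ominus> (x \<otimes> y)"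
  by (simp add: neg_eq_smult b_smult_l)

lemma b_neg_r: "x \<in> carrier M \<Longrightarrow> y \<in> carrier M \<Longrightarrow> x \<otimes> (\<ominus> y) = \<ominus> (x \<otimes> y)"
  by (simp add: neg_eq_smult b_smult_r)

lemma lin_mult_l: "x \<in> carrier M \<Longrightarrow> lin_map M M (\<lambda>y. x \<otimes> y)"
  by (simp add: lin_map_def b_r_distr b_smult_r)

lemma lin_mult_r: "x \<in> carrier M \<Longrightarrow> lin_map M M (\<lambda>y. y \<otimes> x)"
  by (simp add: lin_map_def b_l_distr b_smult_l)

lemma b_finsum_r:
  assumes "x \<in> carrier M" "f \<in> I \<rightarrow> carrier M"
  shows "x \<otimes> finsum M f I = finsum M (\<lambda>i. x \<otimes> f i) I"
proof -
  interpret lin M M "\<lambda>y. x \<otimes> y"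
    using lin_mult_l[OF assms(1)] amod_axioms by (simp add: lin_def lin_axioms_def)
  show ?thesis by (rule finsum) fact
qed

lemma b_finsum_l:
  assumes "x \<in> carrier M" "f \<in> I \<rightarrow> carrier M"
  shows "finsum M f I \<otimes> x = finsum M (\<lambda>i. f i \<otimes> x) I"
proof -
  interpret lin M M "\<lambda>y. y \<otimes> x"
    using lin_mult_r[OF assms(1)] amod_axioms by (simp add: lin_def lin_axioms_def)
  show ?thesis by (rule finsum) fact
qed

end

locale asalg = balg +
  assumes b_assoc: "x \<in> carrier M \<Longrightarrow> y \<in> carrier M \<Longrightarrow> z \<in> carrier M \<Longrightarrow> x \<otimes> y \<otimes> z = x \<otimes> (y \<otimes> z)"
begin

lemma is_ring: "ring M"
  by (intro ringI monoidI) (simp_all add: b_assoc b_l_distr b_r_distr M.abelian_group_axioms)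

lemma prod_of_closed: "set xs \<subseteq> carrier M \<Longrightarrow> prod_of M xs \<in> carrier M"
  by (induction xs) (simp_all add: prod_of_def)

end

lemma prod_of_simps [simp]: "prod_of M [] = \<one>\<^bsub>M\<^esub>" "prod_of M (x # xs) = x \<otimes>\<^bsub>M\<^esub> prod_of M xs"
  by (simp_all add: prod_of_def)

definition words :: "'g set \<Rightarrow> 'g word set" where "words G = {w. set (letters w) \<subseteq> G}"

lemma words_simps [simp]:
  "Word ws \<in> words G \<longleftrightarrow> set ws \<subseteq> G" "0 \<in> words G" "u + v \<in> words G \<longleftrightarrow> u \<in> words G \<and> v \<in> words G"
  by (simp_all add: words_def zero_word_def plus_word_def)

lemma Word_plus: "Word u + Word v = Word (u @ v)"
  by (simp add: plus_word_def)

lemma free_alg_simps: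
  "carrier (free_alg G) = {f. Poly_Mapping.keys f \<subseteq> words G}" "f \<otimes>\<^bsub>free_alg G\<^esub> g = f * g"
  "f \<oplus>\<^bsub>free_alg G\<^esub> g = f + g" "\<one>\<^bsub>free_alg G\<^esub> = 1" "\<zero>\<^bsub>free_alg G\<^esub> = 0" "a \<odot>\<^bsub>free_alg G\<^esub> f = scal a f"
  by (auto simp: free_alg_def words_def)

lemma scal_mult:
  fixes f g :: "'g::monoid_add \<Rightarrow>\<^sub>0 'a::comm_ring_1"
  shows "scal a f * g = scal a (f * g)" "f * scal a g = scal a (f * g)"
proof -
  show "scal a f * g = scal a (f * g)"
    by (simp add: mult_map_scale_conv_mult mult.assoc)
  have "f * Poly_Mapping.single 0 a = Poly_Mapping.single 0 a * f"
    using subset_UNIV[of "Poly_Mapping.keys f"]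
    by (induction f rule: poly_mapping_lin_induct) (simp_all add: algebra_simps mult_single)
  then show "f * scal a g = scal a (f * g)"
    by (simp add: mult_map_scale_conv_mult mult.assoc[symmetric])
qed

lemma free_alg_mult_closed:
  assumes "f \<in> carrier (free_alg G)" "g \<in> carrier (free_alg G)"
  shows "f * g \<in> carrier (free_alg G)"
proof -
  have "Poly_Mapping.keys (f * g) \<subseteq> {a + b | a b. a \<in> words G \<and> b \<in> words G}"
    using keys_mult[of f g] assms unfolding free_alg_simps by blast
  then show ?thesis by (auto simp: free_alg_simps)
qed

lemma free_alg_amod: "amod (free_alg G)"
  by (rule free_amod[of _ "words G"]) (simp_all add: free_alg_simps)

lemma free_alg_ring: "ring (free_alg G :: ('a::comm_ring_1, 'g word \<Rightarrow>\<^sub>0 'a) module)"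
proof -
  interpret amod "free_alg G :: ('a, 'g word \<Rightarrow>\<^sub>0 'a) module" by (rule free_alg_amod)
  have "asalg (free_alg G :: ('a, 'g word \<Rightarrow>\<^sub>0 'a) module)"
  proof (unfold_locales, goal_cases)
    case (1 x y)
    then show ?case using free_alg_mult_closed[of x G y] by (simp add: free_alg_simps(2))
  qed (simp_all add: free_alg_simps scal_mult algebra_simps)
  then show ?thesis by (rule asalg.is_ring)
qed

locale pres = gens: amod Mo for Mo :: "('a::comm_ring_1, 'g) module" +
  fixes R :: "('g word \<Rightarrow>\<^sub>0 'a) set"
  assumes R_sub: "R \<subseteq> carrier (free_alg (carrier Mo))"
begin

abbreviation "Fr \<equiv> free_alg (carrier Mo) :: ('a, 'g word \<Rightarrow>\<^sub>0 'a) module"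

interpretation Fr: ring Fr by (rule free_alg_ring)

lemma letter_closed: "x \<in> carrier Mo \<Longrightarrow> letter x \<in> carrier Fr"
  by (simp add: letter_def free_alg_simps)

lemma rels_sub: "linear_rel Mo \<union> R \<subseteq> carrier Fr"
proof -
  interpret F: amod Fr by (rule free_alg_amod)
  have minus: "f - g \<in> carrier Fr" if "f \<in> carrier Fr" "g \<in> carrier Fr" for f g :: "'g word \<Rightarrow>\<^sub>0 'a"
    using that keys_minus_subset[of f g] by (auto simp: free_alg_simps)
  have "Poly_Mapping.single (Word [x]) a \<in> carrier Fr" if "x \<in> carrier Mo" for a x
    using that by (auto simp: free_alg_simps)
  then show ?thesis
    using R_sub by (auto simp: linear_rel_def intro!: minus letter_closed)
qed

lemma ideal: "ideal (pres_ideal Mo R) Fr"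
  unfolding pres_ideal_def by (rule Fr.genideal_ideal[OF rels_sub])

text \<open>Scalars act as multiplication by the constants \<open>Poly_Mapping.single 0 a\<close>,
  so a two-sided ideal of the free algebra is closed under them.\<close>

lemma ideal_submodule: "submodule (pres_ideal Mo R) base_mod Fr"
proof -
  interpret F: amod Fr by (rule free_alg_amod)
  interpret J: ideal "pres_ideal Mo R" Fr by (rule ideal)
  show ?thesis
  proof (rule F.submoduleI')
    fix a and f :: "'g word \<Rightarrow>\<^sub>0 'a" assume f: "f \<in> pres_ideal Mo R"
    have "Poly_Mapping.single 0 a \<in> carrier Fr" by (auto simp: free_alg_simps)
    from J.I_l_closed[OF f this] show "a \<odot>\<^bsub>Fr\<^esub> f \<in> pres_ideal Mo R"
      by (simp add: free_alg_simps mult_map_scale_conv_mult)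
  qed (use J.a_subset J.zero_closed J.a_closed in auto)
qed

sublocale free_quot Fr "words (carrier Mo)" "pres_ideal Mo R"
  by (rule free_quot.intro) (simp_all only: free_alg_simps ideal_submodule)

lemma Q_pres: "Q = pres_alg Mo R"
  by (simp add: pres_alg_def)

lemmas P_add = Q_add[unfolded Q_pres] and P_smult = Q_smult[unfolded Q_pres]
  and P_carrier = Q_carrier[unfolded Q_pres]

abbreviation "gen \<equiv> pres_gen Mo R"

definition wd :: "'g list \<Rightarrow> ('g word \<Rightarrow>\<^sub>0 'a) set" where
  "wd ws = cl (Poly_Mapping.single (Word ws) 1)"

lemma gen_cl: "gen x = cl (letter x)"
  by (simp add: pres_gen_def cl_def)

lemma wd_single: "wd [x] = gen x"
  by (simp add: wd_def gen_cl letter_def)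

lemma cl_mult:
  assumes f: "f \<in> carrier Fr" and g: "g \<in> carrier Fr"
  shows "cl f \<otimes>\<^bsub>pres_alg Mo R\<^esub> cl g = cl (f * g)"
proof -
  interpret J: ideal "pres_ideal Mo R" Fr by (rule ideal)
  have "cl f \<otimes>\<^bsub>Q\<^esub> cl g = cl (f \<otimes>\<^bsub>Fr\<^esub> g)"
  proof (rule Q_mult)
    fix f' g' assume *: "f' - f \<in> pres_ideal Mo R" "g' - g \<in> pres_ideal Mo R"
    have "g' - g + g \<in> carrier Fr" using * g I_rules(1) by (intro carrier_rules(2)) auto
    then have "(f' - f) * g' \<in> pres_ideal Mo R" "f * (g' - g) \<in> pres_ideal Mo R"
      using J.I_r_closed[OF *(1)] J.I_l_closed[OF *(2)] f by (simp_all add: free_alg_simps(2))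
    then have "(f' - f) * g' + f * (g' - g) \<in> pres_ideal Mo R" by (rule I_rules(3))
    then show "f' \<otimes>\<^bsub>Fr\<^esub> g' - f \<otimes>\<^bsub>Fr\<^esub> g \<in> pres_ideal Mo R"
      by (simp add: free_alg_simps(2) algebra_simps)
  qed
  then show ?thesis by (simp add: Q_pres free_alg_simps(2))
qed

lemma Q_asalg: "asalg (pres_alg Mo R)"
proof -
  interpret amod "pres_alg Mo R" using Q_amod by (simp add: Q_pres)
  note simps = Q_add[unfolded Q_pres] Q_smult[unfolded Q_pres] Q_one[unfolded Q_pres] cl_mult
    free_alg_mult_closed
  have c: "carrier (pres_alg Mo R) = cl ` carrier Fr" using Q_carrier by (simp add: Q_pres)
  have one: "1 \<in> carrier Fr" using Fr.one_closed by (simp only: free_alg_simps(4))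
  show ?thesis
    by unfold_locales (auto simp: c simps one scal_mult algebra_simps free_alg_simps(4))
qed

sublocale asalg "pres_alg Mo R" by (rule Q_asalg)

lemma wd_closed [simp]: "set ws \<subseteq> carrier Mo \<Longrightarrow> wd ws \<in> carrier (pres_alg Mo R)"
  using cl_closed[of "Poly_Mapping.single (Word ws) 1"] by (simp add: wd_def Q_pres)

lemma gen_closed [simp]: "x \<in> carrier Mo \<Longrightarrow> gen x \<in> carrier (pres_alg Mo R)"
  using wd_closed[of "[x]"] by (simp add: wd_single)

lemma wd_append:
  "set u \<subseteq> carrier Mo \<Longrightarrow> set v \<subseteq> carrier Mo \<Longrightarrow> wd (u @ v) = wd u \<otimes>\<^bsub>pres_alg Mo R\<^esub> wd v"
  by (simp add: wd_def cl_mult mult_single Word_plus)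

lemma wd_Nil: "wd [] = \<one>\<^bsub>pres_alg Mo R\<^esub>"
  using Q_one by (simp add: wd_def Q_pres free_alg_simps(4) flip: zero_word_def)

lemma wd_Cons: "x \<in> carrier Mo \<Longrightarrow> set u \<subseteq> carrier Mo \<Longrightarrow> wd (x # u) = gen x \<otimes>\<^bsub>pres_alg Mo R\<^esub> wd u"
  using wd_append[of "[x]" u] by (simp add: wd_single)

lemma wd_prod_of: "set ws \<subseteq> carrier Mo \<Longrightarrow> wd ws = prod_of (pres_alg Mo R) (map gen ws)"
  by (induction ws) (simp_all add: wd_Nil wd_Cons)

lemma cl_rel: "r \<in> linear_rel Mo \<union> R \<Longrightarrow> r \<in> pres_ideal Mo R"
  unfolding pres_ideal_def using Fr.genideal_self[OF rels_sub] by blast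

lemma gen_lin: "lin_map Mo (pres_alg Mo R) gen"
  unfolding lin_map_def
proof (intro conjI ballI allI funcsetI)
  fix x y a assume x: "x \<in> carrier Mo"
  have "letter (a \<odot>\<^bsub>Mo\<^esub> x) - Poly_Mapping.single (Word [x]) a \<in> pres_ideal Mo R"
    using x by (intro cl_rel) (auto simp: linear_rel_def)
  then show "gen (a \<odot>\<^bsub>Mo\<^esub> x) = a \<odot>\<^bsub>pres_alg Mo R\<^esub> gen x"
    using Q_smult[of "letter x" a] letter_closed[OF x] by (simp add: gen_cl Q_pres cl_eq letter_def)
  assume y: "y \<in> carrier Mo"
  have "letter (x \<oplus>\<^bsub>Mo\<^esub> y) - letter x - letter y \<in> pres_ideal Mo R"
    using x y by (intro cl_rel) (auto simp: linear_rel_def)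
  then show "gen (x \<oplus>\<^bsub>Mo\<^esub> y) = gen x \<oplus>\<^bsub>pres_alg Mo R\<^esub> gen y"
    using Q_add[of "letter x" "letter y"] by (simp add: gen_cl Q_pres cl_eq diff_diff_eq)
qed simp

lemma lin_gen: "lin Mo (pres_alg Mo R) gen"
  using gen_lin gens.amod_axioms amod_axioms by (simp add: lin_def lin_axioms_def)

lemma word_induct [consumes 1, case_names zero add word]:
  assumes "x \<in> carrier (pres_alg Mo R)" "P \<zero>\<^bsub>pres_alg Mo R\<^esub>"
    and add: "\<And>x y. x \<in> carrier (pres_alg Mo R) \<Longrightarrow> y \<in> carrier (pres_alg Mo R) \<Longrightarrow> P x \<Longrightarrow> P y \<Longrightarrow>
      P (x \<oplus>\<^bsub>pres_alg Mo R\<^esub> y)"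
    and word: "\<And>ws a. set ws \<subseteq> carrier Mo \<Longrightarrow> P (a \<odot>\<^bsub>pres_alg Mo R\<^esub> wd ws)"
  shows "P x"
proof -
  have "P (a \<odot>\<^bsub>pres_alg Mo R\<^esub> cl (Poly_Mapping.single w 1))" if "w \<in> words (carrier Mo)" for w a
    using word[of "letters w" a] that by (simp add: wd_def words_def)
  then show ?thesis
    using Q_induct[unfolded Q_pres, of x P] assms(1-3) by blast
qed

text \<open>A map that is linear but not multiplicative may kill all relations without killing the
  ideal they generate. Testing each relation between arbitrary words repairs this: the elements that
  pass the test for all pairs of words form a two-sided ideal \<open>J\<close>. This is what allows
  symmetrization, which is not multiplicative, to be defined on a presented algebra.\<close>

lemma ideal_kill:
  assumes N: "amod N" and phi: "lin_map Fr N \<phi>" and f: "f \<in> pres_ideal Mo R"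
    and rel: "\<And>u v r. set u \<subseteq> carrier Mo \<Longrightarrow> set v \<subseteq> carrier Mo \<Longrightarrow> r \<in> linear_rel Mo \<union> R \<Longrightarrow>
      \<phi> (Poly_Mapping.single (Word u) 1 * r * Poly_Mapping.single (Word v) 1) = \<zero>\<^bsub>N\<^esub>"
  shows "\<phi> f = \<zero>\<^bsub>N\<^esub>"
proof -
  interpret phi: lin Fr N \<phi> using N phi F.amod_axioms by (simp add: lin_def lin_axioms_def)
  let ?s = "\<lambda>w. Poly_Mapping.single w 1 :: 'g word \<Rightarrow>\<^sub>0 'a"
  have s_closed: "?s w \<in> carrier Fr" if "w \<in> words (carrier Mo)" for w
    using that by simp
  define J where "J = {f \<in> carrier Fr. \<forall>u \<in> words (carrier Mo). \<forall>v \<in> words (carrier Mo). \<phi> (?s u * f * ?s v) = \<zero>\<^bsub>N\<^esub>}"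
  have J_sub: "submodule J base_mod Fr"
  proof (rule F.submoduleI')
    show "J \<subseteq> carrier Fr" "\<zero>\<^bsub>Fr\<^esub> \<in> J" using phi.zero by (auto simp: J_def)
    show "f \<oplus>\<^bsub>Fr\<^esub> g \<in> J" if "f \<in> J" "g \<in> J" for f g
    proof -
      have "\<phi> (?s u * (f + g) * ?s v) = \<zero>\<^bsub>N\<^esub>" if uv: "u \<in> words (carrier Mo)" "v \<in> words (carrier Mo)" for u v
        using phi.add[of "?s u * f * ?s v" "?s u * g * ?s v"] \<open>f \<in> J\<close> \<open>g \<in> J\<close> uv
        by (simp add: J_def algebra_simps free_alg_mult_closed s_closed)
      then show ?thesis using that by (simp add: J_def)
    qed
    show "a \<odot>\<^bsub>Fr\<^esub> f \<in> J" if "f \<in> J" for f a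
    proof -
      have "\<phi> (?s u * scal a f * ?s v) = \<zero>\<^bsub>N\<^esub>" if uv: "u \<in> words (carrier Mo)" "v \<in> words (carrier Mo)" for u v
        using phi.smult[of "?s u * f * ?s v" a] \<open>f \<in> J\<close> uv
        by (simp add: J_def scal_mult free_alg_mult_closed s_closed)
      then show ?thesis using that by (simp add: J_def)
    qed
  qed
  note J_rules = F.submoduleD[OF J_sub, simplified]
  have J_mult: "g * f \<in> J \<and> f * g \<in> J" if "f \<in> J" "g \<in> carrier Fr" for f g
    using that(2)[unfolded carrier_keys]
  proof (induction g rule: poly_mapping_lin_induct)
    case (add g h)
    then show ?case using J_rules(3) by (simp add: algebra_simps)
  next
    case (single w a)
    have "?s w * f \<in> J" "f * ?s w \<in> J"
    proof -
      have "\<phi> (?s u * (?s w * f) * ?s v) = \<zero>\<^bsub>N\<^esub>" "\<phi> (?s u * (f * ?s w) * ?s v) = \<zero>\<^bsub>N\<^esub>"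
        if uv: "u \<in> words (carrier Mo)" "v \<in> words (carrier Mo)" for u v
      proof -
        have "?s u * (?s w * f) * ?s v = ?s (u + w) * f * ?s v"
          "?s u * (f * ?s w) * ?s v = ?s u * f * ?s (w + v)"
          by (simp_all add: mult_single mult.assoc[symmetric]) (simp add: mult_single mult.assoc)
        then show "\<phi> (?s u * (?s w * f) * ?s v) = \<zero>\<^bsub>N\<^esub>" "\<phi> (?s u * (f * ?s w) * ?s v) = \<zero>\<^bsub>N\<^esub>"
          using \<open>f \<in> J\<close> uv single by (simp_all add: J_def)
      qed
      then show "?s w * f \<in> J" "f * ?s w \<in> J"
        using \<open>f \<in> J\<close> single by (simp_all add: J_def free_alg_mult_closed)
    qed
    then have "scal a (?s w * f) \<in> J" "scal a (f * ?s w) \<in> J" using J_rules(4) by blast+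
    moreover have "Poly_Mapping.single w a = scal a (?s w)" by simp
    ultimately show ?case by (simp only: scal_mult)
  qed (use J_rules in simp)
  have "ideal J Fr"
  proof (rule idealI)
    show "subgroup J (add_monoid Fr)" using J_sub by (simp add: submodule_def)
  qed (use J_mult free_alg_ring in \<open>simp_all add: free_alg_simps(2)\<close>)
  moreover have "linear_rel Mo \<union> R \<subseteq> J"
  proof
    fix r assume r: "r \<in> linear_rel Mo \<union> R"
    have "\<phi> (?s u * r * ?s v) = \<zero>\<^bsub>N\<^esub>" if "u \<in> words (carrier Mo)" "v \<in> words (carrier Mo)" for u v
      using rel[OF _ _ r, of "letters u" "letters v"] that by (simp add: words_def)
    then show "r \<in> J" using r rels_sub by (auto simp: J_def)
  qed
  ultimately have "pres_ideal Mo R \<subseteq> J" unfolding pres_ideal_def by (rule Fr.genideal_minimal)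
  then have "f \<in> J" using f by blast
  then have "\<phi> (?s 0 * f * ?s 0) = \<zero>\<^bsub>N\<^esub>" by (simp only: J_def mem_Collect_eq words_simps)
  then show ?thesis by simp
qed

lemma ext_lin:
  assumes "amod N" "\<And>ws. set ws \<subseteq> carrier Mo \<Longrightarrow> g (Word ws) \<in> carrier N"
  shows "lin_map Fr N (ext N g)"
proof -
  interpret N: amod N by fact
  have g: "g \<in> words (carrier Mo) \<rightarrow> carrier N"
    using assms(2)[of "letters _"] by (auto simp: words_def)
  show ?thesis
    unfolding lin_map_def
    by (auto simp: carrier_keys N.ext_closed[OF _ g] N.ext_add[OF _ _ g] N.ext_scal[OF _ g])
qed

lemma ext_words:
  fixes N :: "('a, 'n) module"
  assumes N: "amod N" and g: "\<And>ws. set ws \<subseteq> carrier Mo \<Longrightarrow> g (Word ws) \<in> carrier N"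
    and u: "set u \<subseteq> carrier Mo" and v: "set v \<subseteq> carrier Mo"
  shows "ext N g (Poly_Mapping.single (Word u) 1 - Poly_Mapping.single (Word v) 1) = g (Word u) \<ominus>\<^bsub>N\<^esub> g (Word v)"
    and "set w \<subseteq> carrier Mo \<Longrightarrow>
      ext N g (Poly_Mapping.single (Word u) 1 - Poly_Mapping.single (Word v) 1 - Poly_Mapping.single (Word w) 1) =
      g (Word u) \<ominus>\<^bsub>N\<^esub> g (Word v) \<ominus>\<^bsub>N\<^esub> g (Word w)"
proof -
  interpret e: lin Fr N "ext N g"
    using N ext_lin[of N g] g F.amod_axioms by (simp add: lin_def lin_axioms_def)
  have s: "ext N g (Poly_Mapping.single (Word u) 1) = g (Word u)" if "set u \<subseteq> carrier Mo" for u
    using g[OF that] by simp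
  have minus: "ext N g (f - f') = ext N g f \<ominus>\<^bsub>N\<^esub> ext N g f'" if "f \<in> carrier Fr" "f' \<in> carrier Fr" for f f'
  proof -
    have gK: "g \<in> words (carrier Mo) \<rightarrow> carrier N"
      using g[of "letters _"] by (auto simp: words_def)
    show ?thesis using that e.N.ext_minus[OF _ _ gK] by (simp add: carrier_keys)
  qed
  have k: "Poly_Mapping.single (Word u) 1 \<in> carrier Fr" if "set u \<subseteq> carrier Mo" for u
    using that by simp
  show *: "ext N g (Poly_Mapping.single (Word u) 1 - Poly_Mapping.single (Word v) 1) = g (Word u) \<ominus>\<^bsub>N\<^esub> g (Word v)"
    using minus[OF k[OF u] k[OF v]] s u v by (simp only:)
  show "ext N g (Poly_Mapping.single (Word u) 1 - Poly_Mapping.single (Word v) 1 - Poly_Mapping.single (Word w) 1) =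
      g (Word u) \<ominus>\<^bsub>N\<^esub> g (Word v) \<ominus>\<^bsub>N\<^esub> g (Word w)" if "set w \<subseteq> carrier Mo"
    using minus[OF carrier_rules(5)[OF k[OF u] k[OF v]] k[OF that]] s[OF that] * by (simp only:)
qed

text \<open>Descent to a presented algebra for maps that are only linear. The two conditions of
  linearity in a letter take care of \<open>linear_rel\<close>; the remaining relations are tested
  between arbitrary words, as \<open>ideal_kill\<close> demands.\<close>

lemma lift_lin:
  assumes N: "amod N" and g: "\<And>ws. set ws \<subseteq> carrier Mo \<Longrightarrow> g (Word ws) \<in> carrier N"
    and add: "\<And>u v x y. set u \<subseteq> carrier Mo \<Longrightarrow> set v \<subseteq> carrier Mo \<Longrightarrow> x \<in> carrier Mo \<Longrightarrow> y \<in> carrier Mo \<Longrightarrow>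
      g (Word (u @ (x \<oplus>\<^bsub>Mo\<^esub> y) # v)) = g (Word (u @ x # v)) \<oplus>\<^bsub>N\<^esub> g (Word (u @ y # v))"
    and smult: "\<And>u v x a. set u \<subseteq> carrier Mo \<Longrightarrow> set v \<subseteq> carrier Mo \<Longrightarrow> x \<in> carrier Mo \<Longrightarrow>
      g (Word (u @ (a \<odot>\<^bsub>Mo\<^esub> x) # v)) = a \<odot>\<^bsub>N\<^esub> g (Word (u @ x # v))"
    and rel: "\<And>u v r. set u \<subseteq> carrier Mo \<Longrightarrow> set v \<subseteq> carrier Mo \<Longrightarrow> r \<in> R \<Longrightarrow>
      ext N g (Poly_Mapping.single (Word u) 1 * r * Poly_Mapping.single (Word v) 1) = \<zero>\<^bsub>N\<^esub>"
  shows "lin_map (pres_alg Mo R) N (lin_lift N g) \<and>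
    (\<forall>ws. set ws \<subseteq> carrier Mo \<longrightarrow> lin_lift N g (wd ws) = g (Word ws))"
proof -
  interpret N: amod N by fact
  have gK: "g \<in> words (carrier Mo) \<rightarrow> carrier N"
    using g[of "letters _"] by (auto simp: words_def)
  interpret e: lin Fr N "ext N g"
    using N ext_lin[of N g] g F.amod_axioms by (simp add: lin_def lin_axioms_def)
  have kill: "ext N g f = \<zero>\<^bsub>N\<^esub>" if "f \<in> pres_ideal Mo R" for f
  proof (rule ideal_kill[OF N e.lin that])
    fix u v r assume uv: "set u \<subseteq> carrier Mo" "set v \<subseteq> carrier Mo" and "r \<in> linear_rel Mo \<union> R"
    then consider "r \<in> R" | x y where "x \<in> carrier Mo" "y \<in> carrier Mo" "r = letter (x \<oplus>\<^bsub>Mo\<^esub> y) - letter x - letter y"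
      | a x where "x \<in> carrier Mo" "r = letter (a \<odot>\<^bsub>Mo\<^esub> x) - Poly_Mapping.single (Word [x]) a"
      by (auto simp: linear_rel_def)
    then show "ext N g (Poly_Mapping.single (Word u) 1 * r * Poly_Mapping.single (Word v) 1) = \<zero>\<^bsub>N\<^esub>"
    proof cases
      case 2
      have "Poly_Mapping.single (Word u) 1 * r * Poly_Mapping.single (Word v) 1 =
        Poly_Mapping.single (Word (u @ (x \<oplus>\<^bsub>Mo\<^esub> y) # v)) 1 -
          (Poly_Mapping.single (Word (u @ x # v)) 1 + Poly_Mapping.single (Word (u @ y # v)) 1)"
        by (simp add: 2 letter_def algebra_simps mult_single Word_plus)
      then show ?thesis
        using uv 2(1,2) g add[OF uv 2(1,2)]
        by (simp add: N.ext_minus[OF _ _ gK] N.ext_add[OF _ _ gK] keys_add[THEN subset_trans] N.minus_eq_zero_iff)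
    next
      case 3
      have "Poly_Mapping.single (Word u) 1 * r * Poly_Mapping.single (Word v) 1 =
        Poly_Mapping.single (Word (u @ (a \<odot>\<^bsub>Mo\<^esub> x) # v)) 1 - Poly_Mapping.single (Word (u @ x # v)) a"
        by (simp add: 3 letter_def algebra_simps mult_single Word_plus)
      then show ?thesis
        using uv 3(1) g smult[OF uv 3(1)]
        by (simp add: N.ext_minus[OF _ _ gK] N.minus_eq_zero_iff)
    qed (use rel uv in blast)
  qed
  show ?thesis
  proof (intro conjI allI impI)
    show "lin_map (pres_alg Mo R) N (lin_lift N g)"
      using lin_lift_lin[OF N gK kill] by (simp add: Q_pres)
    show "lin_lift N g (wd ws) = g (Word ws)" if "set ws \<subseteq> carrier Mo" for ws
      using lin_lift_single[OF N gK kill, of "Word ws"] that by (simp add: wd_def)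
  qed
qed

lemma grade_submodule: "submodule (pres_grade Mo R D p) base_mod (pres_alg Mo R)"
proof (rule submoduleI')
  have eq: "pres_grade Mo R D p = cl ` {f \<in> carrier Fr. Poly_Mapping.keys f \<subseteq> words_of_degree D p}"
    by (auto simp: pres_grade_def cl_def)
  show "pres_grade Mo R D p \<subseteq> carrier (pres_alg Mo R)"
    using Q_carrier by (auto simp: eq Q_pres)
  show "\<zero>\<^bsub>pres_alg Mo R\<^esub> \<in> pres_grade Mo R D p"
    using Q_zero by (auto simp: eq Q_pres)
  show "x \<oplus>\<^bsub>pres_alg Mo R\<^esub> y \<in> pres_grade Mo R D p" if "x \<in> pres_grade Mo R D p" "y \<in> pres_grade Mo R D p" for x y
  proof -
    obtain f g where "x = cl f" "y = cl g" "f \<in> carrier Fr" "g \<in> carrier Fr"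
      "Poly_Mapping.keys f \<subseteq> words_of_degree D p" "Poly_Mapping.keys g \<subseteq> words_of_degree D p"
      using \<open>x \<in> _\<close> \<open>y \<in> _\<close> unfolding eq by blast
    then show ?thesis
      unfolding eq using keys_add[of f g] Q_add[of f g] by (auto simp: Q_pres intro!: imageI)
  qed
  show "a \<odot>\<^bsub>pres_alg Mo R\<^esub> x \<in> pres_grade Mo R D p" if x: "x \<in> pres_grade Mo R D p" for a x
  proof -
    obtain f where "x = cl f" "f \<in> carrier Fr" "Poly_Mapping.keys f \<subseteq> words_of_degree D p"
      using x unfolding eq by blast
    then show ?thesis
      unfolding eq using keys_scal[of a f] Q_smult[of f a] by (auto simp: Q_pres intro!: imageI)
  qed
qed

lemmas grade_rules = submoduleD[OF grade_submodule]

lemma wd_grade: "set ws \<subseteq> carrier Mo \<Longrightarrow> Word ws \<in> words_of_degree D p \<Longrightarrow> wd ws \<in> pres_grade Mo R D p"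
  unfolding pres_grade_def wd_def cl_def by (rule CollectI, rule exI[of _ "Poly_Mapping.single (Word ws) 1"]) simp

lemma grade_induct [consumes 1, case_names zero add word]:
  assumes "x \<in> pres_grade Mo R D p" "P \<zero>\<^bsub>pres_alg Mo R\<^esub>"
    and add: "\<And>x y. x \<in> pres_grade Mo R D p \<Longrightarrow> y \<in> pres_grade Mo R D p \<Longrightarrow> P x \<Longrightarrow> P y \<Longrightarrow>
      P (x \<oplus>\<^bsub>pres_alg Mo R\<^esub> y)"
    and word: "\<And>ws a. set ws \<subseteq> carrier Mo \<Longrightarrow> Word ws \<in> words_of_degree D p \<Longrightarrow> P (a \<odot>\<^bsub>pres_alg Mo R\<^esub> wd ws)"
  shows "P x"
proof -
  let ?K = "words (carrier Mo) \<inter> words_of_degree D p"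
  obtain f where f: "x = cl f" "Poly_Mapping.keys f \<subseteq> ?K"
    using assms(1) by (auto simp: pres_grade_def carrier_keys cl_def)
  from f(2) have "P (cl f)"
  proof (induction rule: poly_mapping_lin_induct)
    case zero
    then show ?case using assms(2) Q_zero by (simp add: Q_pres)
  next
    case (add f g)
    have "cl f \<in> pres_grade Mo R D p" "cl g \<in> pres_grade Mo R D p"
      using add.hyps by (auto simp: pres_grade_def carrier_keys cl_def)
    then show ?case using assms(3)[of "cl f" "cl g"] add Q_add[of f g] by (simp add: Q_pres)
  next
    case (single k a)
    then show ?case
      using word[of "letters k" a] Q_smult[of "Poly_Mapping.single k 1" a]
      by (simp add: wd_def words_def Q_pres)
  qed
  with f show ?thesis by simp
qed

end

lemma words_of_degree_append:
  assumes "Word u \<in> words_of_degree D p" "Word v \<in> words_of_degree D q"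
  shows "Word (u @ v) \<in> words_of_degree D (p + q)"
proof -
  obtain ds es where "u = map snd ds" "\<forall>(d, x) \<in> set ds. x \<in> D d" "sum_list (map fst ds) = p"
    "v = map snd es" "\<forall>(d, x) \<in> set es. x \<in> D d" "sum_list (map fst es) = q"
    using assms by (auto simp: words_of_degree_def)
  then show ?thesis
    by (auto simp: words_of_degree_def intro!: exI[of _ "ds @ es"])
qed

lemma words_of_degree_one: "Word ws \<in> words_of_degree (\<lambda>d. if d = 1 then X else {}) p \<longleftrightarrow> set ws \<subseteq> X \<and> length ws = p"
proof
  assume "Word ws \<in> words_of_degree (\<lambda>d. if d = 1 then X else {}) p"
  then obtain ds where ds: "ws = map snd ds" "\<forall>(d, x) \<in> set ds. x \<in> (if d = 1 then X else {})" "sum_list (map fst ds) = p"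
    by (auto simp: words_of_degree_def)
  have "map fst ds = replicate (length ds) 1"
    using ds(2) by (induction ds) (auto split: if_splits)
  with ds show "set ws \<subseteq> X \<and> length ws = p"
    by (auto simp: sum_list_replicate split: if_splits)
next
  assume *: "set ws \<subseteq> X \<and> length ws = p"
  show "Word ws \<in> words_of_degree (\<lambda>d. if d = 1 then X else {}) p"
    unfolding words_of_degree_def using *
    by (intro CollectI exI[of _ "map (\<lambda>x. (1, x)) ws"]) (auto simp: comp_def sum_list_triv)
qed

lemma (in pres) grade_mult:
  assumes "x \<in> pres_grade Mo R D p" "y \<in> pres_grade Mo R D q"
  shows "x \<otimes>\<^bsub>pres_alg Mo R\<^esub> y \<in> pres_grade Mo R D (p + q)"
  using assms(1)
proof (induction rule: grade_induct)
  case zero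
  then show ?case using grade_rules assms(2) by (simp add: subset_iff)
next
  case (add x x')
  have "x \<in> carrier (pres_alg Mo R)" "x' \<in> carrier (pres_alg Mo R)" "y \<in> carrier (pres_alg Mo R)"
    using add.hyps assms(2) grade_rules(1) by blast+
  with add show ?case by (simp add: b_l_distr grade_rules(3))
next
  case (word u a)
  have "wd u \<otimes>\<^bsub>pres_alg Mo R\<^esub> y \<in> pres_grade Mo R D (p + q)"
    using assms(2)
  proof (induction rule: grade_induct)
    case zero
    then show ?case using grade_rules(2) word by simp
  next
    case (add x x')
    have "x \<in> carrier (pres_alg Mo R)" "x' \<in> carrier (pres_alg Mo R)"
      using add.hyps assms(2) grade_rules(1) by blast+
    with add word show ?case by (simp add: b_r_distr grade_rules(3))
  next
    case (word v b)
    then show ?case using \<open>set u \<subseteq> _\<close> \<open>Word u \<in> _\<close>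
      by (simp add: b_smult_r wd_append[symmetric] wd_grade words_of_degree_append grade_rules(4))
  qed
  moreover have "y \<in> carrier (pres_alg Mo R)" using assms(2) grade_rules(1) by blast
  ultimately show ?case using word by (simp add: b_smult_l grade_rules(4))
qed

section \<open>Tensor products\<close>

locale tens2 = M: amod M + N: amod N
  for M :: "('a::comm_ring_1, 'm) module" and N :: "('a, 'n) module"
begin

lemma free_tens_simps:
  "carrier (free_tens M N) = {f. Poly_Mapping.keys f \<subseteq> carrier M \<times> carrier N}"
  "f \<oplus>\<^bsub>free_tens M N\<^esub> g = f + g" "\<zero>\<^bsub>free_tens M N\<^esub> = 0" "a \<odot>\<^bsub>free_tens M N\<^esub> f = scal a f"
  "\<one>\<^bsub>free_tens M N\<^esub> = Poly_Mapping.single (\<one>\<^bsub>M\<^esub>, \<one>\<^bsub>N\<^esub>) 1"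
  by (simp_all add: free_tens_def)

lemma free_tens_amod: "amod (free_tens M N)"
  by (rule free_amod[of _ "carrier M \<times> carrier N"]) (simp_all add: free_tens_simps)

lemma bilin_rel_sub: "bilin_rel M N \<subseteq> carrier (free_tens M N)"
proof -
  have s: "Poly_Mapping.single (x, n) a \<in> carrier (free_tens M N)" if "x \<in> carrier M" "n \<in> carrier N" for x n a
    using that by (simp add: free_tens_simps)
  have m: "f - g \<in> carrier (free_tens M N)" if "f \<in> carrier (free_tens M N)" "g \<in> carrier (free_tens M N)" for f g
    using that keys_minus_subset[of f g] unfolding free_tens_simps by blast
  show ?thesis
    unfolding bilin_rel_def by (auto intro!: m s)
qed

lemma bilin_rel_intros:
  "x \<in> carrier M \<Longrightarrow> y \<in> carrier M \<Longrightarrow> n \<in> carrier N \<Longrightarrow> Poly_Mapping.single (x \<oplus>\<^bsub>M\<^esub> y, n) 1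
    - Poly_Mapping.single (x, n) 1 - Poly_Mapping.single (y, n) 1 \<in> bilin_rel M N"
  "x \<in> carrier M \<Longrightarrow> m \<in> carrier N \<Longrightarrow> n \<in> carrier N \<Longrightarrow> Poly_Mapping.single (x, m \<oplus>\<^bsub>N\<^esub> n) 1
    - Poly_Mapping.single (x, m) 1 - Poly_Mapping.single (x, n) 1 \<in> bilin_rel M N"
  "x \<in> carrier M \<Longrightarrow> n \<in> carrier N \<Longrightarrow>
    Poly_Mapping.single (a \<odot>\<^bsub>M\<^esub> x, n) 1 - Poly_Mapping.single (x, n) a \<in> bilin_rel M N"
  "x \<in> carrier M \<Longrightarrow> n \<in> carrier N \<Longrightarrow>
    Poly_Mapping.single (x, a \<odot>\<^bsub>N\<^esub> n) 1 - Poly_Mapping.single (x, n) a \<in> bilin_rel M N"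
  unfolding bilin_rel_def by blast+

lemma bilin_rel_cases [consumes 1, case_names add_l add_r smult_l smult_r]:
  assumes "r \<in> bilin_rel M N"
  obtains x y n where "x \<in> carrier M" "y \<in> carrier M" "n \<in> carrier N"
      "r = Poly_Mapping.single (x \<oplus>\<^bsub>M\<^esub> y, n) 1 - Poly_Mapping.single (x, n) 1 - Poly_Mapping.single (y, n) 1"
    | x m n where "x \<in> carrier M" "m \<in> carrier N" "n \<in> carrier N"
      "r = Poly_Mapping.single (x, m \<oplus>\<^bsub>N\<^esub> n) 1 - Poly_Mapping.single (x, m) 1 - Poly_Mapping.single (x, n) 1"
    | x n a where "x \<in> carrier M" "n \<in> carrier N"
      "r = Poly_Mapping.single (a \<odot>\<^bsub>M\<^esub> x, n) 1 - Poly_Mapping.single (x, n) a"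
    | x n a where "x \<in> carrier M" "n \<in> carrier N"
      "r = Poly_Mapping.single (x, a \<odot>\<^bsub>N\<^esub> n) 1 - Poly_Mapping.single (x, n) a"
proof -
  from assms show thesis
    unfolding bilin_rel_def
    by (elim UnE CollectE exE conjE)
      (rule that(1), assumption+, rule that(2), assumption+, rule that(3), assumption+, rule that(4), assumption+)
qed

lemma tens_ideal_submodule: "submodule (tens_ideal M N) base_mod (free_tens M N)"
  unfolding tens_ideal_def
  by (rule amod.gen_submod_submodule[OF free_tens_amod bilin_rel_sub])

sublocale free_quot "free_tens M N" "carrier M \<times> carrier N" "tens_ideal M N"
  by (rule free_quot.intro) (simp_all only: free_tens_simps tens_ideal_submodule)

lemma Q_tensor: "Q = tensor M N"
  by (simp add: tensor_def)

lemma T_amod: "amod (tensor M N)"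
  using Q_amod by (simp add: Q_tensor)

sublocale T: amod "tensor M N" by (rule T_amod)

abbreviation "tn \<equiv> tens M N"

lemma tn_cl: "tn x n = cl (Poly_Mapping.single (x, n) 1)"
  by (simp add: tens_def cl_def)

lemma cl_rel: "r \<in> bilin_rel M N \<Longrightarrow> r \<in> tens_ideal M N"
  unfolding tens_ideal_def using F.gen_submod_incl by blast

lemma tn_closed [simp, intro]: "x \<in> carrier M \<Longrightarrow> n \<in> carrier N \<Longrightarrow> tn x n \<in> carrier (tensor M N)"
  using cl_closed[of "Poly_Mapping.single (x, n) 1"] by (simp add: tn_cl Q_tensor)

lemma tn_scal: "x \<in> carrier M \<Longrightarrow> n \<in> carrier N \<Longrightarrow> a \<odot>\<^bsub>tensor M N\<^esub> tn x n = cl (Poly_Mapping.single (x, n) a)"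
  using Q_smult[of "Poly_Mapping.single (x, n) 1" a] by (simp add: tn_cl Q_tensor)

lemma tn_add_l:
  assumes "x \<in> carrier M" "y \<in> carrier M" "n \<in> carrier N"
  shows "tn (x \<oplus>\<^bsub>M\<^esub> y) n = tn x n \<oplus>\<^bsub>tensor M N\<^esub> tn y n"
proof -
  have "Poly_Mapping.single (x \<oplus>\<^bsub>M\<^esub> y, n) 1 - Poly_Mapping.single (x, n) 1 - Poly_Mapping.single (y, n) 1 \<in> bilin_rel M N"
    using assms unfolding bilin_rel_def by blast
  from cl_rel[OF this] show ?thesis
    using Q_add[of "Poly_Mapping.single (x, n) 1" "Poly_Mapping.single (y, n) 1"]
    by (simp add: tn_cl Q_tensor cl_eq diff_diff_eq)
qed

lemma tn_add_r:
  assumes "x \<in> carrier M" "m \<in> carrier N" "n \<in> carrier N"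
  shows "tn x (m \<oplus>\<^bsub>N\<^esub> n) = tn x m \<oplus>\<^bsub>tensor M N\<^esub> tn x n"
proof -
  have "Poly_Mapping.single (x, m \<oplus>\<^bsub>N\<^esub> n) 1 - Poly_Mapping.single (x, m) 1 - Poly_Mapping.single (x, n) 1 \<in> bilin_rel M N"
    using assms unfolding bilin_rel_def by blast
  from cl_rel[OF this] show ?thesis
    using Q_add[of "Poly_Mapping.single (x, m) 1" "Poly_Mapping.single (x, n) 1"]
    by (simp add: tn_cl Q_tensor cl_eq diff_diff_eq)
qed

lemma tn_smult_l:
  assumes "x \<in> carrier M" "n \<in> carrier N"
  shows "tn (a \<odot>\<^bsub>M\<^esub> x) n = a \<odot>\<^bsub>tensor M N\<^esub> tn x n"
proof -
  have "Poly_Mapping.single (a \<odot>\<^bsub>M\<^esub> x, n) 1 - Poly_Mapping.single (x, n) a \<in> bilin_rel M N"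
    using assms unfolding bilin_rel_def by blast
  from cl_rel[OF this] show ?thesis
    using assms by (simp add: tn_scal) (simp add: tn_cl cl_eq)
qed

lemma tn_smult_r:
  assumes "x \<in> carrier M" "n \<in> carrier N"
  shows "tn x (a \<odot>\<^bsub>N\<^esub> n) = a \<odot>\<^bsub>tensor M N\<^esub> tn x n"
proof -
  have "Poly_Mapping.single (x, a \<odot>\<^bsub>N\<^esub> n) 1 - Poly_Mapping.single (x, n) a \<in> bilin_rel M N"
    using assms unfolding bilin_rel_def by blast
  from cl_rel[OF this] show ?thesis
    using assms by (simp add: tn_scal) (simp add: tn_cl cl_eq)
qed

lemma lin_tn_l: "n \<in> carrier N \<Longrightarrow> lin M (tensor M N) (\<lambda>x. tn x n)"
  by unfold_locales (simp add: lin_map_def tn_add_l tn_smult_l)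

lemma lin_tn_r: "x \<in> carrier M \<Longrightarrow> lin N (tensor M N) (\<lambda>n. tn x n)"
  by unfold_locales (simp add: lin_map_def tn_add_r tn_smult_r)

lemma tensor_induct [consumes 1, case_names zero add tens]:
  assumes "x \<in> carrier (tensor M N)" "P \<zero>\<^bsub>tensor M N\<^esub>"
    and add: "\<And>x y. x \<in> carrier (tensor M N) \<Longrightarrow> y \<in> carrier (tensor M N) \<Longrightarrow> P x \<Longrightarrow> P y \<Longrightarrow>
      P (x \<oplus>\<^bsub>tensor M N\<^esub> y)"
    and tens: "\<And>x n. x \<in> carrier M \<Longrightarrow> n \<in> carrier N \<Longrightarrow> P (tn x n)"
  shows "P x"
proof (rule Q_induct[unfolded Q_tensor, of x P])
  fix k a assume "k \<in> carrier M \<times> carrier N"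
  then have "a \<odot>\<^bsub>tensor M N\<^esub> cl (Poly_Mapping.single k 1) = tn (a \<odot>\<^bsub>M\<^esub> fst k) (snd k)"
    by (cases k) (simp only: fst_conv snd_conv mem_Times_iff tn_smult_l, simp only: tn_cl)
  then show "P (a \<odot>\<^bsub>tensor M N\<^esub> cl (Poly_Mapping.single k 1))"
    using tens[of "a \<odot>\<^bsub>M\<^esub> fst k" "snd k"] \<open>k \<in> _\<close> by auto
qed (use assms in auto)

definition bilin :: "('a, 'p) module \<Rightarrow> ('m \<Rightarrow> 'n \<Rightarrow> 'p) \<Rightarrow> bool" where
  "bilin P b \<longleftrightarrow> (\<forall>x \<in> carrier M. lin_map N P (b x)) \<and> (\<forall>n \<in> carrier N. lin_map M P (\<lambda>x. b x n))"

lemma bilinI: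
  assumes "\<And>x n. x \<in> carrier M \<Longrightarrow> n \<in> carrier N \<Longrightarrow> b x n \<in> carrier P"
    and "\<And>x y n. x \<in> carrier M \<Longrightarrow> y \<in> carrier M \<Longrightarrow> n \<in> carrier N \<Longrightarrow> b (x \<oplus>\<^bsub>M\<^esub> y) n = b x n \<oplus>\<^bsub>P\<^esub> b y n"
    and "\<And>x m n. x \<in> carrier M \<Longrightarrow> m \<in> carrier N \<Longrightarrow> n \<in> carrier N \<Longrightarrow> b x (m \<oplus>\<^bsub>N\<^esub> n) = b x m \<oplus>\<^bsub>P\<^esub> b x n"
    and "\<And>a x n. x \<in> carrier M \<Longrightarrow> n \<in> carrier N \<Longrightarrow> b (a \<odot>\<^bsub>M\<^esub> x) n = a \<odot>\<^bsub>P\<^esub> b x n"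
    and "\<And>a x n. x \<in> carrier M \<Longrightarrow> n \<in> carrier N \<Longrightarrow> b x (a \<odot>\<^bsub>N\<^esub> n) = a \<odot>\<^bsub>P\<^esub> b x n"
  shows "bilin P b"
  using assms by (auto simp: bilin_def lin_map_def)

text \<open>The universal property of the tensor product: bilinearity makes the linear extension
  vanish on each of the four families of \<open>bilin_rel\<close>, hence on the submodule they
  generate.\<close>

lemma lift_bilin:
  assumes P: "amod P" and b: "bilin P b"
  shows "lin_map (tensor M N) P (lin_lift P (\<lambda>(x, n). b x n))"
    and "x \<in> carrier M \<Longrightarrow> n \<in> carrier N \<Longrightarrow> lin_lift P (\<lambda>(x, n). b x n) (tn x n) = b x n"
proof -
  interpret P: amod P by fact
  let ?g = "\<lambda>(x, n). b x n"
  have b_rules: "x \<in> carrier M \<Longrightarrow> n \<in> carrier N \<Longrightarrow> b x n \<in> carrier P"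
    "x \<in> carrier M \<Longrightarrow> y \<in> carrier M \<Longrightarrow> n \<in> carrier N \<Longrightarrow> b (x \<oplus>\<^bsub>M\<^esub> y) n = b x n \<oplus>\<^bsub>P\<^esub> b y n"
    "x \<in> carrier M \<Longrightarrow> n \<in> carrier N \<Longrightarrow> b (a \<odot>\<^bsub>M\<^esub> x) n = a \<odot>\<^bsub>P\<^esub> b x n"
    "x \<in> carrier M \<Longrightarrow> n \<in> carrier N \<Longrightarrow> m \<in> carrier N \<Longrightarrow> b x (m \<oplus>\<^bsub>N\<^esub> n) = b x m \<oplus>\<^bsub>P\<^esub> b x n"
    "x \<in> carrier M \<Longrightarrow> n \<in> carrier N \<Longrightarrow> b x (a \<odot>\<^bsub>N\<^esub> n) = a \<odot>\<^bsub>P\<^esub> b x n" for x y m n a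
    using b unfolding bilin_def lin_map_def by auto
  have g: "?g \<in> carrier M \<times> carrier N \<rightarrow> carrier P" using b_rules(1) by auto
  interpret e: lin "free_tens M N" P "ext P ?g"
    by unfold_locales
      (auto simp: lin_map_def carrier_keys P.ext_closed[OF _ g] P.ext_add[OF _ _ g] P.ext_scal[OF _ g])
  have s: "ext P ?g (Poly_Mapping.single (x, n) a) = a \<odot>\<^bsub>P\<^esub> b x n" if "x \<in> carrier M" "n \<in> carrier N" for x n a
    using that b_rules(1) by simp
  have kill: "ext P ?g f = \<zero>\<^bsub>P\<^esub>" if "f \<in> tens_ideal M N" for f
  proof -
    have "bilin_rel M N \<subseteq> {f \<in> carrier (free_tens M N). ext P ?g f = \<zero>\<^bsub>P\<^esub>}"
    proof
      fix r assume r: "r \<in> bilin_rel M N"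
      have minus: "ext P ?g (f - f') = ext P ?g f \<ominus>\<^bsub>P\<^esub> ext P ?g f'"
        if "f \<in> carrier (free_tens M N)" "f' \<in> carrier (free_tens M N)" for f f'
        using that P.ext_minus[OF _ _ g] by (simp add: carrier_keys)
      have minus2: "x \<oplus>\<^bsub>P\<^esub> y \<ominus>\<^bsub>P\<^esub> x \<ominus>\<^bsub>P\<^esub> y = \<zero>\<^bsub>P\<^esub>" if "x \<in> carrier P" "y \<in> carrier P" for x y
      proof -
        have "x \<oplus>\<^bsub>P\<^esub> y \<ominus>\<^bsub>P\<^esub> x = y"
          using that by (simp add: a_minus_def P.M.a_comm[of x y] P.M.a_assoc P.M.r_neg)
        with that show ?thesis by (simp add: P.minus_eq_zero_iff)
      qed
      from r have "ext P ?g r = \<zero>\<^bsub>P\<^esub>"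
        by (cases rule: bilin_rel_cases) (simp_all add: minus s b_rules minus2 P.minus_eq_zero_iff del: P.ext_single)
      with r bilin_rel_sub show "r \<in> {f \<in> carrier (free_tens M N). ext P ?g f = \<zero>\<^bsub>P\<^esub>}" by auto
    qed
    then have "tens_ideal M N \<subseteq> {f \<in> carrier (free_tens M N). ext P ?g f = \<zero>\<^bsub>P\<^esub>}"
      unfolding tens_ideal_def by (rule F.gen_submod_least[OF e.kernel_submodule])
    with that show ?thesis by auto
  qed
  show "lin_map (tensor M N) P (lin_lift P ?g)"
    using lin_lift_lin[OF P g kill] by (simp add: Q_tensor)
  show "x \<in> carrier M \<Longrightarrow> n \<in> carrier N \<Longrightarrow> lin_lift P ?g (tn x n) = b x n"
    using lin_lift_single[OF P g kill, of "(x, n)"] by (simp add: tn_cl)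
qed

lemma tens_part_sub:
  assumes "X \<subseteq> carrier M" "Y \<subseteq> carrier N"
  shows "submodule (tens_part M N X Y) base_mod (tensor M N)"
  unfolding tens_part_def using assms by (intro T.gen_submod_submodule) auto

lemma tens_part_tn: "x \<in> X \<Longrightarrow> y \<in> Y \<Longrightarrow> tn x y \<in> tens_part M N X Y"
  unfolding tens_part_def by (rule subsetD[OF T.gen_submod_incl]) blast

text \<open>Closure of \<open>X\<close> under scalars lets a coefficient be absorbed into the left
  factor, so that only pure tensors remain in the last case.\<close>

lemma tens_part_induct [consumes 1, case_names sub1 sub2 smult zero add tens]:
  assumes "z \<in> tens_part M N X Y" "X \<subseteq> carrier M" "Y \<subseteq> carrier N"
    and X: "\<And>a x. x \<in> X \<Longrightarrow> a \<odot>\<^bsub>M\<^esub> x \<in> X"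
    and "P \<zero>\<^bsub>tensor M N\<^esub>"
    and add: "\<And>x y. x \<in> carrier (tensor M N) \<Longrightarrow> y \<in> carrier (tensor M N) \<Longrightarrow> P x \<Longrightarrow> P y \<Longrightarrow>
      P (x \<oplus>\<^bsub>tensor M N\<^esub> y)"
    and tens: "\<And>x y. x \<in> X \<Longrightarrow> y \<in> Y \<Longrightarrow> P (tn x y)"
  shows "P z"
proof (rule T.gen_submod_induct[of z _ P])
  show "z \<in> gen_submod (tensor M N) {tn x y |x y. x \<in> X \<and> y \<in> Y}"
    using assms(1) by (simp add: tens_part_def)
  fix a z assume "z \<in> {tn x y |x y. x \<in> X \<and> y \<in> Y}"
  then obtain x y where "z = tn x y" "x \<in> X" "y \<in> Y" by blast
  then show "P (a \<odot>\<^bsub>tensor M N\<^esub> z)"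
    using tens[OF X, of x y a] assms(2,3) by (simp add: tn_smult_l subset_iff)
qed (use assms in auto)

end

locale tens_alg = M: balg M + N: balg N
  for M :: "('a::comm_ring_1, 'm) module" and N :: "('a, 'n) module"
begin

sublocale tens2 M N ..

abbreviation "fm f g \<equiv> f \<otimes>\<^bsub>free_tens M N\<^esub> g"

lemma fm_superset:
  assumes "Poly_Mapping.keys f \<subseteq> X" "Poly_Mapping.keys g \<subseteq> Y" "finite X" "finite Y"
  shows "fm f g = (\<Sum>p\<in>X. \<Sum>q\<in>Y. Poly_Mapping.single (fst p \<otimes>\<^bsub>M\<^esub> fst q, snd p \<otimes>\<^bsub>N\<^esub> snd q)
    (Poly_Mapping.lookup f p * Poly_Mapping.lookup g q))"
proof -
  have "fm f g = (\<Sum>p\<in>Poly_Mapping.keys f. \<Sum>q\<in>Y. Poly_Mapping.single (fst p \<otimes>\<^bsub>M\<^esub> fst q, snd p \<otimes>\<^bsub>N\<^esub> snd q)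
    (Poly_Mapping.lookup f p * Poly_Mapping.lookup g q))"
    unfolding free_tens_def using assms(2,4)
    by (simp, intro sum.cong refl sum.mono_neutral_left) (auto simp: not_in_keys_iff_lookup_eq_zero)
  also have "\<dots> = (\<Sum>p\<in>X. \<Sum>q\<in>Y. Poly_Mapping.single (fst p \<otimes>\<^bsub>M\<^esub> fst q, snd p \<otimes>\<^bsub>N\<^esub> snd q)
    (Poly_Mapping.lookup f p * Poly_Mapping.lookup g q))"
    using assms by (intro sum.mono_neutral_left) (auto simp: in_keys_iff)
  finally show ?thesis .
qed

lemma fm_add:
  "fm (f + f') g = fm f g + fm f' g" "fm g (f + f') = fm g f + fm g f'"
proof -
  let ?X = "Poly_Mapping.keys f \<union> Poly_Mapping.keys f'" and ?Y = "Poly_Mapping.keys g"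
  have k: "Poly_Mapping.keys (f + f') \<subseteq> ?X" by (rule keys_add)
  show "fm (f + f') g = fm f g + fm f' g"
    using k by (simp add: fm_superset[of _ ?X _ ?Y] lookup_add distrib_right single_add sum.distrib)
  show "fm g (f + f') = fm g f + fm g f'"
    using k by (simp add: fm_superset[of _ ?Y _ ?X] lookup_add distrib_left single_add sum.distrib)
qed

lemma scal_sum: "scal a (sum f I) = (\<Sum>i\<in>I. scal a (f i))"
  by (induction I rule: infinite_finite_induct) (simp_all add: scal_distrib)

lemma fm_scal: "fm (scal a f) g = scal a (fm f g)" "fm g (scal a f) = scal a (fm g f)"
proof -
  let ?X = "Poly_Mapping.keys f" and ?Y = "Poly_Mapping.keys g"
  have k: "Poly_Mapping.keys (scal a f) \<subseteq> ?X" by (rule keys_scal)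
  show "fm (scal a f) g = scal a (fm f g)"
    using k by (simp add: fm_superset[of _ ?X _ ?Y] scal_sum mult.assoc)
  show "fm g (scal a f) = scal a (fm g f)"
    using k by (simp add: fm_superset[of _ ?Y _ ?X] scal_sum mult.left_commute)
qed

lemma fm_single:
  "fm (Poly_Mapping.single (x, n) a) (Poly_Mapping.single (y, m) b) = Poly_Mapping.single (x \<otimes>\<^bsub>M\<^esub> y, n \<otimes>\<^bsub>N\<^esub> m) (a * b)"
  by (subst fm_superset[of _ "{(x, n)}" _ "{(y, m)}"]) auto

lemma fm_zero: "fm 0 g = 0" "fm g 0 = 0"
  by (simp_all add: free_tens_def)

lemma fm_minus: "fm (f - f') g = fm f g - fm f' g" "fm g (f - f') = fm g f - fm g f'"
  using fm_add(1)[of "f - f'" f' g] fm_add(2)[of g "f - f'" f'] by simp_all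

lemma fm_closed:
  assumes "f \<in> carrier (free_tens M N)" "g \<in> carrier (free_tens M N)"
  shows "fm f g \<in> carrier (free_tens M N)"
  using assms(1)[unfolded carrier_keys]
proof (induction f rule: poly_mapping_lin_induct)
  case (single p a)
  show ?case
    using assms(2)[unfolded carrier_keys]
  proof (induction g rule: poly_mapping_lin_induct)
    case (single q b)
    then show ?case
      using \<open>p \<in> _\<close> by (cases p; cases q) (simp add: fm_single)
  qed (simp_all add: fm_zero fm_add)
qed (simp_all add: fm_zero fm_add)

text \<open>By distributivity in the two algebras, a defining relation times a single pure tensor is
  again a defining relation. Linearity then extends this to all factors and to the whole generated
  submodule.\<close>

lemma fm_ideal:
  assumes "r \<in> tens_ideal M N" "g \<in> carrier (free_tens M N)"
  shows "fm r g \<in> tens_ideal M N \<and> fm g r \<in> tens_ideal M N"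
proof -
  let ?J = "{r \<in> carrier (free_tens M N). \<forall>g \<in> carrier (free_tens M N). fm r g \<in> tens_ideal M N \<and> fm g r \<in> tens_ideal M N}"
  have "submodule ?J base_mod (free_tens M N)"
    by (rule F.submoduleI') (auto simp: fm_zero fm_add fm_scal I_rules)
  moreover have "bilin_rel M N \<subseteq> ?J"
  proof
    fix r assume r: "r \<in> bilin_rel M N"
    have "fm r g \<in> tens_ideal M N \<and> fm g r \<in> tens_ideal M N" if "g \<in> carrier (free_tens M N)" for g
      using that[unfolded carrier_keys]
    proof (induction g rule: poly_mapping_lin_induct)
      case (single q b)
      then obtain y m where q: "q = (y, m)" "y \<in> carrier M" "m \<in> carrier N" by auto
      let ?s = "Poly_Mapping.single (y, m) 1"
      have "fm r ?s \<in> bilin_rel M N \<and> fm ?s r \<in> bilin_rel M N"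
        using r
        by (cases rule: bilin_rel_cases)
          (simp_all add: q(2,3) fm_minus fm_single bilin_rel_intros M.b_l_distr N.b_l_distr
            M.b_smult_l N.b_smult_l M.b_r_distr N.b_r_distr M.b_smult_r N.b_smult_r)
      then have "scal b (fm r ?s) \<in> tens_ideal M N" "scal b (fm ?s r) \<in> tens_ideal M N"
        by (simp_all add: cl_rel I_rules(4))
      moreover have "Poly_Mapping.single q b = scal b ?s" by (simp add: q)
      ultimately show ?case by (simp only: fm_scal)
    qed (simp_all add: fm_zero fm_add I_rules)
    with r bilin_rel_sub show "r \<in> ?J" by auto
  qed
  ultimately have "tens_ideal M N \<subseteq> ?J"
    unfolding tens_ideal_def by (rule F.gen_submod_least)
  with assms show ?thesis by auto
qed

lemma cl_mult:
  assumes f: "f \<in> carrier (free_tens M N)" and g: "g \<in> carrier (free_tens M N)"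
  shows "cl f \<otimes>\<^bsub>tensor M N\<^esub> cl g = cl (fm f g)"
  unfolding Q_tensor[symmetric]
proof (rule Q_mult)
  fix f' g' assume *: "f' - f \<in> tens_ideal M N" "g' - g \<in> tens_ideal M N"
  have "g' - g + g \<in> carrier (free_tens M N)" using * g I_rules(1) by (intro carrier_rules(2)) auto
  then have "fm (f' - f) g' \<in> tens_ideal M N" "fm f (g' - g) \<in> tens_ideal M N"
    using fm_ideal[OF *(1), of g'] fm_ideal[OF *(2) f] by simp_all
  then have "fm (f' - f) g' + fm f (g' - g) \<in> tens_ideal M N" by (rule I_rules(3))
  then show "fm f' g' - fm f g \<in> tens_ideal M N"
    by (simp add: fm_minus)
qed

lemma tn_mult:
  assumes "x \<in> carrier M" "y \<in> carrier M" "m \<in> carrier N" "n \<in> carrier N"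
  shows "tn x m \<otimes>\<^bsub>tensor M N\<^esub> tn y n = tn (x \<otimes>\<^bsub>M\<^esub> y) (m \<otimes>\<^bsub>N\<^esub> n)"
  using assms by (simp add: tn_cl cl_mult fm_single)

lemma T_one: "\<one>\<^bsub>tensor M N\<^esub> = tn \<one>\<^bsub>M\<^esub> \<one>\<^bsub>N\<^esub>"
  using Q_one by (simp add: Q_tensor tn_cl free_tens_simps)

lemma T_balg: "balg (tensor M N)"
proof -
  let ?T = "tensor M N"
  have obt: "\<exists>f \<in> carrier (free_tens M N). x = cl f" if x: "x \<in> carrier ?T" for x
    using x Q_carrier by (auto simp: Q_tensor)
  have distr: "(x \<oplus>\<^bsub>?T\<^esub> y) \<otimes>\<^bsub>?T\<^esub> z = x \<otimes>\<^bsub>?T\<^esub> z \<oplus>\<^bsub>?T\<^esub> y \<otimes>\<^bsub>?T\<^esub> z"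
    "z \<otimes>\<^bsub>?T\<^esub> (x \<oplus>\<^bsub>?T\<^esub> y) = z \<otimes>\<^bsub>?T\<^esub> x \<oplus>\<^bsub>?T\<^esub> z \<otimes>\<^bsub>?T\<^esub> y"
    "(a \<odot>\<^bsub>?T\<^esub> x) \<otimes>\<^bsub>?T\<^esub> y = a \<odot>\<^bsub>?T\<^esub> (x \<otimes>\<^bsub>?T\<^esub> y)" "x \<otimes>\<^bsub>?T\<^esub> (a \<odot>\<^bsub>?T\<^esub> y) = a \<odot>\<^bsub>?T\<^esub> (x \<otimes>\<^bsub>?T\<^esub> y)"
    "x \<otimes>\<^bsub>?T\<^esub> y \<in> carrier ?T"
    if xyz: "x \<in> carrier ?T" "y \<in> carrier ?T" "z \<in> carrier ?T" for x y z a
  proof -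
    obtain f g h where eqs: "x = cl f" "y = cl g" "z = cl h" and
      cl: "f \<in> carrier (free_tens M N)" "g \<in> carrier (free_tens M N)" "h \<in> carrier (free_tens M N)"
      using obt[OF xyz(1)] obt[OF xyz(2)] obt[OF xyz(3)] by blast
    note c = fm_closed[OF cl(1,2)] fm_closed[OF cl(1,3)] fm_closed[OF cl(2,3)]
      fm_closed[OF cl(3,1)] fm_closed[OF cl(3,2)]
    note simps = Q_add[unfolded Q_tensor] Q_smult[unfolded Q_tensor] cl_mult carrier_rules cl c
    show "(x \<oplus>\<^bsub>?T\<^esub> y) \<otimes>\<^bsub>?T\<^esub> z = x \<otimes>\<^bsub>?T\<^esub> z \<oplus>\<^bsub>?T\<^esub> y \<otimes>\<^bsub>?T\<^esub> z"
      "z \<otimes>\<^bsub>?T\<^esub> (x \<oplus>\<^bsub>?T\<^esub> y) = z \<otimes>\<^bsub>?T\<^esub> x \<oplus>\<^bsub>?T\<^esub> z \<otimes>\<^bsub>?T\<^esub> y"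
      "(a \<odot>\<^bsub>?T\<^esub> x) \<otimes>\<^bsub>?T\<^esub> y = a \<odot>\<^bsub>?T\<^esub> (x \<otimes>\<^bsub>?T\<^esub> y)" "x \<otimes>\<^bsub>?T\<^esub> (a \<odot>\<^bsub>?T\<^esub> y) = a \<odot>\<^bsub>?T\<^esub> (x \<otimes>\<^bsub>?T\<^esub> y)"
      by (simp_all only: eqs simps fm_add fm_scal)
    show "x \<otimes>\<^bsub>?T\<^esub> y \<in> carrier ?T"
      using cl_closed[OF c(1)] by (simp only: eqs cl_mult cl Q_tensor)
  qed
  have one: "\<one>\<^bsub>?T\<^esub> \<in> carrier ?T" by (simp add: T_one)
  \<comment> \<open>The unit laws are immediate on pure tensors and pass to sums by
    distributivity.\<close>
  have ones: "x \<otimes>\<^bsub>?T\<^esub> \<one>\<^bsub>?T\<^esub> = x \<and> \<one>\<^bsub>?T\<^esub> \<otimes>\<^bsub>?T\<^esub> x = x" if "x \<in> carrier ?T" for x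
    using that
  proof (induction rule: tensor_induct)
    case zero
    have "\<zero>\<^bsub>?T\<^esub> = 0 \<odot>\<^bsub>?T\<^esub> \<zero>\<^bsub>?T\<^esub>" by simp
    then show ?case
      using distr(3)[OF T.M.zero_closed one one, of 0] distr(4)[OF one T.M.zero_closed one, of 0]
        distr(5)[OF one T.M.zero_closed one] distr(5)[OF T.M.zero_closed one one] by simp
  next
    case (add x y)
    then show ?case using distr(1)[of x y "\<one>\<^bsub>?T\<^esub>"] distr(2)[of x y "\<one>\<^bsub>?T\<^esub>"] one by simp
  next
    case (tens x n)
    then show ?case by (simp add: T_one tn_mult)
  qed
  show ?thesis
    by (intro balg.intro T_amod balg_axioms.intro one)
      (simp_all add: ones distr(3-5), (rule distr, assumption+)+)
qed

sublocale TA: balg "tensor M N" by (rule T_balg)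

end

section \<open>Completions\<close>

locale graded = balg U for U :: "('a::comm_ring_1, 'u) module" (structure) +
  fixes G :: "nat \<Rightarrow> 'u set"
  assumes G_sub: "submodule (G p) base_mod U"
    and G_one: "\<one> \<in> G 0"
    and G_mult: "x \<in> G p \<Longrightarrow> y \<in> G q \<Longrightarrow> x \<otimes> y \<in> G (p + q)"
begin

abbreviation "C \<equiv> completion U G"

lemmas G_rules = submoduleD[OF G_sub]

lemma G_carrier [simp]: "x \<in> G p \<Longrightarrow> x \<in> carrier U"
  using G_rules(1) by blast

lemma C_simps:
  "w \<in> carrier C \<longleftrightarrow> (\<forall>p. w p \<in> G p)" "(v \<oplus>\<^bsub>C\<^esub> w) p = v p \<oplus> w p" "(a \<odot>\<^bsub>C\<^esub> w) p = a \<odot> w p"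
  "\<zero>\<^bsub>C\<^esub> p = \<zero>" "(v \<otimes>\<^bsub>C\<^esub> w) p = (\<Oplus>i\<in>{..p}. v i \<otimes> w (p - i))" "\<one>\<^bsub>C\<^esub> = homog U 0 \<one>"
  by (auto simp: completion_def homog_def)

lemma C_closed [simp]: "w \<in> carrier C \<Longrightarrow> w p \<in> G p" "w \<in> carrier C \<Longrightarrow> w p \<in> carrier U"
proof -
  show "w \<in> carrier C \<Longrightarrow> w p \<in> G p" by (simp add: C_simps)
  then show "w \<in> carrier C \<Longrightarrow> w p \<in> carrier U" using G_carrier by blast
qed

lemma C_amod: "amod C"
  by (rule amodI; (rule ext)?)
    (simp_all add: C_simps G_rules smult_add_left smult_add_right smult_mult M.a_ac)

lemma homog_closed [simp]: "u \<in> G p \<Longrightarrow> homog U p u \<in> carrier C"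
  by (simp add: C_simps homog_def G_rules)

lemma homog_rules:
  "u \<in> carrier U \<Longrightarrow> v \<in> carrier U \<Longrightarrow> homog U p (u \<oplus> v) = homog U p u \<oplus>\<^bsub>C\<^esub> homog U p v"
  "u \<in> carrier U \<Longrightarrow> homog U p (a \<odot> u) = a \<odot>\<^bsub>C\<^esub> homog U p u"
  "homog U p \<zero> = \<zero>\<^bsub>C\<^esub>"
  by (rule ext; simp add: C_simps homog_def)+

lemma finsum_single_term:
  assumes "i \<in> I" "finite I" "f i \<in> carrier U" "\<And>j. j \<in> I \<Longrightarrow> j \<noteq> i \<Longrightarrow> f j = \<zero>"
  shows "finsum U f I = f i"
proof -
  have f: "f j \<in> carrier U" if "j \<in> I" for j
    using that assms by (cases "j = i") auto
  have "finsum U f I = (\<Oplus>j\<in>I. if i = j then f j else \<zero>)"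
    using assms f by (intro M.finsum_cong') auto
  also have "\<dots> = f i"
    using assms f by (intro M.finsum_singleton) auto
  finally show ?thesis .
qed

lemma homog_mult_l:
  assumes "u \<in> G p" "w \<in> carrier C"
  shows "homog U p u \<otimes>\<^bsub>C\<^esub> w = (\<lambda>n. if p \<le> n then u \<otimes> w (n - p) else \<zero>)"
proof
  fix n
  show "(homog U p u \<otimes>\<^bsub>C\<^esub> w) n = (if p \<le> n then u \<otimes> w (n - p) else \<zero>)"
  proof (cases "p \<le> n")
    case True
    then show ?thesis
      using assms unfolding C_simps(5) by (subst finsum_single_term[of p]) (auto simp: homog_def)
  next
    case False
    then have "(\<Oplus>i\<in>{..n}. homog U p u i \<otimes> w (n - i)) = (\<Oplus>i\<in>{..n}. \<zero>)"
      using assms by (intro M.finsum_cong') (auto simp: homog_def)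
    with False show ?thesis by (simp add: C_simps)
  qed
qed

lemma homog_mult: "u \<in> G p \<Longrightarrow> v \<in> G q \<Longrightarrow> homog U p u \<otimes>\<^bsub>C\<^esub> homog U q v = homog U (p + q) (u \<otimes> v)"
  using homog_mult_l[of u p "homog U q v"] homog_closed[of v q] by (auto simp: homog_def fun_eq_iff)

lemma C_balg: "balg C"
proof -
  interpret C: amod C by (rule C_amod)
  have smult_finsum': "finsum U (\<lambda>i. a \<odot> f i) I = a \<odot> finsum U f I" if "finite I" "f \<in> I \<rightarrow> carrier U" for f I a
    using that by (simp add: smult_finsum)
  show ?thesis
  proof (unfold_locales, goal_cases)
    case (1 x y)
    have "x i \<otimes> y (p - i) \<in> G p" if "i \<le> p" for i p
      using G_mult[of "x i" i "y (p - i)" "p - i"] 1 that by simp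
    then show ?case by (auto simp: C_simps intro!: submodule_finsum[OF G_sub])
  next
    case 2
    then show ?case using G_one by (simp add: C_simps(6))
  next
    case (3 x)
    then show ?case using G_one by (auto simp: C_simps(6) homog_mult_l)
  next
    case (4 x)
    show ?case
    proof
      fix n
      show "(x \<otimes>\<^bsub>C\<^esub> \<one>\<^bsub>C\<^esub>) n = x n"
        using 4 unfolding C_simps(5,6) by (subst finsum_single_term[of n]) (auto simp: homog_def)
    qed
  next
    case (5 x y z)
    then show ?case
      by (intro HOL.ext, unfold C_simps(5) C_simps(2), subst M.finsum_addf[symmetric])
        (auto simp: C_simps(2) b_l_distr intro!: M.finsum_cong')
  next
    case (6 x y z)
    then show ?case
      by (intro HOL.ext, unfold C_simps(5) C_simps(2), subst M.finsum_addf[symmetric])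
        (auto simp: C_simps(2) b_r_distr intro!: M.finsum_cong')
  next
    case (7 x y a)
    then show ?case
      by (intro HOL.ext, unfold C_simps(5) C_simps(3), subst smult_finsum'[symmetric])
        (auto simp: C_simps(3) b_smult_l intro!: M.finsum_cong')
  next
    case (8 x y a)
    then show ?case
      by (intro HOL.ext, unfold C_simps(5) C_simps(3), subst smult_finsum'[symmetric])
        (auto simp: C_simps(3) b_smult_r intro!: M.finsum_cong')
  qed
qed

sublocale C: balg C by (rule C_balg)

lemma C_finsum: "f \<in> I \<rightarrow> carrier C \<Longrightarrow> finsum C f I p = (\<Oplus>i\<in>I. f i p)"
  by (induction I rule: infinite_finite_induct) (auto simp: C_simps(2,4) Pi_def)

lemma C_minus:
  assumes "v \<in> carrier C" "w \<in> carrier C"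
  shows "(v \<ominus>\<^bsub>C\<^esub> w) p = v p \<ominus> w p"
  using assms by (simp add: a_minus_def C.neg_eq_smult neg_eq_smult C_simps(2,3))

end

lemma (in pres) graded_pres:
  assumes "\<And>p. G p = pres_grade Mo R D p"
  shows "graded (pres_alg Mo R) G"
proof (intro graded.intro balg_axioms graded_axioms.intro)
  have "Word [] \<in> words_of_degree D 0" by (auto simp: words_of_degree_def)
  then show "\<one>\<^bsub>pres_alg Mo R\<^esub> \<in> G 0" using wd_grade[of "[]"] by (simp add: assms wd_Nil)
qed (simp_all only: assms grade_submodule grade_mult)

section \<open>Convergent sums\<close>

locale conv_tens = graded U G + N: amod N
  for U :: "('a::comm_ring_1, 'u) module" (structure) and G and N :: "('a, 'n) module"
begin

sublocale tens2 C N ..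

abbreviation "Tn \<equiv> tensor C N"
abbreviation "nb \<equiv> nbhd C N"
abbreviation "cs \<equiv> conv_sum C N"

lemma nb_sub: "submodule (nb p) base_mod Tn"
  unfolding nbhd_def by (rule tens_part_sub) auto

lemmas nb_rules = T.submoduleD[OF nb_sub]

lemma tn_nb: "w \<in> carrier C \<Longrightarrow> n \<in> carrier N \<Longrightarrow> (\<And>i. i < p \<Longrightarrow> w i = \<zero>) \<Longrightarrow> tn w n \<in> nb p"
  unfolding nbhd_def by (rule tens_part_tn) (auto simp: C_simps(4))

lemma csD: "cs f x \<Longrightarrow> f m \<in> carrier Tn" "cs f x \<Longrightarrow> x \<in> carrier Tn"
  by (auto simp: conv_sum_def)

lemma cs_add:
  assumes "cs f x" "cs g y"
  shows "cs (\<lambda>m. f m \<oplus>\<^bsub>Tn\<^esub> g m) (x \<oplus>\<^bsub>Tn\<^esub> y)"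
  unfolding conv_sum_def
proof (intro conjI allI)
  note [simp] = csD[OF assms(1)] csD[OF assms(2)]
  show "range (\<lambda>m. f m \<oplus>\<^bsub>Tn\<^esub> g m) \<subseteq> carrier Tn" "x \<oplus>\<^bsub>Tn\<^esub> y \<in> carrier Tn"
    by auto
  fix p
  obtain n0 n1 where n0: "\<forall>n\<ge>n0. x \<ominus>\<^bsub>Tn\<^esub> finsum Tn f {..<n} \<in> nb p"
    and n1: "\<forall>n\<ge>n1. y \<ominus>\<^bsub>Tn\<^esub> finsum Tn g {..<n} \<in> nb p"
    using assms unfolding conv_sum_def by metis
  have "x \<oplus>\<^bsub>Tn\<^esub> y \<ominus>\<^bsub>Tn\<^esub> finsum Tn (\<lambda>m. f m \<oplus>\<^bsub>Tn\<^esub> g m) {..<n} =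
    (x \<ominus>\<^bsub>Tn\<^esub> finsum Tn f {..<n}) \<oplus>\<^bsub>Tn\<^esub> (y \<ominus>\<^bsub>Tn\<^esub> finsum Tn g {..<n})" for n
    by (simp add: T.M.finsum_addf a_minus_def T.M.minus_add T.M.a_ac Pi_def)
  then show "\<exists>n0. \<forall>n\<ge>n0. x \<oplus>\<^bsub>Tn\<^esub> y \<ominus>\<^bsub>Tn\<^esub> finsum Tn (\<lambda>m. f m \<oplus>\<^bsub>Tn\<^esub> g m) {..<n} \<in> nb p"
    using n0 n1 nb_rules(3) by (intro exI[of _ "max n0 n1"]) auto
qed

lemma cs_zero: "cs (\<lambda>_. \<zero>\<^bsub>Tn\<^esub>) \<zero>\<^bsub>Tn\<^esub>"
  using nb_rules(2) by (auto simp: conv_sum_def T.M.finsum_zero a_minus_def)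

lemma cs_neg:
  assumes "cs f x"
  shows "cs (\<lambda>m. \<ominus>\<^bsub>Tn\<^esub> f m) (\<ominus>\<^bsub>Tn\<^esub> x)"
  unfolding conv_sum_def
proof (intro conjI allI)
  note [simp] = csD[OF assms(1)]
  show "range (\<lambda>m. \<ominus>\<^bsub>Tn\<^esub> f m) \<subseteq> carrier Tn" "\<ominus>\<^bsub>Tn\<^esub> x \<in> carrier Tn"
    by auto
  fix p
  have "finsum Tn (\<lambda>m. \<ominus>\<^bsub>Tn\<^esub> f m) {..<n} = \<ominus>\<^bsub>Tn\<^esub> finsum Tn f {..<n}" for n
    by (simp add: T.neg_eq_smult T.smult_finsum Pi_def)
  then have "\<ominus>\<^bsub>Tn\<^esub> x \<ominus>\<^bsub>Tn\<^esub> finsum Tn (\<lambda>m. \<ominus>\<^bsub>Tn\<^esub> f m) {..<n} = \<ominus>\<^bsub>Tn\<^esub> (x \<ominus>\<^bsub>Tn\<^esub> finsum Tn f {..<n})" for n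
    by (simp add: a_minus_def T.M.minus_add)
  then show "\<exists>n0. \<forall>n\<ge>n0. \<ominus>\<^bsub>Tn\<^esub> x \<ominus>\<^bsub>Tn\<^esub> finsum Tn (\<lambda>m. \<ominus>\<^bsub>Tn\<^esub> f m) {..<n} \<in> nb p"
    using assms nb_rules(5) unfolding conv_sum_def by metis
qed

lemma cs_minus:
  assumes "cs f x" "cs g y"
  shows "cs (\<lambda>m. f m \<ominus>\<^bsub>Tn\<^esub> g m) (x \<ominus>\<^bsub>Tn\<^esub> y)"
  using cs_add[OF assms(1) cs_neg[OF assms(2)]] by (simp add: a_minus_def)

text \<open>At this level only membership in every neighbourhood of 0 can be concluded; that such an
  element is 0 is the content of \<open>separated\<close>.\<close>

lemma cs_of_zero:
  assumes "cs f x" "\<And>m. f m = \<zero>\<^bsub>Tn\<^esub>"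
  shows "x \<in> nb p"
proof -
  have "f = (\<lambda>_. \<zero>\<^bsub>Tn\<^esub>)" using assms(2) by auto
  then obtain n where "x \<ominus>\<^bsub>Tn\<^esub> finsum Tn (\<lambda>_. \<zero>\<^bsub>Tn\<^esub>) {..<n::nat} \<in> nb p"
    using assms(1) unfolding conv_sum_def by blast
  then show ?thesis using csD(2)[OF assms(1)] by (simp add: T.M.finsum_zero a_minus_def)
qed

text \<open>The hypothesis \<open>sum\<close> says that component \<open>i\<close> is complete after
  any number \<open>k > i\<close> of terms. Hence the remainder after \<open>k\<close> terms has no
  component below \<open>k\<close>.\<close>

lemma cs_tens:
  assumes v: "\<And>m. v m \<in> carrier C" and w: "w \<in> carrier C" and n: "n \<in> carrier N"
    and sum: "\<And>i k. i < k \<Longrightarrow> w i = finsum U (\<lambda>m. v m i) {..<k}"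
  shows "cs (\<lambda>m. tn (v m) n) (tn w n)"
  unfolding conv_sum_def
proof (intro conjI allI)
  interpret t: lin C Tn "\<lambda>x. tn x n" by (rule lin_tn_l[OF n])
  show "range (\<lambda>m. tn (v m) n) \<subseteq> carrier Tn" "tn w n \<in> carrier Tn" using v w n by auto
  fix p
  have "tn w n \<ominus>\<^bsub>Tn\<^esub> finsum Tn (\<lambda>m. tn (v m) n) {..<k} \<in> nb p" if "p \<le> k" for k
  proof -
    have vk: "finsum C v {..<k} \<in> carrier C" using v by (intro C.M.finsum_closed) auto
    have "tn w n \<ominus>\<^bsub>Tn\<^esub> finsum Tn (\<lambda>m. tn (v m) n) {..<k} = tn (w \<ominus>\<^bsub>C\<^esub> finsum C v {..<k}) n"
      using v w vk t.finsum[of v "{..<k}"] by (simp add: t.minus Pi_def)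
    also have "\<dots> \<in> nb p"
    proof (rule tn_nb[OF _ n])
      show "w \<ominus>\<^bsub>C\<^esub> finsum C v {..<k} \<in> carrier C" using w vk by (rule C.M.minus_closed)
      fix i assume "i < p"
      then show "(w \<ominus>\<^bsub>C\<^esub> finsum C v {..<k}) i = \<zero>"
        using sum[of i k] that v C_closed(2)[OF w, of i] by (simp only: C_minus[OF w vk]) (simp add: C_finsum Pi_def a_minus_def M.r_neg v)
    qed
    finally show ?thesis .
  qed
  then show "\<exists>n0. \<forall>k\<ge>n0. tn w n \<ominus>\<^bsub>Tn\<^esub> finsum Tn (\<lambda>m. tn (v m) n) {..<k} \<in> nb p" by blast
qed

lemma cs_homog:
  assumes w: "w \<in> carrier C" and n: "n \<in> carrier N"
  shows "cs (\<lambda>p. tn (homog U p (w p)) n) (tn w n)"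
proof (rule cs_tens)
  fix i k :: nat assume "i < k"
  then show "w i = (\<Oplus>m\<in>{..<k}. homog U m (w m) i)"
    using w by (subst finsum_single_term[of i]) (auto simp: homog_def)
qed (use assms in auto)

end

section \<open>Noetherian base rings and separation\<close>

text \<open>Turns finite generation in the sense of ideals into explicit linear combinations: the
  combinations form an ideal containing the generators, hence they exhaust the generated
  ideal.\<close>

lemma noetherian_ideal_fg:
  fixes J :: "'a::comm_ring_1 set"
  assumes "noetherian_ring (base_mod :: ('a, 'a) module)"
    and "0 \<in> J" "\<And>x y. x \<in> J \<Longrightarrow> y \<in> J \<Longrightarrow> x + y \<in> J" "\<And>a x. x \<in> J \<Longrightarrow> a * x \<in> J"
  obtains A where "finite A" "A \<subseteq> J" "\<And>x. x \<in> J \<Longrightarrow> \<exists>c. x = (\<Sum>a\<in>A. c a * a)"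
proof -
  let ?B = "base_mod :: ('a, 'a) module"
  interpret noetherian_ring ?B by fact
  interpret B: amod ?B
    by (rule amodI) (simp_all add: algebra_simps)
  have idl: "ideal H ?B" if "0 \<in> H" "\<And>x y. x \<in> H \<Longrightarrow> y \<in> H \<Longrightarrow> x + y \<in> H" "\<And>a x. x \<in> H \<Longrightarrow> a * x \<in> H" for H
  proof (rule idealI)
    have "submodule H base_mod ?B" using that by (intro B.submoduleI') auto
    then show "subgroup H (add_monoid ?B)" by (simp add: submodule_def)
  qed (use that(3) in \<open>auto simp: ring_axioms mult.commute\<close>)
  obtain A where A: "finite A" "J = Idl\<^bsub>?B\<^esub> A"
    using finetely_gen[OF idl[OF assms(2-4)]] by auto
  define H where "H = {x. \<exists>c. x = (\<Sum>a\<in>A. c a * a)}"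
  have "ideal H ?B"
  proof (rule idl)
    show "0 \<in> H" unfolding H_def by (rule CollectI, rule exI[of _ "\<lambda>_. 0"]) simp
    show "x + y \<in> H" if xy: "x \<in> H" "y \<in> H" for x y
    proof -
      obtain c d where "x = (\<Sum>a\<in>A. c a * a)" "y = (\<Sum>a\<in>A. d a * a)" using xy by (auto simp: H_def)
      then have "x + y = (\<Sum>a\<in>A. (c a + d a) * a)" by (simp add: sum.distrib distrib_right)
      then show ?thesis unfolding H_def by (intro CollectI exI)
    qed
    show "b * x \<in> H" if x: "x \<in> H" for b x
    proof -
      obtain c where "x = (\<Sum>a\<in>A. c a * a)" using x by (auto simp: H_def)
      then have "b * x = (\<Sum>a\<in>A. (b * c a) * a)" by (simp add: sum_distrib_left mult.assoc)
      then show ?thesis unfolding H_def by (intro CollectI exI)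
    qed
  qed
  moreover have "A \<subseteq> H"
  proof
    fix x assume "x \<in> A"
    then have "x = (\<Sum>a\<in>A. (if a = x then 1 else 0) * a)"
      using A(1) by (simp add: if_distrib[of "\<lambda>c. c * _"] sum.delta cong: if_cong)
    then show "x \<in> H" unfolding H_def by (intro CollectI exI)
  qed
  ultimately have "J \<subseteq> H" using A(2) genideal_minimal by blast
  moreover have "A \<subseteq> J" using A(2) genideal_self[of A] by simp
  ultimately show thesis using A(1) that unfolding H_def by blast
qed

text \<open>Finite generation of submodules of a free module of rank \<open>n\<close>, by induction
  on \<open>n\<close>: take generators for the vectors with last coordinate 0, together with lifts
  of generators of the ideal of last coordinates. Vectors are functions on all naturals, of which
  only the first \<open>n\<close> values are compared.\<close>

lemma noetherian_submodule_fg: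
  fixes K :: "(nat \<Rightarrow> 'a::comm_ring_1) set"
  assumes noeth: "noetherian_ring (base_mod :: ('a, 'a) module)"
    and "(\<lambda>_. 0) \<in> K" "\<And>v w. v \<in> K \<Longrightarrow> w \<in> K \<Longrightarrow> (\<lambda>j. v j + w j) \<in> K" "\<And>a v. v \<in> K \<Longrightarrow> (\<lambda>j. a * v j) \<in> K"
  shows "\<exists>R. finite R \<and> R \<subseteq> K \<and> (\<forall>v \<in> K. \<exists>c. \<forall>j<n. v j = (\<Sum>r\<in>R. c r * r j))"
  using assms(2-4)
proof (induction n arbitrary: K)
  case 0
  then show ?case by (intro exI[of _ "{}"]) simp
next
  case (Suc n)
  note K = Suc.prems
  let ?K0 = "{v \<in> K. v n = 0}"
  obtain R0 where R0: "finite R0" "R0 \<subseteq> ?K0" "\<And>v. v \<in> ?K0 \<Longrightarrow> \<exists>c. \<forall>j<n. v j = (\<Sum>r\<in>R0. c r * r j)"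
    using Suc.IH[of ?K0] K by auto
  obtain A where A: "finite A" "A \<subseteq> (\<lambda>v. v n) ` K" "\<And>x. x \<in> (\<lambda>v. v n) ` K \<Longrightarrow> \<exists>c. x = (\<Sum>a\<in>A. c a * a)"
  proof (rule noetherian_ideal_fg[OF noeth, of "(\<lambda>v. v n) ` K"])
    show "0 \<in> (\<lambda>v. v n) ` K" using K(1) by (rule rev_image_eqI) simp
    show "x + y \<in> (\<lambda>v. v n) ` K" if "x \<in> (\<lambda>v. v n) ` K" "y \<in> (\<lambda>v. v n) ` K" for x y
      using that K(2) by (auto intro: rev_image_eqI)
    show "a * x \<in> (\<lambda>v. v n) ` K" if "x \<in> (\<lambda>v. v n) ` K" for a x
      using that K(3) by (auto intro: rev_image_eqI)
  qed blast
  define \<rho> where "\<rho> a = (SOME v. v \<in> K \<and> v n = a)" for a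
  have \<rho>: "\<rho> a \<in> K" "\<rho> a n = a" if "a \<in> A" for a
    using someI_ex[of "\<lambda>v. v \<in> K \<and> v n = a"] A(2) that unfolding \<rho>_def by (auto simp: image_iff)
  have K_sum: "(\<lambda>j. \<Sum>a\<in>B. c a * \<rho> a j) \<in> K" if "B \<subseteq> A" for c B
  proof -
    have "finite B" using that A(1) finite_subset by blast
    then show ?thesis
      using that
    proof (induction B)
      case (insert b B)
      then show ?case using K(2)[OF K(3)[OF \<rho>(1), of b "c b"], of "\<lambda>j. \<Sum>a\<in>B. c a * \<rho> a j"] by simp
    qed (simp add: K(1))
  qed
  show ?case
  proof (rule exI[of _ "R0 \<union> \<rho> ` A"], intro conjI ballI)
    show "finite (R0 \<union> \<rho> ` A)" "R0 \<union> \<rho> ` A \<subseteq> K" using R0 A \<rho> by auto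
    fix v assume v: "v \<in> K"
    obtain c where c: "v n = (\<Sum>a\<in>A. c a * a)" using A(3) v by auto
    \<comment> \<open>A combination of the lifts with the same last coordinate as \<open>v\<close>;
      the difference \<open>v - w\<close> then falls under the induction hypothesis.\<close>
    define w where "w j = (\<Sum>a\<in>A. c a * \<rho> a j)" for j
    have "(\<lambda>j. v j + (- 1) * w j) \<in> K"
      using K(2)[OF v K(3)[OF K_sum, of A "- 1" c]] by (simp add: w_def)
    moreover have "w n = v n" unfolding w_def c using \<rho>(2) by (intro sum.cong) auto
    ultimately obtain d where d: "\<forall>j<n. v j - w j = (\<Sum>r\<in>R0. d r * r j)" "v n - w n = 0"
      using R0(3)[of "\<lambda>j. v j + (- 1) * w j"] by auto
    have dn: "v j - w j = (\<Sum>r\<in>R0. d r * r j)" if "j < Suc n" for j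
    proof (cases "j = n")
      case True
      have "(\<Sum>r\<in>R0. d r * r n) = 0" using R0(2) by (intro sum.neutral) auto
      with True d(2) show ?thesis by simp
    qed (use d(1) that in simp)
    \<comment> \<open>A vector may belong both to \<open>R0\<close> and to the lifts, for instance
      the lift of a generator 0, so its two coefficients are added. For \<open>r = \<rho> a\<close>
      the value \<open>r n\<close> recovers \<open>a\<close>.\<close>
    let ?d = "\<lambda>r. (if r \<in> R0 then d r else 0) + (if r \<in> \<rho> ` A then c (r n) else 0)"
    have inj: "inj_on \<rho> A" using \<rho>(2) by (metis inj_onI)
    show "\<exists>c. \<forall>j<Suc n. v j = (\<Sum>r\<in>R0 \<union> \<rho> ` A. c r * r j)"
    proof (rule exI[of _ ?d], intro allI impI)
      fix j assume j: "j < Suc n"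
      have "(\<Sum>r\<in>R0 \<union> \<rho> ` A. ?d r * r j) =
        (\<Sum>r\<in>R0 \<union> \<rho> ` A. (if r \<in> R0 then d r else 0) * r j) +
        (\<Sum>r\<in>R0 \<union> \<rho> ` A. (if r \<in> \<rho> ` A then c (r n) else 0) * r j)"
        by (simp only: distrib_right sum.distrib)
      also have "(\<Sum>r\<in>R0 \<union> \<rho> ` A. (if r \<in> R0 then d r else 0) * r j) = (\<Sum>r\<in>R0. d r * r j)"
        using R0(1) A(1) by (intro sum.mono_neutral_cong_right) auto
      also have "(\<Sum>r\<in>R0 \<union> \<rho> ` A. (if r \<in> \<rho> ` A then c (r n) else 0) * r j) = (\<Sum>r\<in>\<rho> ` A. c (r n) * r j)"
        using R0(1) A(1) by (intro sum.mono_neutral_cong_right) auto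
      also have "\<dots> = w j"
        unfolding w_def using \<rho>(2) by (simp add: sum.reindex[OF inj])
      also have "(\<Sum>r\<in>R0. d r * r j) + w j = v j" by (simp only: dn[OF j, symmetric] diff_add_cancel)
      finally show "v j = (\<Sum>r\<in>R0 \<union> \<rho> ` A. ?d r * r j)" by (rule sym)
    qed
  qed
qed

text \<open>If \<open>N\<close> is finitely generated over a noetherian ring, it is finitely presented, and then an
  element of \<open>(\<Prod>p. G p) \<otimes> N\<close> that vanishes in every degree is zero.\<close>

lemma (in conv_tens) separated:
  fixes n :: nat
  assumes noeth: "noetherian_ring (base_mod :: ('a, 'a) module)"
    and g: "\<And>j. j < n \<Longrightarrow> g j \<in> carrier N"
    and gen: "\<And>\<mu>. \<mu> \<in> carrier N \<Longrightarrow> \<exists>c. \<mu> = (\<Oplus>\<^bsub>N\<^esub>j\<in>{..<n}. c j \<odot>\<^bsub>N\<^esub> g j)"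
    and x: "x \<in> carrier Tn" "\<And>p. x \<in> nb p"
  shows "x = \<zero>\<^bsub>Tn\<^esub>"
proof -
  define comb where "comb a = (\<Oplus>\<^bsub>N\<^esub>j\<in>{..<n}. a j \<odot>\<^bsub>N\<^esub> g j)" for a
  have comb_closed: "comb a \<in> carrier N" for a
    unfolding comb_def using g by (intro N.M.finsum_closed) auto
  have comb_add: "comb (\<lambda>j. a j + b j) = comb a \<oplus>\<^bsub>N\<^esub> comb b" for a b
  proof -
    have "comb (\<lambda>j. a j + b j) = (\<Oplus>\<^bsub>N\<^esub>j\<in>{..<n}. a j \<odot>\<^bsub>N\<^esub> g j \<oplus>\<^bsub>N\<^esub> b j \<odot>\<^bsub>N\<^esub> g j)"
      unfolding comb_def using g by (intro N.M.finsum_cong') (auto simp: N.smult_add_left)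
    also have "\<dots> = comb a \<oplus>\<^bsub>N\<^esub> comb b"
      unfolding comb_def using g by (intro N.M.finsum_addf) auto
    finally show ?thesis .
  qed
  have comb_smult: "comb (\<lambda>j. t * a j) = t \<odot>\<^bsub>N\<^esub> comb a" for t a
  proof -
    have "t \<odot>\<^bsub>N\<^esub> comb a = (\<Oplus>\<^bsub>N\<^esub>j\<in>{..<n}. t \<odot>\<^bsub>N\<^esub> (a j \<odot>\<^bsub>N\<^esub> g j))"
      unfolding comb_def using g by (intro N.smult_finsum) auto
    also have "\<dots> = comb (\<lambda>j. t * a j)"
      unfolding comb_def using g by (intro N.M.finsum_cong') (auto simp: N.smult_mult)
    finally show ?thesis by simp
  qed
  \<comment> \<open>An arbitrary choice of coordinates, in general not linear in its argument. Its
    failure to be linear always lies in the module \<open>K\<close> of relations between the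
    generators.\<close>
  define c where "c \<mu> = (SOME c. \<mu> = comb c)" for \<mu>
  have c: "comb (c \<mu>) = \<mu>" if "\<mu> \<in> carrier N" for \<mu>
    using someI_ex[OF gen[OF that]] by (simp add: c_def comb_def)
  define K where "K = {a. comb a = \<zero>\<^bsub>N\<^esub>}"
  have K: "(\<lambda>_. 0) \<in> K" "\<And>v w. v \<in> K \<Longrightarrow> w \<in> K \<Longrightarrow> (\<lambda>j. v j + w j) \<in> K" "\<And>a v. v \<in> K \<Longrightarrow> (\<lambda>j. a * v j) \<in> K"
  proof -
    have "comb (\<lambda>j. 0 * 0) = \<zero>\<^bsub>N\<^esub>"
      unfolding comb_smult using comb_closed by (rule N.smult_0)
    then show "(\<lambda>_. 0) \<in> K" by (simp only: K_def mult_zero_left mem_Collect_eq)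
  qed (simp_all only: K_def mem_Collect_eq comb_add comb_smult N.smult_zero N.M.l_zero N.M.zero_closed)
  \<comment> \<open>Here the noetherian hypothesis enters: finitely many relations \<open>R\<close>
    account for all of \<open>K\<close>, and they are fixed before any degree is considered.\<close>
  have "\<exists>R. finite R \<and> R \<subseteq> K \<and> (\<forall>v\<in>K. \<exists>c. \<forall>j<n. v j = (\<Sum>r\<in>R. c r * r j))"
    by (rule noetherian_submodule_fg[of K n, OF noeth K(1)]) (fact K)+
  then obtain R where R: "finite R" "R \<subseteq> K" "\<forall>v \<in> K. \<exists>d. \<forall>j<n. v j = (\<Sum>r\<in>R. d r * r j)"
    by (elim exE conjE) rule
  \<comment> \<open>Coordinates of a formal sum of pairs: each second component is expanded by
    \<open>c\<close> and the results are collected per generator. The map lives on the free module,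
    since it need not respect the tensor relations.\<close>
  define \<Phi> where "\<Phi> f j = ext C (\<lambda>(w, \<mu>). c \<mu> j \<odot>\<^bsub>C\<^esub> w) f" for f j
  have phi_fun: "(\<lambda>(w, \<mu>). c \<mu> j \<odot>\<^bsub>C\<^esub> w) \<in> carrier C \<times> carrier N \<rightarrow> carrier C" for j
    by auto
  let ?F = "free_tens C N"
  have phi_closed [simp]: "\<Phi> f j \<in> carrier C" if "f \<in> carrier ?F" for f j
    using that C.ext_closed[OF _ phi_fun] by (simp add: \<Phi>_def carrier_keys)
  have phi_add: "\<Phi> (f + f') j = \<Phi> f j \<oplus>\<^bsub>C\<^esub> \<Phi> f' j" if "f \<in> carrier ?F" "f' \<in> carrier ?F" for f f' j
    using that C.ext_add[OF _ _ phi_fun] by (simp add: \<Phi>_def carrier_keys)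
  have phi_scal: "\<Phi> (scal a f) j = a \<odot>\<^bsub>C\<^esub> \<Phi> f j" if "f \<in> carrier ?F" for f a j
    using that C.ext_scal[OF _ phi_fun] by (simp add: \<Phi>_def carrier_keys)
  have phi_minus: "\<Phi> (f - f') j = \<Phi> f j \<ominus>\<^bsub>C\<^esub> \<Phi> f' j" if "f \<in> carrier ?F" "f' \<in> carrier ?F" for f f' j
    using that C.ext_minus[OF _ _ phi_fun] by (simp add: \<Phi>_def carrier_keys)
  have phi_zero: "\<Phi> 0 j = \<zero>\<^bsub>C\<^esub>" for j by (simp add: \<Phi>_def)
  have phi_single: "\<Phi> (Poly_Mapping.single (w, \<mu>) a) j = a \<odot>\<^bsub>C\<^esub> (c \<mu> j \<odot>\<^bsub>C\<^esub> w)" if "w \<in> carrier C" for w \<mu> a j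
    unfolding \<Phi>_def using that by simp
  have rep: "cl f = finsum Tn (\<lambda>j. tn (\<Phi> f j) (g j)) {..<n}" if "f \<in> carrier ?F" for f
    using that[unfolded carrier_keys]
  proof (induction f rule: poly_mapping_lin_induct)
    case zero
    have "finsum Tn (\<lambda>j. tn \<zero>\<^bsub>C\<^esub> (g j)) {..<n} = finsum Tn (\<lambda>j. \<zero>\<^bsub>Tn\<^esub>) {..<n}"
      using g lin.zero[OF lin_tn_l] by (intro T.M.finsum_cong') auto
    then show ?case using Q_zero by (simp add: phi_zero T.M.finsum_zero Q_tensor)
  next
    case (add f f')
    then have ff: "f \<in> carrier ?F" "f' \<in> carrier ?F" by (simp_all only: carrier_keys)
    have "finsum Tn (\<lambda>j. tn (\<Phi> (f + f') j) (g j)) {..<n} =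
      finsum Tn (\<lambda>j. tn (\<Phi> f j) (g j) \<oplus>\<^bsub>Tn\<^esub> tn (\<Phi> f' j) (g j)) {..<n}"
      using g ff by (intro T.M.finsum_cong') (auto simp: phi_add tn_add_l)
    also have "\<dots> = cl f \<oplus>\<^bsub>Tn\<^esub> cl f'"
      using g ff add.IH by (subst T.M.finsum_addf) auto
    finally show ?case using Q_add by (simp add: Q_tensor)
  next
    case (single k a)
    then obtain w \<mu> where k: "k = (w, \<mu>)" "w \<in> carrier C" "\<mu> \<in> carrier N" by auto
    interpret r: lin N Tn "\<lambda>n. tn (a \<odot>\<^bsub>C\<^esub> w) n" using k by (intro lin_tn_r) simp
    have "cl (Poly_Mapping.single k a) = tn (a \<odot>\<^bsub>C\<^esub> w) (comb (c \<mu>))"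
      using k by (simp add: c tn_smult_l tn_scal)
    also have "\<dots> = finsum Tn (\<lambda>j. tn (a \<odot>\<^bsub>C\<^esub> w) (c \<mu> j \<odot>\<^bsub>N\<^esub> g j)) {..<n}"
      unfolding comb_def using g by (intro r.finsum) auto
    also have "\<dots> = finsum Tn (\<lambda>j. tn (\<Phi> (Poly_Mapping.single k a) j) (g j)) {..<n}"
      using g k
      by (intro T.M.finsum_cong')
        (auto simp: phi_single tn_smult_l tn_smult_r T.smult_mult[symmetric] mult.commute)
    finally show ?case .
  qed
  \<comment> \<open>Those elements whose coordinate vector in degree \<open>p\<close> is a
    combination of the relations \<open>R\<close> with coefficients in \<open>G p\<close>. The
    tensor relations change the coordinates only in this way, so all of
    \<open>tens_ideal C N\<close> ends up in \<open>H p\<close>.\<close>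
  define H where "H p = {f \<in> carrier ?F. \<exists>y. (\<forall>r \<in> R. y r \<in> G p) \<and> (\<forall>j<n. \<Phi> f j p = (\<Oplus>r\<in>R. r j \<odot> y r))}" for p
  have H_sub: "submodule (H p) base_mod ?F" for p
  proof (rule F.submoduleI')
    show "\<zero>\<^bsub>?F\<^esub> \<in> H p"
      by (auto simp: H_def phi_zero C_simps(4) M.finsum_zero G_rules(2) intro!: exI[of _ "\<lambda>_. \<zero>"])
    show "f \<oplus>\<^bsub>?F\<^esub> f' \<in> H p" if ff: "f \<in> H p" "f' \<in> H p" for f f'
    proof -
      obtain y y' where y: "\<forall>r \<in> R. y r \<in> G p" "\<forall>j<n. \<Phi> f j p = (\<Oplus>r\<in>R. r j \<odot> y r)" "f \<in> carrier ?F"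
        and y': "\<forall>r \<in> R. y' r \<in> G p" "\<forall>j<n. \<Phi> f' j p = (\<Oplus>r\<in>R. r j \<odot> y' r)" "f' \<in> carrier ?F"
        using ff unfolding H_def by blast
      have yc [simp]: "y r \<in> carrier U" "y' r \<in> carrier U" if "r \<in> R" for r
        using y(1) y'(1) G_carrier that by blast+
      have "\<Phi> (f + f') j p = (\<Oplus>r\<in>R. r j \<odot> (y r \<oplus> y' r))" if "j < n" for j
      proof -
        have "(\<Oplus>r\<in>R. r j \<odot> (y r \<oplus> y' r)) = (\<Oplus>r\<in>R. r j \<odot> y r \<oplus> r j \<odot> y' r)"
          using y(1) y'(1) by (intro M.finsum_cong') (auto simp: smult_add_right)
        also have "\<dots> = \<Phi> (f + f') j p"
          using y y' that by (subst M.finsum_addf) (auto simp: phi_add C_simps(2))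
        finally show ?thesis by simp
      qed
      then show ?thesis
        using y y' by (auto simp: H_def G_rules(3) intro!: exI[of _ "\<lambda>r. y r \<oplus> y' r"])
    qed
    show "a \<odot>\<^bsub>?F\<^esub> f \<in> H p" if f: "f \<in> H p" for f a
    proof -
      obtain y where y: "\<forall>r \<in> R. y r \<in> G p" "\<forall>j<n. \<Phi> f j p = (\<Oplus>r\<in>R. r j \<odot> y r)" "f \<in> carrier ?F"
        using f unfolding H_def by blast
      have yc [simp]: "y r \<in> carrier U" if "r \<in> R" for r
        using y(1) G_carrier that by blast
      have "\<Phi> (scal a f) j p = (\<Oplus>r\<in>R. r j \<odot> (a \<odot> y r))" if "j < n" for j
      proof -
        have "(\<Oplus>r\<in>R. r j \<odot> (a \<odot> y r)) = (\<Oplus>r\<in>R. a \<odot> (r j \<odot> y r))"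
          using y(1) by (intro M.finsum_cong') (auto simp: smult_mult[symmetric] mult.commute)
        also have "\<dots> = \<Phi> (scal a f) j p"
          using y that R(1) by (subst smult_finsum[symmetric]) (auto simp: phi_scal C_simps(3))
        finally show ?thesis by simp
      qed
      then show ?thesis
        using y by (auto simp: H_def G_rules(4) intro!: exI[of _ "\<lambda>r. a \<odot> y r"])
    qed
  qed (auto simp: H_def)
  have H_K: "f \<in> H p" if f: "f \<in> carrier ?F" "w \<in> carrier C" "k \<in> K" "\<And>j. \<Phi> f j p = k j \<odot> w p" for f w k p
  proof -
    obtain d where d: "\<forall>j<n. k j = (\<Sum>r\<in>R. d r * r j)" using bspec[OF R(3) f(3)] by blast
    have "(\<Sum>r\<in>I. d r * r j) \<odot> w p = (\<Oplus>r\<in>I. r j \<odot> (d r \<odot> w p))" if "finite I" for I j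
      using that f(2)
      by (induction I) (auto simp: smult_add_left smult_mult[symmetric] Pi_def mult.commute)
    then show ?thesis
      using d f R(1) by (auto simp: H_def G_rules(4) intro!: exI[of _ "\<lambda>r. d r \<odot> w p"])
  qed
  have "bilin_rel C N \<subseteq> H p" for p
  proof
    fix f assume f: "f \<in> bilin_rel C N"
    then have fF: "f \<in> carrier ?F" using bilin_rel_sub by blast
    from f show "f \<in> H p"
    proof (cases rule: bilin_rel_cases)
      case (add_l v w \<mu>)
      have "\<Phi> f j p = \<zero>" for j
        using add_l(1-3) unfolding add_l(4)
        by (simp add: phi_minus phi_single C_minus C_simps(2,3) smult_add_right del: C.smult_add_right)
          (simp add: a_minus_def M.a_assoc M.minus_add[symmetric], simp add: M.a_assoc[symmetric] M.r_neg)
      then show ?thesis using H_K[OF fF C.M.zero_closed K(1)] by (simp add: C_simps)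
    next
      case (add_r w \<mu> \<nu>)
      have "(\<lambda>j. c (\<mu> \<oplus>\<^bsub>N\<^esub> \<nu>) j + (- 1) * (c \<mu> j + c \<nu> j)) \<in> K"
        unfolding K_def mem_Collect_eq comb_add comb_smult
        using add_r(1-3) by (simp add: c N.neg_eq_smult[symmetric] N.M.r_neg)
      then show ?thesis
      proof (rule H_K[OF fF add_r(1)])
        fix j
        show "\<Phi> f j p = (c (\<mu> \<oplus>\<^bsub>N\<^esub> \<nu>) j + (- 1) * (c \<mu> j + c \<nu> j)) \<odot> w p"
          using add_r(1-3) unfolding add_r(4)
          by (simp add: phi_minus phi_single C_minus C_simps(2,3))
            (simp add: a_minus_def neg_eq_smult smult_mult[symmetric] smult_add_left[symmetric] algebra_simps)
      qed
    next
      case (smult_l w \<mu> a)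
      have "\<Phi> f j p = \<zero>" for j
        using smult_l(1-2) unfolding smult_l(3)
        by (simp add: phi_minus phi_single C_minus C_simps(2,3))
          (simp add: minus_eq_zero_iff smult_mult[symmetric] mult.commute)
      then show ?thesis using H_K[OF fF C.M.zero_closed K(1)] by (simp add: C_simps)
    next
      case (smult_r w \<mu> a)
      have "(\<lambda>j. c (a \<odot>\<^bsub>N\<^esub> \<mu>) j + (- a) * c \<mu> j) \<in> K"
        unfolding K_def mem_Collect_eq comb_add comb_smult
        using smult_r(1-2) by (simp add: c N.smult_uminus N.M.r_neg)
      then show ?thesis
      proof (rule H_K[OF fF smult_r(1)])
        fix j
        show "\<Phi> f j p = (c (a \<odot>\<^bsub>N\<^esub> \<mu>) j + (- a) * c \<mu> j) \<odot> w p"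
          using smult_r(1-2) unfolding smult_r(3)
          by (simp add: phi_minus phi_single C_minus C_simps(2,3))
            (simp add: a_minus_def neg_eq_smult smult_mult[symmetric] smult_add_left[symmetric] algebra_simps)
      qed
    qed
  qed
  then have ideal_H: "tens_ideal C N \<subseteq> H p" for p
    unfolding tens_ideal_def by (intro F.gen_submod_least[OF H_sub])
  obtain f0 where f0: "f0 \<in> carrier ?F" "x = cl f0"
    using x(1) Q_carrier by (auto simp: Q_tensor)
  \<comment> \<open>First factors from the neighbourhood with index \<open>Suc p\<close> vanish in
    degree \<open>p\<close>, so a representative built from them has no coordinates there.\<close>
  have van: "\<exists>f \<in> carrier ?F. z = cl f \<and> (\<forall>j. \<Phi> f j p = \<zero>)" if "z \<in> nb (Suc p)" for p z
    using that unfolding nbhd_def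
  proof (induction rule: tens_part_induct)
    case zero
    then show ?case using Q_zero by (intro bexI[of _ 0]) (simp_all add: phi_zero C_simps(4) Q_tensor)
  next
    case (add y z)
    then obtain f f' where "f \<in> carrier ?F" "f' \<in> carrier ?F" "y = cl f" "z = cl f'"
      "\<forall>j. \<Phi> f j p = \<zero>" "\<forall>j. \<Phi> f' j p = \<zero>" by blast
    then show ?case
      using Q_add[of f f'] by (intro bexI[of _ "f + f'"]) (simp_all add: Q_tensor phi_add C_simps(2))
  next
    case (tens w \<mu>)
    then show ?case
      by (intro bexI[of _ "Poly_Mapping.single (w, \<mu>) 1"]) (auto simp: tn_cl phi_single C_simps(3,4))
  qed (auto simp: C_simps G_rules(4))
  have "\<exists>y. (\<forall>r \<in> R. y r \<in> G p) \<and> (\<forall>j<n. \<Phi> f0 j p = (\<Oplus>r\<in>R. r j \<odot> y r))" for p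
  proof -
    obtain f where f: "f \<in> carrier ?F" "x = cl f" "\<forall>j. \<Phi> f j p = \<zero>"
      using van[OF x(2)] by blast
    then have "f0 - f \<in> H p" using f0 ideal_H cl_eq by blast
    moreover have "\<Phi> (f0 - f) j p = \<Phi> f0 j p" for j
      by (simp only: phi_minus f0(1) f(1) C_minus phi_closed) (simp add: f f0(1) a_minus_def)
    ultimately show ?thesis unfolding H_def by simp
  qed
  then obtain y where y: "\<And>p r. r \<in> R \<Longrightarrow> y p r \<in> G p" "\<And>p j. j < n \<Longrightarrow> \<Phi> f0 j p = (\<Oplus>r\<in>R. r j \<odot> y p r)"
    by metis
  \<comment> \<open>Because \<open>R\<close> does not depend on the degree, the coefficients found
    degree by degree assemble into finitely many elements of the completion.\<close>
  define Y where "Y r = (\<lambda>p. y p r)" for r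
  have Y: "Y r \<in> carrier C" if "r \<in> R" for r using y(1)[OF that] by (simp add: Y_def C_simps)
  have phi0: "\<Phi> f0 j = (\<Oplus>\<^bsub>C\<^esub>r\<in>R. r j \<odot>\<^bsub>C\<^esub> Y r)" if "j < n" for j
    using y(2)[OF that] Y by (intro HOL.ext) (subst C_finsum, auto simp: C_simps(3) Y_def)
  have "x = finsum Tn (\<lambda>j. tn (\<Phi> f0 j) (g j)) {..<n}" using rep[OF f0(1)] f0(2) by simp
  also have "\<dots> = finsum Tn (\<lambda>j. finsum Tn (\<lambda>r. tn (Y r) (r j \<odot>\<^bsub>N\<^esub> g j)) R) {..<n}"
  proof (intro T.M.finsum_cong' refl)
    fix j assume "j \<in> {..<n}"
    then have j: "j < n" by simp
    interpret l: lin C Tn "\<lambda>x. tn x (g j)" using g[OF j] by (rule lin_tn_l)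
    have "tn (\<Phi> f0 j) (g j) = finsum Tn (\<lambda>r. tn (r j \<odot>\<^bsub>C\<^esub> Y r) (g j)) R"
      unfolding phi0[OF j] using Y by (intro l.finsum) auto
    also have "\<dots> = finsum Tn (\<lambda>r. tn (Y r) (r j \<odot>\<^bsub>N\<^esub> g j)) R"
      using Y g[OF j] by (intro T.M.finsum_cong') (auto simp: tn_smult_l tn_smult_r)
    finally show "tn (\<Phi> f0 j) (g j) = finsum Tn (\<lambda>r. tn (Y r) (r j \<odot>\<^bsub>N\<^esub> g j)) R" .
  qed (use Y g in \<open>auto intro!: T.M.finsum_closed\<close>)
  \<comment> \<open>Exchanging the sums brings each relation \<open>r\<close> together in the second
    factor, where it evaluates to 0.\<close>
  also have "\<dots> = finsum Tn (\<lambda>r. finsum Tn (\<lambda>j. tn (Y r) (r j \<odot>\<^bsub>N\<^esub> g j)) {..<n}) R"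
    using Y g R(1) by (intro T.finsum_swap) auto
  also have "\<dots> = finsum Tn (\<lambda>r. \<zero>\<^bsub>Tn\<^esub>) R"
  proof (intro T.M.finsum_cong' refl)
    fix r assume r: "r \<in> R"
    interpret rr: lin N Tn "\<lambda>n. tn (Y r) n" using Y[OF r] by (rule lin_tn_r)
    have "finsum Tn (\<lambda>j. tn (Y r) (r j \<odot>\<^bsub>N\<^esub> g j)) {..<n} = tn (Y r) (comb r)"
      unfolding comb_def using g by (subst rr.finsum) auto
    also have "\<dots> = \<zero>\<^bsub>Tn\<^esub>" using r R(2) rr.zero by (auto simp: K_def)
    finally show "finsum Tn (\<lambda>j. tn (Y r) (r j \<odot>\<^bsub>N\<^esub> g j)) {..<n} = \<zero>\<^bsub>Tn\<^esub>" .
  qed simp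
  finally show ?thesis by (simp add: T.M.finsum_zero)
qed

section \<open>Sums over all orderings\<close>

text \<open>Orderings of an index set replace permutations of positions: a subset of
  \<open>I\<close> then keeps the same family \<open>y\<close>, as a recursion that deletes an index
  requires.\<close>

definition psum :: "('a, 'm) module \<Rightarrow> ('i \<Rightarrow> 'm) \<Rightarrow> 'i set \<Rightarrow> 'm" where
  "psum M y I = finsum M (\<lambda>l. prod_of M (map y l)) (permutations_of_set I)"

context asalg
begin

lemma prod_of_map_closed: "y \<in> I \<rightarrow> carrier M \<Longrightarrow> set l \<subseteq> I \<Longrightarrow> prod_of M (map y l) \<in> carrier M"
  by (intro prod_of_closed) auto

lemma psum_closed: "y \<in> I \<rightarrow> carrier M \<Longrightarrow> psum M y I \<in> carrier M"
  unfolding psum_def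
  by (rule M.finsum_closed, rule funcsetI, rule prod_of_map_closed[of y I]) (simp_all add: permutations_of_setD)

lemma psum_empty [simp]: "psum M y {} = \<one>"
  by (simp add: psum_def)

lemma psum_cong: "(\<And>i. i \<in> I \<Longrightarrow> y i = z i) \<Longrightarrow> z \<in> I \<rightarrow> carrier M \<Longrightarrow> psum M y I = psum M z I"
  unfolding psum_def
  by (intro M.finsum_cong')
    (auto dest!: permutations_of_setD(1) intro!: prod_of_map_closed[of z I] arg_cong[of _ _ "prod_of M"])

text \<open>Orderings are sorted by their first entry. The recursion isolates one left factor in a
  noncommutative product, and the inductions on symmetrized products rest on it.\<close>

lemma psum_rec:
  assumes I: "finite I" "I \<noteq> {}" and y: "y \<in> I \<rightarrow> carrier M"
  shows "psum M y I = (\<Oplus>x\<in>I. y x \<otimes> psum M y (I - {x}))"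
proof -
  let ?f = "\<lambda>l. prod_of M (map y l)"
  have f: "?f l \<in> carrier M" if "set l \<subseteq> I" for l
    using that y by (rule prod_of_map_closed[rotated])
  have "psum M y I = finsum M ?f (\<Union>x\<in>I. (#) x ` permutations_of_set (I - {x}))"
    using I by (simp add: psum_def permutations_of_set_nonempty)
  also have "\<dots> = (\<Oplus>x\<in>I. finsum M ?f ((#) x ` permutations_of_set (I - {x})))"
  proof (rule M.add.finprod_UN_disjoint)
    show "pairwise (\<lambda>i j. disjnt ((#) i ` permutations_of_set (I - {i})) ((#) j ` permutations_of_set (I - {j}))) I"
      by (auto simp: pairwise_def disjnt_def)
    fix i l assume "i \<in> I" "l \<in> (#) i ` permutations_of_set (I - {i})"
    then show "?f l \<in> carrier M" by (intro f) (auto dest: permutations_of_setD)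
  qed (use I in auto)
  also have "\<dots> = (\<Oplus>x\<in>I. y x \<otimes> psum M y (I - {x}))"
  proof (intro M.finsum_cong' refl)
    fix x assume x: "x \<in> I"
    have c: "?f l \<in> carrier M" "?f (x # l) \<in> carrier M" if "l \<in> permutations_of_set (I - {x})" for l
      using that x by (intro f; auto dest: permutations_of_setD)+
    have "finsum M ?f ((#) x ` permutations_of_set (I - {x})) =
      finsum M (\<lambda>l. ?f (x # l)) (permutations_of_set (I - {x}))"
      using c by (intro M.finsum_reindex) auto
    also have "\<dots> = y x \<otimes> psum M y (I - {x})"
      unfolding psum_def using x y c by (subst b_finsum_r) auto
    finally show "finsum M ?f ((#) x ` permutations_of_set (I - {x})) = y x \<otimes> psum M y (I - {x})" .
  qed (use y in \<open>auto intro!: psum_closed\<close>)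
  finally show ?thesis .
qed

lemma psum_reindex:
  assumes "inj_on f I" "y \<in> f ` I \<rightarrow> carrier M"
  shows "psum M (\<lambda>i. y (f i)) I = psum M y (f ` I)"
proof -
  have "psum M y (f ` I) = finsum M (\<lambda>l. prod_of M (map y l)) (map f ` permutations_of_set I)"
    using assms(1) by (simp add: psum_def permutations_of_set_image_inj)
  also have "\<dots> = finsum M (\<lambda>l. prod_of M (map y (map f l))) (permutations_of_set I)"
  proof (rule M.finsum_reindex)
    show "inj_on (map f) (permutations_of_set I)"
      using assms(1) by (intro inj_on_mapI) (rule inj_on_subset, assumption, auto dest: permutations_of_setD)
  qed (use assms(2) in \<open>auto dest!: permutations_of_setD(1) intro!: prod_of_map_closed[of y "f ` I"]\<close>)
  finally show ?thesis by (simp add: psum_def comp_def)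
qed

text \<open>Listing the values of a permutation is a bijection onto the orderings of
  \<open>{..<n}\<close>; this connects the permutation sum of \<open>symmetrized\<close> with
  \<open>psum\<close>.\<close>

lemma psum_permutes:
  assumes "y \<in> {..<n} \<rightarrow> carrier M"
  shows "finsum M (\<lambda>\<sigma>. prod_of M (map (\<lambda>i. y (\<sigma> i)) [0..<n])) {\<sigma>. \<sigma> permutes {..<n}} = psum M y {..<n}"
proof -
  let ?h = "\<lambda>\<sigma>::nat \<Rightarrow> nat. map \<sigma> [0..<n]"
  have inj: "inj_on ?h {\<sigma>. \<sigma> permutes {..<n}}"
  proof (rule inj_onI, rule HOL.ext)
    fix \<sigma> \<tau> i assume *: "\<sigma> \<in> {\<sigma>. \<sigma> permutes {..<n}}" "\<tau> \<in> {\<sigma>. \<sigma> permutes {..<n}}" "?h \<sigma> = ?h \<tau>"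
    then show "\<sigma> i = \<tau> i"
      using permutes_not_in[of \<sigma> "{..<n}" i] permutes_not_in[of \<tau> "{..<n}" i] by (cases "i < n") auto
  qed
  have img: "?h ` {\<sigma>. \<sigma> permutes {..<n}} = permutations_of_set {..<n}"
  proof (intro equalityI subsetI)
    fix l assume "l \<in> ?h ` {\<sigma>. \<sigma> permutes {..<n}}"
    then obtain \<sigma> where s: "\<sigma> permutes {..<n}" "l = ?h \<sigma>" by auto
    have "set [0..<n] = {..<n}" by auto
    then show "l \<in> permutations_of_set {..<n}"
      using s permutes_image[OF s(1)] permutes_inj_on[OF s(1)]
      by (intro permutations_of_setI) (simp_all add: distinct_map)
  next
    fix l assume l: "l \<in> permutations_of_set {..<n}"
    then have len: "length l = n" using length_finite_permutations_of_set by force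
    let ?s = "\<lambda>i. if i < n then l ! i else i"
    have "bij_betw ((!) l) {..<n} {..<n}"
      using l len by (intro bij_betw_nth) (auto dest: permutations_of_setD)
    then have "bij_betw ?s {..<n} {..<n}" by (subst bij_betw_cong[of _ _ "(!) l"]) auto
    then have "?s permutes {..<n}" by (rule bij_imp_permutes) simp
    moreover have "?h ?s = l" using len by (intro nth_equalityI) auto
    ultimately show "l \<in> ?h ` {\<sigma>. \<sigma> permutes {..<n}}" by (intro image_eqI[of _ _ ?s]) simp_all
  qed
  have "psum M y {..<n} = finsum M (\<lambda>l. prod_of M (map y l)) (?h ` {\<sigma>. \<sigma> permutes {..<n}})"
    unfolding psum_def img by simp
  also have "\<dots> = finsum M (\<lambda>\<sigma>. prod_of M (map y (?h \<sigma>))) {\<sigma>. \<sigma> permutes {..<n}}"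
  proof (rule M.finsum_reindex[OF _ inj])
    show "(\<lambda>l. prod_of M (map y l)) \<in> ?h ` {\<sigma>. \<sigma> permutes {..<n}} \<rightarrow> carrier M"
      unfolding img by (rule funcsetI, rule prod_of_map_closed[OF assms]) (simp add: permutations_of_setD)
  qed
  finally show ?thesis by (simp add: comp_def)
qed

text \<open>In the recursion by first index, either \<open>k\<close> comes first, where
  distributivity applies and the tails agree, or \<open>k\<close> lies in the tail, where induction
  applies.\<close>

lemma psum_add:
  assumes "finite I" "k \<in> I" "y \<in> I \<rightarrow> carrier M" "z \<in> I \<rightarrow> carrier M" "w \<in> I \<rightarrow> carrier M"
    and "w k = y k \<oplus> z k" "\<And>i. i \<in> I \<Longrightarrow> i \<noteq> k \<Longrightarrow> y i = w i \<and> z i = w i"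
  shows "psum M w I = psum M y I \<oplus> psum M z I"
  using assms
proof (induction "card I" arbitrary: I rule: less_induct)
  case less
  have step: "w x \<otimes> psum M w (I - {x}) = y x \<otimes> psum M y (I - {x}) \<oplus> z x \<otimes> psum M z (I - {x})"
    if x: "x \<in> I" for x
  proof (cases "x = k")
    case True
    have "psum M y (I - {x}) = psum M w (I - {x})" "psum M z (I - {x}) = psum M w (I - {x})"
      using less.prems True by (auto intro!: psum_cong)
    moreover have "psum M w (I - {x}) \<in> carrier M" using less.prems by (intro psum_closed) auto
    moreover have "y k \<in> carrier M" "z k \<in> carrier M" using less.prems by auto
    ultimately show ?thesis
      using less.prems(6) True by (simp add: b_l_distr)
  next
    case False
    have "psum M w (I - {x}) = psum M y (I - {x}) \<oplus> psum M z (I - {x})"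
      using less.prems False x by (intro less.hyps) (simp_all only: card_Diff1_less, auto)
    moreover have "psum M y (I - {x}) \<in> carrier M" "psum M z (I - {x}) \<in> carrier M"
      using less.prems by (auto intro!: psum_closed)
    moreover have "y x = w x" "z x = w x" "w x \<in> carrier M" using less.prems False x by auto
    ultimately show ?thesis by (simp add: b_r_distr)
  qed
  have c: "(\<lambda>x. v x \<otimes> psum M v (I - {x})) \<in> I \<rightarrow> carrier M" if "v \<in> I \<rightarrow> carrier M" for v
    using that by (auto intro!: b_closed psum_closed)
  have "I \<noteq> {}" using less.prems by auto
  then have "psum M w I = (\<Oplus>x\<in>I. w x \<otimes> psum M w (I - {x}))"
    using less.prems by (intro psum_rec)
  also have "\<dots> = (\<Oplus>x\<in>I. y x \<otimes> psum M y (I - {x}) \<oplus> z x \<otimes> psum M z (I - {x}))"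
    using less.prems c[of y] c[of z] by (intro M.finsum_cong' step refl) (auto simp: Pi_def)
  also have "\<dots> = psum M y I \<oplus> psum M z I"
    using \<open>I \<noteq> {}\<close> less.prems c[of y] c[of z] by (simp add: psum_rec M.finsum_addf)
  finally show ?case .
qed

lemma psum_smult:
  assumes "finite I" "k \<in> I" "y \<in> I \<rightarrow> carrier M" "w \<in> I \<rightarrow> carrier M"
    and "w k = a \<odot> y k" "\<And>i. i \<in> I \<Longrightarrow> i \<noteq> k \<Longrightarrow> y i = w i"
  shows "psum M w I = a \<odot> psum M y I"
  using assms
proof (induction "card I" arbitrary: I rule: less_induct)
  case less
  have step: "w x \<otimes> psum M w (I - {x}) = a \<odot> (y x \<otimes> psum M y (I - {x}))"
    if x: "x \<in> I" for x
  proof (cases "x = k")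
    case True
    have "psum M y (I - {x}) = psum M w (I - {x})"
      using less.prems True by (auto intro!: psum_cong)
    moreover have "psum M w (I - {x}) \<in> carrier M" using less.prems by (intro psum_closed) auto
    moreover have "y k \<in> carrier M" using less.prems by auto
    ultimately show ?thesis
      using less.prems(5) True by (simp add: b_smult_l)
  next
    case False
    have "psum M w (I - {x}) = a \<odot> psum M y (I - {x})"
      using less.prems False x by (intro less.hyps) (simp_all only: card_Diff1_less, auto)
    moreover have "psum M y (I - {x}) \<in> carrier M"
      using less.prems by (auto intro!: psum_closed)
    moreover have "y x = w x" "w x \<in> carrier M" using less.prems False x by auto
    ultimately show ?thesis by (simp add: b_smult_r)
  qed
  have c: "(\<lambda>x. y x \<otimes> psum M y (I - {x})) \<in> I \<rightarrow> carrier M"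
    using less.prems by (auto intro!: b_closed psum_closed)
  have "I \<noteq> {}" using less.prems by auto
  then have "psum M w I = (\<Oplus>x\<in>I. w x \<otimes> psum M w (I - {x}))"
    using less.prems by (intro psum_rec)
  also have "\<dots> = (\<Oplus>x\<in>I. a \<odot> (y x \<otimes> psum M y (I - {x})))"
    using less.prems c by (intro M.finsum_cong' step refl) (auto simp: Pi_def)
  also have "\<dots> = a \<odot> psum M y I"
    using \<open>I \<noteq> {}\<close> less.prems c by (simp add: psum_rec smult_finsum)
  finally show ?case .
qed

end

section \<open>The algebras attached to a symplectic domain\<close>

context symplectic_affine_regular_domain
begin

lemma sc_eq: "sc t a = sc t 1 * a"
  using scale_mult[of t 1 a] by simp

lemma sc_mult_right: "a * sc t b = sc t (a * b)"
  by (metis mult.commute scale_mult)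

text \<open>Characteristic zero enters here: a nonzero \<open>n\<close> is invertible in
  \<open>k\<close>, hence in the algebra. Division by factorials and by p + q rests on this.\<close>

lemma sc_inverse_of_nat: "n \<noteq> 0 \<Longrightarrow> sc (1 / of_nat n) 1 * of_nat n = 1"
proof -
  assume "n \<noteq> 0"
  have "of_nat n = sc (of_nat n) 1"
    by (induction n) (simp_all add: scale_left_distrib)
  then have "sc (1 / of_nat n) 1 * of_nat n = sc (1 / of_nat n) (sc (of_nat n) 1)"
    by (metis sc_eq)
  then show ?thesis using \<open>n \<noteq> 0\<close> by simp
qed

lemma Der_amod: "amod (Der sc)"
  by (rule amodI)
    (auto simp: Der_def fun_eq_iff algebra_simps scale_right_distrib sc_mult_right scale_mult[symmetric])

sublocale Der: amod "Der sc" by (rule Der_amod)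

lemma Der_apply:
  "(X \<oplus>\<^bsub>Der sc\<^esub> Y) b = X b + Y b" "(a \<odot>\<^bsub>Der sc\<^esub> X) b = a * X b" "\<zero>\<^bsub>Der sc\<^esub> b = 0"
  by (simp_all add: Der_def)

lemma Lie_simps [simp]:
  "carrier (Lie_mod sc) = UNIV \<times> carrier (Der sc)" "\<zero>\<^bsub>Lie_mod sc\<^esub> = (0, \<zero>\<^bsub>Der sc\<^esub>)"
  "(a, X) \<oplus>\<^bsub>Lie_mod sc\<^esub> (b, Y) = (a + b, X \<oplus>\<^bsub>Der sc\<^esub> Y)"
  "c \<odot>\<^bsub>Lie_mod sc\<^esub> (a, X) = (c * a, c \<odot>\<^bsub>Der sc\<^esub> X)"
  by (simp_all add: Lie_mod_def)

lemma Lie_amod: "amod (Lie_mod sc)"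
  by (rule amodI)
    (auto simp: Der.M.a_ac Der.smult_add_left Der.smult_add_right Der.smult_mult algebra_simps)

lemma kahler_free_amod: "amod (kahler_free :: ('a, 'a \<Rightarrow>\<^sub>0 'a) module)"
  by (rule free_amod[of _ UNIV]) (auto simp: kahler_free_def)

lemma kahler_free_quot: "free_quot kahler_free UNIV (gen_submod kahler_free (kahler_rel sc))"
proof -
  interpret amod "kahler_free :: ('a, 'a \<Rightarrow>\<^sub>0 'a) module" by (rule kahler_free_amod)
  show ?thesis
    by (rule free_quot.intro) (auto simp: kahler_free_def intro!: gen_submod_submodule[unfolded kahler_free_def])
qed

sublocale Kah: free_quot kahler_free UNIV "gen_submod kahler_free (kahler_rel sc)"
  rewrites "mod_quot kahler_free (gen_submod kahler_free (kahler_rel sc)) = Omega1 sc"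
  by (rule kahler_free_quot) (simp add: Omega1_def)

lemma Omega1_amod: "amod (Omega1 sc)"
  by (rule Kah.Q_amod)

lemma pres_Omega: "pres (Omega1 sc) (ext_rel (Omega1 sc))"
proof -
  interpret Omega1: amod "Omega1 sc" by (rule Omega1_amod)
  show ?thesis
    by unfold_locales (auto simp: ext_rel_def letter_def mult_single Word_plus free_alg_simps)
qed

lemma commutator_closed:
  assumes "set u \<subseteq> G" "set v \<subseteq> G"
  shows "Poly_Mapping.single (Word u) 1 - Poly_Mapping.single (Word v) 1 \<in>
    carrier (free_alg G :: ('a, 'g word \<Rightarrow>\<^sub>0 'a) module)"
  using assms keys_minus_subset[of "Poly_Mapping.single (Word u) (1::'a)" "Poly_Mapping.single (Word v) 1"]
  by (auto simp: free_alg_simps)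

lemma pres_Sym: "pres (Der sc) (sym_rel (Der sc))"
  by unfold_locales (auto simp: sym_rel_def letter_def mult_single Word_plus intro!: commutator_closed)

lemma pres_U: "pres (Lie_mod sc) (U_rel sc br)"
proof -
  interpret L: amod "Lie_mod sc" by (rule Lie_amod)
  show ?thesis
  proof
    show "U_rel sc br \<subseteq> carrier (free_alg (carrier (Lie_mod sc)))"
    proof
      fix f assume "f \<in> U_rel sc br"
      then obtain x y where xy: "x \<in> carrier (Lie_mod sc)" "y \<in> carrier (Lie_mod sc)"
        and f: "f = letter x * letter y - letter y * letter x - letter (lie_bracket sc br x y)"
        unfolding U_rel_def env_rel_def by blast
      have "lie_bracket sc br x y \<in> carrier (Lie_mod sc)" by (simp add: lie_bracket_def)
      then have b: "Poly_Mapping.keys (letter (lie_bracket sc br x y) :: 'a lie word \<Rightarrow>\<^sub>0 'a) \<subseteq> words (carrier (Lie_mod sc))"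
        by (simp add: letter_def del: Lie_simps)
      have c: "Poly_Mapping.keys (letter x * letter y - letter y * letter x :: 'a lie word \<Rightarrow>\<^sub>0 'a) \<subseteq> words (carrier (Lie_mod sc))"
        using commutator_closed[of "[x, y]" "carrier (Lie_mod sc)" "[y, x]"] xy
        by (simp add: letter_def mult_single Word_plus free_alg_simps del: Lie_simps)
      show "f \<in> carrier (free_alg (carrier (Lie_mod sc)))"
        unfolding f free_alg_simps mem_Collect_eq
        by (rule order_trans[OF keys_minus_subset Un_least[OF c b]])
    qed
  qed
qed

sublocale Om: pres "Omega1 sc" "ext_rel (Omega1 sc)"
  rewrites "pres_alg (Omega1 sc) (ext_rel (Omega1 sc)) = Omega sc"
    and "pres_gen (Omega1 sc) (ext_rel (Omega1 sc)) = form1 sc"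
  by (rule pres_Omega) (simp_all add: Omega_def form1_def fun_eq_iff)

sublocale Sy: pres "Der sc" "sym_rel (Der sc)"
  rewrites "pres_alg (Der sc) (sym_rel (Der sc)) = Sym sc"
    and "pres_gen (Der sc) (sym_rel (Der sc)) = Sym_in sc"
  by (rule pres_Sym) (simp_all add: Sym_def Sym_in_def fun_eq_iff)

sublocale En: pres "Lie_mod sc" "U_rel sc br"
  rewrites "pres_alg (Lie_mod sc) (U_rel sc br) = U_alg sc br"
    and "pres_gen (Lie_mod sc) (U_rel sc br) = U_in sc br"
  by (rule pres_U) (simp_all add: U_alg_def U_in_def fun_eq_iff)

lemma graded_Omega: "graded (Omega sc) (OmegaQ sc)"
  by (rule Om.graded_pres) (simp add: OmegaQ_def)

lemma graded_Sym: "graded (Sym sc) (Sym_grade sc)"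
  by (rule Sy.graded_pres) (simp add: Sym_grade_def)

lemma graded_U: "graded (U_alg sc br) (U_grade sc br)"
  by (rule En.graded_pres) (simp add: U_grade_def)

end

lemma (in lin) image_submodule: "submodule (f ` carrier M) base_mod N"
proof (rule N.submoduleI')
  show "\<zero>\<^bsub>N\<^esub> \<in> f ` carrier M" by (rule image_eqI[of _ f "\<zero>\<^bsub>M\<^esub>"]) (simp_all add: zero)
  fix x y a assume "x \<in> f ` carrier M"
  then obtain v where v: "v \<in> carrier M" "x = f v" by blast
  show "a \<odot>\<^bsub>N\<^esub> x \<in> f ` carrier M"
    by (rule image_eqI[of _ _ "a \<odot>\<^bsub>M\<^esub> v"]) (simp_all add: v smult)
  assume "y \<in> f ` carrier M"
  then obtain w where w: "w \<in> carrier M" "y = f w" by blast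
  show "x \<oplus>\<^bsub>N\<^esub> y \<in> f ` carrier M"
    by (rule image_eqI[of _ _ "v \<oplus>\<^bsub>M\<^esub> w"]) (simp_all add: v w add)
qed (use closed in auto)

lemma pow_simps: "x [^]\<^bsub>M\<^esub> (0::nat) = \<one>\<^bsub>M\<^esub>" "x [^]\<^bsub>M\<^esub> Suc n = x [^]\<^bsub>M\<^esub> n \<otimes>\<^bsub>M\<^esub> x"
  by (simp_all add: nat_pow_def)

context symplectic_affine_regular_domain
begin

section \<open>The musical map and the central element of the enveloping algebra\<close>

lemma Der_minus: "Y \<in> carrier (Der sc) \<Longrightarrow> (X \<ominus>\<^bsub>Der sc\<^esub> Y) b = X b - Y b"
  by (simp add: a_minus_def Der.neg_eq_smult Der_apply)

lemma ham_Der: "br b \<in> carrier (Der sc)"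
  using Der.gen_submod_incl[of "range (\<lambda>a b. br a b)"] unfolding symplectic by auto

text \<open>The relations between differentials are respected because
  \<open>b \<mapsto> br b\<close> is itself a \<open>k\<close>-derivation with values in
  \<open>Der sc\<close>: the bracket is additive, \<open>k\<close>-linear and Leibniz in its first
  argument.\<close>

lemma sharp_lin: "lin_map (Omega1 sc) (Der sc) (sharp sc br)"
  and sharp_d: "sharp sc br (Kah.cl (Poly_Mapping.single b 1)) = br b"
proof -
  have g: "(\<lambda>b c. br b c) \<in> UNIV \<rightarrow> carrier (Der sc)" using ham_Der by simp
  interpret e: lin kahler_free "Der sc" "ext (Der sc) (\<lambda>b c. br b c)"
    by unfold_locales
      (simp add: lin_map_def Der.ext_closed[OF _ g] Der.ext_add[OF _ _ g] Der.ext_scal[OF _ g])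
  have "kahler_rel sc \<subseteq> {f \<in> carrier kahler_free. ext (Der sc) (\<lambda>b c. br b c) f = \<zero>\<^bsub>Der sc\<^esub>}"
  proof
    fix r assume r: "r \<in> kahler_rel sc"
    have s: "ext (Der sc) (\<lambda>b c. br b c) (Poly_Mapping.single b a) = a \<odot>\<^bsub>Der sc\<^esub> br b" for a b
      using ham_Der by simp
    have m: "ext (Der sc) (\<lambda>b c. br b c) (f - f') =
      ext (Der sc) (\<lambda>b c. br b c) f \<ominus>\<^bsub>Der sc\<^esub> ext (Der sc) (\<lambda>b c. br b c) f'" for f f'
      using Der.ext_minus[OF _ _ g] by simp
    from r have "ext (Der sc) (\<lambda>b c. br b c) r = \<zero>\<^bsub>Der sc\<^esub>"
      unfolding kahler_rel_def
      by (elim UnE CollectE exE conjE; simp only: m s)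
        (auto simp: fun_eq_iff Der_minus Der_apply ham_Der bracket_add bracket_scale leibniz algebra_simps sc_eq[of _ "br _ _"])
    then show "r \<in> {f \<in> carrier kahler_free. ext (Der sc) (\<lambda>b c. br b c) f = \<zero>\<^bsub>Der sc\<^esub>}"
      by (simp add: kahler_free_def)
  qed
  then have "gen_submod kahler_free (kahler_rel sc) \<subseteq> {f \<in> carrier kahler_free. ext (Der sc) (\<lambda>b c. br b c) f = \<zero>\<^bsub>Der sc\<^esub>}"
    by (rule Kah.F.gen_submod_least[OF e.kernel_submodule])
  then have kill: "ext (Der sc) (\<lambda>b c. br b c) f = \<zero>\<^bsub>Der sc\<^esub>" if "f \<in> gen_submod kahler_free (kahler_rel sc)" for f
    using that by auto
  have sh: "sharp sc br = lin_lift (Der sc) (\<lambda>b c. br b c)" by (simp add: sharp_def fun_eq_iff)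
  show "lin_map (Omega1 sc) (Der sc) (sharp sc br)"
    unfolding sh by (rule Kah.lin_lift_lin[OF Der_amod g kill])
  show "sharp sc br (Kah.cl (Poly_Mapping.single b 1)) = br b"
    unfolding sh using Kah.lin_lift_single[OF Der_amod g kill, of b] by simp
qed

lemma lin_sharp: "lin (Omega1 sc) (Der sc) (sharp sc br)"
  using sharp_lin Omega1_amod Der_amod by (simp add: lin_def lin_axioms_def)

sublocale Sh: lin "Omega1 sc" "Der sc" "sharp sc br" by (rule lin_sharp)

text \<open>The symplectic hypothesis in the form in which it is used: the image is a submodule
  containing every \<open>br a\<close>, so every derivation can be written as the
  \<open>sharp\<close> of a 1-form.\<close>

lemma sharp_surj: "sharp sc br ` carrier (Omega1 sc) = carrier (Der sc)"
proof
  show "sharp sc br ` carrier (Omega1 sc) \<subseteq> carrier (Der sc)" using Sh.closed by auto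
  have "submodule (sharp sc br ` carrier (Omega1 sc)) base_mod (Der sc)" by (rule Sh.image_submodule)
  moreover have "range (\<lambda>a b. br a b) \<subseteq> sharp sc br ` carrier (Omega1 sc)"
  proof
    fix X assume "X \<in> range (\<lambda>a b. br a b)"
    then obtain a where X: "X = br a" by auto
    have "sharp sc br (Kah.cl (Poly_Mapping.single a 1)) \<in> sharp sc br ` carrier (Omega1 sc)"
      by (intro imageI Kah.cl_closed Kah.carrier_rules(6)) simp
    then show "X \<in> sharp sc br ` carrier (Omega1 sc)" by (simp only: sharp_d X)
  qed
  ultimately show "carrier (Der sc) \<subseteq> sharp sc br ` carrier (Omega1 sc)"
    unfolding symplectic by (rule Der.gen_submod_least)
qed

text \<open>\<open>flat\<close> picks some preimage under \<open>sharp\<close>, of which only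
  membership in \<open>Omega1 sc\<close> is known here. Pairing with the zero derivation gives 0 on
  every representative of that class.\<close>

lemma omega_zero:
  assumes "Y \<in> carrier (Der sc)"
  shows "omega sc br \<zero>\<^bsub>Der sc\<^esub> Y = 0"
proof -
  have "flat sc br Y \<in> carrier (Omega1 sc)"
    unfolding flat_def by (rule inv_into_into) (simp add: sharp_surj assms)
  then obtain f where f: "flat sc br Y = Kah.cl f" using Kah.Q_carrier by auto
  have "ext base_mod \<zero>\<^bsub>Der sc\<^esub> g = 0" for g
    using Der.R.finsum_zero[of "Poly_Mapping.keys g"] by (simp add: ext_def Der_apply)
  then have "ext base_mod \<zero>\<^bsub>Der sc\<^esub> ` flat sc br Y = {0}"
    using Kah.cl_self[of f] unfolding f by auto
  then show ?thesis by (simp add: omega_def pairing_def lin_lift_ext)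
qed

abbreviation "hU \<equiv> U_in sc br (1, \<zero>\<^bsub>Der sc\<^esub>)"
abbreviation "yU X \<equiv> U_in sc br (0, X)"

lemma hU_closed [simp]: "hU \<in> carrier (U_alg sc br)"
  by (intro En.gen_closed) simp

lemma yU_rules:
  "X \<in> carrier (Der sc) \<Longrightarrow> Y \<in> carrier (Der sc) \<Longrightarrow> yU (X \<oplus>\<^bsub>Der sc\<^esub> Y) = yU X \<oplus>\<^bsub>U_alg sc br\<^esub> yU Y"
  "X \<in> carrier (Der sc) \<Longrightarrow> yU (a \<odot>\<^bsub>Der sc\<^esub> X) = a \<odot>\<^bsub>U_alg sc br\<^esub> yU X"
  "yU \<zero>\<^bsub>Der sc\<^esub> = \<zero>\<^bsub>U_alg sc br\<^esub>"
  using lin_mapD(2)[OF En.gen_lin, of "(0, X)" "(0, Y)"] lin_mapD(3)[OF En.gen_lin, of "(0, X)" a]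
    lin.zero[OF En.lin_gen] by simp_all

lemma hU_smult: "U_in sc br (a, \<zero>\<^bsub>Der sc\<^esub>) = a \<odot>\<^bsub>U_alg sc br\<^esub> hU"
  using lin_mapD(3)[OF En.gen_lin, of "(1, \<zero>\<^bsub>Der sc\<^esub>)" a] by simp

lemma U_commutator:
  assumes x: "x \<in> carrier (Lie_mod sc)" and y: "y \<in> carrier (Lie_mod sc)"
  shows "U_in sc br x \<otimes>\<^bsub>U_alg sc br\<^esub> U_in sc br y =
    U_in sc br y \<otimes>\<^bsub>U_alg sc br\<^esub> U_in sc br x \<oplus>\<^bsub>U_alg sc br\<^esub> omega sc br (snd x) (snd y) \<odot>\<^bsub>U_alg sc br\<^esub> hU"
proof -
  let ?b = "lie_bracket sc br x y"
  have "letter x * letter y - letter y * letter x - letter ?b \<in> U_rel sc br"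
    unfolding U_rel_def env_rel_def using x y by blast
  then have "letter x * letter y - (letter y * letter x + letter ?b) \<in> pres_ideal (Lie_mod sc) (U_rel sc br)"
    using En.cl_rel[of "letter x * letter y - letter y * letter x - letter ?b"] by (simp add: diff_diff_eq)
  then have "En.cl (letter x * letter y) = En.cl (letter y * letter x + letter ?b)"
    by (simp only: En.cl_eq)
  moreover have "U_in sc br ?b = omega sc br (snd x) (snd y) \<odot>\<^bsub>U_alg sc br\<^esub> hU"
    unfolding lie_bracket_def by (rule hU_smult)
  ultimately show ?thesis
    using En.letter_closed[OF x] En.letter_closed[OF y]
    by (simp only: En.gen_cl En.cl_mult flip: En.P_add)
qed

text \<open>The commutator of \<open>h\<close> with a generator is a multiple of a value of
  \<open>omega\<close> at the zero derivation, hence 0; centrality then spreads from letters to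
  words.\<close>

lemma hU_central:
  assumes "u \<in> carrier (U_alg sc br)"
  shows "hU \<otimes>\<^bsub>U_alg sc br\<^esub> u = u \<otimes>\<^bsub>U_alg sc br\<^esub> hU"
  using assms
proof (induction rule: En.word_induct)
  case (word ws a)
  then have "hU \<otimes>\<^bsub>U_alg sc br\<^esub> En.wd ws = En.wd ws \<otimes>\<^bsub>U_alg sc br\<^esub> hU"
  proof (induction ws)
    case (Cons x ws)
    obtain b X where x: "x = (b, X)" "X \<in> carrier (Der sc)" using Cons.prems by (cases x) auto
    have xL: "x \<in> carrier (Lie_mod sc)" using x by simp
    have c: "hU \<otimes>\<^bsub>U_alg sc br\<^esub> U_in sc br x = U_in sc br x \<otimes>\<^bsub>U_alg sc br\<^esub> hU"
      using U_commutator[of "(1, \<zero>\<^bsub>Der sc\<^esub>)" x] xL En.gen_closed[OF xL] by (simp add: omega_zero x)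
    have cl: "En.wd ws \<in> carrier (U_alg sc br)" "U_in sc br x \<in> carrier (U_alg sc br)"
      using Cons.prems En.gen_closed[OF xL] by simp_all
    have "hU \<otimes>\<^bsub>U_alg sc br\<^esub> (U_in sc br x \<otimes>\<^bsub>U_alg sc br\<^esub> En.wd ws) =
      U_in sc br x \<otimes>\<^bsub>U_alg sc br\<^esub> (hU \<otimes>\<^bsub>U_alg sc br\<^esub> En.wd ws)"
      using cl by (simp add: En.b_assoc[symmetric] c)
    also have "\<dots> = U_in sc br x \<otimes>\<^bsub>U_alg sc br\<^esub> En.wd ws \<otimes>\<^bsub>U_alg sc br\<^esub> hU"
      using Cons cl by (simp add: En.b_assoc)
    finally show ?case using Cons.prems xL by (simp add: En.wd_Cons del: Lie_simps)
  qed (simp add: En.wd_Nil)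
  then show ?case using word by (simp add: En.b_smult_l En.b_smult_r)
qed (simp_all add: En.b_l_distr En.b_r_distr)

sublocale UG: graded "U_alg sc br" "U_grade sc br" by (rule graded_U)
sublocale SG: graded "Sym sc" "Sym_grade sc" by (rule graded_Sym)
sublocale OG: graded "Omega sc" "OmegaQ sc" by (rule graded_Omega)

abbreviation "Udeg \<equiv> (\<lambda>d. if d = 1 then {0} \<times> carrier (Der sc)
  else if d = 2 then UNIV \<times> {\<zero>\<^bsub>Der sc\<^esub>} else {}) :: nat \<Rightarrow> ('a \<times> ('a \<Rightarrow> 'a)) set"

text \<open>This dichotomy governs all arguments by degree: words with a central letter are killed
  by \<open>pi_U\<close>, and they carry a visible factor \<open>h\<close> when an element is
  expanded in powers of \<open>h\<close>.\<close>

lemma U_word_cases: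
  assumes "Word ws \<in> words_of_degree Udeg n"
  obtains Xs where "ws = map (Pair 0) Xs" "set Xs \<subseteq> carrier (Der sc)" "length Xs = n"
    | a u v k where "ws = u @ (a, \<zero>\<^bsub>Der sc\<^esub>) # v" "n = k + 2" "Word (u @ v) \<in> words_of_degree Udeg k"
proof -
  obtain ds where ds: "ws = map snd ds" "\<forall>(d, x) \<in> set ds. x \<in> Udeg d" "sum_list (map fst ds) = n"
    using assms by (auto simp: words_of_degree_def)
  \<comment> \<open>The split is on the degrees attached to the letters and not on the letters: the
    zero letter lies in both \<open>Udeg 1\<close> and \<open>Udeg 2\<close>.\<close>
  show thesis
  proof (cases "\<forall>(d, x) \<in> set ds. d = 1")
    case True
    have "set (map (snd \<circ> snd) ds) \<subseteq> carrier (Der sc)" using True ds(2) by fastforce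
    moreover have "ws = map (Pair 0) (map (snd \<circ> snd) ds)"
      using True ds(2) unfolding ds(1) by (simp add: comp_def) force
    moreover have "map fst ds = replicate (length ds) 1"
      using True by (induction ds) auto
    then have "length (map (snd \<circ> snd) ds) = n"
      using ds(3) by (simp add: sum_list_replicate)
    ultimately show thesis using that(1) by blast
  next
    case False
    then obtain d x where dx: "(d, x) \<in> set ds" "d \<noteq> 1" by auto
    then have x: "d = 2" "snd x = \<zero>\<^bsub>Der sc\<^esub>" using bspec[OF ds(2) dx(1)] by (auto split: if_splits)
    obtain es fs where es: "ds = es @ (d, x) # fs" using dx(1) by (meson split_list)
    show thesis
    proof (rule that(2))
      show "ws = map snd es @ (fst x, \<zero>\<^bsub>Der sc\<^esub>) # map snd fs" using es ds(1) x(2) by (cases x) simp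
      show "n = sum_list (map fst (es @ fs)) + 2" using es ds(3) x(1) by simp
      show "Word (map snd es @ map snd fs) \<in> words_of_degree Udeg (sum_list (map fst (es @ fs)))"
        unfolding words_of_degree_def using ds(2) es
        by (intro CollectI exI[of _ "es @ fs"]) auto
    qed
  qed
qed

lemma yword_grade: "set Xs \<subseteq> carrier (Der sc) \<Longrightarrow> En.wd (map (Pair 0) Xs) \<in> U_grade sc br (length Xs)"
proof -
  assume Xs: "set Xs \<subseteq> carrier (Der sc)"
  have "Word (map (Pair 0) Xs) \<in> words_of_degree Udeg (length Xs)"
    unfolding words_of_degree_def using Xs
    by (intro CollectI exI[of _ "map (\<lambda>X. (1, (0, X))) Xs"]) (auto simp: comp_def sum_list_triv)
  then show ?thesis
    unfolding U_grade_def using Xs by (intro En.wd_grade) auto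
qed

lemma hU_grade: "hU \<in> U_grade sc br 2"
proof -
  have "Word [(1, \<zero>\<^bsub>Der sc\<^esub>)] \<in> words_of_degree Udeg 2"
    unfolding words_of_degree_def by (intro CollectI exI[of _ "[(2, (1, \<zero>\<^bsub>Der sc\<^esub>))]"]) simp
  then have "En.wd [(1, \<zero>\<^bsub>Der sc\<^esub>)] \<in> U_grade sc br 2"
    unfolding U_grade_def by (intro En.wd_grade) auto
  then show ?thesis by (simp add: En.wd_single)
qed

lemma yU_grade: "X \<in> carrier (Der sc) \<Longrightarrow> yU X \<in> U_grade sc br 1"
  using yword_grade[of "[X]"] by (simp add: En.wd_single)

lemma Sym_word_grade: "set Xs \<subseteq> carrier (Der sc) \<Longrightarrow> Sy.wd Xs \<in> Sym_grade sc (length Xs)"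
  unfolding Sym_grade_def by (intro Sy.wd_grade) (auto simp: words_of_degree_one[simplified])

section \<open>Commutative and symmetrized products over finite index sets\<close>

lemma Sym_gen_comm:
  assumes x: "X \<in> carrier (Der sc)" and y: "Y \<in> carrier (Der sc)"
  shows "Sym_in sc X \<otimes>\<^bsub>Sym sc\<^esub> Sym_in sc Y = Sym_in sc Y \<otimes>\<^bsub>Sym sc\<^esub> Sym_in sc X"
proof -
  have "letter X * letter Y - letter Y * letter X \<in> sym_rel (Der sc)"
    unfolding sym_rel_def using x y by blast
  then have "letter X * letter Y - letter Y * letter X \<in> pres_ideal (Der sc) (sym_rel (Der sc))"
    by (intro Sy.cl_rel) blast
  then have "Sy.cl (letter X * letter Y) = Sy.cl (letter Y * letter X)"
    by (simp only: Sy.cl_eq)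
  then show ?thesis
    using Sy.letter_closed[OF x] Sy.letter_closed[OF y] by (simp only: Sy.gen_cl Sy.cl_mult)
qed

lemma Sym_move:
  assumes "X \<in> carrier (Der sc)" "set u \<subseteq> carrier (Der sc)" "set v \<subseteq> carrier (Der sc)"
  shows "Sy.wd (u @ X # v) = Sy.wd (X # u @ v)"
  using assms
proof (induction u)
  case (Cons Y u)
  have "Sy.wd (Y # u @ X # v) = Sym_in sc Y \<otimes>\<^bsub>Sym sc\<^esub> (Sym_in sc X \<otimes>\<^bsub>Sym sc\<^esub> Sy.wd (u @ v))"
    using Cons by (simp add: Sy.wd_Cons)
  also have "\<dots> = Sym_in sc X \<otimes>\<^bsub>Sym sc\<^esub> (Sym_in sc Y \<otimes>\<^bsub>Sym sc\<^esub> Sy.wd (u @ v))"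
    using Cons.prems Sym_gen_comm[of X Y] by (simp add: Sy.b_assoc[symmetric])
  also have "\<dots> = Sy.wd (X # Y # u @ v)" using Cons.prems by (simp add: Sy.wd_Cons)
  finally show ?case by simp
qed simp

lemma Sym_perm:
  assumes "mset Xs = mset Ys" "set Xs \<subseteq> carrier (Der sc)"
  shows "Sy.wd Xs = Sy.wd Ys"
  using assms
proof (induction Xs arbitrary: Ys)
  case (Cons X Xs)
  have "X \<in> set Ys" using Cons.prems(1) by (metis list.set_intros(1) mset_eq_setD)
  then obtain u v where Ys: "Ys = u @ X # v" by (meson split_list)
  have s: "set Ys = set (X # Xs)" using Cons.prems(1) by (metis mset_eq_setD)
  then have uv: "set u \<subseteq> carrier (Der sc)" "set v \<subseteq> carrier (Der sc)" "X \<in> carrier (Der sc)"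
    using Cons.prems(2) unfolding Ys by auto
  have "Sy.wd Xs = Sy.wd (u @ v)" using Cons.prems Ys by (intro Cons.IH) auto
  then show ?case
    using uv Cons.prems(2) by (simp add: Ys Sym_move) (simp add: Sy.wd_Cons)
qed simp

text \<open>Sorting is just one choice of ordering; by \<open>PI_perm\<close> every ordering of
  \<open>I\<close> gives the same element.\<close>

definition PI :: "(nat \<Rightarrow> 'a \<Rightarrow> 'a) \<Rightarrow> nat set \<Rightarrow> 'a sym" where
  "PI Y I = Sy.wd (map Y (sorted_list_of_set I))"

text \<open>The image of \<open>PI Y I\<close> under symmetrization, see \<open>pi_dag_PI\<close>,
  written as a normalized sum over orderings so that \<open>psum_rec\<close> applies.\<close>

definition sI :: "(nat \<Rightarrow> 'a \<Rightarrow> 'a) \<Rightarrow> nat set \<Rightarrow> 'a env" where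
  "sI Y I = sc (1 / fact (card I)) 1 \<odot>\<^bsub>U_alg sc br\<^esub> psum (U_alg sc br) (\<lambda>i. yU (Y i)) I"

lemma PI_perm: "finite I \<Longrightarrow> Y ` I \<subseteq> carrier (Der sc) \<Longrightarrow> l \<in> permutations_of_set I \<Longrightarrow> Sy.wd (map Y l) = PI Y I"
proof -
  assume I: "finite I" "Y ` I \<subseteq> carrier (Der sc)" "l \<in> permutations_of_set I"
  then have "mset l = mset (sorted_list_of_set I)"
    using permutations_of_setD[OF I(3)] by (subst set_eq_iff_mset_eq_distinct[symmetric]) auto
  then show ?thesis
    unfolding PI_def using I permutations_of_setD(1)[OF I(3)] by (intro Sym_perm) auto
qed

lemma PI_insert:
  "finite I \<Longrightarrow> Y ` insert i I \<subseteq> carrier (Der sc) \<Longrightarrow> i \<notin> I \<Longrightarrow>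
    PI Y (insert i I) = Sym_in sc (Y i) \<otimes>\<^bsub>Sym sc\<^esub> PI Y I"
proof -
  assume I: "finite I" "Y ` insert i I \<subseteq> carrier (Der sc)" "i \<notin> I"
  have "PI Y (insert i I) = Sy.wd (map Y (i # sorted_list_of_set I))"
    using I by (intro PI_perm[symmetric]) auto
  also have "\<dots> = Sym_in sc (Y i) \<otimes>\<^bsub>Sym sc\<^esub> PI Y I"
    using I by (simp add: PI_def Sy.wd_Cons)
  finally show ?thesis .
qed

lemma PI_closed [simp]: "finite I \<Longrightarrow> Y ` I \<subseteq> carrier (Der sc) \<Longrightarrow> PI Y I \<in> carrier (Sym sc)"
  by (simp add: PI_def)

lemma PI_grade: "finite I \<Longrightarrow> Y ` I \<subseteq> carrier (Der sc) \<Longrightarrow> PI Y I \<in> Sym_grade sc (card I)"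
  using Sym_word_grade[of "map Y (sorted_list_of_set I)"] by (simp add: PI_def)

lemma yU_fun: "Y ` I \<subseteq> carrier (Der sc) \<Longrightarrow> (\<lambda>i. yU (Y i)) \<in> I \<rightarrow> carrier (U_alg sc br)"
  by auto

lemma prod_yU: "set Xs \<subseteq> carrier (Der sc) \<Longrightarrow> prod_of (U_alg sc br) (map yU Xs) = En.wd (map (Pair 0) Xs)"
  by (subst En.wd_prod_of) (auto simp: comp_def)

lemma prod_yU_fun: "Y ` I \<subseteq> carrier (Der sc) \<Longrightarrow> set l \<subseteq> I \<Longrightarrow>
  prod_of (U_alg sc br) (map (\<lambda>i. yU (Y i)) l) = En.wd (map (Pair 0) (map Y l))"
proof -
  assume "Y ` I \<subseteq> carrier (Der sc)" "set l \<subseteq> I"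
  then have "set (map Y l) \<subseteq> carrier (Der sc)" by auto
  from prod_yU[OF this] show ?thesis by (simp add: comp_def)
qed

lemma sI_grade:
  assumes "finite I" "Y ` I \<subseteq> carrier (Der sc)"
  shows "sI Y I \<in> U_grade sc br (card I)"
proof -
  have "psum (U_alg sc br) (\<lambda>i. yU (Y i)) I \<in> U_grade sc br (card I)"
    unfolding psum_def
  proof (rule En.submodule_finsum[OF UG.G_sub])
    fix l assume l: "l \<in> permutations_of_set I"
    then have "set l = I" "length l = card I"
      by (auto dest: permutations_of_setD simp: length_finite_permutations_of_set)
    then show "prod_of (U_alg sc br) (map (\<lambda>i. yU (Y i)) l) \<in> U_grade sc br (card I)"
      using assms yword_grade[of "map Y l"] by (simp add: prod_yU_fun)
  qed
  then show ?thesis by (simp add: sI_def UG.G_rules(4))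
qed

lemma symmetrized_eq:
  assumes "set Ys \<subseteq> carrier (Der sc)"
  shows "symmetrized sc br Ys = sI (\<lambda>i. Ys ! i) {..<length Ys}"
proof -
  have "(\<lambda>i. yU (Ys ! i)) \<in> {..<length Ys} \<rightarrow> carrier (U_alg sc br)"
    using assms by (intro yU_fun) (auto simp: set_conv_nth)
  from En.psum_permutes[OF this] show ?thesis
    by (simp add: symmetrized_def sI_def)
qed

lemma sI_reindex:
  assumes "inj_on f I" "Y ` f ` I \<subseteq> carrier (Der sc)"
  shows "sI (\<lambda>i. Y (f i)) I = sI Y (f ` I)"
  using En.psum_reindex[OF assms(1) yU_fun[OF assms(2)]] card_image[OF assms(1)] by (simp add: sI_def)

lemma sI_cong:
  assumes "\<And>i. i \<in> I \<Longrightarrow> Y i = Z i" "Z ` I \<subseteq> carrier (Der sc)"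
  shows "sI Y I = sI Z I"
  unfolding sI_def using assms(1)
  by (intro arg_cong2[of _ _ _ _ "smult (U_alg sc br)"] refl En.psum_cong yU_fun[OF assms(2)]) auto

text \<open>The positions of a distinct list are in bijection with its entries, so \<open>sI\<close>
  over positions can be reindexed by the entries themselves.\<close>

lemma symmetrized_map:
  assumes "distinct l" "Y ` set l \<subseteq> carrier (Der sc)"
  shows "symmetrized sc br (map Y l) = sI Y (set l)"
proof -
  have img: "(!) l ` {..<length l} = set l" by (auto simp: set_conv_nth)
  have "symmetrized sc br (map Y l) = sI (\<lambda>i. map Y l ! i) {..<length l}"
    using assms by (subst symmetrized_eq) auto
  also have "\<dots> = sI (\<lambda>i. Y (l ! i)) {..<length l}"
    using assms(2) by (intro sI_cong) auto
  also have "\<dots> = sI Y ((!) l ` {..<length l})"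
    using assms img by (intro sI_reindex) (auto simp: inj_on_nth)
  finally show ?thesis by (simp add: img)
qed

text \<open>The enveloping relations die between any two words: letters commute in the symmetric
  algebra, and a bracket has zero derivation part.\<close>

lemma pi_U_lin: "lin_map (U_alg sc br) (Sym sc) (pi_U sc)"
  and pi_U_word: "set ws \<subseteq> UNIV \<times> carrier (Der sc) \<Longrightarrow> pi_U sc (En.wd ws) = Sy.wd (map snd ws)"
proof -
  let ?L = "UNIV \<times> carrier (Der sc)"
  define g where "g = (\<lambda>w. prod_of (Sym sc) (map (\<lambda>(a :: 'a, X). Sym_in sc X) (letters w)))"
  have snd_sub: "set (map snd ws) \<subseteq> carrier (Der sc)" if "set ws \<subseteq> ?L" for ws :: "('a \<times> ('a \<Rightarrow> 'a)) list"
    using that by auto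
  have gw: "g (Word ws) = Sy.wd (map snd ws)" if "set ws \<subseteq> ?L" for ws
    using Sy.wd_prod_of[OF snd_sub[OF that]] by (simp add: g_def case_prod_unfold comp_def)
  have gc: "g (Word ws) \<in> carrier (Sym sc)" if "set ws \<subseteq> carrier (Lie_mod sc)" for ws
    using that Sy.wd_closed[OF snd_sub[of ws]] by (subst gw) simp_all
  have g_mid: "g (Word (u @ x # v)) = Sy.wd (map snd u) \<otimes>\<^bsub>Sym sc\<^esub> (Sym_in sc (snd x) \<otimes>\<^bsub>Sym sc\<^esub> Sy.wd (map snd v))"
    if "set u \<subseteq> ?L" "set v \<subseteq> ?L" "x \<in> ?L" for u v x
  proof -
    have "g (Word (u @ x # v)) = Sy.wd (map snd u @ snd x # map snd v)"
      using that by (subst gw) auto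
    also have "\<dots> = Sy.wd (map snd u) \<otimes>\<^bsub>Sym sc\<^esub> Sy.wd (snd x # map snd v)"
      using that snd_sub by (intro Sy.wd_append) auto
    also have "Sy.wd (snd x # map snd v) = Sym_in sc (snd x) \<otimes>\<^bsub>Sym sc\<^esub> Sy.wd (map snd v)"
      using that snd_sub by (intro Sy.wd_Cons) auto
    finally show ?thesis .
  qed
  have pi: "pi_U sc = lin_lift (Sym sc) g" by (simp add: pi_U_def g_def fun_eq_iff)
  have *: "lin_map (U_alg sc br) (Sym sc) (lin_lift (Sym sc) g) \<and>
    (\<forall>ws. set ws \<subseteq> carrier (Lie_mod sc) \<longrightarrow> lin_lift (Sym sc) g (En.wd ws) = g (Word ws))"
  proof (rule En.lift_lin[of _ g, OF Sy.amod_axioms gc])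
    fix u v x y a assume uv: "set u \<subseteq> carrier (Lie_mod sc)" "set v \<subseteq> carrier (Lie_mod sc)"
    then have uv': "Sy.wd (map snd u) \<in> carrier (Sym sc)" "Sy.wd (map snd v) \<in> carrier (Sym sc)"
      using snd_sub[of u] snd_sub[of v] by simp_all
    {
      assume x: "x \<in> carrier (Lie_mod sc)"
      then have sx: "snd x \<in> carrier (Der sc)" "snd (a \<odot>\<^bsub>Lie_mod sc\<^esub> x) = a \<odot>\<^bsub>Der sc\<^esub> snd x"
        "a \<odot>\<^bsub>Lie_mod sc\<^esub> x \<in> ?L"
        by (cases x; simp)+
      show "g (Word (u @ (a \<odot>\<^bsub>Lie_mod sc\<^esub> x) # v)) = a \<odot>\<^bsub>Sym sc\<^esub> g (Word (u @ x # v))"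
        using uv uv' x sx by (simp only: g_mid Lie_simps(1))
          (simp add: lin_mapD[OF Sy.gen_lin] Sy.b_smult_l Sy.b_smult_r)
      assume y: "y \<in> carrier (Lie_mod sc)"
      then have sy: "snd y \<in> carrier (Der sc)" "snd (x \<oplus>\<^bsub>Lie_mod sc\<^esub> y) = snd x \<oplus>\<^bsub>Der sc\<^esub> snd y"
        "x \<oplus>\<^bsub>Lie_mod sc\<^esub> y \<in> ?L"
        using x by (cases x; cases y; simp)+
      show "g (Word (u @ (x \<oplus>\<^bsub>Lie_mod sc\<^esub> y) # v)) = g (Word (u @ x # v)) \<oplus>\<^bsub>Sym sc\<^esub> g (Word (u @ y # v))"
        using uv uv' x y sx sy by (simp only: g_mid Lie_simps(1))
          (simp add: lin_mapD[OF Sy.gen_lin] Sy.b_l_distr Sy.b_r_distr)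
    }
    fix r assume r: "r \<in> U_rel sc br"
    then obtain x y where xy: "x \<in> carrier (Lie_mod sc)" "y \<in> carrier (Lie_mod sc)"
      and req: "r = letter x * letter y - letter y * letter x - letter (lie_bracket sc br x y)"
      unfolding U_rel_def env_rel_def by auto
    let ?b = "lie_bracket sc br x y"
    have b: "?b \<in> ?L" "snd ?b = \<zero>\<^bsub>Der sc\<^esub>" by (simp_all add: lie_bracket_def)
    have eq: "Poly_Mapping.single (Word u) 1 * r * Poly_Mapping.single (Word v) 1 =
      Poly_Mapping.single (Word (u @ x # y # v)) 1 - Poly_Mapping.single (Word (u @ y # x # v)) 1
      - Poly_Mapping.single (Word (u @ ?b # v)) 1"
      by (simp add: req letter_def algebra_simps mult_single Word_plus)
    have sx: "snd x \<in> carrier (Der sc)" "snd y \<in> carrier (Der sc)" using xy by auto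
    have c: "set (u @ x # y # v) \<subseteq> carrier (Lie_mod sc)" "set (u @ y # x # v) \<subseteq> carrier (Lie_mod sc)"
      "set (u @ ?b # v) \<subseteq> carrier (Lie_mod sc)"
      using uv xy b(1) by simp_all
    have "g (Word (u @ x # y # v)) = Sy.wd (map snd (u @ x # y # v))" using c by (subst gw) simp_all
    also have "\<dots> = Sy.wd (map snd (u @ y # x # v))" using snd_sub[of "u @ x # y # v"] c(1) by (intro Sym_perm) auto
    also have "\<dots> = g (Word (u @ y # x # v))" using c by (subst gw) simp_all
    finally have 1: "g (Word (u @ x # y # v)) = g (Word (u @ y # x # v))" .
    have 2: "g (Word (u @ ?b # v)) = \<zero>\<^bsub>Sym sc\<^esub>"
      using uv uv' b by (simp only: g_mid Lie_simps(1) lin.zero[OF Sy.lin_gen]) simp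
    show "ext (Sym sc) g (Poly_Mapping.single (Word u) 1 * r * Poly_Mapping.single (Word v) 1) = \<zero>\<^bsub>Sym sc\<^esub>"
      using En.ext_words(2)[of "Sym sc" g, OF Sy.amod_axioms gc c] gc[OF c(2)]
      unfolding eq 1 2 by (simp add: a_minus_def Sy.M.r_neg)
  qed
  show "lin_map (U_alg sc br) (Sym sc) (pi_U sc)" using * by (simp only: pi)
  show "pi_U sc (En.wd ws) = Sy.wd (map snd ws)" if "set ws \<subseteq> ?L"
    using * that gw[OF that] by (simp only: pi Lie_simps(1))
qed

lemma sc_fact: "sc (1 / fact n) 1 * of_nat (fact n) = 1"
  using sc_inverse_of_nat[of "fact n"] by (simp add: of_nat_fact)

lemma nth_img: "(!) Ys ` {..<length Ys} = set Ys"
  by (auto simp: set_conv_nth)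

lemma symmetrized_closed: "set Ys \<subseteq> carrier (Der sc) \<Longrightarrow> symmetrized sc br Ys \<in> carrier (U_alg sc br)"
  using UG.G_carrier[OF sI_grade[of "{..<length Ys}" "\<lambda>i. Ys ! i"]] by (simp add: symmetrized_eq nth_img)

lemma nth_mid: "(u @ x # v) ! i = (if i < length u then u ! i else if i = length u then x else v ! (i - Suc (length u)))"
  by (auto simp: nth_append nth_Cons')

text \<open>Symmetrization descends from words because it is linear in every letter, by
  \<open>psum_add\<close> and \<open>psum_smult\<close>, and unchanged when two adjacent letters are
  exchanged.\<close>

lemma pi_dag_U_lin: "lin_map (Sym sc) (U_alg sc br) (pi_dag_U sc br)"
  and pi_dag_U_word: "set Ys \<subseteq> carrier (Der sc) \<Longrightarrow> pi_dag_U sc br (Sy.wd Ys) = symmetrized sc br Ys"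
proof -
  define g where "g = (\<lambda>w. symmetrized sc br (letters w))"
  have gc: "g (Word Ys) \<in> carrier (U_alg sc br)" if "set Ys \<subseteq> carrier (Der sc)" for Ys
    using that by (simp add: g_def symmetrized_closed)
  have pi: "pi_dag_U sc br = lin_lift (U_alg sc br) g" by (simp add: pi_dag_U_def g_def fun_eq_iff)
  have ps: "psum (U_alg sc br) (\<lambda>i. yU (Ys ! i)) {..<length Ys} \<in> carrier (U_alg sc br)"
    and fn: "(\<lambda>i. yU (Ys ! i)) \<in> {..<length Ys} \<rightarrow> carrier (U_alg sc br)"
    if "set Ys \<subseteq> carrier (Der sc)" for Ys
  proof -
    show *: "(\<lambda>i. yU (Ys ! i)) \<in> {..<length Ys} \<rightarrow> carrier (U_alg sc br)"
      using that by (intro yU_fun) (auto simp: set_conv_nth)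
    show "psum (U_alg sc br) (\<lambda>i. yU (Ys ! i)) {..<length Ys} \<in> carrier (U_alg sc br)"
      by (rule En.psum_closed[OF *])
  qed
  have *: "lin_map (Sym sc) (U_alg sc br) (lin_lift (U_alg sc br) g) \<and>
    (\<forall>ws. set ws \<subseteq> carrier (Der sc) \<longrightarrow> lin_lift (U_alg sc br) g (Sy.wd ws) = g (Word ws))"
  proof (rule Sy.lift_lin[of _ g, OF En.amod_axioms gc])
    fix u v x y a assume uv: "set u \<subseteq> carrier (Der sc)" "set v \<subseteq> carrier (Der sc)"
    let ?n = "Suc (length u + length v)"
    {
      assume x: "x \<in> carrier (Der sc)"
      have s1: "set (u @ x # v) \<subseteq> carrier (Der sc)" "set (u @ (a \<odot>\<^bsub>Der sc\<^esub> x) # v) \<subseteq> carrier (Der sc)"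
        using uv x by auto
      have "psum (U_alg sc br) (\<lambda>i. yU ((u @ (a \<odot>\<^bsub>Der sc\<^esub> x) # v) ! i)) {..<?n} =
        a \<odot>\<^bsub>U_alg sc br\<^esub> psum (U_alg sc br) (\<lambda>i. yU ((u @ x # v) ! i)) {..<?n}"
        using fn[OF s1(1)] fn[OF s1(2)] x
        by (intro En.psum_smult[of _ "length u"]) (simp_all add: nth_mid yU_rules)
      then show "g (Word (u @ (a \<odot>\<^bsub>Der sc\<^esub> x) # v)) = a \<odot>\<^bsub>U_alg sc br\<^esub> g (Word (u @ x # v))"
        using ps[OF s1(1)] s1
        by (simp add: g_def symmetrized_eq sI_def En.smult_mult[symmetric] mult.commute)
      assume y: "y \<in> carrier (Der sc)"
      have s2: "set (u @ y # v) \<subseteq> carrier (Der sc)" "set (u @ (x \<oplus>\<^bsub>Der sc\<^esub> y) # v) \<subseteq> carrier (Der sc)"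
        using uv x y by auto
      have "psum (U_alg sc br) (\<lambda>i. yU ((u @ (x \<oplus>\<^bsub>Der sc\<^esub> y) # v) ! i)) {..<?n} =
        psum (U_alg sc br) (\<lambda>i. yU ((u @ x # v) ! i)) {..<?n} \<oplus>\<^bsub>U_alg sc br\<^esub>
        psum (U_alg sc br) (\<lambda>i. yU ((u @ y # v) ! i)) {..<?n}"
        using fn[OF s1(1)] fn[OF s2(1)] fn[OF s2(2)] x y
        by (intro En.psum_add[of _ "length u"]) (simp_all add: nth_mid yU_rules)
      then show "g (Word (u @ (x \<oplus>\<^bsub>Der sc\<^esub> y) # v)) = g (Word (u @ x # v)) \<oplus>\<^bsub>U_alg sc br\<^esub> g (Word (u @ y # v))"
        using ps[OF s1(1)] ps[OF s2(1)] s1 s2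
        by (simp add: g_def symmetrized_eq sI_def En.smult_add_right)
    }
    fix r assume "r \<in> sym_rel (Der sc)"
    then obtain x y where xy: "x \<in> carrier (Der sc)" "y \<in> carrier (Der sc)"
      and req: "r = letter x * letter y - letter y * letter x"
      unfolding sym_rel_def by auto
    have eq: "Poly_Mapping.single (Word u) 1 * r * Poly_Mapping.single (Word v) 1 =
      Poly_Mapping.single (Word (u @ x # y # v)) 1 - Poly_Mapping.single (Word (u @ y # x # v)) 1"
      by (simp add: req letter_def algebra_simps mult_single Word_plus)
    have c: "set (u @ x # y # v) \<subseteq> carrier (Der sc)" "set (u @ y # x # v) \<subseteq> carrier (Der sc)"
      using uv xy by simp_all
    let ?m = "Suc (Suc (length u + length v))"
    \<comment> \<open>The transposition of the two adjacent positions; reindexing by it turns one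
      word into the other.\<close>
    let ?t = "\<lambda>i. if i = length u then Suc (length u) else if i = Suc (length u) then length u else i"
    have inj: "inj_on ?t {..<?m}" by (auto simp: inj_on_def)
    have img: "?t ` {..<?m} = {..<?m}"
      by (rule endo_inj_surj[OF _ _ inj]) auto
    have nth: "(u @ y # x # v) ! i = (u @ x # y # v) ! ?t i" for i
      by (auto simp: nth_append nth_Cons')
    have "sI (\<lambda>i. (u @ y # x # v) ! i) {..<?m} = sI (\<lambda>i. (u @ x # y # v) ! ?t i) {..<?m}"
      by (simp only: nth)
    also have "\<dots> = sI (\<lambda>i. (u @ x # y # v) ! i) (?t ` {..<?m})"
      using c(1) nth_img[of "u @ x # y # v"] by (intro sI_reindex inj) (simp only: img, simp)
    finally have "g (Word (u @ x # y # v)) = g (Word (u @ y # x # v))"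
      unfolding img using c by (simp add: g_def symmetrized_eq)
    then show "ext (U_alg sc br) g (Poly_Mapping.single (Word u) 1 * r * Poly_Mapping.single (Word v) 1) = \<zero>\<^bsub>U_alg sc br\<^esub>"
      using Sy.ext_words(1)[of "U_alg sc br" g, OF En.amod_axioms gc c] gc[OF c(2)]
      unfolding eq by (simp add: a_minus_def En.M.r_neg)
  qed
  show "lin_map (Sym sc) (U_alg sc br) (pi_dag_U sc br)" using * by (simp only: pi)
  show "pi_dag_U sc br (Sy.wd Ys) = symmetrized sc br Ys" if "set Ys \<subseteq> carrier (Der sc)"
    using * that by (simp add: pi g_def)
qed

lemma pi_dag_PI:
  assumes "finite I" "Y ` I \<subseteq> carrier (Der sc)"
  shows "pi_dag_U sc br (PI Y I) = sI Y I"
  unfolding PI_def using assms by (subst pi_dag_U_word) (auto simp: symmetrized_map)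

lemma lin_pi_U: "lin (U_alg sc br) (Sym sc) (pi_U sc)"
  using pi_U_lin En.amod_axioms Sy.amod_axioms by (simp add: lin_def lin_axioms_def)

lemma lin_pi_dag_U: "lin (Sym sc) (U_alg sc br) (pi_dag_U sc br)"
  using pi_dag_U_lin En.amod_axioms Sy.amod_axioms by (simp add: lin_def lin_axioms_def)

sublocale PU: lin "U_alg sc br" "Sym sc" "pi_U sc" by (rule lin_pi_U)
sublocale PD: lin "Sym sc" "U_alg sc br" "pi_dag_U sc br" by (rule lin_pi_dag_U)

text \<open>Once \<open>h\<close> is killed, all orderings give the same commutative product, and
  the normalizing factor cancels their number.\<close>

lemma pi_sI:
  assumes "finite I" "Y ` I \<subseteq> carrier (Der sc)"
  shows "pi_U sc (sI Y I) = PI Y I"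
proof -
  have word: "pi_U sc (prod_of (U_alg sc br) (map (\<lambda>i. yU (Y i)) l)) = PI Y I"
    and closed: "prod_of (U_alg sc br) (map (\<lambda>i. yU (Y i)) l) \<in> carrier (U_alg sc br)"
    if l: "l \<in> permutations_of_set I" for l
  proof -
    have s: "set l = I" "set (map Y l) \<subseteq> carrier (Der sc)"
      using l assms permutations_of_setD(1)[OF l] by auto
    then have eq: "prod_of (U_alg sc br) (map (\<lambda>i. yU (Y i)) l) = En.wd (map (Pair 0) (map Y l))"
      using assms by (intro prod_yU_fun) auto
    show "prod_of (U_alg sc br) (map (\<lambda>i. yU (Y i)) l) \<in> carrier (U_alg sc br)"
      using s unfolding eq by (intro En.wd_closed) auto
    show "pi_U sc (prod_of (U_alg sc br) (map (\<lambda>i. yU (Y i)) l)) = PI Y I"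
      using s assms PI_perm[OF assms l] unfolding eq by (subst pi_U_word) (auto simp: comp_def)
  qed
  have "pi_U sc (psum (U_alg sc br) (\<lambda>i. yU (Y i)) I) = finsum (Sym sc) (\<lambda>_. PI Y I) (permutations_of_set I)"
  proof -
    have "pi_U sc (psum (U_alg sc br) (\<lambda>i. yU (Y i)) I) =
      finsum (Sym sc) (\<lambda>l. pi_U sc (prod_of (U_alg sc br) (map (\<lambda>i. yU (Y i)) l))) (permutations_of_set I)"
      unfolding psum_def using closed by (intro PU.finsum) auto
    also have "\<dots> = finsum (Sym sc) (\<lambda>_. PI Y I) (permutations_of_set I)"
      using assms by (intro Sy.M.finsum_cong') (auto simp: word)
    finally show ?thesis .
  qed
  also have "\<dots> = of_nat (fact (card I)) \<odot>\<^bsub>Sym sc\<^esub> PI Y I"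
    using assms by (simp add: Sy.finsum_of_nat)
  finally show ?thesis
    using assms En.psum_closed[OF yU_fun[OF assms(2)]]
    by (simp add: sI_def PU.smult Sy.smult_mult[symmetric] sc_fact del: of_nat_fact)
qed

text \<open>On words this is \<open>pi_sI\<close>. It lets \<open>pi_map\<close> recover the
  symmetric tensor behind an element of \<open>S_dag_grade\<close>.\<close>

lemma pi_pi_dag:
  assumes "s \<in> carrier (Sym sc)"
  shows "pi_U sc (pi_dag_U sc br s) = s"
  using assms
proof (induction rule: Sy.word_induct)
  case (word ws a)
  have ws: "(\<lambda>i. ws ! i) ` {..<length ws} \<subseteq> carrier (Der sc)" using word by (auto simp: set_conv_nth)
  have "Sy.wd ws = PI (\<lambda>i. ws ! i) {..<length ws}"
    by (simp add: PI_def atLeast0LessThan[symmetric] map_nth del: atLeast0LessThan)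
  then have "pi_U sc (pi_dag_U sc br (Sy.wd ws)) = Sy.wd ws"
    using ws by (simp add: pi_dag_PI pi_sI)
  then show ?case using word by (simp add: PD.smult PU.smult PD.closed)
qed (simp_all add: PD.zero PU.zero PD.add PU.add PD.closed)

text \<open>Words containing a central letter are sent to 0 and the others keep their length, so the
  weighted degree becomes the ordinary one.\<close>

lemma pi_U_grade:
  assumes "u \<in> U_grade sc br p"
  shows "pi_U sc u \<in> Sym_grade sc p"
  using assms unfolding U_grade_def
proof (induction rule: En.grade_induct)
  case zero
  then show ?case by (simp add: PU.zero SG.G_rules(2))
next
  case (add x y)
  then have "x \<in> carrier (U_alg sc br)" "y \<in> carrier (U_alg sc br)" using En.grade_rules(1) by blast+
  then show ?case using add by (simp add: PU.add SG.G_rules(3))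
next
  case (word ws a)
  have ws: "set ws \<subseteq> UNIV \<times> carrier (Der sc)" using word by simp
  from word(2) have "Sy.wd (map snd ws) \<in> Sym_grade sc p"
  proof (cases rule: U_word_cases)
    case (1 Xs)
    then show ?thesis using Sym_word_grade[of Xs] by (simp add: comp_def)
  next
    case (2 b u v k)
    have uv: "set (map snd u) \<subseteq> carrier (Der sc)" "set (map snd v) \<subseteq> carrier (Der sc)" using ws 2 by auto
    have "Sy.wd (map snd u @ \<zero>\<^bsub>Der sc\<^esub> # map snd v) = \<zero>\<^bsub>Sym sc\<^esub>"
      using Sy.wd_closed[OF uv(1)] Sy.wd_closed[OF uv(2)] lin.zero[OF Sy.lin_gen]
      by (subst Sy.wd_append[OF uv(1)]) (use uv(2) in \<open>simp_all add: Sy.wd_Cons\<close>)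
    then show ?thesis by (simp add: 2 SG.G_rules(2))
  qed
  then show ?case using ws word by (simp add: PU.smult pi_U_word SG.G_rules(4))
qed

lemma pi_dag_grade:
  assumes "s \<in> Sym_grade sc p"
  shows "pi_dag_U sc br s \<in> U_grade sc br p"
  using assms unfolding Sym_grade_def
proof (induction rule: Sy.grade_induct)
  case zero
  then show ?case by (simp add: PD.zero UG.G_rules(2))
next
  case (add x y)
  then have "x \<in> carrier (Sym sc)" "y \<in> carrier (Sym sc)" using Sy.grade_rules(1) by blast+
  then show ?case using add by (simp add: PD.add UG.G_rules(3))
next
  case (word ws a)
  then have "length ws = p" by (auto simp: words_of_degree_one[simplified])
  then have "symmetrized sc br ws \<in> U_grade sc br p"
    using sI_grade[of "{..<length ws}" "\<lambda>i. ws ! i"] word by (subst symmetrized_eq) (auto simp: set_conv_nth)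
  then show ?case using word by (simp add: PD.smult pi_dag_U_word UG.G_rules(4))
qed

lemma Sym_grade_induct [consumes 1, case_names zero add PI]:
  assumes "s \<in> Sym_grade sc p" "P \<zero>\<^bsub>Sym sc\<^esub>"
    and add: "\<And>x y. x \<in> Sym_grade sc p \<Longrightarrow> y \<in> Sym_grade sc p \<Longrightarrow> P x \<Longrightarrow> P y \<Longrightarrow> P (x \<oplus>\<^bsub>Sym sc\<^esub> y)"
    and PI: "\<And>Y a. Y ` {..<p} \<subseteq> carrier (Der sc) \<Longrightarrow> P (a \<odot>\<^bsub>Sym sc\<^esub> PI Y {..<p})"
  shows "P s"
  using assms(1,2) add unfolding Sym_grade_def
proof (induction rule: Sy.grade_induct)
  case (word ws a)
  then have ws: "length ws = p" "(\<lambda>i. ws ! i) ` {..<p} \<subseteq> carrier (Der sc)"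
    by (auto simp: words_of_degree_one[simplified] set_conv_nth)
  have "Sy.wd ws = PI (\<lambda>i. ws ! i) {..<p}"
    by (simp add: PI_def ws(1)[symmetric] atLeast0LessThan[symmetric] map_nth del: atLeast0LessThan)
  then show ?case using PI[OF ws(2), of a] by simp
qed auto

lemma PI_empty: "PI Y {} = \<one>\<^bsub>Sym sc\<^esub>"
  by (simp add: PI_def Sy.wd_Nil)

lemma sI_empty: "sI Y {} = \<one>\<^bsub>U_alg sc br\<^esub>"
  using sc_fact[of 0] by (simp add: sI_def sc_eq[symmetric])

text \<open>Reordering a product of \<open>n\<close> derivations changes it by an element of \<open>h U\<^sub>n\<^sub>-\<^sub>2\<close>, so every element of
  \<open>U\<^sub>n\<close> is a sum of products \<open>h\<^sup>m s\<^sub>m\<close> by induction on \<open>n\<close>. Directness of this sum is never needed.\<close>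

definition hU_part :: "nat \<Rightarrow> 'a env set" where
  "hU_part n = (if n < 2 then {\<zero>\<^bsub>U_alg sc br\<^esub>} else (\<lambda>u. hU \<otimes>\<^bsub>U_alg sc br\<^esub> u) ` U_grade sc br (n - 2))"

lemma hU_part_sub: "submodule (hU_part n) base_mod (U_alg sc br)"
proof (cases "n < 2")
  case True
  then show ?thesis by (intro En.submoduleI') (auto simp: hU_part_def)
next
  case False
  let ?H = "(\<lambda>u. hU \<otimes>\<^bsub>U_alg sc br\<^esub> u) ` U_grade sc br (n - 2)"
  have "submodule ?H base_mod (U_alg sc br)"
  proof (rule En.submoduleI')
    show "\<zero>\<^bsub>U_alg sc br\<^esub> \<in> ?H"
      by (rule image_eqI[of _ _ "\<zero>\<^bsub>U_alg sc br\<^esub>"]) (simp_all add: UG.G_rules(2))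
    fix x y a assume "x \<in> ?H"
    then obtain u where u: "u \<in> U_grade sc br (n - 2)" "x = hU \<otimes>\<^bsub>U_alg sc br\<^esub> u" by blast
    show "a \<odot>\<^bsub>U_alg sc br\<^esub> x \<in> ?H"
      using UG.G_carrier[OF u(1)] UG.G_rules(4)[OF u(1)]
      by (intro image_eqI[of _ _ "a \<odot>\<^bsub>U_alg sc br\<^esub> u"]) (simp_all add: u(2) En.b_smult_r)
    assume "y \<in> ?H"
    then obtain v where v: "v \<in> U_grade sc br (n - 2)" "y = hU \<otimes>\<^bsub>U_alg sc br\<^esub> v" by blast
    show "x \<oplus>\<^bsub>U_alg sc br\<^esub> y \<in> ?H"
      using UG.G_carrier[OF u(1)] UG.G_carrier[OF v(1)] UG.G_rules(3)[OF u(1) v(1)]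
      by (intro image_eqI[of _ _ "u \<oplus>\<^bsub>U_alg sc br\<^esub> v"]) (simp_all add: u(2) v(2) En.b_r_distr)
  qed (auto dest: UG.G_carrier)
  with False show ?thesis by (simp add: hU_part_def)
qed

lemmas hU_part_rules = En.submoduleD[OF hU_part_sub]

text \<open>The central factor \<open>h\<close> passes the new letter, so the errors made in
  reordering a word survive multiplication by further letters.\<close>

lemma hU_part_mult:
  assumes "X \<in> carrier (Der sc)" "x \<in> hU_part n"
  shows "yU X \<otimes>\<^bsub>U_alg sc br\<^esub> x \<in> hU_part (Suc n)"
proof (cases "n < 2")
  case True
  then show ?thesis using assms hU_part_rules(2) by (simp add: hU_part_def[of n])
next
  case False
  then obtain u where u: "u \<in> U_grade sc br (n - 2)" "x = hU \<otimes>\<^bsub>U_alg sc br\<^esub> u"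
    using assms by (auto simp: hU_part_def)
  have uc: "u \<in> carrier (U_alg sc br)" using u UG.G_carrier by blast
  have "yU X \<otimes>\<^bsub>U_alg sc br\<^esub> x = hU \<otimes>\<^bsub>U_alg sc br\<^esub> (yU X \<otimes>\<^bsub>U_alg sc br\<^esub> u)"
    using uc assms hU_central[of "yU X"] by (simp add: u(2) En.b_assoc[symmetric])
  moreover have "yU X \<otimes>\<^bsub>U_alg sc br\<^esub> u \<in> U_grade sc br (Suc n - 2)"
    using UG.G_mult[OF yU_grade[OF assms(1)] u(1)] False by (simp add: Suc_diff_le numeral_2_eq_2 Suc_diff_Suc)
  ultimately show ?thesis using False by (auto simp: hU_part_def)
qed

abbreviation "yw Xs \<equiv> En.wd (map (Pair 0) Xs)"

lemma yw_closed [simp]: "set Xs \<subseteq> carrier (Der sc) \<Longrightarrow> yw Xs \<in> carrier (U_alg sc br)"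
  by (intro En.wd_closed) auto

lemma yw_Cons: "X \<in> carrier (Der sc) \<Longrightarrow> set Xs \<subseteq> carrier (Der sc) \<Longrightarrow> yw (X # Xs) = yU X \<otimes>\<^bsub>U_alg sc br\<^esub> yw Xs"
proof -
  assume X: "X \<in> carrier (Der sc)" "set Xs \<subseteq> carrier (Der sc)"
  then have "(0, X) \<in> carrier (Lie_mod sc)" "set (map (Pair 0) Xs) \<subseteq> carrier (Lie_mod sc)" by auto
  from En.wd_Cons[OF this] show ?thesis by simp
qed

text \<open>Each exchange of \<open>X\<close> with a letter \<open>Y\<close> of \<open>u\<close>
  costs \<open>omega sc br Y X\<close> times \<open>h\<close> times a word from which both letters
  are gone, that is, an element of \<open>h\<close> times degree two less.\<close>

lemma yw_move:
  assumes "X \<in> carrier (Der sc)" "set u \<subseteq> carrier (Der sc)" "set v \<subseteq> carrier (Der sc)"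
  shows "\<exists>n \<in> hU_part (Suc (length u + length v)). yw (u @ X # v) = yw (X # u @ v) \<oplus>\<^bsub>U_alg sc br\<^esub> n"
  using assms
proof (induction u)
  case Nil
  then have "yw (X # v) \<in> carrier (U_alg sc br)" by (intro yw_closed) simp
  then show ?case using hU_part_rules(2) by (intro bexI[of _ "\<zero>\<^bsub>U_alg sc br\<^esub>"]) simp_all
next
  case (Cons Y u)
  obtain n where n: "n \<in> hU_part (Suc (length u + length v))" "yw (u @ X # v) = yw (X # u @ v) \<oplus>\<^bsub>U_alg sc br\<^esub> n"
    using Cons by auto
  let ?w = "yw (u @ v)" and ?o = "omega sc br Y X"
  have c: "?w \<in> carrier (U_alg sc br)" "n \<in> carrier (U_alg sc br)" "yU X \<in> carrier (U_alg sc br)" "yU Y \<in> carrier (U_alg sc br)"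
    using Cons.prems n(1) hU_part_rules(1) yw_closed[of "u @ v"] by auto
  have com: "yU Y \<otimes>\<^bsub>U_alg sc br\<^esub> yU X = yU X \<otimes>\<^bsub>U_alg sc br\<^esub> yU Y \<oplus>\<^bsub>U_alg sc br\<^esub> ?o \<odot>\<^bsub>U_alg sc br\<^esub> hU"
    using U_commutator[of "(0, Y)" "(0, X)"] Cons.prems by simp
  have "yw (Y # u @ X # v) = yU Y \<otimes>\<^bsub>U_alg sc br\<^esub> (yU X \<otimes>\<^bsub>U_alg sc br\<^esub> ?w) \<oplus>\<^bsub>U_alg sc br\<^esub> yU Y \<otimes>\<^bsub>U_alg sc br\<^esub> n"
    using Cons.prems n(2) c yw_Cons[of Y "u @ X # v"] yw_Cons[of X "u @ v"] by (simp add: En.b_r_distr)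
  also have "yU Y \<otimes>\<^bsub>U_alg sc br\<^esub> (yU X \<otimes>\<^bsub>U_alg sc br\<^esub> ?w) =
    yU X \<otimes>\<^bsub>U_alg sc br\<^esub> (yU Y \<otimes>\<^bsub>U_alg sc br\<^esub> ?w) \<oplus>\<^bsub>U_alg sc br\<^esub> ?o \<odot>\<^bsub>U_alg sc br\<^esub> (hU \<otimes>\<^bsub>U_alg sc br\<^esub> ?w)"
    using c by (simp add: En.b_assoc[symmetric] com En.b_l_distr En.b_smult_l)
  also have "yU X \<otimes>\<^bsub>U_alg sc br\<^esub> (yU Y \<otimes>\<^bsub>U_alg sc br\<^esub> ?w) = yw (X # (Y # u) @ v)"
    using Cons.prems yw_Cons[of X "Y # u @ v"] yw_Cons[of Y "u @ v"] by simp
  finally have eq: "yw ((Y # u) @ X # v) = yw (X # (Y # u) @ v) \<oplus>\<^bsub>U_alg sc br\<^esub>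
    (?o \<odot>\<^bsub>U_alg sc br\<^esub> (hU \<otimes>\<^bsub>U_alg sc br\<^esub> ?w) \<oplus>\<^bsub>U_alg sc br\<^esub> yU Y \<otimes>\<^bsub>U_alg sc br\<^esub> n)"
    using Cons.prems c yw_closed[of "X # Y # u @ v"] by (simp add: En.M.a_assoc)
  have "hU \<otimes>\<^bsub>U_alg sc br\<^esub> ?w \<in> hU_part (Suc (length (Y # u) + length v))"
    using yword_grade[of "u @ v"] Cons.prems by (auto simp: hU_part_def)
  moreover have "yU Y \<otimes>\<^bsub>U_alg sc br\<^esub> n \<in> hU_part (Suc (length (Y # u) + length v))"
    using hU_part_mult[OF _ n(1), of Y] Cons.prems by simp
  ultimately have "?o \<odot>\<^bsub>U_alg sc br\<^esub> (hU \<otimes>\<^bsub>U_alg sc br\<^esub> ?w) \<oplus>\<^bsub>U_alg sc br\<^esub> yU Y \<otimes>\<^bsub>U_alg sc br\<^esub> n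
    \<in> hU_part (Suc (length (Y # u) + length v))"
    by (intro hU_part_rules(3,4))
  with eq show ?case by blast
qed

lemma yw_perm:
  assumes "mset Xs = mset Ys" "set Xs \<subseteq> carrier (Der sc)"
  shows "\<exists>n \<in> hU_part (length Xs). yw Ys = yw Xs \<oplus>\<^bsub>U_alg sc br\<^esub> n"
  using assms
proof (induction Xs arbitrary: Ys)
  case Nil
  then show ?case using hU_part_rules(2) by (intro bexI[of _ "\<zero>\<^bsub>U_alg sc br\<^esub>"]) (simp_all add: En.wd_Nil)
next
  case (Cons X Xs)
  have "X \<in> set Ys" using Cons.prems(1) by (metis list.set_intros(1) mset_eq_setD)
  then obtain u v where Ys: "Ys = u @ X # v" by (meson split_list)
  have s: "set Ys = set (X # Xs)" using Cons.prems(1) by (metis mset_eq_setD)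
  then have uv: "set u \<subseteq> carrier (Der sc)" "set v \<subseteq> carrier (Der sc)" "X \<in> carrier (Der sc)"
    using Cons.prems(2) unfolding Ys by auto
  have "mset Xs = mset (u @ v)" using Cons.prems(1) by (simp add: Ys)
  then have len: "length u + length v = length Xs" by (metis length_append size_mset)
  obtain n where n: "n \<in> hU_part (length Xs)" "yw (u @ v) = yw Xs \<oplus>\<^bsub>U_alg sc br\<^esub> n"
    using Cons.IH[of "u @ v"] Cons.prems \<open>mset Xs = mset (u @ v)\<close> by auto
  obtain m where m: "m \<in> hU_part (Suc (length Xs))" "yw Ys = yw (X # u @ v) \<oplus>\<^bsub>U_alg sc br\<^esub> m"
    using yw_move[OF uv(3,1,2)] by (auto simp: Ys len)
  have c: "yw Xs \<in> carrier (U_alg sc br)" "n \<in> carrier (U_alg sc br)" "m \<in> carrier (U_alg sc br)" "yU X \<in> carrier (U_alg sc br)"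
    using Cons.prems n(1) m(1) hU_part_rules(1) by auto
  have "yw Ys = yw (X # Xs) \<oplus>\<^bsub>U_alg sc br\<^esub> (yU X \<otimes>\<^bsub>U_alg sc br\<^esub> n \<oplus>\<^bsub>U_alg sc br\<^esub> m)"
    using uv Cons.prems(2) c m(2) n(2) yw_Cons[of X "u @ v"] yw_Cons[of X Xs]
    by (simp add: En.b_r_distr En.M.a_assoc)
  moreover have "yU X \<otimes>\<^bsub>U_alg sc br\<^esub> n \<oplus>\<^bsub>U_alg sc br\<^esub> m \<in> hU_part (length (X # Xs))"
    using hU_part_mult[OF uv(3) n(1)] m(1) by (simp add: hU_part_rules(3))
  ultimately show ?case by blast
qed

text \<open>A symmetrized product is an average of reorderings, each of which agrees with the given
  word modulo the submodule \<open>hU_part\<close>; so the average agrees with it too.\<close>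

lemma yw_symmetrized:
  assumes "set Xs \<subseteq> carrier (Der sc)"
  shows "\<exists>n \<in> hU_part (length Xs). symmetrized sc br Xs = yw Xs \<oplus>\<^bsub>U_alg sc br\<^esub> n"
proof -
  let ?p = "length Xs" and ?S = "permutations_of_set {..<length Xs}"
  have ex: "\<exists>n \<in> hU_part ?p. yw (map ((!) Xs) l) = yw Xs \<oplus>\<^bsub>U_alg sc br\<^esub> n" if l: "l \<in> ?S" for l
  proof -
    have "mset l = mset [0..<?p]"
      using permutations_of_setD[OF l] by (subst set_eq_iff_mset_eq_distinct[symmetric]) (auto simp: atLeast0LessThan)
    then have "mset (map ((!) Xs) l) = mset (map ((!) Xs) [0..<?p])" by (simp only: mset_map)
    then have "mset Xs = mset (map ((!) Xs) l)" by (simp only: map_nth)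
    then show ?thesis using assms by (rule yw_perm)
  qed
  then obtain n where n: "\<And>l. l \<in> ?S \<Longrightarrow> n l \<in> hU_part ?p"
    "\<And>l. l \<in> ?S \<Longrightarrow> yw (map ((!) Xs) l) = yw Xs \<oplus>\<^bsub>U_alg sc br\<^esub> n l" by metis
  have nc: "n l \<in> carrier (U_alg sc br)" if "l \<in> ?S" for l using n(1)[OF that] hU_part_rules(1) by blast
  have Xc: "(!) Xs ` {..<?p} \<subseteq> carrier (Der sc)" using assms by (auto simp: set_conv_nth)
  have "psum (U_alg sc br) (\<lambda>i. yU (Xs ! i)) {..<?p} =
    finsum (U_alg sc br) (\<lambda>l. yw Xs \<oplus>\<^bsub>U_alg sc br\<^esub> n l) ?S"
    unfolding psum_def
  proof (rule En.M.finsum_cong')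
    fix l assume l: "l \<in> ?S"
    then show "prod_of (U_alg sc br) (map (\<lambda>i. yU (Xs ! i)) l) = yw Xs \<oplus>\<^bsub>U_alg sc br\<^esub> n l"
      using prod_yU_fun[OF Xc, of l] permutations_of_setD(1)[OF l] n(2)[OF l] by simp
  qed (use nc assms in auto)
  also have "\<dots> = finsum (U_alg sc br) (\<lambda>l. yw Xs) ?S \<oplus>\<^bsub>U_alg sc br\<^esub> finsum (U_alg sc br) n ?S"
    using nc assms by (intro En.M.finsum_addf) auto
  also have "finsum (U_alg sc br) (\<lambda>l. yw Xs) ?S = of_nat (fact ?p) \<odot>\<^bsub>U_alg sc br\<^esub> yw Xs"
    using assms by (simp add: En.finsum_of_nat)
  finally have ps: "psum (U_alg sc br) (\<lambda>i. yU (Xs ! i)) {..<?p} =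
    of_nat (fact ?p) \<odot>\<^bsub>U_alg sc br\<^esub> yw Xs \<oplus>\<^bsub>U_alg sc br\<^esub> finsum (U_alg sc br) n ?S" .
  have N: "finsum (U_alg sc br) n ?S \<in> hU_part ?p"
    by (rule En.submodule_finsum[OF hU_part_sub n(1)])
  then have Nc: "finsum (U_alg sc br) n ?S \<in> carrier (U_alg sc br)" using hU_part_rules(1) by blast
  have "symmetrized sc br Xs = yw Xs \<oplus>\<^bsub>U_alg sc br\<^esub> sc (1 / fact ?p) 1 \<odot>\<^bsub>U_alg sc br\<^esub> finsum (U_alg sc br) n ?S"
    using assms Nc unfolding symmetrized_eq[OF assms] sI_def ps
    by (simp add: En.smult_add_right En.smult_mult[symmetric] sc_fact del: of_nat_fact)
  then show ?thesis using hU_part_rules(4)[OF N] by blast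
qed

lemma S_dag_sub: "submodule (S_dag_grade sc br p) base_mod (U_alg sc br)"
proof (rule En.submoduleI')
  show "S_dag_grade sc br p \<subseteq> carrier (U_alg sc br)"
    unfolding S_dag_grade_def using PD.closed SG.G_carrier by blast
  show "\<zero>\<^bsub>U_alg sc br\<^esub> \<in> S_dag_grade sc br p"
    unfolding S_dag_grade_def by (rule image_eqI[of _ _ "\<zero>\<^bsub>Sym sc\<^esub>"]) (simp_all add: PD.zero SG.G_rules(2))
  fix x y a assume "x \<in> S_dag_grade sc br p"
  then obtain s where s: "s \<in> Sym_grade sc p" "x = pi_dag_U sc br s" unfolding S_dag_grade_def by blast
  show "a \<odot>\<^bsub>U_alg sc br\<^esub> x \<in> S_dag_grade sc br p"
    unfolding S_dag_grade_def using SG.G_rules(4)[OF s(1)] SG.G_carrier[OF s(1)]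
    by (intro image_eqI[of _ _ "a \<odot>\<^bsub>Sym sc\<^esub> s"]) (simp_all add: s(2) PD.smult)
  assume "y \<in> S_dag_grade sc br p"
  then obtain t where t: "t \<in> Sym_grade sc p" "y = pi_dag_U sc br t" unfolding S_dag_grade_def by blast
  show "x \<oplus>\<^bsub>U_alg sc br\<^esub> y \<in> S_dag_grade sc br p"
    unfolding S_dag_grade_def using SG.G_rules(3)[OF s(1) t(1)] SG.G_carrier[OF s(1)] SG.G_carrier[OF t(1)]
    by (intro image_eqI[of _ _ "s \<oplus>\<^bsub>Sym sc\<^esub> t"]) (simp_all add: s(2) t(2) PD.add)
qed

lemmas S_dag_rules = En.submoduleD[OF S_dag_sub]

lemma S_dag_U: "u \<in> S_dag_grade sc br p \<Longrightarrow> u \<in> U_grade sc br p"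
  unfolding S_dag_grade_def using pi_dag_grade by blast

lemma S_dag_closed: "u \<in> S_dag_grade sc br p \<Longrightarrow> u \<in> carrier (U_alg sc br)"
  using S_dag_rules(1) by blast

abbreviation "hp m \<equiv> hU [^]\<^bsub>U_alg sc br\<^esub> (m::nat)"

lemma hp_grade: "hp m \<in> U_grade sc br (2 * m)"
proof (induction m)
  case 0
  then show ?case using UG.G_one by (simp add: pow_simps)
next
  case (Suc m)
  then show ?case using UG.G_mult[OF Suc hU_grade] by (simp add: pow_simps)
qed

lemma hp_closed [simp]: "hp m \<in> carrier (U_alg sc br)"
  using hp_grade UG.G_carrier by blast

text \<open>A finite expansion in powers of \<open>h\<close> within one degree. As \<open>h\<close>
  has degree 2, the coefficient of its \<open>m\<close>-th power has degree
  \<open>n - 2 * m\<close>; the bound \<open>2 * m \<le> n\<close> keeps the subtraction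
  exact.\<close>

definition decomposed :: "nat \<Rightarrow> 'a env \<Rightarrow> bool" where
  "decomposed n u \<longleftrightarrow> (\<exists>s. (\<forall>m. 2 * m \<le> n \<longrightarrow> s m \<in> S_dag_grade sc br (n - 2 * m)) \<and>
     u = finsum (U_alg sc br) (\<lambda>m. hp m \<otimes>\<^bsub>U_alg sc br\<^esub> s m) {m. 2 * m \<le> n})"

lemma fin_even: "finite {m::nat. 2 * m \<le> n}"
  by (rule finite_subset[of _ "{..n}"]) auto

lemma decomposed_S_dag: "u \<in> S_dag_grade sc br n \<Longrightarrow> decomposed n u"
  unfolding decomposed_def
proof (intro exI[of _ "\<lambda>m. if m = 0 then u else \<zero>\<^bsub>U_alg sc br\<^esub>"] conjI allI impI)
  assume u: "u \<in> S_dag_grade sc br n"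
  show "u = finsum (U_alg sc br) (\<lambda>m. hp m \<otimes>\<^bsub>U_alg sc br\<^esub> (if m = 0 then u else \<zero>\<^bsub>U_alg sc br\<^esub>)) {m. 2 * m \<le> n}"
    using S_dag_closed[OF u] fin_even by (subst UG.finsum_single_term[of 0]) (simp_all add: pow_simps)
qed (auto simp: S_dag_rules(2))

lemma decomposed_add:
  assumes "decomposed n u" "decomposed n v"
  shows "decomposed n (u \<oplus>\<^bsub>U_alg sc br\<^esub> v)"
proof -
  obtain s t where s: "\<forall>m. 2 * m \<le> n \<longrightarrow> s m \<in> S_dag_grade sc br (n - 2 * m)"
    "u = finsum (U_alg sc br) (\<lambda>m. hp m \<otimes>\<^bsub>U_alg sc br\<^esub> s m) {m. 2 * m \<le> n}"
    and t: "\<forall>m. 2 * m \<le> n \<longrightarrow> t m \<in> S_dag_grade sc br (n - 2 * m)"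
    "v = finsum (U_alg sc br) (\<lambda>m. hp m \<otimes>\<^bsub>U_alg sc br\<^esub> t m) {m. 2 * m \<le> n}"
    using assms unfolding decomposed_def by blast
  have c: "s m \<in> carrier (U_alg sc br)" "t m \<in> carrier (U_alg sc br)" if "2 * m \<le> n" for m
    using s(1) t(1) that S_dag_closed by blast+
  have "finsum (U_alg sc br) (\<lambda>m. hp m \<otimes>\<^bsub>U_alg sc br\<^esub> (s m \<oplus>\<^bsub>U_alg sc br\<^esub> t m)) {m. 2 * m \<le> n} =
    finsum (U_alg sc br) (\<lambda>m. hp m \<otimes>\<^bsub>U_alg sc br\<^esub> s m \<oplus>\<^bsub>U_alg sc br\<^esub> hp m \<otimes>\<^bsub>U_alg sc br\<^esub> t m) {m. 2 * m \<le> n}"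
    using c by (intro En.M.finsum_cong') (auto simp: En.b_r_distr)
  also have "\<dots> = u \<oplus>\<^bsub>U_alg sc br\<^esub> v"
    unfolding s(2) t(2) using c by (intro En.M.finsum_addf) auto
  finally show ?thesis
    unfolding decomposed_def using s(1) t(1) S_dag_rules(3)
    by (intro exI[of _ "\<lambda>m. s m \<oplus>\<^bsub>U_alg sc br\<^esub> t m"]) simp
qed

lemma decomposed_smult:
  assumes "decomposed n u"
  shows "decomposed n (a \<odot>\<^bsub>U_alg sc br\<^esub> u)"
proof -
  obtain s where s: "\<forall>m. 2 * m \<le> n \<longrightarrow> s m \<in> S_dag_grade sc br (n - 2 * m)"
    "u = finsum (U_alg sc br) (\<lambda>m. hp m \<otimes>\<^bsub>U_alg sc br\<^esub> s m) {m. 2 * m \<le> n}"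
    using assms unfolding decomposed_def by blast
  have c: "s m \<in> carrier (U_alg sc br)" if "2 * m \<le> n" for m
    using s(1) that S_dag_closed by blast
  have "finsum (U_alg sc br) (\<lambda>m. hp m \<otimes>\<^bsub>U_alg sc br\<^esub> (a \<odot>\<^bsub>U_alg sc br\<^esub> s m)) {m. 2 * m \<le> n} =
    finsum (U_alg sc br) (\<lambda>m. a \<odot>\<^bsub>U_alg sc br\<^esub> (hp m \<otimes>\<^bsub>U_alg sc br\<^esub> s m)) {m. 2 * m \<le> n}"
    using c by (intro En.M.finsum_cong') (auto simp: En.b_smult_r)
  also have "\<dots> = a \<odot>\<^bsub>U_alg sc br\<^esub> u"
    unfolding s(2) using c fin_even by (intro En.smult_finsum[symmetric]) auto
  finally show ?thesis
    unfolding decomposed_def using s(1) S_dag_rules(4)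
    by (intro exI[of _ "\<lambda>m. a \<odot>\<^bsub>U_alg sc br\<^esub> s m"]) simp
qed

lemma decomposed_hU:
  assumes "decomposed n u"
  shows "decomposed (n + 2) (hU \<otimes>\<^bsub>U_alg sc br\<^esub> u)"
proof -
  obtain s where s: "\<forall>m. 2 * m \<le> n \<longrightarrow> s m \<in> S_dag_grade sc br (n - 2 * m)"
    "u = finsum (U_alg sc br) (\<lambda>m. hp m \<otimes>\<^bsub>U_alg sc br\<^esub> s m) {m. 2 * m \<le> n}"
    using assms unfolding decomposed_def by blast
  have c: "s m \<in> carrier (U_alg sc br)" if "2 * m \<le> n" for m
    using s(1) that S_dag_closed by blast
  \<comment> \<open>Multiplication by \<open>h\<close> moves the coefficients up by one power, and
    the new constant coefficient is 0.\<close>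
  define t where "t m = (case m of 0 \<Rightarrow> \<zero>\<^bsub>U_alg sc br\<^esub> | Suc m \<Rightarrow> s m)" for m
  have tc: "t m \<in> carrier (U_alg sc br)" if "2 * m \<le> n + 2" for m
    using c that by (auto simp: t_def split: nat.split)
  let ?f = "\<lambda>m. hp m \<otimes>\<^bsub>U_alg sc br\<^esub> t m"
  have set: "{m. 2 * m \<le> n + 2} = insert 0 (Suc ` {m. 2 * m \<le> n})"
  proof (intro equalityI subsetI)
    fix m assume "m \<in> {m. 2 * m \<le> n + 2}"
    then show "m \<in> insert 0 (Suc ` {m. 2 * m \<le> n})" by (cases m) auto
  qed auto
  have "finsum (U_alg sc br) ?f {m. 2 * m \<le> n + 2} = ?f 0 \<oplus>\<^bsub>U_alg sc br\<^esub> finsum (U_alg sc br) ?f (Suc ` {m. 2 * m \<le> n})"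
    unfolding set using fin_even tc by (subst En.M.finsum_insert) auto
  also have "finsum (U_alg sc br) ?f (Suc ` {m. 2 * m \<le> n}) = finsum (U_alg sc br) (\<lambda>m. ?f (Suc m)) {m. 2 * m \<le> n}"
    using tc by (intro En.M.finsum_reindex) auto
  also have "\<dots> = finsum (U_alg sc br) (\<lambda>m. hU \<otimes>\<^bsub>U_alg sc br\<^esub> (hp m \<otimes>\<^bsub>U_alg sc br\<^esub> s m)) {m. 2 * m \<le> n}"
  proof (intro En.M.finsum_cong' refl)
    fix m assume "m \<in> {m. 2 * m \<le> n}"
    then have "s m \<in> carrier (U_alg sc br)" using c by simp
    then show "?f (Suc m) = hU \<otimes>\<^bsub>U_alg sc br\<^esub> (hp m \<otimes>\<^bsub>U_alg sc br\<^esub> s m)"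
      using hU_central[OF hp_closed, of m] by (simp add: t_def pow_simps En.b_assoc[symmetric])
  qed (use c in auto)
  also have "\<dots> = hU \<otimes>\<^bsub>U_alg sc br\<^esub> u"
    unfolding s(2) using c by (intro En.b_finsum_r[symmetric]) auto
  finally have "hU \<otimes>\<^bsub>U_alg sc br\<^esub> u = finsum (U_alg sc br) ?f {m. 2 * m \<le> n + 2}"
    using c fin_even unfolding s(2) by (simp add: t_def Pi_def)
  moreover have "t m \<in> S_dag_grade sc br (n + 2 - 2 * m)" if "2 * m \<le> n + 2" for m
    using s(1) that S_dag_rules(2) by (auto simp: t_def split: nat.split)
  ultimately show ?thesis unfolding decomposed_def by blast
qed

lemma U_grade_decomposed:
  assumes "u \<in> U_grade sc br n"
  shows "decomposed n u"
  using assms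
proof (induction n arbitrary: u rule: less_induct)
  case (less n)
  have zero: "decomposed n \<zero>\<^bsub>U_alg sc br\<^esub>"
    using S_dag_rules(2) by (rule decomposed_S_dag)
  have words: "decomposed n (En.wd ws)" if ws: "set ws \<subseteq> carrier (Lie_mod sc)" "Word ws \<in> words_of_degree Udeg n" for ws
    using ws(2)
  proof (cases rule: U_word_cases)
    case (1 Xs)
    obtain m where m: "m \<in> hU_part n" "symmetrized sc br Xs = yw Xs \<oplus>\<^bsub>U_alg sc br\<^esub> m"
      using yw_symmetrized[OF 1(2)] 1(3) by auto
    have mc: "\<ominus>\<^bsub>U_alg sc br\<^esub> m \<in> hU_part n" using hU_part_rules(5)[OF m(1)] .
    have "decomposed n (\<ominus>\<^bsub>U_alg sc br\<^esub> m)"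
    proof (cases "n < 2")
      case True
      then show ?thesis using mc zero by (simp add: hU_part_def)
    next
      case False
      then obtain v where v: "v \<in> U_grade sc br (n - 2)" "\<ominus>\<^bsub>U_alg sc br\<^esub> m = hU \<otimes>\<^bsub>U_alg sc br\<^esub> v"
        using mc by (auto simp: hU_part_def)
      have "decomposed (n - 2 + 2) (hU \<otimes>\<^bsub>U_alg sc br\<^esub> v)"
        using False v(1) by (intro decomposed_hU less.IH) auto
      with False v(2) show ?thesis by (simp del: add_2_eq_Suc')
    qed
    moreover have "decomposed n (symmetrized sc br Xs)"
    proof (rule decomposed_S_dag)
      show "symmetrized sc br Xs \<in> S_dag_grade sc br n"
        unfolding S_dag_grade_def using Sym_word_grade[OF 1(2)] 1(2,3)
        by (intro image_eqI[of _ _ "Sy.wd Xs"]) (simp_all add: pi_dag_U_word)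
    qed
    ultimately have "decomposed n (symmetrized sc br Xs \<oplus>\<^bsub>U_alg sc br\<^esub> \<ominus>\<^bsub>U_alg sc br\<^esub> m)"
      by (rule decomposed_add[rotated])
    moreover have "symmetrized sc br Xs \<oplus>\<^bsub>U_alg sc br\<^esub> \<ominus>\<^bsub>U_alg sc br\<^esub> m = yw Xs"
    proof -
      have "m \<in> carrier (U_alg sc br)" using m(1) hU_part_rules(1) by blast
      then show ?thesis using 1(2) by (simp add: m(2) En.M.a_assoc En.M.r_neg)
    qed
    ultimately show ?thesis using 1(1) by simp
  next
    case (2 a u v k)
    have uv: "set u \<subseteq> carrier (Lie_mod sc)" "set v \<subseteq> carrier (Lie_mod sc)" using ws(1) 2(1) by auto
    have c: "En.wd u \<in> carrier (U_alg sc br)" "En.wd v \<in> carrier (U_alg sc br)" using uv En.wd_closed[of u] En.wd_closed[of v] by blast+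
    have "En.wd ws = En.wd u \<otimes>\<^bsub>U_alg sc br\<^esub> (a \<odot>\<^bsub>U_alg sc br\<^esub> hU \<otimes>\<^bsub>U_alg sc br\<^esub> En.wd v)"
      unfolding 2(1) hU_smult[of a, symmetric] using uv
      by (subst En.wd_append) (auto simp: En.wd_Cons)
    also have "\<dots> = a \<odot>\<^bsub>U_alg sc br\<^esub> (hU \<otimes>\<^bsub>U_alg sc br\<^esub> (En.wd u \<otimes>\<^bsub>U_alg sc br\<^esub> En.wd v))"
      using c hU_central[OF c(1)] by (simp add: En.b_smult_l En.b_smult_r En.b_assoc[symmetric])
    also have "En.wd u \<otimes>\<^bsub>U_alg sc br\<^esub> En.wd v = En.wd (u @ v)" using uv by (rule En.wd_append[symmetric])
    finally have "En.wd ws = a \<odot>\<^bsub>U_alg sc br\<^esub> (hU \<otimes>\<^bsub>U_alg sc br\<^esub> En.wd (u @ v))" .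
    moreover have "En.wd (u @ v) \<in> U_grade sc br k"
      unfolding U_grade_def using uv 2(3) by (intro En.wd_grade) auto
    ultimately show ?thesis
      using decomposed_smult[OF decomposed_hU[OF less.IH[of k]]] 2(2) by simp
  qed
  show ?case
    using less.prems unfolding U_grade_def
  proof (induction rule: En.grade_induct)
    case (word ws a)
    then show ?case using decomposed_smult[OF words] by blast
  qed (use zero decomposed_add in auto)
qed

end

section \<open>Differential forms\<close>

lemma base_amod: "amod (base_mod :: ('a::comm_ring_1, 'a) module)"
  by (rule amodI) (simp_all add: algebra_simps)

context symplectic_affine_regular_domain
begin

lemma form1_sq: "\<nu> \<in> carrier (Omega1 sc) \<Longrightarrow> form1 sc \<nu> \<otimes>\<^bsub>Omega sc\<^esub> form1 sc \<nu> = \<zero>\<^bsub>Omega sc\<^esub>"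
proof -
  assume \<nu>: "\<nu> \<in> carrier (Omega1 sc)"
  have "letter \<nu> * letter \<nu> \<in> ext_rel (Omega1 sc)" unfolding ext_rel_def using \<nu> by blast
  then have "letter \<nu> * letter \<nu> \<in> pres_ideal (Omega1 sc) (ext_rel (Omega1 sc))"
    by (intro Om.cl_rel) blast
  then have "Om.cl (letter \<nu> * letter \<nu>) = Om.cl 0" by (simp add: Om.cl_eq)
  then show ?thesis
    using Om.letter_closed[OF \<nu>] Om.Q_zero by (simp add: Om.gen_cl Om.cl_mult Om.Q_pres)
qed

text \<open>Polarization of \<open>form1_sq\<close> at the sum of the two forms.\<close>

lemma form1_anticomm:
  assumes \<mu>: "\<mu> \<in> carrier (Omega1 sc)" and \<nu>: "\<nu> \<in> carrier (Omega1 sc)"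
  shows "form1 sc \<mu> \<otimes>\<^bsub>Omega sc\<^esub> form1 sc \<nu> = \<ominus>\<^bsub>Omega sc\<^esub> (form1 sc \<nu> \<otimes>\<^bsub>Omega sc\<^esub> form1 sc \<mu>)"
proof -
  let ?m = "form1 sc \<mu>" and ?n = "form1 sc \<nu>"
  have c: "?m \<in> carrier (Omega sc)" "?n \<in> carrier (Omega sc)" using assms by simp_all
  have "(?m \<oplus>\<^bsub>Omega sc\<^esub> ?n) \<otimes>\<^bsub>Omega sc\<^esub> (?m \<oplus>\<^bsub>Omega sc\<^esub> ?n) = \<zero>\<^bsub>Omega sc\<^esub>"
    using form1_sq[of "\<mu> \<oplus>\<^bsub>Omega1 sc\<^esub> \<nu>"] assms lin_mapD(2)[OF Om.gen_lin assms] by simp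
  then have "?m \<otimes>\<^bsub>Omega sc\<^esub> ?n \<oplus>\<^bsub>Omega sc\<^esub> ?n \<otimes>\<^bsub>Omega sc\<^esub> ?m = \<zero>\<^bsub>Omega sc\<^esub>"
    using c by (simp add: Om.b_l_distr Om.b_r_distr form1_sq[OF \<mu>] form1_sq[OF \<nu>] Om.M.a_comm)
  then show ?thesis
    using c by (intro Om.M.minus_equality[symmetric]) simp_all
qed

lemma Omega_word_grade: "set ws \<subseteq> carrier (Omega1 sc) \<Longrightarrow> Om.wd ws \<in> OmegaQ sc (length ws)"
  unfolding OmegaQ_def by (intro Om.wd_grade) (auto simp: words_of_degree_one[simplified])

lemma form1_grade: "\<nu> \<in> carrier (Omega1 sc) \<Longrightarrow> form1 sc \<nu> \<in> OmegaQ sc 1"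
  using Omega_word_grade[of "[\<nu>]"] by (simp add: Om.wd_single)

text \<open>The leading form moves to the right through \<open>w\<close>, each exchange costing a
  sign, until it meets its copy and the square vanishes.\<close>

lemma repeated_word_zero:
  assumes "\<nu> \<in> carrier (Omega1 sc)" "set w \<subseteq> carrier (Omega1 sc)"
  shows "form1 sc \<nu> \<otimes>\<^bsub>Omega sc\<^esub> Om.wd (w @ [\<nu>]) = \<zero>\<^bsub>Omega sc\<^esub>"
  using assms
proof (induction w)
  case Nil
  then show ?case by (simp add: Om.wd_single form1_sq)
next
  case (Cons x w)
  have c: "Om.wd (w @ [\<nu>]) \<in> carrier (Omega sc)" "form1 sc \<nu> \<in> carrier (Omega sc)" "form1 sc x \<in> carrier (Omega sc)"
    using Cons.prems by simp_all
  have "form1 sc \<nu> \<otimes>\<^bsub>Omega sc\<^esub> Om.wd ((x # w) @ [\<nu>]) =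
    \<ominus>\<^bsub>Omega sc\<^esub> (form1 sc x \<otimes>\<^bsub>Omega sc\<^esub> form1 sc \<nu>) \<otimes>\<^bsub>Omega sc\<^esub> Om.wd (w @ [\<nu>])"
    using Cons.prems c form1_anticomm[of \<nu> x] by (simp add: Om.wd_Cons Om.b_assoc[symmetric])
  also have "\<dots> = \<ominus>\<^bsub>Omega sc\<^esub> (form1 sc x \<otimes>\<^bsub>Omega sc\<^esub> (form1 sc \<nu> \<otimes>\<^bsub>Omega sc\<^esub> Om.wd (w @ [\<nu>])))"
    using c by (simp add: Om.b_neg_l Om.b_assoc)
  finally show ?case using Cons c by simp
qed

lemma not_distinct_word_zero:
  assumes "\<not> distinct ws" "set ws \<subseteq> carrier (Omega1 sc)"
  shows "Om.wd ws = \<zero>\<^bsub>Omega sc\<^esub>"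
proof -
  obtain u \<nu> v w where ws: "ws = u @ [\<nu>] @ v @ [\<nu>] @ w" using not_distinct_decomp[OF assms(1)] by blast
  then have "Om.wd ws = Om.wd u \<otimes>\<^bsub>Omega sc\<^esub> ((form1 sc \<nu> \<otimes>\<^bsub>Omega sc\<^esub> Om.wd (v @ [\<nu>])) \<otimes>\<^bsub>Omega sc\<^esub> Om.wd w)"
    using assms(2) Om.wd_append[of "u" "(\<nu> # v @ [\<nu>]) @ w"] Om.wd_append[of "\<nu> # v @ [\<nu>]" w]
      Om.wd_Cons[of \<nu> "v @ [\<nu>]"] by simp
  then show ?thesis using assms(2) by (simp add: ws repeated_word_zero)
qed

section \<open>Finite generation of the modules of differential forms\<close>

definition dA :: "'a \<Rightarrow> 'a kform1" where "dA b = Kah.cl (Poly_Mapping.single b 1)"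

lemma dA_closed [simp]: "dA b \<in> carrier (Omega1 sc)"
  unfolding dA_def by (intro Kah.cl_closed Kah.carrier_rules(6)) simp

lemma dA_rules:
  "dA (a + b) = dA a \<oplus>\<^bsub>Omega1 sc\<^esub> dA b"
  "dA (sc c a) = sc c 1 \<odot>\<^bsub>Omega1 sc\<^esub> dA a"
  "dA (a * b) = a \<odot>\<^bsub>Omega1 sc\<^esub> dA b \<oplus>\<^bsub>Omega1 sc\<^esub> b \<odot>\<^bsub>Omega1 sc\<^esub> dA a"
proof -
  have rel: "r \<in> kahler_rel sc \<Longrightarrow> r \<in> gen_submod kahler_free (kahler_rel sc)" for r
    using Kah.F.gen_submod_incl by blast
  have sm: "t \<odot>\<^bsub>Omega1 sc\<^esub> dA x = Kah.cl (Poly_Mapping.single x t)" for t x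
    unfolding dA_def by (subst Kah.Q_smult) simp_all
  have "Poly_Mapping.single (a + b) 1 - Poly_Mapping.single a 1 - Poly_Mapping.single b 1 \<in> kahler_rel sc"
    unfolding kahler_rel_def by blast
  then show "dA (a + b) = dA a \<oplus>\<^bsub>Omega1 sc\<^esub> dA b"
    unfolding dA_def Kah.Q_add Kah.cl_eq by (simp only: rel diff_diff_eq[symmetric])
  have "Poly_Mapping.single (sc c a) 1 - Poly_Mapping.single a (sc c 1) \<in> kahler_rel sc"
    unfolding kahler_rel_def by blast
  then show "dA (sc c a) = sc c 1 \<odot>\<^bsub>Omega1 sc\<^esub> dA a"
    unfolding sm unfolding dA_def Kah.cl_eq by (rule rel)
  have "Poly_Mapping.single (a * b) 1 - Poly_Mapping.single b a - Poly_Mapping.single a b \<in> kahler_rel sc"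
    unfolding kahler_rel_def by blast
  then show "dA (a * b) = a \<odot>\<^bsub>Omega1 sc\<^esub> dA b \<oplus>\<^bsub>Omega1 sc\<^esub> b \<odot>\<^bsub>Omega1 sc\<^esub> dA a"
    unfolding sm unfolding dA_def Kah.Q_add Kah.cl_eq by (simp only: rel diff_diff_eq[symmetric])
qed

lemma dA_one: "dA 1 = \<zero>\<^bsub>Omega1 sc\<^esub>"
proof -
  have "dA 1 \<oplus>\<^bsub>Omega1 sc\<^esub> dA 1 = dA 1 \<oplus>\<^bsub>Omega1 sc\<^esub> \<zero>\<^bsub>Omega1 sc\<^esub>"
    using dA_rules(3)[of 1 1] by simp
  then show ?thesis by (simp only: Om.gens.M.add.l_cancel dA_closed Om.gens.M.zero_closed)
qed

text \<open>The elements whose differential lies in the span of the differentials of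
  \<open>X\<close> form a subring, by the product rule, and contain \<open>X\<close> and the
  constants. For affine generators \<open>X\<close> this is the whole algebra.\<close>

lemma Omega1_span:
  obtains X where "finite X" "carrier (Omega1 sc) = gen_submod (Omega1 sc) (dA ` X)"
proof -
  obtain X where X: "finite X" "generate_ring base_mod (X \<union> range (\<lambda>c. sc c 1)) = UNIV"
    using affine by blast
  let ?H = "gen_submod (Omega1 sc) (dA ` X)"
  have H: "submodule ?H base_mod (Omega1 sc)"
    by (rule Om.gens.gen_submod_submodule) auto
  note Hr = Om.gens.submoduleD[OF H]
  have "dA b \<in> ?H" if "b \<in> generate_ring base_mod (X \<union> range (\<lambda>c. sc c 1))" for b
    using that
  proof induction
    case one
    then show ?case using Hr(2) by (simp add: dA_one)
  next
    case (incl b)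
    then show ?case
    proof
      assume "b \<in> X"
      then show ?thesis by (intro subsetD[OF Om.gens.gen_submod_incl] imageI)
    next
      assume "b \<in> range (\<lambda>c. sc c 1)"
      then show ?thesis using Hr(2) by (auto simp: dA_rules dA_one)
    qed
  next
    case (a_inv b)
    have "\<ominus>\<^bsub>base_mod\<^esub> b = sc (- 1) b" by simp
    then show ?case using Hr(4)[OF a_inv.IH, of "sc (- 1) 1"] by (simp only: dA_rules)
  next
    case (eng_add a b)
    then show ?case using Hr(3) by (simp add: dA_rules)
  next
    case (eng_mult a b)
    then show ?case using Hr(3)[OF Hr(4) Hr(4)] by (simp add: dA_rules)
  qed
  then have d: "dA b \<in> ?H" for b using X(2) by simp
  have "x \<in> ?H" if "x \<in> carrier (Omega1 sc)" for x
    using that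
  proof (induction rule: Kah.Q_induct)
    case (gen k a)
    show ?case using Hr(4)[OF d[of k], of a] unfolding dA_def[of k] .
  qed (use Hr in auto)
  then have "carrier (Omega1 sc) = ?H" using Hr(1) by blast
  with X(1) show thesis by (rule that)
qed

text \<open>Words in finitely many generators of \<open>Omega1 sc\<close> span the exterior algebra,
  and words with a repeated letter vanish. Finitely many words without repetition remain.\<close>

lemma Omega_fg:
  obtains n and g :: "nat \<Rightarrow> 'a kform"
  where "\<And>j. j < n \<Longrightarrow> g j \<in> carrier (Omega sc)"
    and "\<And>\<mu>. \<mu> \<in> carrier (Omega sc) \<Longrightarrow> \<exists>c. \<mu> = (\<Oplus>\<^bsub>Omega sc\<^esub>j\<in>{..<n}. c j \<odot>\<^bsub>Omega sc\<^esub> g j)"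
proof -
  obtain X where X: "finite X" "carrier (Omega1 sc) = gen_submod (Omega1 sc) (dA ` X)"
    by (rule Omega1_span)
  let ?D = "dA ` X"
  have D: "?D \<subseteq> carrier (Omega1 sc)" by auto
  have fin: "finite {ws. set ws \<subseteq> ?D \<and> distinct ws}"
    using X(1) by (intro finite_subset_distinct) simp
  obtain e where "bij_betw e {0..<card {ws. set ws \<subseteq> ?D \<and> distinct ws}} {ws. set ws \<subseteq> ?D \<and> distinct ws}"
    using ex_bij_betw_nat_finite[OF fin] by (rule exE)
  then obtain n where e: "e ` {..<n::nat} = {ws. set ws \<subseteq> ?D \<and> distinct ws}"
    unfolding bij_betw_def atLeast0LessThan by blast
  define g where "g j = Om.wd (e j)" for j
  have ej: "set (e j) \<subseteq> carrier (Omega1 sc)" if "j < n" for j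
    using e that D by blast
  have g: "g j \<in> carrier (Omega sc)" if "j < n" for j
    using ej[OF that] by (simp add: g_def)
  define H where "H = {\<mu>. \<exists>c. \<mu> = (\<Oplus>\<^bsub>Omega sc\<^esub>j\<in>{..<n}. c j \<odot>\<^bsub>Omega sc\<^esub> g j)}"
  have "submodule H base_mod (Omega sc)"
  proof (rule Om.submoduleI')
    show "H \<subseteq> carrier (Omega sc)"
      using g by (auto simp: H_def intro!: Om.M.finsum_closed)
    have "\<zero>\<^bsub>Omega sc\<^esub> = (\<Oplus>\<^bsub>Omega sc\<^esub>j\<in>{..<n}. 0 \<odot>\<^bsub>Omega sc\<^esub> g j)"
      using g by (subst Om.M.add.finprod_one_eqI) auto
    then have "\<exists>c. \<zero>\<^bsub>Omega sc\<^esub> = (\<Oplus>\<^bsub>Omega sc\<^esub>j\<in>{..<n}. c j \<odot>\<^bsub>Omega sc\<^esub> g j)" by (rule exI[of _ "\<lambda>_. 0"])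
    then show "\<zero>\<^bsub>Omega sc\<^esub> \<in> H" unfolding H_def by (rule CollectI)
    fix x y a assume "x \<in> H"
    then obtain c where c: "x = (\<Oplus>\<^bsub>Omega sc\<^esub>j\<in>{..<n}. c j \<odot>\<^bsub>Omega sc\<^esub> g j)" unfolding H_def by blast
    have "a \<odot>\<^bsub>Omega sc\<^esub> x = (\<Oplus>\<^bsub>Omega sc\<^esub>j\<in>{..<n}. a \<odot>\<^bsub>Omega sc\<^esub> (c j \<odot>\<^bsub>Omega sc\<^esub> g j))"
      unfolding c using g by (intro Om.smult_finsum) auto
    also have "\<dots> = (\<Oplus>\<^bsub>Omega sc\<^esub>j\<in>{..<n}. (a * c j) \<odot>\<^bsub>Omega sc\<^esub> g j)"
      using g by (intro Om.M.finsum_cong') (auto simp: Om.smult_mult)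
    finally have "\<exists>c'. a \<odot>\<^bsub>Omega sc\<^esub> x = (\<Oplus>\<^bsub>Omega sc\<^esub>j\<in>{..<n}. c' j \<odot>\<^bsub>Omega sc\<^esub> g j)" by (rule exI[of _ "\<lambda>j. a * c j"])
    then show "a \<odot>\<^bsub>Omega sc\<^esub> x \<in> H" unfolding H_def by (rule CollectI)
    assume "y \<in> H"
    then obtain d where d: "y = (\<Oplus>\<^bsub>Omega sc\<^esub>j\<in>{..<n}. d j \<odot>\<^bsub>Omega sc\<^esub> g j)" unfolding H_def by blast
    have "x \<oplus>\<^bsub>Omega sc\<^esub> y = (\<Oplus>\<^bsub>Omega sc\<^esub>j\<in>{..<n}. c j \<odot>\<^bsub>Omega sc\<^esub> g j \<oplus>\<^bsub>Omega sc\<^esub> d j \<odot>\<^bsub>Omega sc\<^esub> g j)"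
      unfolding c d using g by (intro Om.M.finsum_addf[symmetric]) auto
    also have "\<dots> = (\<Oplus>\<^bsub>Omega sc\<^esub>j\<in>{..<n}. (c j + d j) \<odot>\<^bsub>Omega sc\<^esub> g j)"
      using g by (intro Om.M.finsum_cong') (auto simp: Om.smult_add_left)
    finally have "\<exists>c'. x \<oplus>\<^bsub>Omega sc\<^esub> y = (\<Oplus>\<^bsub>Omega sc\<^esub>j\<in>{..<n}. c' j \<odot>\<^bsub>Omega sc\<^esub> g j)" by (rule exI[of _ "\<lambda>j. c j + d j"])
    then show "x \<oplus>\<^bsub>Omega sc\<^esub> y \<in> H" unfolding H_def by (rule CollectI)
  qed
  note Hr = Om.submoduleD[OF this]
  have D_words: "Om.wd u \<in> H" if u: "set u \<subseteq> ?D" for u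
  proof (cases "distinct u")
    case True
    have "u \<in> e ` {..<n}" unfolding e using u True by blast
    then obtain i where i: "i < n" "e i = u" by blast
    have "Om.wd u = (\<Oplus>\<^bsub>Omega sc\<^esub>j\<in>{..<n}. (if j = i then 1 else 0) \<odot>\<^bsub>Omega sc\<^esub> g j)"
      using i g by (subst OG.finsum_single_term[of i]) (auto simp: g_def)
    then have "\<exists>c. Om.wd u = (\<Oplus>\<^bsub>Omega sc\<^esub>j\<in>{..<n}. c j \<odot>\<^bsub>Omega sc\<^esub> g j)" by (rule exI[of _ "\<lambda>j. if j = i then 1 else 0"])
    then show ?thesis unfolding H_def by (rule CollectI)
  next
    case False
    have "set u \<subseteq> carrier (Omega1 sc)" using u D by blast
    from not_distinct_word_zero[OF False this] show ?thesis using Hr(2) by simp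
  qed
  \<comment> \<open>Letters are expanded one at a time from the left; \<open>u\<close> is the part
    already written in the generators \<open>?D\<close>.\<close>
  have all_words: "Om.wd (u @ ws) \<in> H" if "set u \<subseteq> ?D" "set ws \<subseteq> carrier (Omega1 sc)" for u ws
    using that
  proof (induction ws arbitrary: u)
    case Nil
    then show ?case using D_words by simp
  next
    case (Cons \<nu> ws)
    have uD: "set u \<subseteq> carrier (Omega1 sc)" using Cons.prems(1) D by blast
    have ws: "set ws \<subseteq> carrier (Omega1 sc)" using Cons.prems(2) by simp
    have mid: "Om.wd (u @ x # ws) = Om.wd u \<otimes>\<^bsub>Omega sc\<^esub> (form1 sc x \<otimes>\<^bsub>Omega sc\<^esub> Om.wd ws)"
      if "x \<in> carrier (Omega1 sc)" for x
      using that uD ws Om.wd_append[of u "x # ws"] by (simp add: Om.wd_Cons)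
    have "\<nu> \<in> gen_submod (Omega1 sc) ?D" using Cons.prems X(2) by simp
    from this D have "\<nu> \<in> carrier (Omega1 sc) \<and> Om.wd (u @ \<nu> # ws) \<in> H"
    proof (induction rule: Om.gens.gen_submod_induct)
      case zero
      then show ?case using uD ws Hr(2) lin.zero[OF Om.lin_gen] by (simp add: mid)
    next
      case (add x y)
      then have m: "x \<in> carrier (Omega1 sc)" "y \<in> carrier (Omega1 sc)" "Om.wd (u @ x # ws) \<in> H" "Om.wd (u @ y # ws) \<in> H"
        by simp_all
      then show ?case
        using uD ws Hr(3)[OF m(3,4)]
        by (simp add: mid lin_mapD[OF Om.gen_lin] Om.b_l_distr Om.b_r_distr)
    next
      case (gen a x)
      then have x: "x \<in> carrier (Omega1 sc)" using D by blast
      have "Om.wd ((u @ [x]) @ ws) \<in> H" using gen Cons.prems(1) ws by (intro Cons.IH) auto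
      then have "Om.wd (u @ x # ws) \<in> H" by simp
      from Hr(4)[OF this, of a] show ?case
        using x uD ws
        by (simp add: mid lin_mapD[OF Om.gen_lin] Om.b_smult_l Om.b_smult_r)
    qed
    then show ?case by simp
  qed
  have "\<mu> \<in> H" if "\<mu> \<in> carrier (Omega sc)" for \<mu>
    using that
  proof (induction rule: Om.word_induct)
    case (word ws a)
    then show ?case using all_words[of "[]" ws] Hr(4) by simp
  qed (use Hr in auto)
  then have "\<exists>c. \<mu> = (\<Oplus>\<^bsub>Omega sc\<^esub>j\<in>{..<n}. c j \<odot>\<^bsub>Omega sc\<^esub> g j)" if "\<mu> \<in> carrier (Omega sc)" for \<mu>
    using that unfolding H_def by blast
  with g show thesis by (rule that)
qed

text \<open>The coefficient of the empty word is well defined on \<open>\<Omega>\<close> and on the symmetric algebra, since all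
  relations are homogeneous of positive degree.\<close>

lemma coeff0_Sym: "lin_map (Sym sc) base_mod coeff0"
  and coeff0_Sym_word: "set ws \<subseteq> carrier (Der sc) \<Longrightarrow> coeff0 (Sy.wd ws) = (if ws = [] then 1 else (0::'a))"
proof -
  define g where "g = (\<lambda>w :: ('a \<Rightarrow> 'a) word. if w = 0 then 1 else (0::'a))"
  have g: "g (Word ws) = (if ws = [] then 1 else 0)" for ws by (simp add: g_def zero_word_def)
  have gc: "g (Word ws) \<in> carrier base_mod" if "set ws \<subseteq> carrier (Der sc)" for ws by simp
  have "lin_map (Sym sc) base_mod (lin_lift base_mod g) \<and>
    (\<forall>ws. set ws \<subseteq> carrier (Der sc) \<longrightarrow> lin_lift base_mod g (Sy.wd ws) = g (Word ws))"
  proof (rule Sy.lift_lin[of base_mod g, OF base_amod gc])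
    fix u v r assume uv: "set u \<subseteq> carrier (Der sc)" "set v \<subseteq> carrier (Der sc)" and "r \<in> sym_rel (Der sc)"
    then obtain x y where xy: "x \<in> carrier (Der sc)" "y \<in> carrier (Der sc)"
      and req: "r = letter x * letter y - letter y * letter x"
      unfolding sym_rel_def by auto
    have eq: "Poly_Mapping.single (Word u) 1 * r * Poly_Mapping.single (Word v) 1 =
      Poly_Mapping.single (Word (u @ x # y # v)) 1 - Poly_Mapping.single (Word (u @ y # x # v)) 1"
      by (simp add: req letter_def algebra_simps mult_single Word_plus)
    have c: "set (u @ x # y # v) \<subseteq> carrier (Der sc)" "set (u @ y # x # v) \<subseteq> carrier (Der sc)"
      using uv xy by simp_all
    show "ext base_mod g (Poly_Mapping.single (Word u) 1 * r * Poly_Mapping.single (Word v) 1) = \<zero>\<^bsub>base_mod\<^esub>"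
      using Sy.ext_words(1)[of base_mod g, OF base_amod gc c] unfolding eq
      by (simp add: g a_minus_def)
  qed (simp_all add: g)
  then show "lin_map (Sym sc) base_mod coeff0"
    "set ws \<subseteq> carrier (Der sc) \<Longrightarrow> coeff0 (Sy.wd ws) = (if ws = [] then 1 else (0::'a))"
    unfolding coeff0_def g_def[symmetric] by (simp_all add: g)
qed

lemma coeff0_Omega: "lin_map (Omega sc) base_mod coeff0"
  and coeff0_Omega_word: "set ws \<subseteq> carrier (Omega1 sc) \<Longrightarrow> coeff0 (Om.wd ws) = (if ws = [] then 1 else (0::'a))"
proof -
  define g where "g = (\<lambda>w :: 'a kform1 word. if w = 0 then 1 else (0::'a))"
  have g: "g (Word ws) = (if ws = [] then 1 else 0)" for ws by (simp add: g_def zero_word_def)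
  have gc: "g (Word ws) \<in> carrier base_mod" if "set ws \<subseteq> carrier (Omega1 sc)" for ws by simp
  have "lin_map (Omega sc) base_mod (lin_lift base_mod g) \<and>
    (\<forall>ws. set ws \<subseteq> carrier (Omega1 sc) \<longrightarrow> lin_lift base_mod g (Om.wd ws) = g (Word ws))"
  proof (rule Om.lift_lin[of base_mod g, OF base_amod gc])
    fix u v r assume "r \<in> ext_rel (Omega1 sc)"
    then obtain x where req: "r = letter x * letter x" unfolding ext_rel_def by auto
    have eq: "Poly_Mapping.single (Word u) 1 * r * Poly_Mapping.single (Word v) 1 =
      Poly_Mapping.single (Word (u @ x # x # v)) 1"
      by (simp add: req letter_def algebra_simps mult_single Word_plus)
    show "ext base_mod g (Poly_Mapping.single (Word u) 1 * r * Poly_Mapping.single (Word v) 1) = \<zero>\<^bsub>base_mod\<^esub>"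
      unfolding eq using amod.ext_single[OF base_amod, of g "Word (u @ x # x # v)" 1] by (simp add: g)
  qed (simp_all add: g)
  then show "lin_map (Omega sc) base_mod coeff0"
    "set ws \<subseteq> carrier (Omega1 sc) \<Longrightarrow> coeff0 (Om.wd ws) = (if ws = [] then 1 else (0::'a))"
    unfolding coeff0_def g_def[symmetric] by (simp_all add: g)
qed

section \<open>The tensor products with \<open>\<Omega>\<close>\<close>

lemmas W_simps = UG.C_simps[folded W_alg_def] and W_closed = UG.C_closed[folded W_alg_def]
  and W_homog = UG.homog_closed[folded W_alg_def] and W_homog_rules = UG.homog_rules[folded W_alg_def]
  and W_homog_mult = UG.homog_mult[folded W_alg_def] and W_homog_mult_l = UG.homog_mult_l[folded W_alg_def]
lemmas S_simps = SG.C_simps[folded S_alg_def] and S_closed = SG.C_closed[folded S_alg_def]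
  and S_homog = SG.homog_closed[folded S_alg_def] and S_homog_rules = SG.homog_rules[folded S_alg_def]
  and S_homog_mult = SG.homog_mult[folded S_alg_def]

lemma tens_alg_W: "tens_alg (W_alg sc br) (Omega sc)"
  using UG.C_balg[folded W_alg_def] Om.balg_axioms by (rule tens_alg.intro)

lemma tens_alg_S: "tens_alg (S_alg sc) (Omega sc)"
  using SG.C_balg[folded S_alg_def] Om.balg_axioms by (rule tens_alg.intro)

sublocale WA: tens_alg "W_alg sc br" "Omega sc"
  rewrites "tensor (W_alg sc br) (Omega sc) = WOmega sc br"
  by (rule tens_alg_W) (simp add: WOmega_def)

sublocale SA: tens_alg "S_alg sc" "Omega sc"
  rewrites "tensor (S_alg sc) (Omega sc) = SOmega sc"
  by (rule tens_alg_S) (simp add: SOmega_def)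

lemma conv_W: "conv_tens (U_alg sc br) (U_grade sc br) (Omega sc)"
  using graded_U Om.amod_axioms by (rule conv_tens.intro)

lemmas conv_add = conv_tens.cs_add[OF conv_W, folded W_alg_def, folded WOmega_def]
  and conv_zero = conv_tens.cs_zero[OF conv_W, folded W_alg_def, folded WOmega_def]
  and conv_minus = conv_tens.cs_minus[OF conv_W, folded W_alg_def, folded WOmega_def]
  and conv_of_zero = conv_tens.cs_of_zero[OF conv_W, folded W_alg_def, folded WOmega_def]
  and conv_tens_sum = conv_tens.cs_tens[OF conv_W, folded W_alg_def, folded WOmega_def]
  and conv_homog = conv_tens.cs_homog[OF conv_W, folded W_alg_def, folded WOmega_def]
  and convD = conv_tens.csD[OF conv_W, folded W_alg_def, folded WOmega_def]

lemma noetherian: "noetherian_ring (base_mod :: ('a, 'a) module)"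
  using regular by (simp add: regular_domain_def)

text \<open>Uniqueness of limits in the form used below: two sums of the same series differ by a sum
  of zeros. The noetherian base ring and \<open>Omega_fg\<close> supply what
  \<open>separated\<close> requires.\<close>

lemma conv_zeros_zero:
  assumes "conv_sum (W_alg sc br) (Omega sc) f x" "\<And>m. f m = \<zero>\<^bsub>WOmega sc br\<^esub>"
  shows "x = \<zero>\<^bsub>WOmega sc br\<^esub>"
proof -
  obtain n g where g: "\<And>j. j < n \<Longrightarrow> g j \<in> carrier (Omega sc)"
    "\<And>\<mu>. \<mu> \<in> carrier (Omega sc) \<Longrightarrow> \<exists>c. \<mu> = (\<Oplus>\<^bsub>Omega sc\<^esub>j\<in>{..<n::nat}. c j \<odot>\<^bsub>Omega sc\<^esub> g j)"
    using Omega_fg by blast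
  show ?thesis
    by (rule conv_tens.separated[OF conv_W noetherian g, folded W_alg_def, folded WOmega_def])
      (use convD(2)[OF assms(1)] conv_of_zero[OF assms] in auto)
qed

section \<open>Calculus of homogeneous pure tensors\<close>

abbreviation "WT \<equiv> WOmega sc br"
abbreviation "ST \<equiv> SOmega sc"
abbreviation "OM \<equiv> Omega sc"
abbreviation "tW p u \<mu> \<equiv> tens (W_alg sc br) (Omega sc) (homog (U_alg sc br) p u) \<mu>"
abbreviation "tS p s \<mu> \<equiv> tens (S_alg sc) (Omega sc) (homog (Sym sc) p s) \<mu>"

lemma tW_closed [simp]: "u \<in> U_grade sc br p \<Longrightarrow> \<mu> \<in> carrier OM \<Longrightarrow> tW p u \<mu> \<in> carrier WT"
  by (intro WA.tn_closed W_homog)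

lemma tW_rules:
  assumes u: "u \<in> U_grade sc br p" and \<mu>: "\<mu> \<in> carrier OM"
  shows "v \<in> U_grade sc br p \<Longrightarrow> tW p (u \<oplus>\<^bsub>U_alg sc br\<^esub> v) \<mu> = tW p u \<mu> \<oplus>\<^bsub>WT\<^esub> tW p v \<mu>"
    "tW p (a \<odot>\<^bsub>U_alg sc br\<^esub> u) \<mu> = a \<odot>\<^bsub>WT\<^esub> tW p u \<mu>"
    "\<nu> \<in> carrier OM \<Longrightarrow> tW p u (\<mu> \<oplus>\<^bsub>OM\<^esub> \<nu>) = tW p u \<mu> \<oplus>\<^bsub>WT\<^esub> tW p u \<nu>"
    "tW p u (a \<odot>\<^bsub>OM\<^esub> \<mu>) = a \<odot>\<^bsub>WT\<^esub> tW p u \<mu>"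
    "tW p u \<zero>\<^bsub>OM\<^esub> = \<zero>\<^bsub>WT\<^esub>" "tW p \<zero>\<^bsub>U_alg sc br\<^esub> \<mu> = \<zero>\<^bsub>WT\<^esub>"
    "tW p u (\<ominus>\<^bsub>OM\<^esub> \<mu>) = \<ominus>\<^bsub>WT\<^esub> tW p u \<mu>"
proof -
  have h: "homog (U_alg sc br) p u \<in> carrier (W_alg sc br)" using u by (rule W_homog)
  interpret r: lin OM WT "\<lambda>\<mu>. tW p u \<mu>" using h by (rule WA.lin_tn_r)
  interpret l: lin "W_alg sc br" WT "\<lambda>w. tens (W_alg sc br) OM w \<mu>" using \<mu> by (rule WA.lin_tn_l)
  note uc = UG.G_carrier[OF u]
  show "tW p (u \<oplus>\<^bsub>U_alg sc br\<^esub> v) \<mu> = tW p u \<mu> \<oplus>\<^bsub>WT\<^esub> tW p v \<mu>" if v: "v \<in> U_grade sc br p"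
    using l.add[OF h W_homog[OF v]] W_homog_rules(1)[OF uc UG.G_carrier[OF v]] by simp
  show "tW p (a \<odot>\<^bsub>U_alg sc br\<^esub> u) \<mu> = a \<odot>\<^bsub>WT\<^esub> tW p u \<mu>"
    using l.smult[OF h] W_homog_rules(2)[OF uc] by simp
  show "tW p \<zero>\<^bsub>U_alg sc br\<^esub> \<mu> = \<zero>\<^bsub>WT\<^esub>" using l.zero by (simp add: W_homog_rules)
  show "\<nu> \<in> carrier OM \<Longrightarrow> tW p u (\<mu> \<oplus>\<^bsub>OM\<^esub> \<nu>) = tW p u \<mu> \<oplus>\<^bsub>WT\<^esub> tW p u \<nu>"
    "tW p u (a \<odot>\<^bsub>OM\<^esub> \<mu>) = a \<odot>\<^bsub>WT\<^esub> tW p u \<mu>"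
    "tW p u \<zero>\<^bsub>OM\<^esub> = \<zero>\<^bsub>WT\<^esub>" "tW p u (\<ominus>\<^bsub>OM\<^esub> \<mu>) = \<ominus>\<^bsub>WT\<^esub> tW p u \<mu>"
    using r.add[OF \<mu>] r.smult[OF \<mu>] r.zero r.neg[OF \<mu>] by blast+
qed

lemma tW_finsum_l:
  assumes "\<And>i. i \<in> I \<Longrightarrow> f i \<in> U_grade sc br p" "\<mu> \<in> carrier OM"
  shows "tW p (finsum (U_alg sc br) f I) \<mu> = finsum WT (\<lambda>i. tW p (f i) \<mu>) I"
  using assms
proof (induction I rule: infinite_finite_induct)
  case (insert i I)
  then have "f \<in> I \<rightarrow> carrier (U_alg sc br)" "f i \<in> carrier (U_alg sc br)"
    using UG.G_carrier by blast+
  then show ?case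
    using insert tW_rules(1)[of "f i" p \<mu> "finsum (U_alg sc br) f I"] En.submodule_finsum[OF UG.G_sub, of I f p]
    by (simp add: Pi_def)
qed (simp_all add: tW_rules[OF UG.G_rules(2)])

lemma tW_mult:
  assumes "u \<in> U_grade sc br p" "v \<in> U_grade sc br q" "\<mu> \<in> carrier OM" "\<nu> \<in> carrier OM"
  shows "tW p u \<mu> \<otimes>\<^bsub>WT\<^esub> tW q v \<nu> = tW (p + q) (u \<otimes>\<^bsub>U_alg sc br\<^esub> v) (\<mu> \<otimes>\<^bsub>OM\<^esub> \<nu>)"
  using WA.tn_mult[OF W_homog[OF assms(1)] W_homog[OF assms(2)] assms(3,4)]
  by (simp add: W_homog_mult[OF assms(1,2)])

lemma tS_closed [simp]: "s \<in> Sym_grade sc p \<Longrightarrow> \<mu> \<in> carrier OM \<Longrightarrow> tS p s \<mu> \<in> carrier ST"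
  by (intro SA.tn_closed S_homog)

lemma tS_rules:
  assumes u: "u \<in> Sym_grade sc p" and \<mu>: "\<mu> \<in> carrier OM"
  shows "v \<in> Sym_grade sc p \<Longrightarrow> tS p (u \<oplus>\<^bsub>Sym sc\<^esub> v) \<mu> = tS p u \<mu> \<oplus>\<^bsub>ST\<^esub> tS p v \<mu>"
    "tS p (a \<odot>\<^bsub>Sym sc\<^esub> u) \<mu> = a \<odot>\<^bsub>ST\<^esub> tS p u \<mu>"
    "\<nu> \<in> carrier OM \<Longrightarrow> tS p u (\<mu> \<oplus>\<^bsub>OM\<^esub> \<nu>) = tS p u \<mu> \<oplus>\<^bsub>ST\<^esub> tS p u \<nu>"
    "tS p u (a \<odot>\<^bsub>OM\<^esub> \<mu>) = a \<odot>\<^bsub>ST\<^esub> tS p u \<mu>"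
    "tS p u \<zero>\<^bsub>OM\<^esub> = \<zero>\<^bsub>ST\<^esub>" "tS p \<zero>\<^bsub>Sym sc\<^esub> \<mu> = \<zero>\<^bsub>ST\<^esub>"
    "tS p u (\<ominus>\<^bsub>OM\<^esub> \<mu>) = \<ominus>\<^bsub>ST\<^esub> tS p u \<mu>"
proof -
  have h: "homog (Sym sc) p u \<in> carrier (S_alg sc)" using u by (rule S_homog)
  interpret r: lin OM ST "\<lambda>\<mu>. tS p u \<mu>" using h by (rule SA.lin_tn_r)
  interpret l: lin "S_alg sc" ST "\<lambda>w. tens (S_alg sc) OM w \<mu>" using \<mu> by (rule SA.lin_tn_l)
  note uc = SG.G_carrier[OF u]
  show "tS p (u \<oplus>\<^bsub>Sym sc\<^esub> v) \<mu> = tS p u \<mu> \<oplus>\<^bsub>ST\<^esub> tS p v \<mu>" if v: "v \<in> Sym_grade sc p"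
    using l.add[OF h S_homog[OF v]] S_homog_rules(1)[OF uc SG.G_carrier[OF v]] by simp
  show "tS p (a \<odot>\<^bsub>Sym sc\<^esub> u) \<mu> = a \<odot>\<^bsub>ST\<^esub> tS p u \<mu>"
    using l.smult[OF h] S_homog_rules(2)[OF uc] by simp
  show "tS p \<zero>\<^bsub>Sym sc\<^esub> \<mu> = \<zero>\<^bsub>ST\<^esub>" using l.zero by (simp add: S_homog_rules)
  show "\<nu> \<in> carrier OM \<Longrightarrow> tS p u (\<mu> \<oplus>\<^bsub>OM\<^esub> \<nu>) = tS p u \<mu> \<oplus>\<^bsub>ST\<^esub> tS p u \<nu>"
    "tS p u (a \<odot>\<^bsub>OM\<^esub> \<mu>) = a \<odot>\<^bsub>ST\<^esub> tS p u \<mu>"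
    "tS p u \<zero>\<^bsub>OM\<^esub> = \<zero>\<^bsub>ST\<^esub>" "tS p u (\<ominus>\<^bsub>OM\<^esub> \<mu>) = \<ominus>\<^bsub>ST\<^esub> tS p u \<mu>"
    using r.add[OF \<mu>] r.smult[OF \<mu>] r.zero r.neg[OF \<mu>] by blast+
qed

lemma tS_mult:
  assumes "s \<in> Sym_grade sc p" "t \<in> Sym_grade sc q" "\<mu> \<in> carrier OM" "\<nu> \<in> carrier OM"
  shows "tS p s \<mu> \<otimes>\<^bsub>ST\<^esub> tS q t \<nu> = tS (p + q) (s \<otimes>\<^bsub>Sym sc\<^esub> t) (\<mu> \<otimes>\<^bsub>OM\<^esub> \<nu>)"
  using SA.tn_mult[OF S_homog[OF assms(1)] S_homog[OF assms(2)] assms(3,4)]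
  by (simp add: S_homog_mult[OF assms(1,2)])

lemma U_one_grade [simp]: "\<one>\<^bsub>U_alg sc br\<^esub> \<in> U_grade sc br 0" by (rule UG.G_one)
lemma S_one_grade [simp]: "\<one>\<^bsub>Sym sc\<^esub> \<in> Sym_grade sc 0" by (rule SG.G_one)
lemma OM_one_grade [simp]: "\<one>\<^bsub>OM\<^esub> \<in> OmegaQ sc 0" by (rule OG.G_one)

lemma WT_one: "\<one>\<^bsub>WT\<^esub> = tW 0 \<one>\<^bsub>U_alg sc br\<^esub> \<one>\<^bsub>OM\<^esub>"
  by (simp add: WA.T_one W_simps(6))

lemma inOmega_tW: "inOmega sc br \<mu> = tW 0 \<one>\<^bsub>U_alg sc br\<^esub> \<mu>"
  by (simp add: inOmega_def W_simps(6))

lemma inDer_tW: "inDer sc br X = tW 1 (yU X) \<one>\<^bsub>OM\<^esub>"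
  by (simp add: inDer_def inW_def)

lemma h_W_tW: "h_W sc br = tW 2 hU \<one>\<^bsub>OM\<^esub>"
  by (simp add: h_W_def inW_def)

lemma S_one_tens: "tens (S_alg sc) OM \<one>\<^bsub>S_alg sc\<^esub> \<mu> = tS 0 \<one>\<^bsub>Sym sc\<^esub> \<mu>"
  by (simp add: S_simps(6))

lemma h_W_pow: "h_W sc br [^]\<^bsub>WT\<^esub> (m::nat) = tW (2 * m) (hp m) \<one>\<^bsub>OM\<^esub>"
proof (induction m)
  case 0
  then show ?case by (simp add: pow_simps WT_one)
next
  case (Suc m)
  then show ?case
    using tW_mult[OF hp_grade[of m] hU_grade Om.b_one Om.b_one] by (simp add: pow_simps h_W_tW)
qed

lemma pi_U_W: "w \<in> carrier (W_alg sc br) \<Longrightarrow> (\<lambda>p. pi_U sc (w p)) \<in> carrier (S_alg sc)"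
  by (simp add: S_simps W_simps pi_U_grade)

lemma pi_dag_U_S: "s \<in> carrier (S_alg sc) \<Longrightarrow> (\<lambda>p. pi_dag_U sc br (s p)) \<in> carrier (W_alg sc br)"
  by (simp add: S_simps W_simps pi_dag_grade)

lemma pi_map_lin: "lin_map WT ST (pi_map sc)"
  and pi_map_tens: "w \<in> carrier (W_alg sc br) \<Longrightarrow> \<mu> \<in> carrier OM \<Longrightarrow>
    pi_map sc (tens (W_alg sc br) OM w \<mu>) = tens (S_alg sc) OM (\<lambda>p. pi_U sc (w p)) \<mu>"
proof -
  have b: "WA.bilin ST (\<lambda>w \<mu>. tens (S_alg sc) OM (\<lambda>p. pi_U sc (w p)) \<mu>)"
  proof (rule WA.bilinI)
    fix v w \<mu> \<nu> a assume w: "w \<in> carrier (W_alg sc br)" and \<mu>: "\<mu> \<in> carrier OM"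
    note pw = pi_U_W[OF w]
    show "tens (S_alg sc) OM (\<lambda>p. pi_U sc (w p)) \<mu> \<in> carrier ST"
      using pw \<mu> by (rule SA.tn_closed)
    have "(\<lambda>p. pi_U sc ((a \<odot>\<^bsub>W_alg sc br\<^esub> w) p)) = a \<odot>\<^bsub>S_alg sc\<^esub> (\<lambda>p. pi_U sc (w p))"
      using w by (intro HOL.ext) (simp add: W_simps(3) S_simps(3) W_closed PU.smult)
    then show "tens (S_alg sc) OM (\<lambda>p. pi_U sc ((a \<odot>\<^bsub>W_alg sc br\<^esub> w) p)) \<mu> =
        a \<odot>\<^bsub>ST\<^esub> tens (S_alg sc) OM (\<lambda>p. pi_U sc (w p)) \<mu>"
      using SA.tn_smult_l[OF pw \<mu>] by simp
    show "tens (S_alg sc) OM (\<lambda>p. pi_U sc (w p)) (a \<odot>\<^bsub>OM\<^esub> \<mu>) =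
        a \<odot>\<^bsub>ST\<^esub> tens (S_alg sc) OM (\<lambda>p. pi_U sc (w p)) \<mu>"
      using SA.tn_smult_r[OF pw \<mu>] .
    show "tens (S_alg sc) OM (\<lambda>p. pi_U sc (w p)) (\<mu> \<oplus>\<^bsub>OM\<^esub> \<nu>) =
        tens (S_alg sc) OM (\<lambda>p. pi_U sc (w p)) \<mu> \<oplus>\<^bsub>ST\<^esub> tens (S_alg sc) OM (\<lambda>p. pi_U sc (w p)) \<nu>"
      if "\<nu> \<in> carrier OM"
      using SA.tn_add_r[OF pw \<mu> that] .
    assume v: "v \<in> carrier (W_alg sc br)"
    have "(\<lambda>p. pi_U sc ((w \<oplus>\<^bsub>W_alg sc br\<^esub> v) p)) = (\<lambda>p. pi_U sc (w p)) \<oplus>\<^bsub>S_alg sc\<^esub> (\<lambda>p. pi_U sc (v p))"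
      using w v by (intro HOL.ext) (simp add: W_simps(2) S_simps(2) W_closed PU.add)
    then show "tens (S_alg sc) OM (\<lambda>p. pi_U sc ((w \<oplus>\<^bsub>W_alg sc br\<^esub> v) p)) \<mu> =
        tens (S_alg sc) OM (\<lambda>p. pi_U sc (w p)) \<mu> \<oplus>\<^bsub>ST\<^esub> tens (S_alg sc) OM (\<lambda>p. pi_U sc (v p)) \<mu>"
      using SA.tn_add_l[OF pw pi_U_W[OF v] \<mu>] by simp
  qed
  have eq: "pi_map sc = lin_lift ST (\<lambda>(w, \<mu>). tens (S_alg sc) OM (\<lambda>p. pi_U sc (w p)) \<mu>)"
    by (simp add: pi_map_def fun_eq_iff)
  show "lin_map WT ST (pi_map sc)"
    unfolding eq by (rule WA.lift_bilin(1)[OF SA.T_amod b])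
  show "pi_map sc (tens (W_alg sc br) OM w \<mu>) = tens (S_alg sc) OM (\<lambda>p. pi_U sc (w p)) \<mu>"
    if "w \<in> carrier (W_alg sc br)" "\<mu> \<in> carrier OM"
    unfolding eq by (rule WA.lift_bilin(2)[OF SA.T_amod b that])
qed

lemma pi_dag_lin: "lin_map ST WT (pi_dag sc br)"
  and pi_dag_tens: "s \<in> carrier (S_alg sc) \<Longrightarrow> \<mu> \<in> carrier OM \<Longrightarrow>
    pi_dag sc br (tens (S_alg sc) OM s \<mu>) = tens (W_alg sc br) OM (\<lambda>p. pi_dag_U sc br (s p)) \<mu>"
proof -
  have b: "SA.bilin WT (\<lambda>s \<mu>. tens (W_alg sc br) OM (\<lambda>p. pi_dag_U sc br (s p)) \<mu>)"
  proof (rule SA.bilinI)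
    fix v w \<mu> \<nu> a assume w: "w \<in> carrier (S_alg sc)" and \<mu>: "\<mu> \<in> carrier OM"
    note pw = pi_dag_U_S[OF w]
    show "tens (W_alg sc br) OM (\<lambda>p. pi_dag_U sc br (w p)) \<mu> \<in> carrier WT"
      using pw \<mu> by (rule WA.tn_closed)
    have "(\<lambda>p. pi_dag_U sc br ((a \<odot>\<^bsub>S_alg sc\<^esub> w) p)) = a \<odot>\<^bsub>W_alg sc br\<^esub> (\<lambda>p. pi_dag_U sc br (w p))"
      using w by (intro HOL.ext) (simp add: W_simps(3) S_simps(3) S_closed PD.smult)
    then show "tens (W_alg sc br) OM (\<lambda>p. pi_dag_U sc br ((a \<odot>\<^bsub>S_alg sc\<^esub> w) p)) \<mu> =
        a \<odot>\<^bsub>WT\<^esub> tens (W_alg sc br) OM (\<lambda>p. pi_dag_U sc br (w p)) \<mu>"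
      using WA.tn_smult_l[OF pw \<mu>] by simp
    show "tens (W_alg sc br) OM (\<lambda>p. pi_dag_U sc br (w p)) (a \<odot>\<^bsub>OM\<^esub> \<mu>) =
        a \<odot>\<^bsub>WT\<^esub> tens (W_alg sc br) OM (\<lambda>p. pi_dag_U sc br (w p)) \<mu>"
      using WA.tn_smult_r[OF pw \<mu>] .
    show "tens (W_alg sc br) OM (\<lambda>p. pi_dag_U sc br (w p)) (\<mu> \<oplus>\<^bsub>OM\<^esub> \<nu>) =
        tens (W_alg sc br) OM (\<lambda>p. pi_dag_U sc br (w p)) \<mu> \<oplus>\<^bsub>WT\<^esub> tens (W_alg sc br) OM (\<lambda>p. pi_dag_U sc br (w p)) \<nu>"
      if "\<nu> \<in> carrier OM"
      using WA.tn_add_r[OF pw \<mu> that] .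
    assume v: "v \<in> carrier (S_alg sc)"
    have "(\<lambda>p. pi_dag_U sc br ((w \<oplus>\<^bsub>S_alg sc\<^esub> v) p)) = (\<lambda>p. pi_dag_U sc br (w p)) \<oplus>\<^bsub>W_alg sc br\<^esub> (\<lambda>p. pi_dag_U sc br (v p))"
      using w v by (intro HOL.ext) (simp add: W_simps(2) S_simps(2) S_closed PD.add)
    then show "tens (W_alg sc br) OM (\<lambda>p. pi_dag_U sc br ((w \<oplus>\<^bsub>S_alg sc\<^esub> v) p)) \<mu> =
        tens (W_alg sc br) OM (\<lambda>p. pi_dag_U sc br (w p)) \<mu> \<oplus>\<^bsub>WT\<^esub> tens (W_alg sc br) OM (\<lambda>p. pi_dag_U sc br (v p)) \<mu>"
      using WA.tn_add_l[OF pw pi_dag_U_S[OF v] \<mu>] by simp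
  qed
  have eq: "pi_dag sc br = lin_lift WT (\<lambda>(s, \<mu>). tens (W_alg sc br) OM (\<lambda>p. pi_dag_U sc br (s p)) \<mu>)"
    by (simp add: pi_dag_def fun_eq_iff)
  show "lin_map ST WT (pi_dag sc br)"
    unfolding eq by (rule SA.lift_bilin(1)[OF WA.T_amod b])
  show "pi_dag sc br (tens (S_alg sc) OM s \<mu>) = tens (W_alg sc br) OM (\<lambda>p. pi_dag_U sc br (s p)) \<mu>"
    if "s \<in> carrier (S_alg sc)" "\<mu> \<in> carrier OM"
    unfolding eq by (rule SA.lift_bilin(2)[OF WA.T_amod b that])
qed

lemma lin_pi_map: "lin WT ST (pi_map sc)"
  using pi_map_lin WA.T_amod SA.T_amod by (simp add: lin_def lin_axioms_def)

lemma lin_pi_dag: "lin ST WT (pi_dag sc br)"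
  using pi_dag_lin WA.T_amod SA.T_amod by (simp add: lin_def lin_axioms_def)

sublocale PM: lin WT ST "pi_map sc" by (rule lin_pi_map)
sublocale PG: lin ST WT "pi_dag sc br" by (rule lin_pi_dag)

lemma pi_map_tW: "u \<in> U_grade sc br p \<Longrightarrow> \<mu> \<in> carrier OM \<Longrightarrow> pi_map sc (tW p u \<mu>) = tS p (pi_U sc u) \<mu>"
  by (subst pi_map_tens[OF W_homog]) (auto simp: homog_def PU.zero fun_eq_iff intro!: arg_cong2[of _ _ _ _ "tens (S_alg sc) OM"])

lemma pi_dag_tS: "s \<in> Sym_grade sc p \<Longrightarrow> \<mu> \<in> carrier OM \<Longrightarrow> pi_dag sc br (tS p s \<mu>) = tW p (pi_dag_U sc br s) \<mu>"
  by (subst pi_dag_tens[OF S_homog]) (auto simp: homog_def PD.zero fun_eq_iff intro!: arg_cong2[of _ _ _ _ "tens (W_alg sc br) OM"])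

lemma tau_S_lin: "lin_map ST base_mod tau_S"
  and tau_S_tens: "s \<in> carrier (S_alg sc) \<Longrightarrow> \<mu> \<in> carrier OM \<Longrightarrow>
    tau_S (tens (S_alg sc) OM s \<mu>) = coeff0 (s 0) * coeff0 \<mu>"
proof -
  have b: "SA.bilin base_mod (\<lambda>s \<mu>. coeff0 (s 0) * coeff0 \<mu>)"
    using lin_mapD[OF coeff0_Omega] lin_mapD[OF coeff0_Sym]
    by (intro SA.bilinI) (simp_all add: S_simps(2,3) S_closed algebra_simps)
  show "lin_map ST base_mod tau_S"
    unfolding tau_S_def by (rule SA.lift_bilin(1)[OF base_amod b])
  show "tau_S (tens (S_alg sc) OM s \<mu>) = coeff0 (s 0) * coeff0 \<mu>"
    if "s \<in> carrier (S_alg sc)" "\<mu> \<in> carrier OM"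
    unfolding tau_S_def by (rule SA.lift_bilin(2)[OF base_amod b that])
qed

section \<open>Power series in \<open>h\<close> inside the completed algebra\<close>

lemma h_series_W: "(\<lambda>p. if even p then c (p div 2) \<odot>\<^bsub>U_alg sc br\<^esub> hp (p div 2) else \<zero>\<^bsub>U_alg sc br\<^esub>) \<in> carrier (W_alg sc br)"
proof -
  have "c (p div 2) \<odot>\<^bsub>U_alg sc br\<^esub> hp (p div 2) \<in> U_grade sc br p" if "even p" for p
    using UG.G_rules(4)[OF hp_grade[of "p div 2"], of "c (p div 2)"] that by simp
  then show ?thesis by (simp add: W_simps UG.G_rules(2))
qed

lemma inAh_closed: "inAh sc br c \<in> carrier WT"
  unfolding inAh_def inW_def using h_series_W by (intro WA.tn_closed) auto

lemma inAh_add: "inAh sc br (c + d) = inAh sc br c \<oplus>\<^bsub>WT\<^esub> inAh sc br d"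
proof -
  let ?w = "\<lambda>c p. if even p then fps_nth c (p div 2) \<odot>\<^bsub>U_alg sc br\<^esub> hp (p div 2) else \<zero>\<^bsub>U_alg sc br\<^esub>"
  have "?w (c + d) = ?w c \<oplus>\<^bsub>W_alg sc br\<^esub> ?w d"
    by (intro HOL.ext) (simp add: W_simps(2) En.smult_add_left)
  then show ?thesis
    unfolding inAh_def inW_def using WA.tn_add_l[OF h_series_W h_series_W Om.b_one] by simp
qed

lemma inAh_zero: "inAh sc br 0 = \<zero>\<^bsub>WT\<^esub>"
proof -
  have "inAh sc br 0 \<oplus>\<^bsub>WT\<^esub> inAh sc br 0 = inAh sc br 0 \<oplus>\<^bsub>WT\<^esub> \<zero>\<^bsub>WT\<^esub>"
    using inAh_add[of 0 0] inAh_closed[of 0] by simp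
  then show ?thesis using inAh_closed[of 0] by (simp only: WA.T.M.add.l_cancel WA.T.M.zero_closed)
qed

lemma inAh_power: "inAh sc br (fps_X ^ m) = tW (2 * m) (hp m) \<one>\<^bsub>OM\<^esub>"
proof -
  have "(\<lambda>p. if even p then fps_nth (fps_X ^ m) (p div 2) \<odot>\<^bsub>U_alg sc br\<^esub> hp (p div 2) else \<zero>\<^bsub>U_alg sc br\<^esub>) =
    homog (U_alg sc br) (2 * m) (hp m)"
    by (auto simp: fun_eq_iff homog_def fps_X_power_nth)
  then show ?thesis unfolding inAh_def inW_def by simp
qed

lemma inAh_conv:
  "conv_sum (W_alg sc br) OM
    (\<lambda>p. tW p (if even p then fps_nth c (p div 2) \<odot>\<^bsub>U_alg sc br\<^esub> hp (p div 2) else \<zero>\<^bsub>U_alg sc br\<^esub>) \<one>\<^bsub>OM\<^esub>)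
    (inAh sc br c)"
  unfolding inAh_def inW_def using conv_homog[OF h_series_W Om.b_one, of "fps_nth c"] by simp

section \<open>The Koszul operators\<close>

lemma of_nat_sc: "(of_nat n :: 'a) = sc (of_nat n) 1"
  by (induction n) (simp_all add: scale_left_distrib)

lemma sI_closed [simp]: "finite I \<Longrightarrow> Y ` I \<subseteq> carrier (Der sc) \<Longrightarrow> sI Y I \<in> carrier (U_alg sc br)"
  using UG.G_carrier[OF sI_grade] by blast

text \<open>This is \<open>psum_rec\<close> with the normalizations taken into account: the shorter
  products are divided by the factorial of a size smaller by one, whence the factor
  \<open>card J\<close>.\<close>

lemma sI_rec:
  assumes J: "finite J" and Y: "Y ` J \<subseteq> carrier (Der sc)"
  shows "finsum (U_alg sc br) (\<lambda>x. yU (Y x) \<otimes>\<^bsub>U_alg sc br\<^esub> sI Y (J - {x})) J = of_nat (card J) \<odot>\<^bsub>U_alg sc br\<^esub> sI Y J"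
proof (cases "J = {}")
  case True
  then show ?thesis using sI_closed[OF J Y] by simp
next
  case False
  define n where "n = card J - 1"
  have n: "card J = Suc n" using False J by (simp add: n_def card_gt_0_iff)
  let ?y = "\<lambda>i. yU (Y i)" and ?c = "sc (1 / fact n) 1"
  have y: "?y \<in> J \<rightarrow> carrier (U_alg sc br)" using Y by (rule yU_fun)
  have p: "psum (U_alg sc br) ?y (J - {x}) \<in> carrier (U_alg sc br)" for x
    using y by (intro En.psum_closed) auto
  have "finsum (U_alg sc br) (\<lambda>x. ?y x \<otimes>\<^bsub>U_alg sc br\<^esub> sI Y (J - {x})) J =
    finsum (U_alg sc br) (\<lambda>x. ?c \<odot>\<^bsub>U_alg sc br\<^esub> (?y x \<otimes>\<^bsub>U_alg sc br\<^esub> psum (U_alg sc br) ?y (J - {x}))) J"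
  proof (intro En.M.finsum_cong' refl)
    fix x assume x: "x \<in> J"
    then have "card (J - {x}) = n" using n J by simp
    then show "?y x \<otimes>\<^bsub>U_alg sc br\<^esub> sI Y (J - {x}) = ?c \<odot>\<^bsub>U_alg sc br\<^esub> (?y x \<otimes>\<^bsub>U_alg sc br\<^esub> psum (U_alg sc br) ?y (J - {x}))"
      using p[of x] y x by (simp add: sI_def En.b_smult_r Pi_def)
  qed (use p y in auto)
  also have "\<dots> = ?c \<odot>\<^bsub>U_alg sc br\<^esub> psum (U_alg sc br) ?y J"
    using J False y p by (subst En.smult_finsum[symmetric]) (auto simp: En.psum_rec)
  also have "?c = of_nat (card J) * sc (1 / fact (card J)) 1"
    unfolding of_nat_sc n by (simp add: sc_eq[symmetric] field_simps del: of_nat_Suc)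
  finally show ?thesis
    using En.psum_closed[OF y] by (simp add: sI_def En.smult_mult)
qed

lemma Sym_in_grade: "X \<in> carrier (Der sc) \<Longrightarrow> Sym_in sc X \<in> Sym_grade sc 1"
  using Sym_word_grade[of "[X]"] by (simp add: Sy.wd_single)

lemma Sym_gen_central:
  assumes "s \<in> carrier (Sym sc)" "X \<in> carrier (Der sc)"
  shows "s \<otimes>\<^bsub>Sym sc\<^esub> Sym_in sc X = Sym_in sc X \<otimes>\<^bsub>Sym sc\<^esub> s"
  using assms(1)
proof (induction rule: Sy.word_induct)
  case (word ws a)
  have "Sy.wd ws \<otimes>\<^bsub>Sym sc\<^esub> Sym_in sc X = Sym_in sc X \<otimes>\<^bsub>Sym sc\<^esub> Sy.wd ws"
    using word assms(2) Sym_move[of X ws "[]"] by (simp add: Sy.wd_append Sy.wd_Cons Sy.wd_Nil)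
  then show ?case using word assms(2) by (simp add: Sy.b_smult_l Sy.b_smult_r)
qed (use assms in \<open>simp_all add: Sy.b_l_distr Sy.b_r_distr\<close>)

abbreviation "sY \<nu> \<equiv> Sym_in sc (sharp sc br \<nu>)"

lemma sY_grade: "\<nu> \<in> carrier (Omega1 sc) \<Longrightarrow> sY \<nu> \<in> Sym_grade sc 1"
  by (intro Sym_in_grade Sh.closed)

declare sY_grade [simp] sY_grade [simplified, simp]

lemma form1_closed [simp]: "\<nu> \<in> carrier (Omega1 sc) \<Longrightarrow> form1 sc \<nu> \<in> carrier OM"
  by (rule Om.gen_closed)

lemma DerOmega_sub: "submodule (DerOmega sc) base_mod ST"
  unfolding DerOmega_def using S_homog[OF Sym_in_grade] by (intro SA.tens_part_sub) auto

lemmas DerOmega_rules = SA.T.submoduleD[OF DerOmega_sub]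

lemma DerOmega_closed [simp]: "z \<in> DerOmega sc \<Longrightarrow> z \<in> carrier ST"
  using DerOmega_rules(1) by blast

lemma DerOmega_tS: "X \<in> carrier (Der sc) \<Longrightarrow> \<gamma> \<in> carrier OM \<Longrightarrow> tS 1 (Sym_in sc X) \<gamma> \<in> DerOmega sc"
  unfolding DerOmega_def by (intro SA.tens_part_tn imageI)

declare DerOmega_tS [simplified, intro]

lemma DerOmega_induct [consumes 1, case_names zero add tens]:
  assumes "z \<in> DerOmega sc" "P \<zero>\<^bsub>ST\<^esub>"
    and add: "\<And>x y. x \<in> carrier ST \<Longrightarrow> y \<in> carrier ST \<Longrightarrow> P x \<Longrightarrow> P y \<Longrightarrow> P (x \<oplus>\<^bsub>ST\<^esub> y)"
    and tens: "\<And>X \<gamma>. X \<in> carrier (Der sc) \<Longrightarrow> \<gamma> \<in> carrier OM \<Longrightarrow> P (tS 1 (Sym_in sc X) \<gamma>)"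
  shows "P z"
  using assms(1) unfolding DerOmega_def
proof (induction rule: SA.tens_part_induct)
  case sub1
  then show ?case using S_homog[OF Sym_in_grade] by auto
next
  case (smult a x)
  then obtain X where X: "X \<in> carrier (Der sc)" "x = homog (Sym sc) 1 (Sym_in sc X)" by blast
  have "a \<odot>\<^bsub>S_alg sc\<^esub> x = homog (Sym sc) 1 (Sym_in sc (a \<odot>\<^bsub>Der sc\<^esub> X))"
    using X by (simp add: lin_mapD[OF Sy.gen_lin] S_homog_rules(2))
  then show ?case using X(1) by auto
qed (use assms in auto)

text \<open>If \<open>z \<in> Der A \<otimes> \<Omega>\<^sup>q\<close> is related to \<open>\<kappa>\<close>, then contracting the two factors of \<open>z\<close> by means of \<open>\<flat>\<close> gives
  \<open>\<kappa>\<close>. As a relation, this does not require that \<open>\<sharp>\<close> be injective.\<close>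

inductive euler_rel :: "nat \<Rightarrow> 'a SOm \<Rightarrow> 'a kform \<Rightarrow> bool" for q where
  zero: "euler_rel q \<zero>\<^bsub>ST\<^esub> \<zero>\<^bsub>OM\<^esub>"
| step: "euler_rel q z \<kappa> \<Longrightarrow> \<zeta> \<in> carrier (Omega1 sc) \<Longrightarrow> \<gamma> \<in> OmegaQ sc q \<Longrightarrow>
    euler_rel q (tS 1 (sY \<zeta>) \<gamma> \<oplus>\<^bsub>ST\<^esub> z) (form1 sc \<zeta> \<otimes>\<^bsub>OM\<^esub> \<gamma> \<oplus>\<^bsub>OM\<^esub> \<kappa>)"

lemma euler_rel_closed: "euler_rel q z \<kappa> \<Longrightarrow> z \<in> DerOmega sc \<and> \<kappa> \<in> carrier OM"
  by (induction rule: euler_rel.induct)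
    (auto simp: DerOmega_rules(2) Sh.closed dest: OG.G_carrier intro!: DerOmega_rules(3) DerOmega_tS)

lemma euler_rel_add:
  assumes "euler_rel q z \<kappa>" "euler_rel q z' \<kappa>'"
  shows "euler_rel q (z \<oplus>\<^bsub>ST\<^esub> z') (\<kappa> \<oplus>\<^bsub>OM\<^esub> \<kappa>')"
  using assms(1)
proof (induction rule: euler_rel.induct)
  case zero
  then show ?case using assms(2) euler_rel_closed[OF assms(2)] by simp
next
  case (step z \<kappa> \<zeta> \<gamma>)
  have "z \<in> carrier ST" "\<kappa> \<in> carrier OM" "\<gamma> \<in> carrier OM" "z' \<in> carrier ST" "\<kappa>' \<in> carrier OM"
    using euler_rel_closed[OF step(1)] euler_rel_closed[OF assms(2)] OG.G_carrier[OF step(3)] by simp_all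
  then show ?case using euler_rel.step[OF step.IH step(2,3)] step(2) by (simp add: SA.T.M.a_assoc Om.M.a_assoc)
qed

lemma euler_rel_smult: "euler_rel q z \<kappa> \<Longrightarrow> euler_rel q (a \<odot>\<^bsub>ST\<^esub> z) (a \<odot>\<^bsub>OM\<^esub> \<kappa>)"
proof (induction rule: euler_rel.induct)
  case zero
  then show ?case using euler_rel.zero by simp
next
  case (step z \<kappa> \<zeta> \<gamma>)
  have "z \<in> carrier ST" "\<kappa> \<in> carrier OM" "\<gamma> \<in> carrier OM"
    using euler_rel_closed[OF step(1)] OG.G_carrier[OF step(3)] by simp_all
  then show ?case
    using euler_rel.step[OF step.IH step(2) OG.G_rules(4)[OF step(3)], of a] step(2)
    by (simp add: SA.T.smult_add_right Om.smult_add_right tS_rules Om.b_smult_r)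
qed

text \<open>After multiplication by \<nu>, contraction puts \<zeta> in front of \<nu>. Exchanging
  the two 1-forms costs a sign, which the minus in front of the product cancels; it is the minus of
  the antiderivation rule.\<close>

lemma euler_rel_mult:
  assumes \<nu>: "\<nu> \<in> carrier (Omega1 sc)" and "euler_rel q z \<kappa>"
  shows "euler_rel (Suc q) (\<ominus>\<^bsub>ST\<^esub> (tS 0 \<one>\<^bsub>Sym sc\<^esub> (form1 sc \<nu>) \<otimes>\<^bsub>ST\<^esub> z)) (form1 sc \<nu> \<otimes>\<^bsub>OM\<^esub> \<kappa>)"
  using assms(2)
proof (induction rule: euler_rel.induct)
  case zero
  then show ?case using euler_rel.zero \<nu> by simp
next
  case (step z \<kappa> \<zeta> \<gamma>)
  let ?n = "form1 sc \<nu>" and ?z = "form1 sc \<zeta>"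
  have sz: "sY \<zeta> \<in> Sym_grade sc 1" by (rule sY_grade[OF step(2)])
  have c: "z \<in> carrier ST" "\<kappa> \<in> carrier OM" "\<gamma> \<in> carrier OM" "?n \<in> carrier OM" "?z \<in> carrier OM"
    using euler_rel_closed[OF step(1)] OG.G_carrier[OF step(3)] \<nu> step(2) by simp_all
  have g: "\<ominus>\<^bsub>OM\<^esub> (?n \<otimes>\<^bsub>OM\<^esub> \<gamma>) \<in> OmegaQ sc (Suc q)"
    using OG.G_rules(5)[OF OG.G_mult[OF form1_grade[OF \<nu>] step(3)]] by simp
  have "?z \<otimes>\<^bsub>OM\<^esub> (\<ominus>\<^bsub>OM\<^esub> (?n \<otimes>\<^bsub>OM\<^esub> \<gamma>)) = ?n \<otimes>\<^bsub>OM\<^esub> (?z \<otimes>\<^bsub>OM\<^esub> \<gamma>)"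
    using c form1_anticomm[OF \<nu> step(2)] by (simp add: Om.b_neg_r Om.b_neg_l Om.b_assoc[symmetric])
  moreover have "tS 0 \<one>\<^bsub>Sym sc\<^esub> ?n \<otimes>\<^bsub>ST\<^esub> tS 1 (sY \<zeta>) \<gamma> = tS 1 (sY \<zeta>) (?n \<otimes>\<^bsub>OM\<^esub> \<gamma>)"
    using tS_mult[OF S_one_grade sz, of ?n \<gamma>] c SG.G_carrier[OF sz] by simp
  ultimately show ?case
    using euler_rel.step[OF step.IH step(2) g] c step(2)
    by (simp add: SA.TA.b_r_distr SA.T.M.minus_add Om.b_r_distr tS_rules)
qed

end

section \<open>Formal consequences of the properties that characterize the operators\<close>

locale koszul_maps = symplectic_affine_regular_domain sc br
  for sc :: "'k::field_char_0 \<Rightarrow> 'a::idom \<Rightarrow> 'a" and br +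
  fixes d dt :: "'a WOm \<Rightarrow> 'a WOm" and ds :: "'a kform \<Rightarrow> 'a SOm"
  assumes is_d: "is_delta sc br d" and is_ds: "is_delta_star sc br ds"
    and is_dt: "is_delta_tilde sc br ds dt"
begin

lemmas d_props = is_d[unfolded is_delta_def]
lemmas d_cont = d_props[THEN conjunct2, THEN conjunct1]

lemma d_closed [simp]: "x \<in> carrier WT \<Longrightarrow> d x \<in> carrier WT"
  by (rule funcset_mem[OF d_props[THEN conjunct1]])

lemma d_add: "x \<in> carrier WT \<Longrightarrow> y \<in> carrier WT \<Longrightarrow> d (x \<oplus>\<^bsub>WT\<^esub> y) = d x \<oplus>\<^bsub>WT\<^esub> d y"
  by (rule bspec[OF bspec[OF d_props[THEN conjunct2, THEN conjunct2, THEN conjunct1]]])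

lemma tW_Q: "u \<in> U_grade sc br p \<Longrightarrow> \<mu> \<in> OmegaQ sc q \<Longrightarrow> tW p u \<mu> \<in> WOmegaQ sc br q"
  unfolding WOmegaQ_def by (intro WA.tens_part_tn W_homog)

lemma d_leibniz0:
  assumes "x \<in> WOmegaQ sc br 0" "y \<in> carrier WT"
  shows "d (x \<otimes>\<^bsub>WT\<^esub> y) = d x \<otimes>\<^bsub>WT\<^esub> y \<oplus>\<^bsub>WT\<^esub> x \<otimes>\<^bsub>WT\<^esub> d y"
  using bspec[OF bspec[OF spec[OF d_props[THEN conjunct2, THEN conjunct2, THEN conjunct2, THEN conjunct2, THEN conjunct1]]
    assms(1)] assms(2)] by (simp add: signed_def)

lemma d_Omega:
  assumes "\<mu> \<in> carrier OM"
  shows "d (tW 0 \<one>\<^bsub>U_alg sc br\<^esub> \<mu>) = \<zero>\<^bsub>WT\<^esub>"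
  using bspec[OF d_props[THEN conjunct2, THEN conjunct2, THEN conjunct2, THEN conjunct2, THEN conjunct2, THEN conjunct1] assms]
  by (simp only: inOmega_tW)

lemma d_Y:
  assumes "\<nu> \<in> carrier (Omega1 sc)"
  shows "d (tW 1 (yU (sharp sc br \<nu>)) \<one>\<^bsub>OM\<^esub>) = tW 0 \<one>\<^bsub>U_alg sc br\<^esub> (form1 sc \<nu>)"
  using bspec[OF d_props[THEN conjunct2, THEN conjunct2, THEN conjunct2, THEN conjunct2, THEN conjunct2, THEN conjunct2,
    THEN conjunct2] assms] by (simp only: inOmega_tW inDer_tW)

lemma d_h: "d (tW 2 hU \<one>\<^bsub>OM\<^esub>) = \<zero>\<^bsub>WT\<^esub>"
  using d_props[THEN conjunct2, THEN conjunct2, THEN conjunct2, THEN conjunct2, THEN conjunct2, THEN conjunct2,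
    THEN conjunct1] by (simp only: h_W_tW)

lemma scalar_mult: "x \<in> carrier WT \<Longrightarrow> tW 0 \<one>\<^bsub>U_alg sc br\<^esub> (a \<odot>\<^bsub>OM\<^esub> \<one>\<^bsub>OM\<^esub>) \<otimes>\<^bsub>WT\<^esub> x = a \<odot>\<^bsub>WT\<^esub> x"
  by (simp add: tW_rules WA.TA.b_smult_l WT_one[symmetric])

text \<open>The assumption on \<open>d\<close> is additivity; linearity over the algebra comes from
  the Leibniz rule. A scalar \<open>a\<close> is the 0-form \<open>a \<odot> 1\<close>, which
  \<open>d\<close> kills like every form.\<close>

lemma d_lin: "lin WT WT d"
proof (intro lin.intro lin_axioms.intro WA.T_amod)
  have "d (a \<odot>\<^bsub>WT\<^esub> x) = a \<odot>\<^bsub>WT\<^esub> d x" if x: "x \<in> carrier WT" for a x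
  proof -
    let ?a = "tW 0 \<one>\<^bsub>U_alg sc br\<^esub> (a \<odot>\<^bsub>OM\<^esub> \<one>\<^bsub>OM\<^esub>)"
    have "d (?a \<otimes>\<^bsub>WT\<^esub> x) = d ?a \<otimes>\<^bsub>WT\<^esub> x \<oplus>\<^bsub>WT\<^esub> ?a \<otimes>\<^bsub>WT\<^esub> d x"
      using x OG.G_rules(4)[OF OM_one_grade] by (intro d_leibniz0 tW_Q) auto
    then show ?thesis using x by (simp add: scalar_mult d_Omega)
  qed
  then show "lin_map WT WT d" by (simp add: lin_map_def d_add)
qed

sublocale D: lin WT WT d by (rule d_lin)

lemmas dt_props = is_dt[unfolded is_delta_tilde_def]
lemmas dt_cont = dt_props[THEN conjunct2, THEN conjunct1]

lemma dt_closed [simp]: "x \<in> carrier WT \<Longrightarrow> dt x \<in> carrier WT"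
  by (rule funcset_mem[OF dt_props[THEN conjunct1]])

lemma dt_add: "x \<in> carrier WT \<Longrightarrow> y \<in> carrier WT \<Longrightarrow> dt (x \<oplus>\<^bsub>WT\<^esub> y) = dt x \<oplus>\<^bsub>WT\<^esub> dt y"
  by (rule bspec[OF bspec[OF dt_props[THEN conjunct2, THEN conjunct2, THEN conjunct1]]])

lemma dt_h: "x \<in> carrier WT \<Longrightarrow> dt (inAh sc br c \<otimes>\<^bsub>WT\<^esub> x) = inAh sc br c \<otimes>\<^bsub>WT\<^esub> dt x"
  by (rule bspec[OF spec[OF dt_props[THEN conjunct2, THEN conjunct2, THEN conjunct2, THEN conjunct1]]])

lemma dt_A: "dt (inA sc br a) = \<zero>\<^bsub>WT\<^esub>"
  by (rule spec[OF dt_props[THEN conjunct2, THEN conjunct2, THEN conjunct2, THEN conjunct2, THEN conjunct1]])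

lemma dt_SPQ:
  assumes "x \<in> SdagOmegaPQ sc br p q" "0 < p + q"
  shows "dt x = sc (1 / of_nat (p + q)) 1 \<odot>\<^bsub>WT\<^esub> pi_dag sc br (delta_star_S sc ds (pi_map sc x))"
proof -
  have "(p, q) \<noteq> (0, 0)" using assms(2) by simp
  from bspec[OF mp[OF spec[OF spec[OF dt_props[THEN conjunct2, THEN conjunct2, THEN conjunct2, THEN conjunct2,
    THEN conjunct2], of p], of q] this] assms(1)] show ?thesis .
qed

text \<open>Scalars are the constant power series in \<open>h\<close>, so this is a special case of
  linearity over power series.\<close>

lemma dt_lin: "lin WT WT dt"
proof (intro lin.intro lin_axioms.intro WA.T_amod)
  have "dt (a \<odot>\<^bsub>WT\<^esub> x) = a \<odot>\<^bsub>WT\<^esub> dt x" if x: "x \<in> carrier WT" for a x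
  proof -
    have "(\<lambda>p. if even p then fps_nth (fps_const a) (p div 2) \<odot>\<^bsub>U_alg sc br\<^esub> hp (p div 2) else \<zero>\<^bsub>U_alg sc br\<^esub>) =
      homog (U_alg sc br) 0 (a \<odot>\<^bsub>U_alg sc br\<^esub> \<one>\<^bsub>U_alg sc br\<^esub>)"
      by (auto simp: fun_eq_iff homog_def pow_simps)
    then have "inAh sc br (fps_const a) = a \<odot>\<^bsub>WT\<^esub> \<one>\<^bsub>WT\<^esub>"
      by (simp add: inAh_def inW_def tW_rules WT_one)
    then show ?thesis using dt_h[OF x, of "fps_const a"] x by (simp add: WA.TA.b_smult_l)
  qed
  then show "lin_map WT WT dt" by (simp add: lin_map_def dt_add)
qed

sublocale DT: lin WT WT dt by (rule dt_lin)

lemma tW_split: "u \<in> U_grade sc br p \<Longrightarrow> \<mu> \<in> carrier OM \<Longrightarrow>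
  tW p u \<one>\<^bsub>OM\<^esub> \<otimes>\<^bsub>WT\<^esub> tW 0 \<one>\<^bsub>U_alg sc br\<^esub> \<mu> = tW p u \<mu>"
  using tW_mult[of u p "\<one>\<^bsub>U_alg sc br\<^esub>" 0 "\<one>\<^bsub>OM\<^esub>" \<mu>] UG.G_carrier[of u p] by simp

text \<open>The form is split off as a right factor, where \<open>d\<close> kills it; the left
  factor has form degree 0, so no sign arises.\<close>

lemma d_tW: "u \<in> U_grade sc br p \<Longrightarrow> \<mu> \<in> carrier OM \<Longrightarrow>
  d (tW p u \<mu>) = d (tW p u \<one>\<^bsub>OM\<^esub>) \<otimes>\<^bsub>WT\<^esub> tW 0 \<one>\<^bsub>U_alg sc br\<^esub> \<mu>"
  using d_leibniz0[OF tW_Q[of u p "\<one>\<^bsub>OM\<^esub>" 0], of "tW 0 \<one>\<^bsub>U_alg sc br\<^esub> \<mu>"]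
  by (simp add: tW_split d_Omega)

abbreviation "hW m \<equiv> tW (2 * m) (hp m) \<one>\<^bsub>OM\<^esub>"

lemma hW_closed [simp]: "hW m \<in> carrier WT"
  by (intro tW_closed hp_grade) simp

lemma d_hW: "d (hW m) = \<zero>\<^bsub>WT\<^esub>"
proof (induction m)
  case 0
  then show ?case using d_Omega[of "\<one>\<^bsub>OM\<^esub>"] by (simp add: pow_simps)
next
  case (Suc m)
  have eq: "hW (Suc m) = hW m \<otimes>\<^bsub>WT\<^esub> tW 2 hU \<one>\<^bsub>OM\<^esub>"
    using tW_mult[OF hp_grade[of m] hU_grade, of "\<one>\<^bsub>OM\<^esub>" "\<one>\<^bsub>OM\<^esub>"] by (simp add: pow_simps)
  show ?case
    unfolding eq using d_leibniz0[OF tW_Q[OF hp_grade OM_one_grade], of "tW 2 hU \<one>\<^bsub>OM\<^esub>" m] Suc hU_grade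
    by (simp add: d_h)
qed

lemma d_hW_mult: "x \<in> carrier WT \<Longrightarrow> d (hW m \<otimes>\<^bsub>WT\<^esub> x) = hW m \<otimes>\<^bsub>WT\<^esub> d x"
  using d_leibniz0[OF tW_Q[OF hp_grade OM_one_grade], of x m] by (simp add: d_hW)

lemma dt_hW_mult: "x \<in> carrier WT \<Longrightarrow> dt (hW m \<otimes>\<^bsub>WT\<^esub> x) = hW m \<otimes>\<^bsub>WT\<^esub> dt x"
  using dt_h[of x "fps_X ^ m"] by (simp add: inAh_power)

text \<open>\<open>\<delta>\<close> commutes with symmetrization: it is the Koszul differential on symmetrized products.\<close>

lemma d_sI:
  assumes "finite I" "\<eta> ` I \<subseteq> carrier (Omega1 sc)"
  shows "d (tW (card I) (sI (\<lambda>i. sharp sc br (\<eta> i)) I) \<one>\<^bsub>OM\<^esub>) =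
    finsum WT (\<lambda>x. tW (card I - 1) (sI (\<lambda>i. sharp sc br (\<eta> i)) (I - {x})) (form1 sc (\<eta> x))) I"
  using assms
proof (induction "card I" arbitrary: I)
  case 0
  then show ?case using d_Omega[of "\<one>\<^bsub>OM\<^esub>"] by (simp add: sI_empty)
next
  case (Suc m)
  note I = Suc.prems
  have cI: "card I = Suc m" using Suc.hyps(2) by simp
  let ?Y = "\<lambda>i. sharp sc br (\<eta> i)" and ?e = "\<lambda>x. form1 sc (\<eta> x)"
  have Y: "?Y ` J \<subseteq> carrier (Der sc)" if "J \<subseteq> I" for J using I that Sh.closed by auto
  have e: "?e x \<in> carrier OM" if "x \<in> I" for x using I that by auto
  have g: "sI ?Y J \<in> U_grade sc br (card J)" if "J \<subseteq> I" for J
    using that I(1) Y by (intro sI_grade) (auto intro: finite_subset)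
  have cx: "card (I - {x}) = m" if "x \<in> I" for x using that cI I(1) by simp
  have gx: "sI ?Y (I - {x}) \<in> U_grade sc br m" if "x \<in> I" for x using g[of "I - {x}"] cx[OF that] by auto
  have y: "yU (?Y x) \<in> U_grade sc br 1" if "x \<in> I" for x using I that by (intro yU_grade Sh.closed) auto
  have gxz: "yU (?Y x) \<otimes>\<^bsub>U_alg sc br\<^esub> sI ?Y (I - {x} - {z}) \<in> U_grade sc br m" if "x \<in> I" "z \<in> I" "z \<noteq> x" for x z
  proof -
    have "card (I - {x} - {z}) = m - 1" using that cx[of x] I(1) by simp
    moreover have "z \<in> I - {x}" using that by simp
    then have "card (I - {x}) \<noteq> 0" using I(1) by (metis card_0_eq empty_iff finite_Diff)
    then have "0 < m" unfolding cx[OF that(1)] by simp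
    ultimately show ?thesis using UG.G_mult[OF y[OF that(1)] g[of "I - {x} - {z}"]] by auto
  qed
  \<comment> \<open>\<open>f x z\<close> is the part of the derivative with first factor
    \<open>x\<close> in which a later factor \<open>z\<close> is differentiated, and
    \<open>b x\<close> the part in which the first factor itself is. The diagonal of
    \<open>f\<close> is set to 0 so that both indices range over all of \<open>I\<close>.\<close>
  define f where "f x z = (if z = x then \<zero>\<^bsub>WT\<^esub> else tW m (yU (?Y x) \<otimes>\<^bsub>U_alg sc br\<^esub> sI ?Y (I - {x} - {z})) (?e z))" for x z
  define b where "b x = tW m (sI ?Y (I - {x})) (?e x)" for x
  have fc: "f x z \<in> carrier WT" if "x \<in> I" "z \<in> I" for x z
    using that gxz e by (simp add: f_def)
  have bc: "b x \<in> carrier WT" if "x \<in> I" for x using gx e that by (simp add: b_def)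
  have one: "d (tW (Suc m) (yU (?Y x) \<otimes>\<^bsub>U_alg sc br\<^esub> sI ?Y (I - {x})) \<one>\<^bsub>OM\<^esub>) = b x \<oplus>\<^bsub>WT\<^esub> finsum WT (f x) I"
    if x: "x \<in> I" for x
  proof -
    let ?q = "sI ?Y (I - {x})"
    have "tW (Suc m) (yU (?Y x) \<otimes>\<^bsub>U_alg sc br\<^esub> ?q) \<one>\<^bsub>OM\<^esub> = tW 1 (yU (?Y x)) \<one>\<^bsub>OM\<^esub> \<otimes>\<^bsub>WT\<^esub> tW m ?q \<one>\<^bsub>OM\<^esub>"
      using tW_mult[OF y[OF x] gx[OF x], of "\<one>\<^bsub>OM\<^esub>" "\<one>\<^bsub>OM\<^esub>"] by simp
    then have "d (tW (Suc m) (yU (?Y x) \<otimes>\<^bsub>U_alg sc br\<^esub> ?q) \<one>\<^bsub>OM\<^esub>) =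
      tW 0 \<one>\<^bsub>U_alg sc br\<^esub> (?e x) \<otimes>\<^bsub>WT\<^esub> tW m ?q \<one>\<^bsub>OM\<^esub> \<oplus>\<^bsub>WT\<^esub> tW 1 (yU (?Y x)) \<one>\<^bsub>OM\<^esub> \<otimes>\<^bsub>WT\<^esub> d (tW m ?q \<one>\<^bsub>OM\<^esub>)"
      using d_leibniz0[OF tW_Q[OF y[OF x] OM_one_grade], of "tW m ?q \<one>\<^bsub>OM\<^esub>"] gx[OF x] x I(2) d_Y[of "\<eta> x"] by auto
    also have "tW 0 \<one>\<^bsub>U_alg sc br\<^esub> (?e x) \<otimes>\<^bsub>WT\<^esub> tW m ?q \<one>\<^bsub>OM\<^esub> = b x"
      using tW_mult[OF U_one_grade gx[OF x] e[OF x] Om.b_one] e[OF x] UG.G_carrier[OF gx[OF x]] by (simp add: b_def)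
    also have "d (tW m ?q \<one>\<^bsub>OM\<^esub>) = finsum WT (\<lambda>z. tW (m - 1) (sI ?Y (I - {x} - {z})) (?e z)) (I - {x})"
      using Suc.hyps(1)[of "I - {x}"] cx[OF x] I by auto
    also have "tW 1 (yU (?Y x)) \<one>\<^bsub>OM\<^esub> \<otimes>\<^bsub>WT\<^esub> \<dots> =
      finsum WT (\<lambda>z. tW 1 (yU (?Y x)) \<one>\<^bsub>OM\<^esub> \<otimes>\<^bsub>WT\<^esub> tW (m - 1) (sI ?Y (I - {x} - {z})) (?e z)) (I - {x})"
    proof (rule WA.TA.b_finsum_r)
      show "(\<lambda>z. tW (m - 1) (sI ?Y (I - {x} - {z})) (?e z)) \<in> I - {x} \<rightarrow> carrier WT"
      proof
        fix z assume z: "z \<in> I - {x}"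
        then have c: "card (I - {x} - {z}) = m - 1" using cx[OF x] I(1) by simp
        have "I - {x} - {z} \<subseteq> I" by auto
        from g[OF this] show "tW (m - 1) (sI ?Y (I - {x} - {z})) (?e z) \<in> carrier WT"
          unfolding c using e z by (intro tW_closed) auto
      qed
    qed (use y[OF x] in simp)
    also have "\<dots> = finsum WT (f x) I"
    proof (rule WA.T.M.add.finprod_mono_neutral_cong_left)
      fix z assume z: "z \<in> I - {x}"
      then have "card (I - {x}) \<noteq> 0" using I(1) by (metis card_0_eq empty_iff finite_Diff)
      then have "0 < m" unfolding cx[OF x] by simp
      moreover have "card (I - {x} - {z}) = m - 1" using z cx[OF x] I(1) by simp
      ultimately have c: "card (I - {x} - {z}) = m - 1" "0 < m" by simp_all
      then have gg: "sI ?Y (I - {x} - {z}) \<in> U_grade sc br (m - 1)"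
        using g[of "I - {x} - {z}"] unfolding c(1) by blast
      show "tW 1 (yU (?Y x)) \<one>\<^bsub>OM\<^esub> \<otimes>\<^bsub>WT\<^esub> tW (m - 1) (sI ?Y (I - {x} - {z})) (?e z) = f x z"
        using tW_mult[OF y[OF x] gg Om.b_one e[of z]] z c e[of z] by (simp add: f_def)
    qed (use I(1) x fc in \<open>auto simp: f_def\<close>)
    finally show ?thesis .
  qed
  \<comment> \<open>For fixed \<open>z\<close>, summing over the first factor \<open>x\<close>
    rebuilds, by \<open>sI_rec\<close>, the symmetrized product without \<open>z\<close>, namely
    \<open>m\<close> times. With the one copy in \<open>b z\<close> this makes \<open>m + 1\<close>,
    which cancels the factor 1/(m + 1) of the recursion.\<close>
  have fz: "finsum WT (\<lambda>x. f x z) I = of_nat m \<odot>\<^bsub>WT\<^esub> b z" if z: "z \<in> I" for z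
  proof -
    have "finsum WT (\<lambda>x. f x z) I =
      finsum WT (\<lambda>x. tW m (yU (?Y x) \<otimes>\<^bsub>U_alg sc br\<^esub> sI ?Y (I - {z} - {x})) (?e z)) (I - {z})"
    proof (rule WA.T.M.add.finprod_mono_neutral_cong_right)
      fix x assume "x \<in> I - {z}"
      moreover have "I - {x} - {z} = I - {z} - {x}" by auto
      ultimately show "f x z = tW m (yU (?Y x) \<otimes>\<^bsub>U_alg sc br\<^esub> sI ?Y (I - {z} - {x})) (?e z)"
        by (auto simp: f_def)
    qed (use I(1) z fc in \<open>auto simp: f_def\<close>)
    also have "\<dots> = tW m (finsum (U_alg sc br) (\<lambda>x. yU (?Y x) \<otimes>\<^bsub>U_alg sc br\<^esub> sI ?Y (I - {z} - {x})) (I - {z})) (?e z)"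
    proof (rule tW_finsum_l[symmetric])
      fix x assume x: "x \<in> I - {z}"
      moreover have "I - {x} - {z} = I - {z} - {x}" by auto
      ultimately show "yU (?Y x) \<otimes>\<^bsub>U_alg sc br\<^esub> sI ?Y (I - {z} - {x}) \<in> U_grade sc br m"
        using gxz[of x z] z by auto
    qed (rule e[OF z])
    also have "finsum (U_alg sc br) (\<lambda>x. yU (?Y x) \<otimes>\<^bsub>U_alg sc br\<^esub> sI ?Y (I - {z} - {x})) (I - {z}) =
      of_nat m \<odot>\<^bsub>U_alg sc br\<^esub> sI ?Y (I - {z})"
      using sI_rec[of "I - {z}" ?Y] I(1) Y[of "I - {z}"] cx[OF z] by auto
    finally show ?thesis using gx[OF z] e[OF z] by (simp add: tW_rules b_def)
  qed
  let ?c = "sc (1 / of_nat (Suc m)) 1"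
  have inv: "?c * of_nat (Suc m) = 1" by (rule sc_inverse_of_nat) simp
  have gs: "yU (?Y x) \<otimes>\<^bsub>U_alg sc br\<^esub> sI ?Y (I - {x}) \<in> U_grade sc br (Suc m)" if "x \<in> I" for x
    using UG.G_mult[OF y[OF that] gx[OF that]] by simp
  have sIc: "sI ?Y I \<in> carrier (U_alg sc br)" using I(1) Y[of I] by simp
  have "sI ?Y I = ?c \<odot>\<^bsub>U_alg sc br\<^esub> finsum (U_alg sc br) (\<lambda>x. yU (?Y x) \<otimes>\<^bsub>U_alg sc br\<^esub> sI ?Y (I - {x})) I"
    using sI_rec[OF I(1) Y[OF order_refl]] cI inv sIc by (simp add: En.smult_mult[symmetric] del: of_nat_Suc)
  moreover have "finsum (U_alg sc br) (\<lambda>x. yU (?Y x) \<otimes>\<^bsub>U_alg sc br\<^esub> sI ?Y (I - {x})) I \<in> U_grade sc br (Suc m)"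
    using gs by (rule En.submodule_finsum[OF UG.G_sub])
  ultimately have "tW (Suc m) (sI ?Y I) \<one>\<^bsub>OM\<^esub> =
    ?c \<odot>\<^bsub>WT\<^esub> finsum WT (\<lambda>x. tW (Suc m) (yU (?Y x) \<otimes>\<^bsub>U_alg sc br\<^esub> sI ?Y (I - {x})) \<one>\<^bsub>OM\<^esub>) I"
    using gs by (simp only: tW_rules(2) tW_finsum_l Om.b_one)
  moreover have "(\<lambda>x. tW (Suc m) (yU (?Y x) \<otimes>\<^bsub>U_alg sc br\<^esub> sI ?Y (I - {x})) \<one>\<^bsub>OM\<^esub>) \<in> I \<rightarrow> carrier WT"
    using gs by auto
  ultimately have "d (tW (Suc m) (sI ?Y I) \<one>\<^bsub>OM\<^esub>) =
    ?c \<odot>\<^bsub>WT\<^esub> finsum WT (\<lambda>x. d (tW (Suc m) (yU (?Y x) \<otimes>\<^bsub>U_alg sc br\<^esub> sI ?Y (I - {x})) \<one>\<^bsub>OM\<^esub>)) I"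
    by (simp add: D.smult D.finsum WA.T.M.finsum_closed)
  also have "finsum WT (\<lambda>x. d (tW (Suc m) (yU (?Y x) \<otimes>\<^bsub>U_alg sc br\<^esub> sI ?Y (I - {x})) \<one>\<^bsub>OM\<^esub>)) I =
    finsum WT (\<lambda>x. b x \<oplus>\<^bsub>WT\<^esub> finsum WT (f x) I) I"
    using one bc fc by (intro WA.T.M.finsum_cong') (auto intro!: WA.T.M.a_closed WA.T.M.finsum_closed)
  also have "\<dots> = finsum WT b I \<oplus>\<^bsub>WT\<^esub> finsum WT (\<lambda>x. finsum WT (f x) I) I"
    using bc fc by (intro WA.T.M.finsum_addf) (auto intro!: WA.T.M.finsum_closed)
  also have "finsum WT (\<lambda>x. finsum WT (f x) I) I = finsum WT (\<lambda>z. finsum WT (\<lambda>x. f x z) I) I"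
    using I(1) fc by (intro WA.T.finsum_swap) auto
  also have "\<dots> = finsum WT (\<lambda>z. of_nat m \<odot>\<^bsub>WT\<^esub> b z) I"
    using fz bc by (intro WA.T.M.finsum_cong') auto
  also have "\<dots> = of_nat m \<odot>\<^bsub>WT\<^esub> finsum WT b I"
    using I(1) bc by (intro WA.T.smult_finsum[symmetric]) auto
  finally have "d (tW (Suc m) (sI ?Y I) \<one>\<^bsub>OM\<^esub>) = ?c \<odot>\<^bsub>WT\<^esub> (of_nat (Suc m) \<odot>\<^bsub>WT\<^esub> finsum WT b I)"
    using bc by (simp add: WA.T.smult_add_left WA.T.M.finsum_closed Pi_def)
  also have "\<dots> = finsum WT b I"
    using bc inv by (simp add: WA.T.smult_mult[symmetric] WA.T.M.finsum_closed Pi_def del: of_nat_Suc)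
  finally show ?case unfolding cI b_def by simp
qed

lemma d_sI_mult:
  assumes I: "finite I" "\<eta> ` I \<subseteq> carrier (Omega1 sc)" and \<mu>: "\<mu> \<in> carrier OM"
  shows "d (tW (card I) (sI (\<lambda>i. sharp sc br (\<eta> i)) I) \<mu>) =
    finsum WT (\<lambda>x. tW (card I - 1) (sI (\<lambda>i. sharp sc br (\<eta> i)) (I - {x})) (form1 sc (\<eta> x) \<otimes>\<^bsub>OM\<^esub> \<mu>)) I"
proof -
  let ?Y = "\<lambda>i. sharp sc br (\<eta> i)"
  have Y: "?Y ` J \<subseteq> carrier (Der sc)" if "J \<subseteq> I" for J using I that Sh.closed by auto
  have g: "sI ?Y (I - {x}) \<in> U_grade sc br (card I - 1)" and e: "form1 sc (\<eta> x) \<in> carrier OM" if "x \<in> I" for x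
    using sI_grade[of "I - {x}" ?Y] I Y[of "I - {x}"] that by auto
  have "d (tW (card I) (sI ?Y I) \<mu>) =
    finsum WT (\<lambda>x. tW (card I - 1) (sI ?Y (I - {x})) (form1 sc (\<eta> x))) I \<otimes>\<^bsub>WT\<^esub> tW 0 \<one>\<^bsub>U_alg sc br\<^esub> \<mu>"
    using I Y[of I] \<mu> by (subst d_tW) (auto simp: d_sI intro!: sI_grade)
  also have "\<dots> = finsum WT (\<lambda>x. tW (card I - 1) (sI ?Y (I - {x})) (form1 sc (\<eta> x)) \<otimes>\<^bsub>WT\<^esub> tW 0 \<one>\<^bsub>U_alg sc br\<^esub> \<mu>) I"
    using \<mu> g e by (intro WA.TA.b_finsum_l) auto
  also have "\<dots> = finsum WT (\<lambda>x. tW (card I - 1) (sI ?Y (I - {x})) (form1 sc (\<eta> x) \<otimes>\<^bsub>OM\<^esub> \<mu>)) I"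
  proof (intro WA.T.M.finsum_cong' refl)
    fix x assume x: "x \<in> I"
    show "tW (card I - 1) (sI ?Y (I - {x})) (form1 sc (\<eta> x)) \<otimes>\<^bsub>WT\<^esub> tW 0 \<one>\<^bsub>U_alg sc br\<^esub> \<mu> =
      tW (card I - 1) (sI ?Y (I - {x})) (form1 sc (\<eta> x) \<otimes>\<^bsub>OM\<^esub> \<mu>)"
      using tW_mult[OF g[OF x] U_one_grade e[OF x] \<mu>] UG.G_carrier[OF g[OF x]] by simp
  qed (use g e \<mu> in auto)
  finally show ?thesis .
qed

section \<open>The antiderivation on forms and its extension to the symmetric algebra\<close>

abbreviation "DS \<equiv> delta_star_S sc ds"
abbreviation "f1 \<nu> \<equiv> tS 0 \<one>\<^bsub>Sym sc\<^esub> (form1 sc \<nu>)"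

lemmas ds_props = is_ds[unfolded is_delta_star_def]

lemma ds_DerOmega [simp]: "\<mu> \<in> carrier OM \<Longrightarrow> ds \<mu> \<in> DerOmega sc"
  by (rule funcset_mem[OF ds_props[THEN conjunct1]])

lemma ds_lin: "lin OM ST ds"
proof (intro lin.intro lin_axioms.intro SA.T_amod Om.amod_axioms)
  show "lin_map OM ST ds"
    unfolding lin_map_def
    using ds_props[THEN conjunct2, THEN conjunct1] ds_props[THEN conjunct2, THEN conjunct2, THEN conjunct1]
    by (simp add: DerOmega_closed)
qed

sublocale DSt: lin OM ST ds by (rule ds_lin)

lemma ds_form1: "\<nu> \<in> carrier (Omega1 sc) \<Longrightarrow> ds (form1 sc \<nu>) = tS 1 (sY \<nu>) \<one>\<^bsub>OM\<^esub>"
  by (rule bspec[OF ds_props[THEN conjunct2, THEN conjunct2, THEN conjunct2, THEN conjunct1]])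

lemma ds_leibniz:
  assumes "\<alpha> \<in> OmegaQ sc q" "\<beta> \<in> carrier OM"
  shows "ds (\<alpha> \<otimes>\<^bsub>OM\<^esub> \<beta>) = ds \<alpha> \<otimes>\<^bsub>ST\<^esub> tS 0 \<one>\<^bsub>Sym sc\<^esub> \<beta> \<oplus>\<^bsub>ST\<^esub>
    signed ST q (tS 0 \<one>\<^bsub>Sym sc\<^esub> \<alpha> \<otimes>\<^bsub>ST\<^esub> ds \<beta>)"
  using bspec[OF bspec[OF spec[OF ds_props[THEN conjunct2, THEN conjunct2, THEN conjunct2, THEN conjunct2]] assms(1)] assms(2)]
  by (simp only: S_one_tens)

lemma S_one_one: "tS 0 \<one>\<^bsub>Sym sc\<^esub> \<one>\<^bsub>OM\<^esub> = \<one>\<^bsub>ST\<^esub>"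
  by (simp add: SA.T_one S_simps(6))

lemma ds_one: "ds \<one>\<^bsub>OM\<^esub> = \<zero>\<^bsub>ST\<^esub>"
proof -
  have c: "ds \<one>\<^bsub>OM\<^esub> \<in> carrier ST" by (simp add: DSt.closed)
  have "ds \<one>\<^bsub>OM\<^esub> \<oplus>\<^bsub>ST\<^esub> ds \<one>\<^bsub>OM\<^esub> = ds \<one>\<^bsub>OM\<^esub> \<oplus>\<^bsub>ST\<^esub> \<zero>\<^bsub>ST\<^esub>"
    using ds_leibniz[OF OM_one_grade Om.b_one] c by (simp add: signed_def S_one_one)
  then show ?thesis using c by (simp only: SA.T.M.add.l_cancel SA.T.M.zero_closed)
qed

lemma DS_lin: "lin_map ST ST DS"
  and DS_tens: "s \<in> carrier (S_alg sc) \<Longrightarrow> \<nu> \<in> carrier OM \<Longrightarrow>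
    DS (tens (S_alg sc) OM s \<nu>) = tens (S_alg sc) OM s \<one>\<^bsub>OM\<^esub> \<otimes>\<^bsub>ST\<^esub> ds \<nu>"
proof -
  have b: "SA.bilin ST (\<lambda>s \<nu>. tens (S_alg sc) OM s \<one>\<^bsub>OM\<^esub> \<otimes>\<^bsub>ST\<^esub> ds \<nu>)"
    by (intro SA.bilinI)
      (simp_all add: DSt.closed DSt.add DSt.smult SA.tn_add_l SA.tn_smult_l SA.TA.b_l_distr SA.TA.b_r_distr
        SA.TA.b_smult_l SA.TA.b_smult_r SA.tn_closed)
  show "lin_map ST ST DS"
    unfolding delta_star_S_def by (rule SA.lift_bilin(1)[OF SA.T_amod b])
  show "DS (tens (S_alg sc) OM s \<nu>) = tens (S_alg sc) OM s \<one>\<^bsub>OM\<^esub> \<otimes>\<^bsub>ST\<^esub> ds \<nu>"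
    if "s \<in> carrier (S_alg sc)" "\<nu> \<in> carrier OM"
    unfolding delta_star_S_def by (rule SA.lift_bilin(2)[OF SA.T_amod b that])
qed

lemma lin_DS: "lin ST ST DS"
  using DS_lin SA.T_amod by (simp add: lin_def lin_axioms_def)

sublocale DS: lin ST ST DS by (rule lin_DS)

lemma DS_tS: "s \<in> Sym_grade sc p \<Longrightarrow> \<nu> \<in> carrier OM \<Longrightarrow> DS (tS p s \<nu>) = tS p s \<one>\<^bsub>OM\<^esub> \<otimes>\<^bsub>ST\<^esub> ds \<nu>"
  by (rule DS_tens[OF S_homog])

text \<open>\<open>DerOmega sc\<close> is spanned by pure tensors with a derivation as first factor.
  For homogeneous pure tensors the claim is associativity in the symmetric algebra and in the
  forms.\<close>

lemma tS_assoc: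
  assumes "s \<in> Sym_grade sc p" "t \<in> Sym_grade sc q" "\<mu> \<in> carrier OM" "\<nu> \<in> carrier OM" "z \<in> DerOmega sc"
  shows "(tS p s \<mu> \<otimes>\<^bsub>ST\<^esub> tS q t \<nu>) \<otimes>\<^bsub>ST\<^esub> z = tS p s \<mu> \<otimes>\<^bsub>ST\<^esub> (tS q t \<nu> \<otimes>\<^bsub>ST\<^esub> z)"
  using assms(5)
proof (induction rule: DerOmega_induct)
  case zero
  then show ?case using assms(1-4) by simp
next
  case (add x y)
  then show ?case using assms(1-4) by (simp add: SA.TA.b_r_distr)
next
  case (tens X \<gamma>)
  note X = Sym_in_grade[OF tens(1)]
  note g = SG.G_mult[OF assms(1,2)] SG.G_mult[OF assms(2) X]
  show ?case
    using assms(1-4) tens X g SG.G_carrier[OF X] SG.G_carrier[OF assms(1)] SG.G_carrier[OF assms(2)]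
    by (simp only: tS_mult Om.b_closed Sy.b_assoc Om.b_assoc add.assoc)
qed

lemma tS_mult_z_closed [simp]:
  "s \<in> Sym_grade sc p \<Longrightarrow> \<mu> \<in> carrier OM \<Longrightarrow> z \<in> carrier ST \<Longrightarrow> tS p s \<mu> \<otimes>\<^bsub>ST\<^esub> z \<in> carrier ST"
  by (intro SA.TA.b_closed tS_closed)

text \<open>\<open>DS\<close> acts on the form factor, so multiplication by symmetric tensors from
  the left passes through it; on pure tensors this is \<open>tS_assoc\<close>.\<close>

lemma DS_mult:
  assumes s: "s \<in> Sym_grade sc p" and "z \<in> DerOmega sc"
  shows "DS (tS p s \<one>\<^bsub>OM\<^esub> \<otimes>\<^bsub>ST\<^esub> z) = tS p s \<one>\<^bsub>OM\<^esub> \<otimes>\<^bsub>ST\<^esub> DS z"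
  using assms(2)
proof (induction rule: DerOmega_induct)
  case zero
  then show ?case using s by (simp add: DS.zero)
next
  case (add x y)
  then show ?case using s by (simp add: SA.TA.b_r_distr DS.add DS.closed)
next
  case (tens X \<gamma>)
  note X = Sym_in_grade[OF tens(1)]
  have "DS (tS p s \<one>\<^bsub>OM\<^esub> \<otimes>\<^bsub>ST\<^esub> tS 1 (Sym_in sc X) \<gamma>) = (tS p s \<one>\<^bsub>OM\<^esub> \<otimes>\<^bsub>ST\<^esub> tS 1 (Sym_in sc X) \<one>\<^bsub>OM\<^esub>) \<otimes>\<^bsub>ST\<^esub> ds \<gamma>"
    using s X tens(2) SG.G_mult[OF s X] by (simp only: tS_mult Om.b_one Om.b_l_one DS_tS)
  then show ?case using s X tens(2) by (simp only: tS_assoc Om.b_one ds_DerOmega DS_tS)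
qed

text \<open>The antiderivation rule for a leading 1-form. Its minus sign is the origin of both
  cancellations: in the square of delta-tilde, and between the mixed terms of the two
  products.\<close>

lemma ds_mult:
  assumes \<nu>: "\<nu> \<in> carrier (Omega1 sc)" and \<beta>: "\<beta> \<in> carrier OM"
  shows "ds (form1 sc \<nu> \<otimes>\<^bsub>OM\<^esub> \<beta>) = tS 1 (sY \<nu>) \<beta> \<ominus>\<^bsub>ST\<^esub> f1 \<nu> \<otimes>\<^bsub>ST\<^esub> ds \<beta>"
proof -
  note g = sY_grade[OF \<nu>]
  have "tS 1 (sY \<nu>) \<one>\<^bsub>OM\<^esub> \<otimes>\<^bsub>ST\<^esub> tS 0 \<one>\<^bsub>Sym sc\<^esub> \<beta> = tS 1 (sY \<nu>) \<beta>"
    using tS_mult[OF g S_one_grade Om.b_one \<beta>] \<beta> SG.G_carrier[OF g] by simp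
  then show ?thesis
    using ds_leibniz[OF form1_grade[OF \<nu>] \<beta>] \<nu> by (simp only: ds_form1 signed_def a_minus_def) simp
qed

text \<open>The antiderivation rule one level up, for \<open>z\<close> in
  \<open>DerOmega sc\<close>. Commutativity of the symmetric algebra exchanges the derivation in
  \<open>z\<close> with the one attached to \<nu>.\<close>

lemma DS_f1_mult:
  assumes \<nu>: "\<nu> \<in> carrier (Omega1 sc)" and "z \<in> DerOmega sc"
  shows "DS (f1 \<nu> \<otimes>\<^bsub>ST\<^esub> z) = tS 1 (sY \<nu>) \<one>\<^bsub>OM\<^esub> \<otimes>\<^bsub>ST\<^esub> z \<ominus>\<^bsub>ST\<^esub> f1 \<nu> \<otimes>\<^bsub>ST\<^esub> DS z"
  using assms(2)
proof (induction rule: DerOmega_induct)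
  case zero
  then show ?case using \<nu> by (simp add: DS.zero a_minus_def)
next
  case (add x y)
  have c: "tS 1 (sY \<nu>) \<one>\<^bsub>OM\<^esub> \<in> carrier ST" "f1 \<nu> \<in> carrier ST" "DS x \<in> carrier ST" "DS y \<in> carrier ST"
    using \<nu> add by (simp_all add: DS.closed)
  show ?case
    using c add
    by (simp add: SA.TA.b_r_distr DS.add a_minus_def SA.T.M.minus_add SA.T.M.a_ac SA.TA.b_closed del: One_nat_def)
next
  case (tens X \<gamma>)
  note X = Sym_in_grade[OF tens(1)] and Y = sY_grade[OF \<nu>] and \<gamma> = tens(2)
  let ?X = "Sym_in sc X" and ?e = "form1 sc \<nu>"
  note Xc = SG.G_carrier[OF X] SG.G_carrier[OF Y]
  have e: "?e \<in> carrier OM" using \<nu> by simp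
  have c: "f1 \<nu> \<otimes>\<^bsub>ST\<^esub> ds \<gamma> \<in> carrier ST" "tS 1 ?X \<one>\<^bsub>OM\<^esub> \<in> carrier ST" "tS 1 (sY \<nu>) \<gamma> \<in> carrier ST"
    using e \<gamma> X Y by (auto intro!: tS_mult_z_closed DSt.closed tS_closed simp del: One_nat_def)
  have "f1 \<nu> \<otimes>\<^bsub>ST\<^esub> tS 1 ?X \<gamma> = tS 1 ?X (?e \<otimes>\<^bsub>OM\<^esub> \<gamma>)"
    using tS_mult[OF S_one_grade X e \<gamma>] Xc by simp
  then have "DS (f1 \<nu> \<otimes>\<^bsub>ST\<^esub> tS 1 ?X \<gamma>) = tS 1 ?X \<one>\<^bsub>OM\<^esub> \<otimes>\<^bsub>ST\<^esub> ds (?e \<otimes>\<^bsub>OM\<^esub> \<gamma>)"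
    using DS_tS[OF X Om.b_closed[OF e \<gamma>]] by (simp only:)
  also have "\<dots> = tS 1 ?X \<one>\<^bsub>OM\<^esub> \<otimes>\<^bsub>ST\<^esub> tS 1 (sY \<nu>) \<gamma> \<ominus>\<^bsub>ST\<^esub> tS 1 ?X \<one>\<^bsub>OM\<^esub> \<otimes>\<^bsub>ST\<^esub> (f1 \<nu> \<otimes>\<^bsub>ST\<^esub> ds \<gamma>)"
    using c by (simp only: ds_mult[OF \<nu> \<gamma>] a_minus_def SA.TA.b_r_distr SA.T.M.a_inv_closed SA.TA.b_neg_r)
  also have "tS 1 ?X \<one>\<^bsub>OM\<^esub> \<otimes>\<^bsub>ST\<^esub> tS 1 (sY \<nu>) \<gamma> = tS 1 (sY \<nu>) \<one>\<^bsub>OM\<^esub> \<otimes>\<^bsub>ST\<^esub> tS 1 ?X \<gamma>"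
    using Sym_gen_central[OF Xc(1) Sh.closed[OF \<nu>]] by (simp only: tS_mult[OF X Y Om.b_one \<gamma>] tS_mult[OF Y X Om.b_one \<gamma>])
  also have "tS 1 ?X \<one>\<^bsub>OM\<^esub> \<otimes>\<^bsub>ST\<^esub> (f1 \<nu> \<otimes>\<^bsub>ST\<^esub> ds \<gamma>) = (f1 \<nu> \<otimes>\<^bsub>ST\<^esub> tS 1 ?X \<one>\<^bsub>OM\<^esub>) \<otimes>\<^bsub>ST\<^esub> ds \<gamma>"
    using tS_assoc[OF X S_one_grade Om.b_one e ds_DerOmega[OF \<gamma>]] tS_mult[OF X S_one_grade Om.b_one e]
      tS_mult[OF S_one_grade X e Om.b_one] Xc e by (simp del: One_nat_def)
  also have "\<dots> = f1 \<nu> \<otimes>\<^bsub>ST\<^esub> DS (tS 1 ?X \<gamma>)"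
    by (simp only: tS_assoc[OF S_one_grade X e Om.b_one ds_DerOmega[OF \<gamma>]] DS_tS[OF X \<gamma>])
  finally show ?case .
qed

text \<open>Induction on words of 1-forms. By \<open>ds_mult\<close> and \<open>DS_f1_mult\<close>
  the term with the derivation of the leading form occurs twice with opposite signs, and the rest
  vanishes by induction.\<close>

lemma DS_ds:
  assumes "\<mu> \<in> carrier OM"
  shows "DS (ds \<mu>) = \<zero>\<^bsub>ST\<^esub>"
  using assms
proof (induction rule: Om.word_induct)
  case (word ws a)
  then have "DS (ds (Om.wd ws)) = \<zero>\<^bsub>ST\<^esub>"
  proof (induction ws)
    case Nil
    then show ?case by (simp add: Om.wd_Nil ds_one DS.zero)
  next
    case (Cons \<nu> ws)
    let ?b = "Om.wd ws"
    have \<nu>: "\<nu> \<in> carrier (Omega1 sc)" and b: "?b \<in> carrier OM" and IH: "DS (ds ?b) = \<zero>\<^bsub>ST\<^esub>"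
      using Cons by simp_all
    have c: "tS 1 (sY \<nu>) ?b \<in> carrier ST" "f1 \<nu> \<otimes>\<^bsub>ST\<^esub> ds ?b \<in> carrier ST"
      "tS 1 (sY \<nu>) \<one>\<^bsub>OM\<^esub> \<otimes>\<^bsub>ST\<^esub> ds ?b \<in> carrier ST"
      using \<nu> b by (simp_all add: DSt.closed)
    have "DS (ds (form1 sc \<nu> \<otimes>\<^bsub>OM\<^esub> ?b)) = tS 1 (sY \<nu>) \<one>\<^bsub>OM\<^esub> \<otimes>\<^bsub>ST\<^esub> ds ?b \<ominus>\<^bsub>ST\<^esub>
      (tS 1 (sY \<nu>) \<one>\<^bsub>OM\<^esub> \<otimes>\<^bsub>ST\<^esub> ds ?b \<ominus>\<^bsub>ST\<^esub> f1 \<nu> \<otimes>\<^bsub>ST\<^esub> DS (ds ?b))"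
      using c by (simp only: ds_mult[OF \<nu> b] DS.minus DS_tS[OF sY_grade[OF \<nu>] b] DS_f1_mult[OF \<nu> ds_DerOmega[OF b]])
    also have "\<dots> = \<zero>\<^bsub>ST\<^esub>"
      using c(3) \<nu> by (simp add: IH a_minus_def SA.T.M.r_neg del: One_nat_def)
    finally show ?case using Cons.prems by (simp add: Om.wd_Cons)
  qed
  then show ?case using word by (simp add: DSt.smult DS.smult DSt.closed)
qed (simp_all add: DSt.zero DS.zero DSt.add DS.add DSt.closed)

text \<open>Euler's identity for forms, by induction on words: the leading form contributes one copy
  of the word through its own derivation, and the remaining letters contribute one copy each through
  \<open>euler_rel_mult\<close>.\<close>

lemma euler_rel_ds:
  assumes "\<mu> \<in> OmegaQ sc (Suc q)"
  shows "euler_rel q (ds \<mu>) (of_nat (Suc q) \<odot>\<^bsub>OM\<^esub> \<mu>)"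
proof -
  have wds: "euler_rel q (ds (Om.wd ws)) (of_nat (Suc q) \<odot>\<^bsub>OM\<^esub> Om.wd ws)"
    if "set ws \<subseteq> carrier (Omega1 sc)" "length ws = Suc q" for ws q
    using that
  proof (induction q arbitrary: ws)
    case 0
    then obtain \<nu> where ws: "ws = [\<nu>]" and \<nu>: "\<nu> \<in> carrier (Omega1 sc)" by (auto simp: length_Suc_conv)
    have wd: "Om.wd ws = form1 sc \<nu>" using \<nu> by (simp add: ws Om.wd_single)
    show ?case
      using euler_rel.step[OF euler_rel.zero \<nu> OM_one_grade] \<nu> sY_grade[OF \<nu>] ds_form1[OF \<nu>] by (simp add: wd)
  next
    case (Suc q)
    then obtain \<nu> vs where ws: "ws = \<nu> # vs" and \<nu>: "\<nu> \<in> carrier (Omega1 sc)"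
      and vs: "set vs \<subseteq> carrier (Omega1 sc)" "length vs = Suc q" by (auto simp: length_Suc_conv)
    have wd: "Om.wd ws = form1 sc \<nu> \<otimes>\<^bsub>OM\<^esub> Om.wd vs" using \<nu> vs by (simp add: ws Om.wd_Cons)
    have v: "Om.wd vs \<in> carrier OM" "Om.wd vs \<in> OmegaQ sc (Suc q)" using vs Omega_word_grade[OF vs(1)] by simp_all
    have c: "form1 sc \<nu> \<otimes>\<^bsub>OM\<^esub> Om.wd vs \<in> carrier OM" using \<nu> v by simp
    have "of_nat (Suc (Suc q)) \<odot>\<^bsub>OM\<^esub> Om.wd ws =
      form1 sc \<nu> \<otimes>\<^bsub>OM\<^esub> Om.wd vs \<oplus>\<^bsub>OM\<^esub> form1 sc \<nu> \<otimes>\<^bsub>OM\<^esub> (of_nat (Suc q) \<odot>\<^bsub>OM\<^esub> Om.wd vs)"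
      using c v \<nu> Om.smult_add_left[of "form1 sc \<nu> \<otimes>\<^bsub>OM\<^esub> Om.wd vs" 1 "of_nat (Suc q)"]
      by (simp add: wd Om.b_smult_r del: of_nat_Suc) (simp add: add.commute)
    moreover have "ds (Om.wd ws) = tS 1 (sY \<nu>) (Om.wd vs) \<oplus>\<^bsub>ST\<^esub> \<ominus>\<^bsub>ST\<^esub> (f1 \<nu> \<otimes>\<^bsub>ST\<^esub> ds (Om.wd vs))"
      using ds_mult[OF \<nu> v(1)] by (simp only: wd a_minus_def)
    ultimately show ?case
      using euler_rel.step[OF euler_rel_mult[OF \<nu> Suc.IH[OF vs]] \<nu> v(2)] by simp
  qed
  show ?thesis
    using assms unfolding OmegaQ_def
  proof (induction rule: Om.grade_induct)
    case zero
    then show ?case using euler_rel.zero by (simp add: DSt.zero)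
  next
    case (add x y)
    then have "x \<in> carrier OM" "y \<in> carrier OM" using Om.grade_rules(1) by blast+
    then show ?case using euler_rel_add[OF add.IH] by (simp only: DSt.add Om.smult_add_right)
  next
    case (word ws a)
    then have ws: "set ws \<subseteq> carrier (Omega1 sc)" "length ws = Suc q"
      by (auto simp: words_of_degree_one[simplified])
    have "of_nat (Suc q) \<odot>\<^bsub>OM\<^esub> (a \<odot>\<^bsub>OM\<^esub> Om.wd ws) = a \<odot>\<^bsub>OM\<^esub> (of_nat (Suc q) \<odot>\<^bsub>OM\<^esub> Om.wd ws)"
      using ws by (simp add: Om.smult_mult[symmetric] mult.commute)
    then show ?case using euler_rel_smult[OF wds[OF ws], of a] ws by (simp only: DSt.smult Om.wd_closed)
  qed
qed

lemma ds_zero: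
  assumes "\<mu> \<in> OmegaQ sc 0"
  shows "ds \<mu> = \<zero>\<^bsub>ST\<^esub>"
  using assms unfolding OmegaQ_def
proof (induction rule: Om.grade_induct)
  case zero
  then show ?case by (simp add: DSt.zero)
next
  case (add x y)
  then have "x \<in> carrier OM" "y \<in> carrier OM" using Om.grade_rules(1) by blast+
  then show ?case using add by (simp add: DSt.add)
next
  case (word ws a)
  then have "ws = []" by (auto simp: words_of_degree_one[simplified])
  then show ?case by (simp add: DSt.smult Om.wd_Nil ds_one)
qed

section \<open>The operator \<open>d\<close> after the adjoint Koszul operator\<close>

lemma PI_cong: "finite I \<Longrightarrow> (\<And>i. i \<in> I \<Longrightarrow> Y i = Z i) \<Longrightarrow> PI Y I = PI Z I"
  unfolding PI_def by (intro arg_cong[of _ _ Sy.wd] map_cong) auto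

abbreviation "shp \<eta> \<equiv> \<lambda>i. sharp sc br (\<eta> i)"

text \<open>One summand of the mixed term R: the factor \<open>x\<close> leaves the product and its
  1-form multiplies \<open>z\<close>. The subtraction in \<open>card I - 1\<close> is exact for
  \<open>x \<in> I\<close>.\<close>

abbreviation "contr \<eta> I x z \<equiv> pi_dag sc br (tS (card I - 1) (PI (shp \<eta>) (I - {x})) (form1 sc (\<eta> x)) \<otimes>\<^bsub>ST\<^esub> z)"

lemma shp_fun: "\<eta> ` I \<subseteq> carrier (Omega1 sc) \<Longrightarrow> J \<subseteq> I \<Longrightarrow> shp \<eta> ` J \<subseteq> carrier (Der sc)"
  using Sh.closed by auto

lemma PI_remove_grade:
  assumes "finite I" "\<eta> ` I \<subseteq> carrier (Omega1 sc)" "x \<in> I"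
  shows "PI (shp \<eta>) (I - {x}) \<in> Sym_grade sc (card I - 1)"
  using PI_grade[of "I - {x}" "shp \<eta>"] shp_fun[OF assms(2), of "I - {x}"] assms(1,3) by auto

lemma contr_closed:
  assumes "finite I" "\<eta> ` I \<subseteq> carrier (Omega1 sc)" "x \<in> I" "z \<in> carrier ST"
  shows "contr \<eta> I x z \<in> carrier WT"
  using PI_remove_grade[OF assms(1-3)] assms(2-4) by (intro PG.closed tS_mult_z_closed) auto

text \<open>The derivation attached to \<zeta> is merged into the symmetrized product as one more
  factor. By \<open>d_sI_mult\<close>, differentiating the new factor returns \<zeta> in front of
  \<gamma>, while differentiating an old factor gives a term \<open>contr\<close>.\<close>

lemma d_pi_dag_single:
  assumes I: "finite I" "\<eta> ` I \<subseteq> carrier (Omega1 sc)" and \<zeta>: "\<zeta> \<in> carrier (Omega1 sc)" and \<gamma>: "\<gamma> \<in> carrier OM"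
  shows "d (pi_dag sc br (tS (card I) (PI (shp \<eta>) I) \<one>\<^bsub>OM\<^esub> \<otimes>\<^bsub>ST\<^esub> tS 1 (sY \<zeta>) \<gamma>)) =
    tW (card I) (sI (shp \<eta>) I) (form1 sc \<zeta> \<otimes>\<^bsub>OM\<^esub> \<gamma>) \<oplus>\<^bsub>WT\<^esub>
    finsum WT (\<lambda>x. contr \<eta> I x (tS 1 (sY \<zeta>) \<gamma>)) I"
proof -
  \<comment> \<open>A fresh index for the additional factor; \<open>\<theta>\<close> extends the
    family \<open>\<eta>\<close> by \<open>\<zeta>\<close> at this index.\<close>
  obtain k where k: "k \<notin> I" using I(1) ex_new_if_finite infinite_UNIV_nat by blast
  define \<theta> where "\<theta> = \<eta>(k := \<zeta>)"
  have \<theta>: "\<theta> i = \<eta> i" if "i \<in> I" for i using that k by (auto simp: \<theta>_def)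
  have \<theta>k: "\<theta> k = \<zeta>" by (simp add: \<theta>_def)
  have \<theta>I: "\<theta> ` insert k I \<subseteq> carrier (Omega1 sc)" using I \<zeta> by (auto simp: \<theta>_def)
  have merge: "pi_dag sc br (tS (card K) (PI (shp \<eta>) K) \<alpha> \<otimes>\<^bsub>ST\<^esub> tS 1 (sY \<zeta>) \<gamma>) =
    tW (Suc (card K)) (sI (shp \<theta>) (insert k K)) (\<alpha> \<otimes>\<^bsub>OM\<^esub> \<gamma>)" if K: "K \<subseteq> I" and \<alpha>: "\<alpha> \<in> carrier OM" for K \<alpha>
  proof -
    have fK: "finite K" using K I(1) finite_subset by blast
    have kK: "k \<notin> K" using K k by blast
    have Y: "shp \<eta> ` K \<subseteq> carrier (Der sc)" by (rule shp_fun[OF I(2) K])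
    have Z: "shp \<theta> ` insert k K \<subseteq> carrier (Der sc)" by (rule shp_fun[OF \<theta>I]) (use K in auto)
    have P: "PI (shp \<eta>) K = PI (shp \<theta>) K" using K \<theta> by (intro PI_cong[OF fK]) auto
    have "PI (shp \<eta>) K \<otimes>\<^bsub>Sym sc\<^esub> sY \<zeta> = PI (shp \<theta>) (insert k K)"
      using Sym_gen_central[OF PI_closed[OF fK Y] Sh.closed[OF \<zeta>]] PI_insert[OF fK Z kK] by (simp add: P \<theta>k)
    then have "tS (card K) (PI (shp \<eta>) K) \<alpha> \<otimes>\<^bsub>ST\<^esub> tS 1 (sY \<zeta>) \<gamma> =
      tS (card (insert k K)) (PI (shp \<theta>) (insert k K)) (\<alpha> \<otimes>\<^bsub>OM\<^esub> \<gamma>)"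
      using tS_mult[OF PI_grade[OF fK Y] sY_grade[OF \<zeta>] \<alpha> \<gamma>] fK kK by simp
    then show ?thesis
      using pi_dag_tS[OF PI_grade[of "insert k K" "shp \<theta>"], of "\<alpha> \<otimes>\<^bsub>OM\<^esub> \<gamma>"] pi_dag_PI[of "insert k K" "shp \<theta>"]
        fK Z kK \<alpha> \<gamma> by simp
  qed
  let ?f = "\<lambda>x. tW (card I) (sI (shp \<theta>) (insert k I - {x})) (form1 sc (\<theta> x) \<otimes>\<^bsub>OM\<^esub> \<gamma>)"
  have f: "?f x \<in> carrier WT" if "x \<in> insert k I" for x
  proof -
    have "sI (shp \<theta>) (insert k I - {x}) \<in> U_grade sc br (card (insert k I - {x}))"
      using I(1) by (intro sI_grade shp_fun[OF \<theta>I]) auto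
    moreover have "card (insert k I - {x}) = card I" using that I(1) k by (simp add: card_Diff_singleton)
    ultimately show ?thesis using \<theta>I that \<gamma> by auto
  qed
  have "d (pi_dag sc br (tS (card I) (PI (shp \<eta>) I) \<one>\<^bsub>OM\<^esub> \<otimes>\<^bsub>ST\<^esub> tS 1 (sY \<zeta>) \<gamma>)) =
    d (tW (card (insert k I)) (sI (shp \<theta>) (insert k I)) \<gamma>)"
    using merge[OF order_refl Om.b_one] \<gamma> I(1) k by simp
  also have "\<dots> = finsum WT ?f (insert k I)"
    using d_sI_mult[of "insert k I" \<theta> \<gamma>] \<theta>I I(1) \<gamma> k by simp
  also have "\<dots> = ?f k \<oplus>\<^bsub>WT\<^esub> finsum WT ?f I"
    using I(1) k f f[OF insertI1] by (intro WA.T.M.finsum_insert) auto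
  also have "?f k = tW (card I) (sI (shp \<eta>) I) (form1 sc \<zeta> \<otimes>\<^bsub>OM\<^esub> \<gamma>)"
  proof -
    have "sI (shp \<theta>) I = sI (shp \<eta>) I" using shp_fun[OF I(2) order_refl] \<theta> by (intro sI_cong) auto
    then show ?thesis using k by (simp add: \<theta>k)
  qed
  also have "finsum WT ?f I = finsum WT (\<lambda>x. contr \<eta> I x (tS 1 (sY \<zeta>) \<gamma>)) I"
  proof (intro WA.T.M.finsum_cong' refl)
    fix x assume x: "x \<in> I"
    have "0 < card I" using x I(1) by (auto simp: card_gt_0_iff)
    then have c: "card (I - {x}) = card I - 1" "Suc (card I - 1) = card I" using x I(1) by simp_all
    have "insert k I - {x} = insert k (I - {x})" using x k by auto
    then show "?f x = contr \<eta> I x (tS 1 (sY \<zeta>) \<gamma>)"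
      using merge[of "I - {x}" "form1 sc (\<eta> x)"] x I(2) \<theta>[OF x] unfolding c by auto
  qed (use contr_closed[OF I] tS_closed[OF sY_grade[OF \<zeta>] \<gamma>] in auto)
  finally show ?thesis .
qed

text \<open>The case of a single tensor is summed along \<open>euler_rel\<close>: the products of
  \<zeta> and \<gamma> collect into \<kappa>, and the contractions add up by linearity in
  \<open>z\<close>.\<close>

lemma d_pi_dag:
  assumes I: "finite I" "\<eta> ` I \<subseteq> carrier (Omega1 sc)" and "euler_rel q z \<kappa>"
  shows "d (pi_dag sc br (tS (card I) (PI (shp \<eta>) I) \<one>\<^bsub>OM\<^esub> \<otimes>\<^bsub>ST\<^esub> z)) =
    tW (card I) (sI (shp \<eta>) I) \<kappa> \<oplus>\<^bsub>WT\<^esub> finsum WT (\<lambda>x. contr \<eta> I x z) I"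
proof -
  have P: "PI (shp \<eta>) I \<in> Sym_grade sc (card I)" and S: "sI (shp \<eta>) I \<in> U_grade sc br (card I)"
    using PI_grade[OF I(1) shp_fun[OF I(2) order_refl]] sI_grade[OF I(1) shp_fun[OF I(2) order_refl]] .
  have Px: "tS (card I - 1) (PI (shp \<eta>) (I - {x})) (form1 sc (\<eta> x)) \<in> carrier ST" if "x \<in> I" for x
    using PI_remove_grade[OF I that] I(2) that by auto
  show ?thesis
    using assms(3)
  proof (induction rule: euler_rel.induct)
    case zero
    have "finsum WT (\<lambda>x. contr \<eta> I x \<zero>\<^bsub>ST\<^esub>) I = finsum WT (\<lambda>x. \<zero>\<^bsub>WT\<^esub>) I"
      using Px by (intro WA.T.M.finsum_cong') (auto simp: SA.TA.b_zero_r PG.zero)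
    then show ?case
      using tW_rules(5)[OF S Om.M.zero_closed] tS_closed[OF P Om.b_one]
      by (simp add: SA.TA.b_zero_r PG.zero D.zero WA.T.M.finsum_zero)
  next
    case (step z \<kappa> \<zeta> \<gamma>)
    let ?z = "tS 1 (sY \<zeta>) \<gamma>" and ?k = "form1 sc \<zeta> \<otimes>\<^bsub>OM\<^esub> \<gamma>" and ?P = "tS (card I) (PI (shp \<eta>) I) \<one>\<^bsub>OM\<^esub>"
    have \<gamma>: "\<gamma> \<in> carrier OM" by (rule OG.G_carrier[OF step(3)])
    have c: "?z \<in> carrier ST" "z \<in> carrier ST" "?k \<in> carrier OM" "\<kappa> \<in> carrier OM"
      using tS_closed[OF sY_grade[OF step(2)] \<gamma>] euler_rel_closed[OF step(1)] \<gamma> step(2) by auto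
    have "contr \<eta> I x (?z \<oplus>\<^bsub>ST\<^esub> z) = contr \<eta> I x ?z \<oplus>\<^bsub>WT\<^esub> contr \<eta> I x z" if "x \<in> I" for x
      using Px[OF that] c by (simp only: SA.TA.b_r_distr PG.add SA.TA.b_closed)
    then have "finsum WT (\<lambda>x. contr \<eta> I x (?z \<oplus>\<^bsub>ST\<^esub> z)) I = finsum WT (\<lambda>x. contr \<eta> I x ?z \<oplus>\<^bsub>WT\<^esub> contr \<eta> I x z) I"
      using contr_closed[OF I] c by (intro WA.T.M.finsum_cong' refl) (simp_all only:, auto)
    also have "\<dots> = finsum WT (\<lambda>x. contr \<eta> I x ?z) I \<oplus>\<^bsub>WT\<^esub> finsum WT (\<lambda>x. contr \<eta> I x z) I"
      using contr_closed[OF I] c by (intro WA.T.M.finsum_addf) auto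
    finally have sums: "finsum WT (\<lambda>x. contr \<eta> I x (?z \<oplus>\<^bsub>ST\<^esub> z)) I =
      finsum WT (\<lambda>x. contr \<eta> I x ?z) I \<oplus>\<^bsub>WT\<^esub> finsum WT (\<lambda>x. contr \<eta> I x z) I" .
    have cs: "finsum WT (\<lambda>x. contr \<eta> I x ?z) I \<in> carrier WT" "finsum WT (\<lambda>x. contr \<eta> I x z) I \<in> carrier WT"
      using contr_closed[OF I] c by (auto intro!: WA.T.M.finsum_closed)
    have "d (pi_dag sc br (?P \<otimes>\<^bsub>ST\<^esub> (?z \<oplus>\<^bsub>ST\<^esub> z))) = d (pi_dag sc br (?P \<otimes>\<^bsub>ST\<^esub> ?z)) \<oplus>\<^bsub>WT\<^esub> d (pi_dag sc br (?P \<otimes>\<^bsub>ST\<^esub> z))"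
      using c tS_closed[OF P Om.b_one] by (simp only: SA.TA.b_r_distr PG.add D.add SA.TA.b_closed PG.closed)
    also have "\<dots> = (tW (card I) (sI (shp \<eta>) I) ?k \<oplus>\<^bsub>WT\<^esub> finsum WT (\<lambda>x. contr \<eta> I x ?z) I) \<oplus>\<^bsub>WT\<^esub>
      (tW (card I) (sI (shp \<eta>) I) \<kappa> \<oplus>\<^bsub>WT\<^esub> finsum WT (\<lambda>x. contr \<eta> I x z) I)"
      by (simp only: d_pi_dag_single[OF I step(2) \<gamma>] step.IH)
    also have "\<dots> = tW (card I) (sI (shp \<eta>) I) (?k \<oplus>\<^bsub>OM\<^esub> \<kappa>) \<oplus>\<^bsub>WT\<^esub> finsum WT (\<lambda>x. contr \<eta> I x (?z \<oplus>\<^bsub>ST\<^esub> z)) I"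
      using cs c tW_closed[OF S c(3)] tW_closed[OF S c(4)]
      by (simp add: sums tW_rules(3)[OF S c(3,4)] WA.T.M.a_ac del: One_nat_def)
    finally show ?case .
  qed
qed

section \<open>Delta-tilde on homogeneous elements\<close>

abbreviation "inv_deg n \<equiv> sc (1 / of_nat n) 1"

lemma dt_tW:
  assumes s: "s \<in> Sym_grade sc p" and \<mu>: "\<mu> \<in> OmegaQ sc q" and pq: "0 < p + q"
  shows "dt (tW p (pi_dag_U sc br s) \<mu>) = inv_deg (p + q) \<odot>\<^bsub>WT\<^esub> pi_dag sc br (tS p s \<one>\<^bsub>OM\<^esub> \<otimes>\<^bsub>ST\<^esub> ds \<mu>)"
proof -
  have "tW p (pi_dag_U sc br s) \<mu> \<in> SdagOmegaPQ sc br p q"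
    unfolding SdagOmegaPQ_def S_dag_grade_def using s \<mu> by (intro WA.tens_part_tn imageI)
  moreover have "pi_map sc (tW p (pi_dag_U sc br s) \<mu>) = tS p s \<mu>"
    using pi_map_tW[OF pi_dag_grade[OF s] OG.G_carrier[OF \<mu>]] pi_pi_dag[OF SG.G_carrier[OF s]] by simp
  ultimately show ?thesis
    using dt_SPQ[OF _ pq] DS_tS[OF s OG.G_carrier[OF \<mu>]] by simp
qed

text \<open>All forms recorded by \<open>euler_rel r\<close> have degree \<open>r\<close>, so every
  summand has total degree \<open>p + 1 + r\<close> and the same denominator applies to the whole
  element. This is why the relation carries the form degree.\<close>

lemma dt_pi_dag:
  assumes s: "s \<in> Sym_grade sc p" and "euler_rel r z \<kappa>"
  shows "dt (pi_dag sc br (tS p s \<one>\<^bsub>OM\<^esub> \<otimes>\<^bsub>ST\<^esub> z)) =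
    inv_deg (p + 1 + r) \<odot>\<^bsub>WT\<^esub> pi_dag sc br (DS (tS p s \<one>\<^bsub>OM\<^esub> \<otimes>\<^bsub>ST\<^esub> z))"
  using assms(2)
proof (induction rule: euler_rel.induct)
  case zero
  then show ?case using tS_closed[OF s Om.b_one] by (simp add: SA.TA.b_zero_r PG.zero DT.zero DS.zero)
next
  case (step z \<kappa> \<zeta> \<gamma>)
  let ?s = "tS p s \<one>\<^bsub>OM\<^esub>" and ?z = "tS 1 (sY \<zeta>) \<gamma>" and ?c = "inv_deg (p + 1 + r)"
  note Y = sY_grade[OF step(2)] and sc = tS_closed[OF s Om.b_one]
  have \<gamma>: "\<gamma> \<in> carrier OM" by (rule OG.G_carrier[OF step(3)])
  have c: "?z \<in> carrier ST" "z \<in> carrier ST"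
    using tS_closed[OF Y \<gamma>] euler_rel_closed[OF step(1)] by auto
  have e: "?s \<otimes>\<^bsub>ST\<^esub> ?z = tS (p + 1) (s \<otimes>\<^bsub>Sym sc\<^esub> sY \<zeta>) \<gamma>"
    using tS_mult[OF s Y Om.b_one \<gamma>] \<gamma> by simp
  note g = SG.G_mult[OF s Y]
  have "dt (pi_dag sc br (?s \<otimes>\<^bsub>ST\<^esub> ?z)) = ?c \<odot>\<^bsub>WT\<^esub> pi_dag sc br (DS (?s \<otimes>\<^bsub>ST\<^esub> ?z))"
    unfolding e pi_dag_tS[OF g \<gamma>] DS_tS[OF g \<gamma>] by (rule dt_tW[OF g step(3)]) simp
  then show ?case
    using step.IH c sc
    by (simp only: SA.TA.b_r_distr PG.add DT.add DS.add SA.TA.b_closed PG.closed DS.closed WA.T.smult_add_right)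
qed

lemma Sym_grade_0: "s \<in> Sym_grade sc 0 \<Longrightarrow> s = coeff0 s \<odot>\<^bsub>Sym sc\<^esub> \<one>\<^bsub>Sym sc\<^esub>"
proof (induction rule: Sym_grade_induct)
  case (add x y)
  then have "x \<in> carrier (Sym sc)" "y \<in> carrier (Sym sc)" using SG.G_carrier by blast+
  then show ?case using add(3,4) Sy.smult_add_left[of "\<one>\<^bsub>Sym sc\<^esub>" "coeff0 x" "coeff0 y"]
    by (simp add: lin_mapD(2)[OF coeff0_Sym])
next
  case (PI Y a)
  then show ?case
    using coeff0_Sym_word[of "[]"] by (simp add: PI_empty lin_mapD(3)[OF coeff0_Sym] Sy.wd_Nil)
qed (simp add: lin_mapD(3)[OF coeff0_Sym, of "\<zero>\<^bsub>Sym sc\<^esub>" 0, simplified])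

lemma coeff0_Omega_grade:
  assumes "\<mu> \<in> OmegaQ sc q"
  shows "if q = 0 then \<mu> = coeff0 \<mu> \<odot>\<^bsub>OM\<^esub> \<one>\<^bsub>OM\<^esub> else coeff0 \<mu> = 0"
  using assms unfolding OmegaQ_def
proof (induction rule: Om.grade_induct)
  case zero
  then show ?case by (simp add: lin_mapD(3)[OF coeff0_Omega, of "\<zero>\<^bsub>OM\<^esub>" 0, simplified])
next
  case (add x y)
  then have "x \<in> carrier OM" "y \<in> carrier OM" using Om.grade_rules(1) by blast+
  then show ?case using add(3,4) Om.smult_add_left[of "\<one>\<^bsub>OM\<^esub>" "coeff0 x" "coeff0 y"]
    by (auto simp: lin_mapD(2)[OF coeff0_Omega])
next
  case (word ws a)
  then have "length ws = q" by (auto simp: words_of_degree_one[simplified])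
  then show ?case
    using word(1) by (auto simp: lin_mapD(3)[OF coeff0_Omega] coeff0_Omega_word Om.wd_Nil)
qed

text \<open>In degree 0 both tensor factors are multiples of 1, so the element is a scalar multiple
  of the unit. This is the case excluded from the rule with denominator p + q.\<close>

lemma tW_degree_0:
  assumes s: "s \<in> Sym_grade sc 0" and \<mu>: "\<mu> \<in> OmegaQ sc 0"
  shows "tW 0 (pi_dag_U sc br s) \<mu> = (coeff0 s * coeff0 \<mu>) \<odot>\<^bsub>WT\<^esub> \<one>\<^bsub>WT\<^esub>"
proof -
  have one: "pi_dag_U sc br \<one>\<^bsub>Sym sc\<^esub> = \<one>\<^bsub>U_alg sc br\<^esub>"
    using pi_dag_PI[of "{}"] by (simp add: PI_empty sI_empty)
  have "\<mu> = coeff0 \<mu> \<odot>\<^bsub>OM\<^esub> \<one>\<^bsub>OM\<^esub>" using coeff0_Omega_grade[OF \<mu>] by simp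
  moreover have "pi_dag_U sc br s = coeff0 s \<odot>\<^bsub>U_alg sc br\<^esub> \<one>\<^bsub>U_alg sc br\<^esub>"
    by (subst Sym_grade_0[OF s]) (simp add: PD.smult one)
  ultimately have "tW 0 (pi_dag_U sc br s) \<mu> = tW 0 (coeff0 s \<odot>\<^bsub>U_alg sc br\<^esub> \<one>\<^bsub>U_alg sc br\<^esub>) (coeff0 \<mu> \<odot>\<^bsub>OM\<^esub> \<one>\<^bsub>OM\<^esub>)"
    by simp
  then show ?thesis
    using tW_rules(2)[OF U_one_grade Om.b_one] tW_rules(4)[OF UG.G_rules(4)[OF U_one_grade] Om.b_one]
      tW_closed[OF U_one_grade Om.b_one]
    by (simp add: WT_one WA.T.smult_mult mult.commute[of "coeff0 s"])
qed

lemma d_one: "d \<one>\<^bsub>WT\<^esub> = \<zero>\<^bsub>WT\<^esub>" and dt_one: "dt \<one>\<^bsub>WT\<^esub> = \<zero>\<^bsub>WT\<^esub>"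
proof -
  show "d \<one>\<^bsub>WT\<^esub> = \<zero>\<^bsub>WT\<^esub>" using d_Omega[of "\<one>\<^bsub>OM\<^esub>"] by (simp add: WT_one)
  show "dt \<one>\<^bsub>WT\<^esub> = \<zero>\<^bsub>WT\<^esub>" using dt_A[of 1] by (simp add: inA_def)
qed

text \<open>In positive total degree the two denominators are scalars that come out, and what
  remains contains \<open>DS (ds \<mu>)\<close>, which is 0. In degree 0 the element is a
  scalar.\<close>

lemma dt_dt_homogeneous:
  assumes s: "s \<in> Sym_grade sc p" and \<mu>: "\<mu> \<in> OmegaQ sc q"
  shows "dt (dt (tW p (pi_dag_U sc br s) \<mu>)) = \<zero>\<^bsub>WT\<^esub>"
proof (cases "p + q = 0")
  case True
  then show ?thesis using s \<mu> by (simp add: tW_degree_0 DT.smult dt_one DT.zero)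
next
  case False
  let ?s = "tS p s \<one>\<^bsub>OM\<^esub>"
  have sc: "?s \<in> carrier ST" by (rule tS_closed[OF s Om.b_one])
  note \<mu>c = OG.G_carrier[OF \<mu>]
  have "dt (pi_dag sc br (?s \<otimes>\<^bsub>ST\<^esub> ds \<mu>)) = \<zero>\<^bsub>WT\<^esub>"
  proof (cases q)
    case 0
    then show ?thesis using ds_zero[of \<mu>] \<mu> sc by (simp add: SA.TA.b_zero_r PG.zero DT.zero)
  next
    case (Suc r)
    then show ?thesis
      using dt_pi_dag[OF s euler_rel_ds[of \<mu> r]] \<mu> sc DS_mult[OF s ds_DerOmega[OF \<mu>c]]
      by (simp add: DS_ds[OF \<mu>c] SA.TA.b_zero_r PG.zero)
  qed
  then show ?thesis
    using dt_tW[OF s \<mu>] False PG.closed[OF SA.TA.b_closed[OF sc DSt.closed[OF \<mu>c]]] by (simp add: DT.smult)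
qed

text \<open>The two products are combined into one map, so that linearity, continuity and
  compatibility with \<open>h\<close> are inherited at once and reductions can be made for the sum
  alone.\<close>

definition G :: "'a WOm \<Rightarrow> 'a WOm" where
  "G x = dt (d x) \<oplus>\<^bsub>WT\<^esub> d (dt x)"

lemma G_lin: "lin WT WT G"
proof (intro lin.intro lin_axioms.intro WA.T_amod)
  show "lin_map WT WT G"
    unfolding lin_map_def G_def
    by (auto simp: D.add DT.add D.smult DT.smult WA.T.smult_add_right WA.T.M.a_ac)
qed

sublocale G: lin WT WT G by (rule G_lin)

text \<open>For \<open>q = 0\<close> both sides are zero and any index \<open>r\<close> serves, so
  the computation of \<open>G\<close> can treat all form degrees uniformly.\<close>

lemma euler_rel_ds':
  assumes "\<mu> \<in> OmegaQ sc q"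
  shows "\<exists>r. euler_rel r (ds \<mu>) (of_nat q \<odot>\<^bsub>OM\<^esub> \<mu>)"
proof (cases q)
  case 0
  then show ?thesis using assms euler_rel.zero ds_zero[of \<mu>] OG.G_carrier[OF assms] by simp
next
  case (Suc r)
  then show ?thesis using euler_rel_ds[of \<mu> r] assms by blast
qed

text \<open>The Fundamental Formula on \<open>S\<^sub>p\<^sup>\<dagger> \<otimes> \<Omega>\<^sup>q\<close>: up to the factor \<open>p + q\<close>, the two products of \<open>\<delta>\<close> and its
  partial inverse give \<open>p x - R\<close> and \<open>q x + R\<close> with the same mixed term \<open>R\<close>.\<close>

lemma G_sI:
  assumes I: "finite I" "\<eta> ` I \<subseteq> carrier (Omega1 sc)" and \<mu>: "\<mu> \<in> OmegaQ sc q" and pq: "0 < card I + q"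
  shows "G (tW (card I) (sI (shp \<eta>) I) \<mu>) = tW (card I) (sI (shp \<eta>) I) \<mu>"
proof -
  let ?P = "PI (shp \<eta>) I" and ?x = "tW (card I) (sI (shp \<eta>) I) \<mu>" and ?c = "inv_deg (card I + q)"
  let ?R = "finsum WT (\<lambda>i. contr \<eta> I i (ds \<mu>)) I"
  have P: "?P \<in> Sym_grade sc (card I)" and S: "sI (shp \<eta>) I \<in> U_grade sc br (card I)"
    using PI_grade[OF I(1) shp_fun[OF I(2) order_refl]] sI_grade[OF I(1) shp_fun[OF I(2) order_refl]] .
  have pP: "pi_dag_U sc br ?P = sI (shp \<eta>) I" using pi_dag_PI[OF I(1) shp_fun[OF I(2) order_refl]] .
  note \<mu>c = OG.G_carrier[OF \<mu>]
  note dsc = DSt.closed[OF \<mu>c]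
  have x: "?x \<in> carrier WT" by (rule tW_closed[OF S \<mu>c])
  have Rc: "contr \<eta> I i (ds \<mu>) \<in> carrier WT" if "i \<in> I" for i by (rule contr_closed[OF I that dsc])
  have R: "?R \<in> carrier WT" using Rc by (intro WA.T.M.finsum_closed) auto
  have "dt ?x = ?c \<odot>\<^bsub>WT\<^esub> pi_dag sc br (tS (card I) ?P \<one>\<^bsub>OM\<^esub> \<otimes>\<^bsub>ST\<^esub> ds \<mu>)"
    using dt_tW[OF P \<mu> pq] unfolding pP .
  moreover obtain r where "euler_rel r (ds \<mu>) (of_nat q \<odot>\<^bsub>OM\<^esub> \<mu>)" using euler_rel_ds'[OF \<mu>] by blast
  from d_pi_dag[OF I this] have "d (pi_dag sc br (tS (card I) ?P \<one>\<^bsub>OM\<^esub> \<otimes>\<^bsub>ST\<^esub> ds \<mu>)) = of_nat q \<odot>\<^bsub>WT\<^esub> ?x \<oplus>\<^bsub>WT\<^esub> ?R"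
    by (simp only: tW_rules(4)[OF S \<mu>c])
  ultimately have ddt: "d (dt ?x) = ?c \<odot>\<^bsub>WT\<^esub> (of_nat q \<odot>\<^bsub>WT\<^esub> ?x \<oplus>\<^bsub>WT\<^esub> ?R)"
    using D.smult[OF PG.closed[OF tS_mult_z_closed[OF P Om.b_one dsc]]] by (simp only:)
  \<comment> \<open>Differentiating the factor \<open>i\<close> gives bidegree
    \<open>(card I - 1, q + 1)\<close>, of the same total degree and hence with the same
    \<open>?c\<close>. In \<open>ds_mult\<close> the first term restores the factor \<open>i\<close>
    and yields \<open>?x\<close>; the second is a summand of \<open>?R\<close> with a minus
    sign.\<close>
  have single: "dt (tW (card I - 1) (sI (shp \<eta>) (I - {i})) (form1 sc (\<eta> i) \<otimes>\<^bsub>OM\<^esub> \<mu>)) =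
    ?c \<odot>\<^bsub>WT\<^esub> (?x \<ominus>\<^bsub>WT\<^esub> contr \<eta> I i (ds \<mu>))" if i: "i \<in> I" for i
  proof -
    let ?Q = "PI (shp \<eta>) (I - {i})" and ?e = "form1 sc (\<eta> i)"
    have Y: "shp \<eta> ` (I - {i}) \<subseteq> carrier (Der sc)" by (rule shp_fun[OF I(2)]) auto
    have \<eta>i: "\<eta> i \<in> carrier (Omega1 sc)" using I(2) i by auto
    note Q = PI_remove_grade[OF I i] and e = form1_closed[OF \<eta>i]
    have "0 < card I" using i I(1) by (auto simp: card_gt_0_iff)
    then have card: "card I - 1 + Suc q = card I + q" "card I - 1 + 1 = card I" by simp_all
    have "?e \<otimes>\<^bsub>OM\<^esub> \<mu> \<in> OmegaQ sc (1 + q)" by (rule OG.G_mult[OF form1_grade[OF \<eta>i] \<mu>])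
    then have "dt (tW (card I - 1) (sI (shp \<eta>) (I - {i})) (?e \<otimes>\<^bsub>OM\<^esub> \<mu>)) =
      inv_deg (card I - 1 + Suc q) \<odot>\<^bsub>WT\<^esub> pi_dag sc br (tS (card I - 1) ?Q \<one>\<^bsub>OM\<^esub> \<otimes>\<^bsub>ST\<^esub> ds (?e \<otimes>\<^bsub>OM\<^esub> \<mu>))"
      using dt_tW[OF Q, of "?e \<otimes>\<^bsub>OM\<^esub> \<mu>" "Suc q"] pi_dag_PI[OF finite_Diff[OF I(1)] Y] by simp
    also have "tS (card I - 1) ?Q \<one>\<^bsub>OM\<^esub> \<otimes>\<^bsub>ST\<^esub> ds (?e \<otimes>\<^bsub>OM\<^esub> \<mu>) =
      tS (card I - 1) ?Q \<one>\<^bsub>OM\<^esub> \<otimes>\<^bsub>ST\<^esub> tS 1 (sY (\<eta> i)) \<mu> \<ominus>\<^bsub>ST\<^esub>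
      tS (card I - 1) ?Q \<one>\<^bsub>OM\<^esub> \<otimes>\<^bsub>ST\<^esub> (f1 (\<eta> i) \<otimes>\<^bsub>ST\<^esub> ds \<mu>)"
      using tS_closed[OF Q Om.b_one] tS_closed[OF sY_grade[OF \<eta>i] \<mu>c] tS_mult_z_closed[OF S_one_grade e dsc]
      by (simp only: ds_mult[OF \<eta>i \<mu>c] a_minus_def SA.TA.b_r_distr SA.T.M.a_inv_closed SA.TA.b_neg_r)
    also have "tS (card I - 1) ?Q \<one>\<^bsub>OM\<^esub> \<otimes>\<^bsub>ST\<^esub> (f1 (\<eta> i) \<otimes>\<^bsub>ST\<^esub> ds \<mu>) = tS (card I - 1) ?Q ?e \<otimes>\<^bsub>ST\<^esub> ds \<mu>"
      using tS_assoc[OF Q S_one_grade Om.b_one e ds_DerOmega[OF \<mu>c]] tS_mult[OF Q S_one_grade Om.b_one e]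
        SG.G_carrier[OF Q] e by (simp del: One_nat_def)
    also have "tS (card I - 1) ?Q \<one>\<^bsub>OM\<^esub> \<otimes>\<^bsub>ST\<^esub> tS 1 (sY (\<eta> i)) \<mu> = tS (card I) ?P \<mu>"
    proof -
      have ins: "insert i (I - {i}) = I" using i by auto
      have "?Q \<otimes>\<^bsub>Sym sc\<^esub> sY (\<eta> i) = ?P"
        using PI_insert[of "I - {i}" "shp \<eta>" i] Sym_gen_central[OF SG.G_carrier[OF Q] Sh.closed[OF \<eta>i]]
          shp_fun[OF I(2) order_refl] I(1) unfolding ins by simp
      then show ?thesis
        using tS_mult[OF Q sY_grade[OF \<eta>i] Om.b_one \<mu>c] \<mu>c unfolding card(2) by simp
    qed
    also have "pi_dag sc br (tS (card I) ?P \<mu> \<ominus>\<^bsub>ST\<^esub> tS (card I - 1) ?Q ?e \<otimes>\<^bsub>ST\<^esub> ds \<mu>) = ?x \<ominus>\<^bsub>WT\<^esub> contr \<eta> I i (ds \<mu>)"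
      using PG.minus[OF tS_closed[OF P \<mu>c] tS_mult_z_closed[OF Q e dsc]] pi_dag_tS[OF P \<mu>c] by (simp only: pP)
    finally show ?thesis unfolding card(1) .
  qed
  have y: "tW (card I - 1) (sI (shp \<eta>) (I - {i})) (form1 sc (\<eta> i) \<otimes>\<^bsub>OM\<^esub> \<mu>) \<in> carrier WT" if i: "i \<in> I" for i
  proof -
    have "sI (shp \<eta>) (I - {i}) \<in> U_grade sc br (card I - 1)"
      using pi_dag_grade[OF PI_remove_grade[OF I i]] pi_dag_PI[of "I - {i}" "shp \<eta>"] I(1)
        shp_fun[OF I(2), of "I - {i}"] by auto
    then show ?thesis using I(2) i \<mu>c by auto
  qed
  have "dt (d ?x) = finsum WT (\<lambda>i. dt (tW (card I - 1) (sI (shp \<eta>) (I - {i})) (form1 sc (\<eta> i) \<otimes>\<^bsub>OM\<^esub> \<mu>))) I"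
    unfolding d_sI_mult[OF I \<mu>c] using y by (intro DT.finsum) auto
  also have "\<dots> = finsum WT (\<lambda>i. ?c \<odot>\<^bsub>WT\<^esub> (?x \<ominus>\<^bsub>WT\<^esub> contr \<eta> I i (ds \<mu>))) I"
    using single x Rc by (intro WA.T.M.finsum_cong' refl) auto
  also have "\<dots> = ?c \<odot>\<^bsub>WT\<^esub> finsum WT (\<lambda>i. ?x \<ominus>\<^bsub>WT\<^esub> contr \<eta> I i (ds \<mu>)) I"
    using I(1) x Rc by (intro WA.T.smult_finsum[symmetric]) auto
  also have "finsum WT (\<lambda>i. ?x \<ominus>\<^bsub>WT\<^esub> contr \<eta> I i (ds \<mu>)) I = of_nat (card I) \<odot>\<^bsub>WT\<^esub> ?x \<ominus>\<^bsub>WT\<^esub> ?R"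
    using WA.T.finsum_minus[of "\<lambda>i. ?x" I "\<lambda>i. contr \<eta> I i (ds \<mu>)"] WA.T.finsum_of_nat[OF I(1) x] x Rc by auto
  finally have "G ?x = ?c \<odot>\<^bsub>WT\<^esub> ((of_nat (card I) \<odot>\<^bsub>WT\<^esub> ?x \<ominus>\<^bsub>WT\<^esub> ?R) \<oplus>\<^bsub>WT\<^esub> (of_nat q \<odot>\<^bsub>WT\<^esub> ?x \<oplus>\<^bsub>WT\<^esub> ?R))"
    using x R by (simp add: G_def ddt WA.T.smult_add_right)
  also have "(of_nat (card I) \<odot>\<^bsub>WT\<^esub> ?x \<ominus>\<^bsub>WT\<^esub> ?R) \<oplus>\<^bsub>WT\<^esub> (of_nat q \<odot>\<^bsub>WT\<^esub> ?x \<oplus>\<^bsub>WT\<^esub> ?R) =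
    of_nat (card I) \<odot>\<^bsub>WT\<^esub> ?x \<oplus>\<^bsub>WT\<^esub> of_nat q \<odot>\<^bsub>WT\<^esub> ?x"
  proof -
    have abel: "(a \<ominus>\<^bsub>WT\<^esub> b) \<oplus>\<^bsub>WT\<^esub> (e \<oplus>\<^bsub>WT\<^esub> b) = a \<oplus>\<^bsub>WT\<^esub> e"
      if "a \<in> carrier WT" "b \<in> carrier WT" "e \<in> carrier WT" for a b e
      using that by (simp add: a_minus_def WA.T.M.a_assoc WA.T.M.a_comm[of e b] WA.T.M.r_neg1)
    show ?thesis using x R by (intro abel) auto
  qed
  also have "\<dots> = of_nat (card I + q) \<odot>\<^bsub>WT\<^esub> ?x" using x by (simp add: WA.T.smult_add_left)
  also have "?c \<odot>\<^bsub>WT\<^esub> \<dots> = ?x"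
    using x sc_inverse_of_nat[of "card I + q"] pq by (simp add: WA.T.smult_mult[symmetric] del: of_nat_add)
  finally show ?thesis .
qed

section \<open>The Fundamental Formula\<close>

lemma G_one: "G \<one>\<^bsub>WT\<^esub> = \<zero>\<^bsub>WT\<^esub>"
  by (simp add: G_def d_one dt_one D.zero DT.zero)

lemma G_Sym:
  assumes s: "s \<in> Sym_grade sc p" and \<mu>: "\<mu> \<in> OmegaQ sc q" and pq: "0 < p + q"
  shows "G (tW p (pi_dag_U sc br s) \<mu>) = tW p (pi_dag_U sc br s) \<mu>"
  using s
proof (induction rule: Sym_grade_induct)
  case zero
  then show ?case
    using tW_rules(6)[OF UG.G_rules(2) OG.G_carrier[OF \<mu>]] by (simp add: PD.zero G.zero)
next
  case (add x y)
  note g = pi_dag_grade[OF add(1)] pi_dag_grade[OF add(2)] and \<mu>c = OG.G_carrier[OF \<mu>]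
  show ?case
    using add(3,4) tW_closed[OF g(1) \<mu>c] tW_closed[OF g(2) \<mu>c]
    by (simp only: PD.add[OF SG.G_carrier[OF add(1)] SG.G_carrier[OF add(2)]] tW_rules(1)[OF g(1) \<mu>c g(2)] G.add)
next
  case (PI Y a)
  \<comment> \<open>Surjectivity of \<open>sharp\<close> provides 1-forms for the factors. The
    identity obtained mentions only the derivations, so it does not matter which preimages are
    chosen.\<close>
  have "\<forall>i\<in>{..<p}. \<exists>\<nu>. \<nu> \<in> carrier (Omega1 sc) \<and> sharp sc br \<nu> = Y i"
  proof
    fix i assume "i \<in> {..<p}"
    then have "Y i \<in> sharp sc br ` carrier (Omega1 sc)" using PI unfolding sharp_surj by auto
    then show "\<exists>\<nu>. \<nu> \<in> carrier (Omega1 sc) \<and> sharp sc br \<nu> = Y i" by auto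
  qed
  from bchoice[OF this] obtain \<eta>
    where \<eta>: "\<And>i. i < p \<Longrightarrow> \<eta> i \<in> carrier (Omega1 sc) \<and> sharp sc br (\<eta> i) = Y i" by auto
  have \<eta>I: "\<eta> ` {..<p} \<subseteq> carrier (Omega1 sc)" using \<eta> by auto
  have "sI (shp \<eta>) {..<p} = sI Y {..<p}" using \<eta> PI by (intro sI_cong) auto
  then have "G (tW p (sI Y {..<p}) \<mu>) = tW p (sI Y {..<p}) \<mu>"
    using G_sI[OF _ \<eta>I \<mu>] pq by simp
  moreover have S: "sI Y {..<p} \<in> U_grade sc br p" using sI_grade[OF _ PI] by simp
  ultimately show ?case
    using PI pi_dag_PI[OF _ PI] OG.G_carrier[OF \<mu>]
    by (simp add: PD.smult PI_closed[OF _ PI] tW_rules(2) G.smult)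
qed

text \<open>The added scalar is the contribution of tau. It vanishes for \<open>p > 0\<close> by the
  case distinction and for \<open>q > 0\<close> because \<open>coeff0\<close> is 0 on forms of
  positive degree; for \<open>p = q = 0\<close> it is the whole element, since \<open>G\<close>
  kills scalars.\<close>

lemma G_homogeneous:
  assumes s: "s \<in> Sym_grade sc p" and \<mu>: "\<mu> \<in> OmegaQ sc q"
  shows "G (tW p (pi_dag_U sc br s) \<mu>) \<oplus>\<^bsub>WT\<^esub> (if p = 0 then coeff0 s * coeff0 \<mu> else 0) \<odot>\<^bsub>WT\<^esub> \<one>\<^bsub>WT\<^esub> =
    tW p (pi_dag_U sc br s) \<mu>"
proof (cases "p + q = 0")
  case True
  then show ?thesis
    using s \<mu> WA.TA.b_one by (simp add: tW_degree_0 G.smult G_one)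
next
  case False
  then have "(if p = 0 then coeff0 s * coeff0 \<mu> else 0) = 0" using coeff0_Omega_grade[OF \<mu>] by auto
  then show ?thesis
    using G_Sym[OF s \<mu>] False tW_closed[OF pi_dag_grade[OF s] OG.G_carrier[OF \<mu>]] WA.TA.b_one by simp
qed

text \<open>Words of 1-forms are homogeneous and span all forms, so the two homogeneous statements
  extend additively to arbitrary forms.\<close>

lemma S_dag_forms:
  assumes s: "s \<in> S_dag_grade sc br p" and \<mu>: "\<mu> \<in> carrier OM"
  shows "dt (dt (tW p s \<mu>)) = \<zero>\<^bsub>WT\<^esub>"
    and "G (tW p s \<mu>) \<oplus>\<^bsub>WT\<^esub> (if p = 0 then coeff0 (pi_U sc s) * coeff0 \<mu> else 0) \<odot>\<^bsub>WT\<^esub> \<one>\<^bsub>WT\<^esub> = tW p s \<mu>"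
proof -
  obtain t where t: "t \<in> Sym_grade sc p" "s = pi_dag_U sc br t"
    using s by (auto simp: S_dag_grade_def)
  have ps: "pi_U sc s = t" using t pi_pi_dag[OF SG.G_carrier[OF t(1)]] by simp
  have sU: "s \<in> U_grade sc br p" by (rule S_dag_U[OF s])
  have word: "a \<odot>\<^bsub>OM\<^esub> Om.wd ws \<in> OmegaQ sc (length ws)" if "set ws \<subseteq> carrier (Omega1 sc)" for a ws
    by (rule OG.G_rules(4)[OF Omega_word_grade[OF that]])
  let ?c = "\<lambda>\<mu>. if p = 0 then coeff0 (pi_U sc s) * coeff0 \<mu> else 0"
  show "dt (dt (tW p s \<mu>)) = \<zero>\<^bsub>WT\<^esub>"
    using \<mu>
  proof (induction rule: Om.word_induct)
    case (word ws a)
    then show ?case using dt_dt_homogeneous[OF t(1) \<open>_ \<Longrightarrow> _ \<in> OmegaQ sc _\<close>[OF word], of a] t(2) by simp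
  qed (simp_all add: tW_rules(3)[OF sU] tW_rules(5)[OF sU Om.M.zero_closed] DT.zero DT.add sU)
  show "G (tW p s \<mu>) \<oplus>\<^bsub>WT\<^esub> ?c \<mu> \<odot>\<^bsub>WT\<^esub> \<one>\<^bsub>WT\<^esub> = tW p s \<mu>"
    using \<mu>
  proof (induction rule: Om.word_induct)
    case zero
    have "?c \<zero>\<^bsub>OM\<^esub> = 0" using lin_mapD(3)[OF coeff0_Omega, of "\<zero>\<^bsub>OM\<^esub>" 0] by simp
    then show ?case using tW_rules(5)[OF sU Om.M.zero_closed] WA.TA.b_one by (simp add: G.zero)
  next
    case (add x y)
    have c: "?c (x \<oplus>\<^bsub>OM\<^esub> y) = ?c x + ?c y"
      using add by (simp add: lin_mapD(2)[OF coeff0_Omega] distrib_left)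
    have cl: "G (tW p s x) \<in> carrier WT" "G (tW p s y) \<in> carrier WT"
      "?c x \<odot>\<^bsub>WT\<^esub> \<one>\<^bsub>WT\<^esub> \<in> carrier WT" "?c y \<odot>\<^bsub>WT\<^esub> \<one>\<^bsub>WT\<^esub> \<in> carrier WT"
      using sU add(1,2) WA.TA.b_one by (simp_all add: G.closed)
    have "G (tW p s (x \<oplus>\<^bsub>OM\<^esub> y)) \<oplus>\<^bsub>WT\<^esub> ?c (x \<oplus>\<^bsub>OM\<^esub> y) \<odot>\<^bsub>WT\<^esub> \<one>\<^bsub>WT\<^esub> =
      (G (tW p s x) \<oplus>\<^bsub>WT\<^esub> ?c x \<odot>\<^bsub>WT\<^esub> \<one>\<^bsub>WT\<^esub>) \<oplus>\<^bsub>WT\<^esub> (G (tW p s y) \<oplus>\<^bsub>WT\<^esub> ?c y \<odot>\<^bsub>WT\<^esub> \<one>\<^bsub>WT\<^esub>)"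
      unfolding c using cl tW_closed[OF sU add(1)] tW_closed[OF sU add(2)]
      by (simp only: tW_rules(3)[OF sU add(1,2)] G.add WA.T.smult_add_left[OF WA.TA.b_one] WA.T.M.a_ac WA.T.M.a_closed)
    then show ?case by (simp only: add(3,4) tW_rules(3)[OF sU add(1,2)])
  next
    case (word ws a)
    then show ?case
      using G_homogeneous[OF t(1) \<open>_ \<Longrightarrow> _ \<in> OmegaQ sc _\<close>[OF word], of a] unfolding t(2)[symmetric] ps by simp
  qed
qed

lemma tW_decomposed:
  assumes s: "\<And>m. 2 * m \<le> n \<Longrightarrow> s m \<in> S_dag_grade sc br (n - 2 * m)" and \<mu>: "\<mu> \<in> carrier OM"
  shows "tW n (finsum (U_alg sc br) (\<lambda>m. hp m \<otimes>\<^bsub>U_alg sc br\<^esub> s m) {m. 2 * m \<le> n}) \<mu> =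
    finsum WT (\<lambda>m. hW m \<otimes>\<^bsub>WT\<^esub> tW (n - 2 * m) (s m) \<mu>) {m. 2 * m \<le> n}"
proof -
  have g: "hp m \<otimes>\<^bsub>U_alg sc br\<^esub> s m \<in> U_grade sc br n" if "2 * m \<le> n" for m
    using UG.G_mult[OF hp_grade S_dag_U[OF s[OF that]], of m] that by simp
  have "tW n (finsum (U_alg sc br) (\<lambda>m. hp m \<otimes>\<^bsub>U_alg sc br\<^esub> s m) {m. 2 * m \<le> n}) \<mu> =
    finsum WT (\<lambda>m. tW n (hp m \<otimes>\<^bsub>U_alg sc br\<^esub> s m) \<mu>) {m. 2 * m \<le> n}"
    using g \<mu> by (intro tW_finsum_l) auto
  also have "\<dots> = finsum WT (\<lambda>m. hW m \<otimes>\<^bsub>WT\<^esub> tW (n - 2 * m) (s m) \<mu>) {m. 2 * m \<le> n}"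
  proof (intro WA.T.M.finsum_cong' refl)
    fix m assume m: "m \<in> {m. 2 * m \<le> n}"
    then show "tW n (hp m \<otimes>\<^bsub>U_alg sc br\<^esub> s m) \<mu> = hW m \<otimes>\<^bsub>WT\<^esub> tW (n - 2 * m) (s m) \<mu>"
      using tW_mult[OF hp_grade S_dag_U[OF s] Om.b_one \<mu>, of m m] \<mu> by simp
  next
    show "(\<lambda>m. hW m \<otimes>\<^bsub>WT\<^esub> tW (n - 2 * m) (s m) \<mu>) \<in> {m. 2 * m \<le> n} \<rightarrow> carrier WT"
      using S_dag_U[OF s] \<mu> by (auto intro!: WA.TA.b_closed hW_closed tW_closed)
  qed
  finally show ?thesis .
qed

lemma dt_dt_tW:
  assumes u: "u \<in> U_grade sc br n" and \<mu>: "\<mu> \<in> carrier OM"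
  shows "dt (dt (tW n u \<mu>)) = \<zero>\<^bsub>WT\<^esub>"
proof -
  obtain s where s: "\<And>m. 2 * m \<le> n \<Longrightarrow> s m \<in> S_dag_grade sc br (n - 2 * m)"
    and us: "u = finsum (U_alg sc br) (\<lambda>m. hp m \<otimes>\<^bsub>U_alg sc br\<^esub> s m) {m. 2 * m \<le> n}"
    using U_grade_decomposed[OF u] unfolding decomposed_def by blast
  let ?y = "\<lambda>m. tW (n - 2 * m) (s m) \<mu>"
  have y: "?y m \<in> carrier WT" if "2 * m \<le> n" for m using S_dag_U[OF s[OF that]] \<mu> by simp
  have h: "hW m \<otimes>\<^bsub>WT\<^esub> ?y m \<in> carrier WT" if "2 * m \<le> n" for m using y[OF that] by simp
  have eq: "tW n u \<mu> = finsum WT (\<lambda>m. hW m \<otimes>\<^bsub>WT\<^esub> ?y m) {m. 2 * m \<le> n}"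
    unfolding us by (rule tW_decomposed[OF s \<mu>])
  have "dt (tW n u \<mu>) = finsum WT (\<lambda>m. dt (hW m \<otimes>\<^bsub>WT\<^esub> ?y m)) {m. 2 * m \<le> n}"
    unfolding eq using h by (intro DT.finsum) auto
  then have "dt (dt (tW n u \<mu>)) = dt (finsum WT (\<lambda>m. dt (hW m \<otimes>\<^bsub>WT\<^esub> ?y m)) {m. 2 * m \<le> n})"
    by (rule arg_cong)
  also have "\<dots> = finsum WT (\<lambda>m. dt (dt (hW m \<otimes>\<^bsub>WT\<^esub> ?y m))) {m. 2 * m \<le> n}"
    using h by (intro DT.finsum) auto
  also have "\<dots> = finsum WT (\<lambda>m. \<zero>\<^bsub>WT\<^esub>) {m. 2 * m \<le> n}"
    using y S_dag_forms(1)[OF s \<mu>]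
    by (intro WA.T.M.finsum_cong' refl) (auto simp: dt_hW_mult WA.TA.b_zero_r)
  finally show ?thesis by (simp add: WA.T.M.finsum_zero)
qed

text \<open>\<open>G\<close> passes through powers of \<open>h\<close>, and the coefficient of the
  \<open>m\<close>-th power has degree \<open>n - 2 * m\<close>. A contribution of tau therefore
  arises only for even \<open>n\<close>, at \<open>m = n div 2\<close>.\<close>

lemma G_tW:
  assumes s: "\<And>m. 2 * m \<le> n \<Longrightarrow> s m \<in> S_dag_grade sc br (n - 2 * m)"
    and us: "u = finsum (U_alg sc br) (\<lambda>m. hp m \<otimes>\<^bsub>U_alg sc br\<^esub> s m) {m. 2 * m \<le> n}" and \<mu>: "\<mu> \<in> carrier OM"
  shows "G (tW n u \<mu>) \<oplus>\<^bsub>WT\<^esub> tW n (if even n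
      then (coeff0 (pi_U sc (s (n div 2))) * coeff0 \<mu>) \<odot>\<^bsub>U_alg sc br\<^esub> hp (n div 2) else \<zero>\<^bsub>U_alg sc br\<^esub>) \<one>\<^bsub>OM\<^esub> =
    tW n u \<mu>"
proof -
  let ?y = "\<lambda>m. tW (n - 2 * m) (s m) \<mu>" and ?I = "{m. 2 * m \<le> n}"
  let ?e = "\<lambda>m. if n - 2 * m = 0 then coeff0 (pi_U sc (s m)) * coeff0 \<mu> else 0"
  have y: "?y m \<in> carrier WT" if "2 * m \<le> n" for m using S_dag_U[OF s[OF that]] \<mu> by simp
  have h: "hW m \<otimes>\<^bsub>WT\<^esub> ?y m \<in> carrier WT" if "2 * m \<le> n" for m using y[OF that] by simp
  have G: "G (hW m \<otimes>\<^bsub>WT\<^esub> ?y m) = hW m \<otimes>\<^bsub>WT\<^esub> G (?y m)" if "2 * m \<le> n" for m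
    using y[OF that] by (simp add: G_def d_hW_mult dt_hW_mult WA.TA.b_r_distr)
  have one: "hW m \<otimes>\<^bsub>WT\<^esub> ?y m = G (hW m \<otimes>\<^bsub>WT\<^esub> ?y m) \<oplus>\<^bsub>WT\<^esub> ?e m \<odot>\<^bsub>WT\<^esub> hW m" if m: "2 * m \<le> n" for m
  proof -
    have "hW m \<otimes>\<^bsub>WT\<^esub> (g \<oplus>\<^bsub>WT\<^esub> e \<odot>\<^bsub>WT\<^esub> \<one>\<^bsub>WT\<^esub>) = hW m \<otimes>\<^bsub>WT\<^esub> g \<oplus>\<^bsub>WT\<^esub> e \<odot>\<^bsub>WT\<^esub> hW m" if "g \<in> carrier WT" for g e
      using that WA.TA.b_one by (simp add: WA.TA.b_r_distr WA.TA.b_smult_r)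
    from this[OF G.closed[OF y[OF m]], of "?e m"]
    show ?thesis unfolding S_dag_forms(2)[OF s[OF m] \<mu>] G[OF m] .
  qed
  have Gc: "(\<lambda>m. G (hW m \<otimes>\<^bsub>WT\<^esub> ?y m)) \<in> ?I \<rightarrow> carrier WT" using G.closed[OF h] by auto
  have ec: "(\<lambda>m. ?e m \<odot>\<^bsub>WT\<^esub> hW m) \<in> ?I \<rightarrow> carrier WT" by simp
  have sum: "tW n u \<mu> = finsum WT (\<lambda>m. hW m \<otimes>\<^bsub>WT\<^esub> ?y m) ?I" unfolding us by (rule tW_decomposed[OF s \<mu>])
  also have "\<dots> = finsum WT (\<lambda>m. G (hW m \<otimes>\<^bsub>WT\<^esub> ?y m) \<oplus>\<^bsub>WT\<^esub> ?e m \<odot>\<^bsub>WT\<^esub> hW m) ?I"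
    by (intro WA.T.M.finsum_cong' refl) (use one Gc ec in \<open>auto simp only: Pi_def mem_Collect_eq intro!: WA.T.M.a_closed\<close>)
  also have "\<dots> = finsum WT (\<lambda>m. G (hW m \<otimes>\<^bsub>WT\<^esub> ?y m)) ?I \<oplus>\<^bsub>WT\<^esub> finsum WT (\<lambda>m. ?e m \<odot>\<^bsub>WT\<^esub> hW m) ?I"
    using Gc ec by (rule WA.T.M.finsum_addf)
  also have "finsum WT (\<lambda>m. G (hW m \<otimes>\<^bsub>WT\<^esub> ?y m)) ?I = G (tW n u \<mu>)"
    unfolding sum using h by (intro G.finsum[symmetric]) auto
  also have "finsum WT (\<lambda>m. ?e m \<odot>\<^bsub>WT\<^esub> hW m) ?I =
    tW n (if even n then (coeff0 (pi_U sc (s (n div 2))) * coeff0 \<mu>) \<odot>\<^bsub>U_alg sc br\<^esub> hp (n div 2) else \<zero>\<^bsub>U_alg sc br\<^esub>) \<one>\<^bsub>OM\<^esub>"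
  proof (cases "even n")
    case True
    then obtain k where n: "n = 2 * k" by blast
    have "finsum WT (\<lambda>m. ?e m \<odot>\<^bsub>WT\<^esub> hW m) ?I = finsum WT (\<lambda>m. if k = m then ?e m \<odot>\<^bsub>WT\<^esub> hW m else \<zero>\<^bsub>WT\<^esub>) ?I"
      by (intro WA.T.M.finsum_cong' refl) (auto simp: n)
    also have "\<dots> = ?e k \<odot>\<^bsub>WT\<^esub> hW k"
      by (rule WA.T.M.add.finprod_singleton) (use fin_even[of n] ec in \<open>auto simp: n\<close>)
    finally show ?thesis using tW_rules(2)[OF hp_grade Om.b_one, of k] by (simp add: n)
  next
    case False
    then have "finsum WT (\<lambda>m. ?e m \<odot>\<^bsub>WT\<^esub> hW m) ?I = finsum WT (\<lambda>m. \<zero>\<^bsub>WT\<^esub>) ?I"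
      by (intro WA.T.M.finsum_cong' refl) auto
    then show ?thesis
      using False tW_rules(6)[OF UG.G_rules(2) Om.b_one, of n] by (simp add: WA.T.M.finsum_zero)
  qed
  finally show ?thesis by simp
qed

section \<open>Passage to the completion by continuity\<close>

lemma continuous_mapD:
  "continuous_map C N f \<Longrightarrow> conv_sum C N g x \<Longrightarrow> conv_sum C N (\<lambda>m. f (g m)) (f x)"
  by (simp add: continuous_map_def)

text \<open>A pure tensor is the sum of the series of its homogeneous components. By continuity its
  image is a sum of zeros, and \<open>conv_zeros_zero\<close> applies.\<close>

lemma dt_dt:
  assumes "x \<in> carrier WT"
  shows "dt (dt x) = \<zero>\<^bsub>WT\<^esub>"
  using assms
proof (induction rule: WA.tensor_induct)
  case (tens w \<mu>)
  have "conv_sum (W_alg sc br) OM (\<lambda>p. dt (dt (tW p (w p) \<mu>))) (dt (dt (tens (W_alg sc br) OM w \<mu>)))"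
    by (intro continuous_mapD[OF dt_cont] conv_homog[OF tens])
  then show ?case
    by (rule conv_zeros_zero) (rule dt_dt_tW[OF W_closed(1)[OF tens(1)] tens(2)])
qed (simp_all add: DT.zero DT.add)

lemma G_cont: "conv_sum (W_alg sc br) OM f x \<Longrightarrow> conv_sum (W_alg sc br) OM (\<lambda>m. G (f m)) (G x)"
  unfolding G_def by (intro conv_add continuous_mapD[OF dt_cont] continuous_mapD[OF d_cont])

lemma SdagOmega_sub: "submodule (SdagOmega sc br) base_mod WT"
  unfolding SdagOmega_def using S_dag_U by (intro WA.tens_part_sub) (auto simp: W_simps)

lemmas SdagOmega_rules = WA.T.submoduleD[OF SdagOmega_sub]

lemma h_W_closed: "h_W sc br [^]\<^bsub>WT\<^esub> (m::nat) \<in> carrier WT"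
  by (simp add: h_W_pow)

text \<open>Every element has an expansion \<open>\<Sum> h\<^sup>m s\<^sub>m\<close>; its uniqueness is not needed, since \<open>\<tau>\<close> is prescribed on
  every such expansion.\<close>

lemma fundamental_formula:
  assumes "x \<in> carrier WT"
  shows "\<exists>s. (\<forall>m. s m \<in> SdagOmega sc br) \<and>
    conv_sum (W_alg sc br) OM (\<lambda>m. h_W sc br [^]\<^bsub>WT\<^esub> (m::nat) \<otimes>\<^bsub>WT\<^esub> s m) x \<and>
    G x \<oplus>\<^bsub>WT\<^esub> inAh sc br (Abs_fps (\<lambda>m. tau_S (pi_map sc (s m)))) = x"
  using assms
proof (induction rule: WA.tensor_induct)
  case zero
  have "tau_S \<zero>\<^bsub>ST\<^esub> = (0::'a)" using lin_mapD(3)[OF tau_S_lin, of "\<zero>\<^bsub>ST\<^esub>" 0] by simp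
  then have "Abs_fps (\<lambda>m. tau_S (pi_map sc \<zero>\<^bsub>WT\<^esub>)) = (0 :: 'a fps)" by (simp add: fps_eq_iff PM.zero)
  then show ?case
    using conv_zero SdagOmega_rules(2) h_W_closed
    by (intro exI[of _ "\<lambda>_. \<zero>\<^bsub>WT\<^esub>"]) (simp add: G.zero inAh_zero WA.TA.b_zero_r)
next
  case (add x y)
  from add(3) obtain s where s: "\<And>m. s m \<in> SdagOmega sc br"
    and sx: "conv_sum (W_alg sc br) OM (\<lambda>m. h_W sc br [^]\<^bsub>WT\<^esub> (m::nat) \<otimes>\<^bsub>WT\<^esub> s m) x"
      "G x \<oplus>\<^bsub>WT\<^esub> inAh sc br (Abs_fps (\<lambda>m. tau_S (pi_map sc (s m)))) = x" by blast
  from add(4) obtain t where t: "\<And>m. t m \<in> SdagOmega sc br"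
    and ty: "conv_sum (W_alg sc br) OM (\<lambda>m. h_W sc br [^]\<^bsub>WT\<^esub> (m::nat) \<otimes>\<^bsub>WT\<^esub> t m) y"
      "G y \<oplus>\<^bsub>WT\<^esub> inAh sc br (Abs_fps (\<lambda>m. tau_S (pi_map sc (t m)))) = y" by blast
  let ?c = "\<lambda>s. Abs_fps (\<lambda>m. tau_S (pi_map sc (s m)))"
  have c: "s m \<in> carrier WT" "t m \<in> carrier WT" for m using s t SdagOmega_rules(1) by blast+
  have "tau_S (pi_map sc (s m \<oplus>\<^bsub>WT\<^esub> t m)) = tau_S (pi_map sc (s m)) + tau_S (pi_map sc (t m))" for m
    using lin_mapD(2)[OF tau_S_lin] c by (simp add: PM.add PM.closed)
  then have fps: "?c (\<lambda>m. s m \<oplus>\<^bsub>WT\<^esub> t m) = ?c s + ?c t" by (simp add: fps_eq_iff)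
  have "G (x \<oplus>\<^bsub>WT\<^esub> y) \<oplus>\<^bsub>WT\<^esub> inAh sc br (?c s + ?c t) = (G x \<oplus>\<^bsub>WT\<^esub> inAh sc br (?c s)) \<oplus>\<^bsub>WT\<^esub> (G y \<oplus>\<^bsub>WT\<^esub> inAh sc br (?c t))"
    using add(1,2) inAh_closed G.closed by (simp add: G.add inAh_add WA.T.M.a_ac)
  then have "G (x \<oplus>\<^bsub>WT\<^esub> y) \<oplus>\<^bsub>WT\<^esub> inAh sc br (?c (\<lambda>m. s m \<oplus>\<^bsub>WT\<^esub> t m)) = x \<oplus>\<^bsub>WT\<^esub> y"
    unfolding fps sx(2) ty(2) .
  moreover have "conv_sum (W_alg sc br) OM (\<lambda>m. h_W sc br [^]\<^bsub>WT\<^esub> (m::nat) \<otimes>\<^bsub>WT\<^esub> (s m \<oplus>\<^bsub>WT\<^esub> t m)) (x \<oplus>\<^bsub>WT\<^esub> y)"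
  proof -
    have "(\<lambda>m::nat. h_W sc br [^]\<^bsub>WT\<^esub> m \<otimes>\<^bsub>WT\<^esub> (s m \<oplus>\<^bsub>WT\<^esub> t m)) =
      (\<lambda>m. h_W sc br [^]\<^bsub>WT\<^esub> m \<otimes>\<^bsub>WT\<^esub> s m \<oplus>\<^bsub>WT\<^esub> h_W sc br [^]\<^bsub>WT\<^esub> m \<otimes>\<^bsub>WT\<^esub> t m)"
      by (intro HOL.ext WA.TA.b_r_distr h_W_closed c)
    then show ?thesis using conv_add[OF sx(1) ty(1)] by (simp only:)
  qed
  ultimately show ?case
    using SdagOmega_rules(3)[OF s t] by (intro exI[of _ "\<lambda>m. s m \<oplus>\<^bsub>WT\<^esub> t m"]) simp
next
  case (tens w \<mu>)
  note w = tens(1) and \<mu> = tens(2)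
  have "\<forall>n. \<exists>s. (\<forall>m. 2 * m \<le> n \<longrightarrow> s m \<in> S_dag_grade sc br (n - 2 * m)) \<and>
     w n = finsum (U_alg sc br) (\<lambda>m. hp m \<otimes>\<^bsub>U_alg sc br\<^esub> s m) {m. 2 * m \<le> n}"
    using U_grade_decomposed[OF W_closed(1)[OF w]] unfolding decomposed_def by blast
  from choice[OF this] obtain S where
    "\<forall>n. (\<forall>m. 2 * m \<le> n \<longrightarrow> S n m \<in> S_dag_grade sc br (n - 2 * m)) \<and>
     w n = finsum (U_alg sc br) (\<lambda>m. hp m \<otimes>\<^bsub>U_alg sc br\<^esub> S n m) {m. 2 * m \<le> n}" by blast
  then have S: "\<And>n m. 2 * m \<le> n \<Longrightarrow> S n m \<in> S_dag_grade sc br (n - 2 * m)"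
    and wS: "\<And>n. w n = finsum (U_alg sc br) (\<lambda>m. hp m \<otimes>\<^bsub>U_alg sc br\<^esub> S n m) {m. 2 * m \<le> n}" by blast+
  \<comment> \<open>Regrouping by powers of \<open>h\<close>: component \<open>p\<close> of the
    coefficient of the \<open>m\<close>-th power comes from degree \<open>p + 2 * m\<close> of
    \<open>w\<close>. Each \<open>\<sigma> m\<close> is thus one element of the completed
    symmetrized part.\<close>
  define \<sigma> where "\<sigma> m p = S (p + 2 * m) m" for m p
  have \<sigma>: "\<sigma> m p \<in> S_dag_grade sc br p" for m p using S[of m "p + 2 * m"] by (simp add: \<sigma>_def)
  then have \<sigma>W: "\<sigma> m \<in> carrier (W_alg sc br)" for m using S_dag_U by (simp add: W_simps)
  let ?x = "tens (W_alg sc br) OM w \<mu>" and ?s = "\<lambda>m. tens (W_alg sc br) OM (\<sigma> m) \<mu>"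
  let ?c = "Abs_fps (\<lambda>m. tau_S (pi_map sc (?s m)))"
  have x: "?x \<in> carrier WT" using w \<mu> by simp
  have sdag: "?s m \<in> SdagOmega sc br" for m
    unfolding SdagOmega_def using \<sigma> \<mu> by (intro WA.tens_part_tn) auto
  let ?v = "\<lambda>m. homog (U_alg sc br) (2 * m) (hp m) \<otimes>\<^bsub>W_alg sc br\<^esub> \<sigma> m"
  have v: "?v m p = (if 2 * m \<le> p then hp m \<otimes>\<^bsub>U_alg sc br\<^esub> S p m else \<zero>\<^bsub>U_alg sc br\<^esub>)" for m p
    using W_homog_mult_l[OF hp_grade \<sigma>W, of m m] by (simp add: \<sigma>_def)
  have "conv_sum (W_alg sc br) OM (\<lambda>m. tens (W_alg sc br) OM (?v m) \<mu>) ?x"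
  proof (rule conv_tens_sum[OF _ w \<mu>])
    show "?v m \<in> carrier (W_alg sc br)" for m
      by (rule balg.b_closed[OF UG.C_balg[folded W_alg_def] W_homog[OF hp_grade] \<sigma>W])
    fix i k :: nat assume "i < k"
    \<comment> \<open>In degree \<open>i\<close> only the powers with \<open>2 * m \<le> i\<close>
      contribute, and all of them occur among the first \<open>k > i\<close> terms.\<close>
    show "w i = finsum (U_alg sc br) (\<lambda>m. ?v m i) {..<k}"
      unfolding wS[of i]
    proof (rule En.M.add.finprod_mono_neutral_cong_left)
      show "finite {..<k}" "{m. 2 * m \<le> i} \<subseteq> {..<k}" using \<open>i < k\<close> by auto
      show "(\<lambda>m. ?v m i) \<in> {..<k} \<rightarrow> carrier (U_alg sc br)"
        using S_dag_closed[OF S] by (auto simp: v)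
    qed (auto simp: v)
  qed
  moreover have "h_W sc br [^]\<^bsub>WT\<^esub> (m::nat) \<otimes>\<^bsub>WT\<^esub> ?s m = tens (W_alg sc br) OM (?v m) \<mu>" for m
    using WA.tn_mult[OF W_homog[OF hp_grade] \<sigma>W Om.b_one \<mu>, of m m] \<mu> by (simp add: h_W_pow)
  ultimately have conv: "conv_sum (W_alg sc br) OM (\<lambda>m. h_W sc br [^]\<^bsub>WT\<^esub> (m::nat) \<otimes>\<^bsub>WT\<^esub> ?s m) ?x" by simp
  \<comment> \<open>Component 0 of \<open>\<sigma> m\<close> is \<open>S (2 * m) m\<close>, the
    coefficient that \<open>G_tW\<close> isolates in degree \<open>2 * m\<close>.\<close>
  have c: "fps_nth ?c m = coeff0 (pi_U sc (S (2 * m) m)) * coeff0 \<mu>" for m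
    using tau_S_tens[OF pi_U_W[OF \<sigma>W[of m]] \<mu>] pi_map_tens[OF \<sigma>W[of m] \<mu>] by (simp add: \<sigma>_def)
  let ?e = "\<lambda>p. tW p (if even p then fps_nth ?c (p div 2) \<odot>\<^bsub>U_alg sc br\<^esub> hp (p div 2) else \<zero>\<^bsub>U_alg sc br\<^esub>) \<one>\<^bsub>OM\<^esub>"
  have "G (tW p (w p) \<mu>) \<oplus>\<^bsub>WT\<^esub> ?e p = tW p (w p) \<mu>" for p
    using G_tW[OF S wS \<mu>, of p] unfolding c by (cases "even p") auto
  moreover have "conv_sum (W_alg sc br) OM (\<lambda>p. G (tW p (w p) \<mu>) \<oplus>\<^bsub>WT\<^esub> ?e p) (G ?x \<oplus>\<^bsub>WT\<^esub> inAh sc br ?c)"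
    by (intro conv_add G_cont conv_homog[OF w \<mu>] inAh_conv)
  ultimately have "conv_sum (W_alg sc br) OM (\<lambda>p. tW p (w p) \<mu>) (G ?x \<oplus>\<^bsub>WT\<^esub> inAh sc br ?c)" by simp
  \<comment> \<open>Both elements are sums of the same series of homogeneous components, so their
    difference is a sum of zeros.\<close>
  from conv_minus[OF this conv_homog[OF w \<mu>]] have "(G ?x \<oplus>\<^bsub>WT\<^esub> inAh sc br ?c) \<ominus>\<^bsub>WT\<^esub> ?x = \<zero>\<^bsub>WT\<^esub>"
    by (rule conv_zeros_zero)
      (use W_closed(1)[OF w] \<mu> in \<open>simp add: a_minus_def WA.T.M.r_neg\<close>)
  then have "G ?x \<oplus>\<^bsub>WT\<^esub> inAh sc br ?c = ?x"
    using x G.closed[OF x] inAh_closed by (simp add: WA.T.minus_eq_zero_iff)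
  with sdag conv show ?case by (intro exI[of _ ?s]) simp
qed

end

theorem theorem2p1:
  fixes sc :: "'k::field_char_0 \<Rightarrow> 'a::idom \<Rightarrow> 'a"
    and br :: "'a \<Rightarrow> 'a \<Rightarrow> 'a"
    and \<delta> \<delta>t :: "'a WOm \<Rightarrow> 'a WOm"
    and \<delta>s :: "'a kform \<Rightarrow> 'a SOm"
    and \<tau> :: "'a WOm \<Rightarrow> 'a fps"
  assumes "symplectic_affine_regular_domain sc br"
    and "is_delta sc br \<delta>"
    and "is_delta_star sc br \<delta>s"
    and "is_delta_tilde sc br \<delta>s \<delta>t"
    and "is_tau sc br \<tau>"
  shows "(\<forall>x \<in> carrier (WOmega sc br). \<delta>t (\<delta>t x) = \<zero>\<^bsub>WOmega sc br\<^esub>) \<and>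
    (\<forall>x \<in> carrier (WOmega sc br).
      \<delta>t (\<delta> x) \<oplus>\<^bsub>WOmega sc br\<^esub> \<delta> (\<delta>t x) \<oplus>\<^bsub>WOmega sc br\<^esub> inAh sc br (\<tau> x) = x)"
proof -
  interpret koszul_maps sc br \<delta> \<delta>t \<delta>s
    using assms by (intro koszul_maps.intro koszul_maps_axioms.intro)
  have "G x \<oplus>\<^bsub>WT\<^esub> inAh sc br (\<tau> x) = x" if x: "x \<in> carrier WT" for x
  proof -
    obtain s where "(\<forall>m. s m \<in> SdagOmega sc br) \<and>
        conv_sum (W_alg sc br) OM (\<lambda>m. h_W sc br [^]\<^bsub>WT\<^esub> (m::nat) \<otimes>\<^bsub>WT\<^esub> s m) x"
      and f: "G x \<oplus>\<^bsub>WT\<^esub> inAh sc br (Abs_fps (\<lambda>m. tau_S (pi_map sc (s m)))) = x"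
      using fundamental_formula[OF x] by blast
    then have "\<tau> x = Abs_fps (\<lambda>m. tau_S (pi_map sc (s m)))"
      using assms(5) unfolding is_tau_def by blast
    with f show ?thesis by simp
  qed
  then show ?thesis using dt_dt by (simp add: G_def)
qed

end
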